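(* Let $G=\{G_1\rightrightarrows G_0\}$ be a Lie groupoid. The functor $\mathsf{Act}:\mathsf{WRep}(G)\to\mathsf{VB}(G)$, sending a weak representation $(V,A,\alpha)$ to its action groupoid $G\times_A V$ and a map of weak representations $(F,\delta)$ to $\mathsf{Act}(F,\delta)$, is an equivalence of categories.
   Context: **Notation.** $s,t,u$ are the source, target and unit maps of $G$. $G_n$ is the manifold of composable $n$-tuples $(g_1,\dots,g_n)$, i.e. $s(g_i)=t(g_{i+1})$; $t_2(g,h)=t(g)$. In all groupoids a product $ab$ means "first $b$, then $a$". **VB-groupoids.** A VB-groupoid over $G$ is a map of Lie groupoids $\pi:V\to G$ such that $\pi_0:V_0\to G_0$ and $\pi_1:V_1\to G_1$ are vector bundles and all structure maps of $V$ are vector bundle maps covering the structure maps of $G$. A map of VB-groupoids over $G$ is a map of Lie groupoids whose components on objects and arrows are vector bundle maps covering $\mathrm{id}_{G_0}$ and $\mathrm{id}_{G_1}$. These form the category $\mathsf{VB}(G)$. **Linear Lie groupoid bundles.** A linear Lie groupoid bundle over a manifold $M$ is a VB-groupoid over the trivial groupoid $M$ (objects and morphisms $M$, all structure maps $\mathrm{id}_M$). A map of linear Lie groupoid bundles is a map of Lie groupoids whose object and arrow components are vector bundle maps covering one and the same smooth map $\bar f$ of bases. A natural transformation of linear Lie groupoid bundles between two maps $f,g:V\to W$ covering the same $\bar f$ is a natural transformation that is, as a map $V_0\to W_1$, a vector bundle map covering $\bar f$. **Weak representations.** A weak representation of $G$ on a linear Lie groupoid bundle $\pi:V\to G_0$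 is a pair $(A,\alpha)$ where: (1) $A:G_1\times_{s,G_0}V\to V$ is a map of linear Lie groupoid bundles covering $t:G_1\to G_0$; here $G_1\times_{s,G_0}V$ is the linear Lie groupoid bundle over $G_1$ with objects $\{(g,x)\in G_1\times V_0: s(g)=\pi_0(x)\}$, arrows $\{(g,v)\in G_1\times V_1: s(g)=\pi_1(v)\}$, and groupoid structure only in the $V$-factor. Write $g\cdot x=A(g,x)$, $g\cdot v=A(g,v)$. (2) $A$ is unital: $u(\pi(x))\cdot x=x$ and $u(\pi(v))\cdot v=v$ for all $x\in V_0$, $v\in V_1$. (3) $\alpha$ is a natural transformation of linear Lie groupoid bundles covering $t_2$ with components $\alpha(g,k,x):g\cdot(k\cdot x)\to(gk)\cdot x$, for $(g,k)\in G_2$, $x\in V_0$, $s(k)=\pi_0(x)$; naturality means $\alpha(g,k,y)\,(g\cdot(k\cdot v))=((gk)\cdot v)\,\alpha(g,k,x)$ for $v:x\to y$. (4) For all $(g,k,l)\in G_3$ and $x\in V_0$ with $s(l)=\pi_0(x)$: $\alpha(g,kl,x)\,(g\cdot\alpha(k,l,x))=\alpha(gk,l,x)\,\alpha(g,k,l\cdot x)$; and $\alpha(g,u(\pi(x)),x)$ and $\alpha(u(t(g)),g,x)$ are identity arrows of $V$ at $g\cdot x$. A map of weak representations $(V,A,\alpha)\to(W,B,\beta)$ is a pair $(F,\delta)$ where $F:V\to W$ is a map of linear Lie groupoid bundles covering $\mathrm{id}_{G_0}$ and $\delta$ is a natural transformation of linear Lie groupoid bundles covering $t$, with components $\delta(g,x):F(g\cdot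 x)\to g\cdot F(x)$, such that $\beta(g,k,F(x))\,(g\cdot\delta(k,x))\,\delta(g,k\cdot x)=\delta(gk,x)\,F(\alpha(g,k,x))$ for all composable $(g,k,x)$, and $\delta(u(\pi(x)),x)$ is the identity arrow at $F(x)$. Composition: $(F',\delta')\circ(F,\delta)=(F'\circ F,\ (g,x)\mapsto \delta'(g,F(x))\,F'(\delta(g,x)))$. $\mathsf{WRep}(G)$ is the resulting category. **Action groupoid.** Let $\tilde s,\tilde t,\tilde u$ be the source, target and unit maps of $V$. $G\times_A V$ is the VB-groupoid over $G$ with objects $V_0$, arrows $\{(g,x,v)\in G_1\times V_0\times V_1: s(g)=\pi_0(x),\ \tilde t(v)=g\cdot x\}$, source $(g,x,v)\mapsto x$, target $(g,x,v)\mapsto\tilde s(v)$, multiplication $(g,x,v)(g',x',v')=(gg',x',\alpha(g,g',x')\,(g\cdot v')\,v)$, units $x\mapsto(u(\pi(x)),x,\tilde u(x))$, and projection to $G$ given by $\pi_0$ on objects and $(g,x,v)\mapsto g$ on arrows (with fibrewise vector space structure in $(x,v)$). For a map $(F,\delta):(V,A,\alpha)\to(W,B,\beta)$, $\mathsf{Act}(F,\delta):G\times_AV\to G\times_BW$ is $F_0$ on objects and $(g,x,v)\mapsto(g,F(x),\delta(g,x)F(v))$ on arrows. *)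

theory Defs
  imports "HOL-Analysis.Analysis"
begin

section \<open>Smooth functions on open subsets of Euclidean space\<close>

text \<open>
  R^n is the library's \<^const>\<open>Euclidean_space\<close>, i.e. sequences vanishing from index n on, so that
  R^k is literally a subset of R^n for k \<le> n and dimensions are ordinary natural numbers.
\<close>

definition partial_deriv :: "nat \<Rightarrow> ((nat \<Rightarrow> real) \<Rightarrow> real) \<Rightarrow> (nat \<Rightarrow> real) \<Rightarrow> real" where
  "partial_deriv i f x = deriv (\<lambda>t. f (x(i := t))) (x i)"

primrec Ck :: "nat \<Rightarrow> (nat \<Rightarrow> real) set \<Rightarrow> nat \<Rightarrow> ((nat \<Rightarrow> real) \<Rightarrow> real) \<Rightarrow> bool" where
  "Ck n W 0 f \<longleftrightarrow> continuous_map (subtopology (Euclidean_space n) W) euclideanreal f"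
| "Ck n W (Suc k) f \<longleftrightarrow>
     continuous_map (subtopology (Euclidean_space n) W) euclideanreal f \<and>
     (\<forall>i<n. (\<forall>x\<in>W. (\<lambda>t. f (x(i := t))) field_differentiable at (x i)) \<and>
            Ck n W k (partial_deriv i f))"

text \<open>Smoothness of a map from W, open in R^n, to R^m.\<close>

definition smooth_euclid ::
  "nat \<Rightarrow> (nat \<Rightarrow> real) set \<Rightarrow> nat \<Rightarrow> ((nat \<Rightarrow> real) \<Rightarrow> nat \<Rightarrow> real) \<Rightarrow> bool" where
  "smooth_euclid n W m f \<longleftrightarrow> (\<forall>i<m. \<forall>k. Ck n W k (\<lambda>x. f x i))"


section \<open>Manifolds\<close>

text \<open>
  A chart is a triple (n, U, \<phi>) with \<phi> a homeomorphism of U onto an open subset of R^n. The values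
  of \<phi> outside U are irrelevant; a maximal atlas contains every choice of them. The dimension n
  may differ between connected components (correspondingly, the rank of a vector bundle is locally
  constant).
\<close>

type_synonym 'a chart = "nat \<times> 'a set \<times> ('a \<Rightarrow> nat \<Rightarrow> real)"

definition is_chart :: "'a topology \<Rightarrow> 'a chart \<Rightarrow> bool" where
  "is_chart X = (\<lambda>(n, U, \<phi>).
     openin X U \<and> openin (Euclidean_space n) (\<phi> ` U) \<and>
     homeomorphic_map (subtopology X U) (subtopology (Euclidean_space n) (\<phi> ` U)) \<phi>)"

definition compatible :: "'a chart \<Rightarrow> 'a chart \<Rightarrow> bool" where
  "compatible = (\<lambda>(n, U, \<phi>) (m, V, \<psi>).
     smooth_euclid n (\<phi> ` (U \<inter> V)) m (\<lambda>x. \<psi> (inv_into U \<phi> x)) \<and>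
     smooth_euclid m (\<psi> ` (U \<inter> V)) n (\<lambda>x. \<phi> (inv_into V \<psi> x)))"

definition max_atlas :: "'a topology \<Rightarrow> 'a chart set \<Rightarrow> 'a chart set" where
  "max_atlas X \<A> = {c. is_chart X c \<and> (\<forall>d\<in>\<A>. compatible c d)}"

record 'a mfd =
  mtop :: "'a topology"
  charts :: "'a chart set"

abbreviation pts :: "'a mfd \<Rightarrow> 'a set" where
  "pts M \<equiv> topspace (mtop M)"

definition manifold :: "'a mfd \<Rightarrow> bool" where
  "manifold M \<longleftrightarrow>
     Hausdorff_space (mtop M) \<and> second_countable (mtop M) \<and>
     (\<Union>(n, U, \<phi>)\<in>charts M. U) = pts M \<and>
     charts M = max_atlas (mtop M) (charts M)"

definition smooth_map :: "'a mfd \<Rightarrow> 'b mfd \<Rightarrow> ('a \<Rightarrow> 'b) \<Rightarrow> bool" where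
  "smooth_map M N f \<longleftrightarrow>
     (\<forall>p\<in>pts M. \<exists>(n, U, \<phi>)\<in>charts M. \<exists>(m, V, \<psi>)\<in>charts N.
        p \<in> U \<and> f ` U \<subseteq> V \<and> smooth_euclid n (\<phi> ` U) m (\<lambda>x. \<psi> (f (inv_into U \<phi> x))))"

definition diffeo :: "'a mfd \<Rightarrow> 'b mfd \<Rightarrow> ('a \<Rightarrow> 'b) \<Rightarrow> bool" where
  "diffeo M N f \<longleftrightarrow> smooth_map M N f \<and>
     (\<exists>h. smooth_map N M h \<and> (\<forall>p\<in>pts M. h (f p) = p) \<and> (\<forall>q\<in>pts N. f (h q) = q))"

text \<open>The differential of f at p, written as a Jacobian matrix in charts, is onto.\<close>

definition submersion :: "'a mfd \<Rightarrow> 'b mfd \<Rightarrow> ('a \<Rightarrow> 'b) \<Rightarrow> bool" where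
  "submersion M N f \<longleftrightarrow> smooth_map M N f \<and>
     (\<forall>(n, U, \<phi>)\<in>charts M. \<forall>(m, V, \<psi>)\<in>charts N. \<forall>p\<in>U. f p \<in> V \<longrightarrow>
        (\<forall>w::nat \<Rightarrow> real. \<exists>v. \<forall>i<m.
           (\<Sum>j<n. partial_deriv j (\<lambda>x. \<psi> (f (inv_into U \<phi> x)) i) (\<phi> p) * v j) = w i))"

definition euclid_mfd :: "nat \<Rightarrow> (nat \<Rightarrow> real) mfd" where
  "euclid_mfd n = \<lparr>mtop = Euclidean_space n,
     charts = max_atlas (Euclidean_space n) {(n, topspace (Euclidean_space n), id)}\<rparr>"

definition prod_mfd :: "'a mfd \<Rightarrow> 'b mfd \<Rightarrow> ('a \<times> 'b) mfd" where
  "prod_mfd M N = \<lparr>mtop = prod_topology (mtop M) (mtop N),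
     charts = max_atlas (prod_topology (mtop M) (mtop N))
       {(n + m, U \<times> V, \<lambda>(p, q) i. if i < n then \<phi> p i else \<psi> q (i - n)) | n U \<phi> m V \<psi>.
          (n, U, \<phi>) \<in> charts M \<and> (m, V, \<psi>) \<in> charts N}\<rparr>"

text \<open>
  The structure of an embedded submanifold S (for instance an open subset), generated by slice
  charts. It is a manifold structure on S exactly when S is embedded; below it is only used for
  open sets and for fibre products along submersions.
\<close>

definition sub_mfd :: "'a mfd \<Rightarrow> 'a set \<Rightarrow> 'a mfd" where
  "sub_mfd M S = \<lparr>mtop = subtopology (mtop M) S,
     charts = max_atlas (subtopology (mtop M) S)
       {(k, S \<inter> U, \<phi>) | n U \<phi> k. (n, U, \<phi>) \<in> charts M \<and> k \<le> n \<and>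
          \<phi> ` (S \<inter> U) = {x \<in> \<phi> ` U. \<forall>i\<ge>k. x i = 0}}\<rparr>"

text \<open>Transport of a manifold structure along an injection e.\<close>

definition push_mfd :: "('a \<Rightarrow> 'b) \<Rightarrow> 'a mfd \<Rightarrow> 'b mfd" where
  "push_mfd e M = \<lparr>mtop = pullback_topology (range e) (inv e) (mtop M),
     charts = {(n, U, \<phi>). U \<subseteq> range e \<and> (n, e -` U, \<phi> \<circ> e) \<in> charts M}\<rparr>"

definition fibre_prod_set :: "'a mfd \<Rightarrow> ('a \<Rightarrow> 'c) \<Rightarrow> 'b mfd \<Rightarrow> ('b \<Rightarrow> 'c) \<Rightarrow> ('a \<times> 'b) set" where
  "fibre_prod_set M f N h = {(p, q). p \<in> pts M \<and> q \<in> pts N \<and> f p = h q}"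

definition fibre_prod :: "'a mfd \<Rightarrow> ('a \<Rightarrow> 'c) \<Rightarrow> 'b mfd \<Rightarrow> ('b \<Rightarrow> 'c) \<Rightarrow> ('a \<times> 'b) mfd" where
  "fibre_prod M f N h = sub_mfd (prod_mfd M N) (fibre_prod_set M f N h)"


section \<open>Lie groupoids\<close>

text \<open>
  The values of the structure maps outside their domains are irrelevant. The product mul a b means
  ``first b, then a''.
\<close>

record ('b, 'g) lgpd =
  Ob :: "'b mfd"
  Ar :: "'g mfd"
  src :: "'g \<Rightarrow> 'b"
  tgt :: "'g \<Rightarrow> 'b"
  unt :: "'b \<Rightarrow> 'g"
  mul :: "'g \<Rightarrow> 'g \<Rightarrow> 'g"

abbreviation composable :: "('b, 'g) lgpd \<Rightarrow> 'g \<Rightarrow> 'g \<Rightarrow> bool" where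
  "composable G g h \<equiv> g \<in> pts (Ar G) \<and> h \<in> pts (Ar G) \<and> src G g = tgt G h"

text \<open>The manifold of composable pairs.\<close>

definition Ar2 :: "('b, 'g) lgpd \<Rightarrow> ('g \<times> 'g) mfd" where
  "Ar2 G = fibre_prod (Ar G) (src G) (Ar G) (tgt G)"

definition is_inverse :: "('b, 'g) lgpd \<Rightarrow> 'g \<Rightarrow> 'g \<Rightarrow> bool" where
  "is_inverse G g h \<longleftrightarrow> composable G g h \<and> composable G h g \<and>
     mul G g h = unt G (tgt G g) \<and> mul G h g = unt G (src G g)"

definition groupoid :: "('b, 'g) lgpd \<Rightarrow> bool" where
  "groupoid G \<longleftrightarrow>
     (\<forall>g\<in>pts (Ar G). src G g \<in> pts (Ob G) \<and> tgt G g \<in> pts (Ob G)) \<and>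
     (\<forall>x\<in>pts (Ob G). unt G x \<in> pts (Ar G) \<and> src G (unt G x) = x \<and> tgt G (unt G x) = x) \<and>
     (\<forall>g h. composable G g h \<longrightarrow>
        mul G g h \<in> pts (Ar G) \<and> src G (mul G g h) = src G h \<and> tgt G (mul G g h) = tgt G g) \<and>
     (\<forall>g h k. composable G g h \<and> composable G h k \<longrightarrow>
        mul G (mul G g h) k = mul G g (mul G h k)) \<and>
     (\<forall>g\<in>pts (Ar G). mul G g (unt G (src G g)) = g \<and> mul G (unt G (tgt G g)) g = g) \<and>
     (\<forall>g\<in>pts (Ar G). \<exists>h. is_inverse G g h)"

definition ginv :: "('b, 'g) lgpd \<Rightarrow> 'g \<Rightarrow> 'g" where
  "ginv G g = (THE h. is_inverse G g h)"

definition lie_groupoid :: "('b, 'g) lgpd \<Rightarrow> bool" where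
  "lie_groupoid G \<longleftrightarrow>
     manifold (Ob G) \<and> manifold (Ar G) \<and> groupoid G \<and>
     submersion (Ar G) (Ob G) (src G) \<and> submersion (Ar G) (Ob G) (tgt G) \<and>
     smooth_map (Ob G) (Ar G) (unt G) \<and>
     smooth_map (Ar2 G) (Ar G) (\<lambda>(g, h). mul G g h) \<and>
     smooth_map (Ar G) (Ar G) (ginv G)"

definition lgpd_map ::
  "('b, 'g) lgpd \<Rightarrow> ('c, 'h) lgpd \<Rightarrow> ('b \<Rightarrow> 'c) \<times> ('g \<Rightarrow> 'h) \<Rightarrow> bool" where
  "lgpd_map G H = (\<lambda>(f0, f1).
     smooth_map (Ob G) (Ob H) f0 \<and> smooth_map (Ar G) (Ar H) f1 \<and>
     (\<forall>g\<in>pts (Ar G). src H (f1 g) = f0 (src G g) \<and> tgt H (f1 g) = f0 (tgt G g)) \<and>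
     (\<forall>x\<in>pts (Ob G). f1 (unt G x) = unt H (f0 x)) \<and>
     (\<forall>g h. composable G g h \<longrightarrow> f1 (mul G g h) = mul H (f1 g) (f1 h)))"

definition trivial_gpd :: "'b mfd \<Rightarrow> ('b, 'b) lgpd" where
  "trivial_gpd M = \<lparr>Ob = M, Ar = M, src = id, tgt = id, unt = id, mul = (\<lambda>x y. x)\<rparr>"


section \<open>Vector bundles\<close>

record ('e, 'b) vbun =
  tot :: "'e mfd"
  base :: "'b mfd"
  proj :: "'e \<Rightarrow> 'b"
  vadd :: "'e \<Rightarrow> 'e \<Rightarrow> 'e"
  vscale :: "real \<Rightarrow> 'e \<Rightarrow> 'e"

definition real_vector_space_on :: "'e set \<Rightarrow> ('e \<Rightarrow> 'e \<Rightarrow> 'e) \<Rightarrow> (real \<Rightarrow> 'e \<Rightarrow> 'e) \<Rightarrow> bool" where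
  "real_vector_space_on S a m \<longleftrightarrow>
     (\<forall>x\<in>S. \<forall>y\<in>S. a x y \<in> S \<and> a x y = a y x) \<and>
     (\<forall>x\<in>S. \<forall>y\<in>S. \<forall>z\<in>S. a (a x y) z = a x (a y z)) \<and>
     (\<exists>z\<in>S. \<forall>x\<in>S. a z x = x \<and> (\<exists>y\<in>S. a x y = z)) \<and>
     (\<forall>c. \<forall>x\<in>S. m c x \<in> S) \<and>
     (\<forall>c. \<forall>x\<in>S. \<forall>y\<in>S. m c (a x y) = a (m c x) (m c y)) \<and>
     (\<forall>c d. \<forall>x\<in>S. m (c + d) x = a (m c x) (m d x) \<and> m (c * d) x = m c (m d x)) \<and>
     (\<forall>x\<in>S. m 1 x = x)"

definition local_triv ::
  "('e, 'b) vbun \<Rightarrow> 'b set \<Rightarrow> nat \<Rightarrow> ('e \<Rightarrow> 'b \<times> (nat \<Rightarrow> real)) \<Rightarrow> bool" where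
  "local_triv E U k \<Phi> \<longleftrightarrow>
     (let EU = {e \<in> pts (tot E). proj E e \<in> U} in
        diffeo (sub_mfd (tot E) EU) (prod_mfd (sub_mfd (base E) U) (euclid_mfd k)) \<Phi> \<and>
        (\<forall>e\<in>EU. fst (\<Phi> e) = proj E e) \<and>
        (\<forall>e\<in>EU. \<forall>e'\<in>EU. proj E e = proj E e' \<longrightarrow>
           snd (\<Phi> (vadd E e e')) = (\<lambda>i. snd (\<Phi> e) i + snd (\<Phi> e') i)) \<and>
        (\<forall>c. \<forall>e\<in>EU. snd (\<Phi> (vscale E c e)) = (\<lambda>i. c * snd (\<Phi> e) i)))"

definition vector_bundle :: "('e, 'b) vbun \<Rightarrow> bool" where
  "vector_bundle E \<longleftrightarrow>
     manifold (tot E) \<and> manifold (base E) \<and> smooth_map (tot E) (base E) (proj E) \<and>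
     (\<forall>p\<in>pts (base E). real_vector_space_on {e \<in> pts (tot E). proj E e = p} (vadd E) (vscale E)) \<and>
     (\<forall>p\<in>pts (base E). \<exists>U k \<Phi>. openin (mtop (base E)) U \<and> p \<in> U \<and> local_triv E U k \<Phi>)"

definition vb_map :: "('e, 'b) vbun \<Rightarrow> ('f, 'c) vbun \<Rightarrow> ('e \<Rightarrow> 'f) \<Rightarrow> ('b \<Rightarrow> 'c) \<Rightarrow> bool" where
  "vb_map E F f fb \<longleftrightarrow>
     smooth_map (tot E) (tot F) f \<and> smooth_map (base E) (base F) fb \<and>
     (\<forall>e\<in>pts (tot E). proj F (f e) = fb (proj E e)) \<and>
     (\<forall>e\<in>pts (tot E). \<forall>e'\<in>pts (tot E). proj E e = proj E e' \<longrightarrow>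
        f (vadd E e e') = vadd F (f e) (f e')) \<and>
     (\<forall>c. \<forall>e\<in>pts (tot E). f (vscale E c e) = vscale F c (f e))"


section \<open>VB-groupoids\<close>

record ('x, 'y, 'b, 'g) vbgpd =
  gpd :: "('x, 'y) lgpd"
  pr0 :: "'x \<Rightarrow> 'b"
  add0 :: "'x \<Rightarrow> 'x \<Rightarrow> 'x"
  scale0 :: "real \<Rightarrow> 'x \<Rightarrow> 'x"
  pr1 :: "'y \<Rightarrow> 'g"
  add1 :: "'y \<Rightarrow> 'y \<Rightarrow> 'y"
  scale1 :: "real \<Rightarrow> 'y \<Rightarrow> 'y"

abbreviation V0 :: "('x, 'y, 'b, 'g) vbgpd \<Rightarrow> 'x mfd" where "V0 V \<equiv> Ob (gpd V)"
abbreviation V1 :: "('x, 'y, 'b, 'g) vbgpd \<Rightarrow> 'y mfd" where "V1 V \<equiv> Ar (gpd V)"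

definition bun0 :: "('b, 'g) lgpd \<Rightarrow> ('x, 'y, 'b, 'g) vbgpd \<Rightarrow> ('x, 'b) vbun" where
  "bun0 G V = \<lparr>tot = V0 V, base = Ob G, proj = pr0 V, vadd = add0 V, vscale = scale0 V\<rparr>"

definition bun1 :: "('b, 'g) lgpd \<Rightarrow> ('x, 'y, 'b, 'g) vbgpd \<Rightarrow> ('y, 'g) vbun" where
  "bun1 G V = \<lparr>tot = V1 V, base = Ar G, proj = pr1 V, vadd = add1 V, vscale = scale1 V\<rparr>"

text \<open>Composable pairs of V, as a bundle over composable pairs of G.\<close>

definition bun2 :: "('b, 'g) lgpd \<Rightarrow> ('x, 'y, 'b, 'g) vbgpd \<Rightarrow> ('y \<times> 'y, 'g \<times> 'g) vbun" where
  "bun2 G V = \<lparr>tot = Ar2 (gpd V), base = Ar2 G, proj = map_prod (pr1 V) (pr1 V),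
     vadd = (\<lambda>(v, w) (v', w'). (add1 V v v', add1 V w w')),
     vscale = (\<lambda>c (v, w). (scale1 V c v, scale1 V c w))\<rparr>"

definition vb_groupoid :: "('b, 'g) lgpd \<Rightarrow> ('x, 'y, 'b, 'g) vbgpd \<Rightarrow> bool" where
  "vb_groupoid G V \<longleftrightarrow>
     lie_groupoid G \<and> lie_groupoid (gpd V) \<and> lgpd_map (gpd V) G (pr0 V, pr1 V) \<and>
     vector_bundle (bun0 G V) \<and> vector_bundle (bun1 G V) \<and>
     vb_map (bun1 G V) (bun0 G V) (src (gpd V)) (src G) \<and>
     vb_map (bun1 G V) (bun0 G V) (tgt (gpd V)) (tgt G) \<and>
     vb_map (bun0 G V) (bun1 G V) (unt (gpd V)) (unt G) \<and>
     vb_map (bun2 G V) (bun1 G V) (\<lambda>(v, w). mul (gpd V) v w) (\<lambda>(g, h). mul G g h) \<and>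
     vb_map (bun1 G V) (bun1 G V) (ginv (gpd V)) (ginv G)"

text \<open>
  Morphisms of the categories below are extensional functions, so that equality of morphisms is
  equality of maps.
\<close>

definition vb_gpd_map :: "('b, 'g) lgpd \<Rightarrow> ('x, 'y, 'b, 'g) vbgpd \<Rightarrow> ('x', 'y', 'b, 'g) vbgpd \<Rightarrow>
    ('x \<Rightarrow> 'x') \<times> ('y \<Rightarrow> 'y') \<Rightarrow> bool" where
  "vb_gpd_map G V W f \<longleftrightarrow>
     lgpd_map (gpd V) (gpd W) f \<and>
     vb_map (bun0 G V) (bun0 G W) (fst f) id \<and> vb_map (bun1 G V) (bun1 G W) (snd f) id \<and>
     fst f \<in> extensional (pts (V0 V)) \<and> snd f \<in> extensional (pts (V1 V))"


section \<open>Linear Lie groupoid bundles\<close>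

definition llgb :: "'b mfd \<Rightarrow> ('x, 'y, 'b, 'b) vbgpd \<Rightarrow> bool" where
  "llgb M V \<longleftrightarrow> vb_groupoid (trivial_gpd M) V"

definition llgb_map :: "'b mfd \<Rightarrow> 'c mfd \<Rightarrow> ('x, 'y, 'b, 'b) vbgpd \<Rightarrow> ('x', 'y', 'c, 'c) vbgpd \<Rightarrow>
    ('b \<Rightarrow> 'c) \<Rightarrow> ('x \<Rightarrow> 'x') \<times> ('y \<Rightarrow> 'y') \<Rightarrow> bool" where
  "llgb_map M N V W fb f \<longleftrightarrow>
     lgpd_map (gpd V) (gpd W) f \<and>
     vb_map (bun0 (trivial_gpd M) V) (bun0 (trivial_gpd N) W) (fst f) fb \<and>
     vb_map (bun1 (trivial_gpd M) V) (bun1 (trivial_gpd N) W) (snd f) fb"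

text \<open>T is a natural transformation from f to h, both covering fb.\<close>

definition llgb_nat_trans :: "'b mfd \<Rightarrow> 'c mfd \<Rightarrow> ('x, 'y, 'b, 'b) vbgpd \<Rightarrow>
    ('x', 'y', 'c, 'c) vbgpd \<Rightarrow> ('b \<Rightarrow> 'c) \<Rightarrow> ('x \<Rightarrow> 'x') \<times> ('y \<Rightarrow> 'y') \<Rightarrow>
    ('x \<Rightarrow> 'x') \<times> ('y \<Rightarrow> 'y') \<Rightarrow> ('x \<Rightarrow> 'y') \<Rightarrow> bool" where
  "llgb_nat_trans M N V W fb f h T \<longleftrightarrow>
     vb_map (bun0 (trivial_gpd M) V) (bun1 (trivial_gpd N) W) T fb \<and>
     (\<forall>x\<in>pts (V0 V). src (gpd W) (T x) = fst f x \<and> tgt (gpd W) (T x) = fst h x) \<and>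
     (\<forall>v\<in>pts (V1 V). mul (gpd W) (T (tgt (gpd V) v)) (snd f v) =
                     mul (gpd W) (snd h v) (T (src (gpd V) v)))"

text \<open>The bundle over P obtained from V by pullback along f, with groupoid structure in the V-factor.\<close>

definition pullback :: "'p mfd \<Rightarrow> ('p \<Rightarrow> 'b) \<Rightarrow> ('x, 'y, 'b, 'b) vbgpd \<Rightarrow>
    ('p \<times> 'x, 'p \<times> 'y, 'p, 'p) vbgpd" where
  "pullback P f V =
     \<lparr>gpd = \<lparr>Ob = fibre_prod P f (V0 V) (pr0 V), Ar = fibre_prod P f (V1 V) (pr1 V),
        src = (\<lambda>(p, v). (p, src (gpd V) v)), tgt = (\<lambda>(p, v). (p, tgt (gpd V) v)),
        unt = (\<lambda>(p, x). (p, unt (gpd V) x)),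
        mul = (\<lambda>(p, v) (q, w). (p, mul (gpd V) v w))\<rparr>,
      pr0 = fst,
      add0 = (\<lambda>(p, x) (q, y). (p, add0 V x y)), scale0 = (\<lambda>c (p, x). (p, scale0 V c x)),
      pr1 = fst,
      add1 = (\<lambda>(p, v) (q, w). (p, add1 V v w)), scale1 = (\<lambda>c (p, v). (p, scale1 V c v))\<rparr>"


section \<open>Weak representations\<close>

record ('b, 'g, 'x, 'y) wrep =
  bnd :: "('x, 'y, 'b, 'b) vbgpd"
  act0 :: "'g \<Rightarrow> 'x \<Rightarrow> 'x"
  act1 :: "'g \<Rightarrow> 'y \<Rightarrow> 'y"
  alp :: "'g \<Rightarrow> 'g \<Rightarrow> 'x \<Rightarrow> 'y"

abbreviation wgpd :: "('b, 'g, 'x, 'y) wrep \<Rightarrow> ('x, 'y) lgpd" where "wgpd R \<equiv> gpd (bnd R)"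

definition weak_rep :: "('b, 'g) lgpd \<Rightarrow> ('b, 'g, 'x, 'y) wrep \<Rightarrow> bool" where
  "weak_rep G R \<longleftrightarrow>
     llgb (Ob G) (bnd R) \<and>
     llgb_map (Ar G) (Ob G) (pullback (Ar G) (src G) (bnd R)) (bnd R) (tgt G)
       (\<lambda>(g, x). act0 R g x, \<lambda>(g, v). act1 R g v) \<and>
     (\<forall>x\<in>pts (V0 (bnd R)). act0 R (unt G (pr0 (bnd R) x)) x = x) \<and>
     (\<forall>v\<in>pts (V1 (bnd R)). act1 R (unt G (pr1 (bnd R) v)) v = v) \<and>
     llgb_nat_trans (Ar2 G) (Ob G) (pullback (Ar2 G) (\<lambda>(g, k). src G k) (bnd R)) (bnd R)
       (\<lambda>(g, k). tgt G g)
       (\<lambda>((g, k), x). act0 R g (act0 R k x), \<lambda>((g, k), v). act1 R g (act1 R k v))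
       (\<lambda>((g, k), x). act0 R (mul G g k) x, \<lambda>((g, k), v). act1 R (mul G g k) v)
       (\<lambda>((g, k), x). alp R g k x) \<and>
     (\<forall>g k l x. composable G g k \<and> composable G k l \<and> x \<in> pts (V0 (bnd R)) \<and>
        src G l = pr0 (bnd R) x \<longrightarrow>
        mul (wgpd R) (alp R g (mul G k l) x) (act1 R g (alp R k l x)) =
        mul (wgpd R) (alp R (mul G g k) l x) (alp R g k (act0 R l x))) \<and>
     (\<forall>g\<in>pts (Ar G). \<forall>x\<in>pts (V0 (bnd R)). src G g = pr0 (bnd R) x \<longrightarrow>
        alp R g (unt G (pr0 (bnd R) x)) x = unt (wgpd R) (act0 R g x) \<and>
        alp R (unt G (tgt G g)) g x = unt (wgpd R) (act0 R g x))"

text \<open>The set of pairs (g, x) with s(g) = \<pi>(x), i.e. the domain of the component \<delta> of a morphism.\<close>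

abbreviation act_dom :: "('b, 'g) lgpd \<Rightarrow> ('b, 'g, 'x, 'y) wrep \<Rightarrow> ('g \<times> 'x) set" where
  "act_dom G R \<equiv> fibre_prod_set (Ar G) (src G) (V0 (bnd R)) (pr0 (bnd R))"

definition weak_rep_map :: "('b, 'g) lgpd \<Rightarrow> ('b, 'g, 'x, 'y) wrep \<Rightarrow> ('b, 'g, 'x', 'y') wrep \<Rightarrow>
    (('x \<Rightarrow> 'x') \<times> ('y \<Rightarrow> 'y')) \<times> ('g \<times> 'x \<Rightarrow> 'y') \<Rightarrow> bool" where
  "weak_rep_map G R S = (\<lambda>((F0, F1), \<delta>).
     llgb_map (Ob G) (Ob G) (bnd R) (bnd S) id (F0, F1) \<and>
     llgb_nat_trans (Ar G) (Ob G) (pullback (Ar G) (src G) (bnd R)) (bnd S) (tgt G)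
       (\<lambda>(g, x). F0 (act0 R g x), \<lambda>(g, v). F1 (act1 R g v))
       (\<lambda>(g, x). act0 S g (F0 x), \<lambda>(g, v). act1 S g (F1 v)) \<delta> \<and>
     (\<forall>g k x. composable G g k \<and> x \<in> pts (V0 (bnd R)) \<and> src G k = pr0 (bnd R) x \<longrightarrow>
        mul (wgpd S) (mul (wgpd S) (alp S g k (F0 x)) (act1 S g (\<delta> (k, x)))) (\<delta> (g, act0 R k x)) =
        mul (wgpd S) (\<delta> (mul G g k, x)) (F1 (alp R g k x))) \<and>
     (\<forall>x\<in>pts (V0 (bnd R)). \<delta> (unt G (pr0 (bnd R) x), x) = unt (wgpd S) (F0 x)) \<and>
     F0 \<in> extensional (pts (V0 (bnd R))) \<and> F1 \<in> extensional (pts (V1 (bnd R))) \<and>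
     \<delta> \<in> extensional (act_dom G R))"


section \<open>Categories\<close>

text \<open>Cmp C a b c k h is the composite of h from a to b, followed by k from b to c.\<close>

record ('o, 'm) cat =
  Objs :: "'o set"
  Hom :: "'o \<Rightarrow> 'o \<Rightarrow> 'm set"
  Idn :: "'o \<Rightarrow> 'm"
  Cmp :: "'o \<Rightarrow> 'o \<Rightarrow> 'o \<Rightarrow> 'm \<Rightarrow> 'm \<Rightarrow> 'm"

definition category :: "('o, 'm) cat \<Rightarrow> bool" where
  "category C \<longleftrightarrow>
     (\<forall>a\<in>Objs C. Idn C a \<in> Hom C a a) \<and>
     (\<forall>a\<in>Objs C. \<forall>b\<in>Objs C. \<forall>c\<in>Objs C. \<forall>h\<in>Hom C a b. \<forall>k\<in>Hom C b c.
        Cmp C a b c k h \<in> Hom C a c) \<and>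
     (\<forall>a\<in>Objs C. \<forall>b\<in>Objs C. \<forall>h\<in>Hom C a b.
        Cmp C a a b h (Idn C a) = h \<and> Cmp C a b b (Idn C b) h = h) \<and>
     (\<forall>a\<in>Objs C. \<forall>b\<in>Objs C. \<forall>c\<in>Objs C. \<forall>d\<in>Objs C.
        \<forall>h\<in>Hom C a b. \<forall>k\<in>Hom C b c. \<forall>l\<in>Hom C c d.
        Cmp C a c d l (Cmp C a b c k h) = Cmp C a b d (Cmp C b c d l k) h)"

type_synonym ('o, 'm, 'o', 'm') ftor = "('o \<Rightarrow> 'o') \<times> ('o \<Rightarrow> 'o \<Rightarrow> 'm \<Rightarrow> 'm')"

definition is_functor :: "('o, 'm) cat \<Rightarrow> ('o', 'm') cat \<Rightarrow> ('o, 'm, 'o', 'm') ftor \<Rightarrow> bool" where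
  "is_functor C D = (\<lambda>(Fo, Fm).
     category C \<and> category D \<and>
     (\<forall>a\<in>Objs C. Fo a \<in> Objs D \<and> Fm a a (Idn C a) = Idn D (Fo a)) \<and>
     (\<forall>a\<in>Objs C. \<forall>b\<in>Objs C. \<forall>h\<in>Hom C a b. Fm a b h \<in> Hom D (Fo a) (Fo b)) \<and>
     (\<forall>a\<in>Objs C. \<forall>b\<in>Objs C. \<forall>c\<in>Objs C. \<forall>h\<in>Hom C a b. \<forall>k\<in>Hom C b c.
        Fm a c (Cmp C a b c k h) = Cmp D (Fo a) (Fo b) (Fo c) (Fm b c k) (Fm a b h)))"

definition id_ftor :: "('o, 'm, 'o, 'm) ftor" where
  "id_ftor = (id, \<lambda>a b. id)"

definition comp_ftor ::
  "('o', 'm', 'o'', 'm'') ftor \<Rightarrow> ('o, 'm, 'o', 'm') ftor \<Rightarrow> ('o, 'm, 'o'', 'm'') ftor" where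
  "comp_ftor Q P = (fst Q \<circ> fst P, \<lambda>a b h. snd Q (fst P a) (fst P b) (snd P a b h))"

definition is_iso :: "('o, 'm) cat \<Rightarrow> 'o \<Rightarrow> 'o \<Rightarrow> 'm \<Rightarrow> bool" where
  "is_iso C a b h \<longleftrightarrow> h \<in> Hom C a b \<and>
     (\<exists>k\<in>Hom C b a. Cmp C a b a k h = Idn C a \<and> Cmp C b a b h k = Idn C b)"

definition naturally_isomorphic ::
  "('o, 'm) cat \<Rightarrow> ('o', 'm') cat \<Rightarrow> ('o, 'm, 'o', 'm') ftor \<Rightarrow> ('o, 'm, 'o', 'm') ftor \<Rightarrow> bool" where
  "naturally_isomorphic C D P Q \<longleftrightarrow>
     (\<exists>\<eta>. (\<forall>a\<in>Objs C. is_iso D (fst P a) (fst Q a) (\<eta> a)) \<and>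
        (\<forall>a\<in>Objs C. \<forall>b\<in>Objs C. \<forall>h\<in>Hom C a b.
           Cmp D (fst P a) (fst P b) (fst Q b) (\<eta> b) (snd P a b h) =
           Cmp D (fst P a) (fst Q a) (fst Q b) (snd Q a b h) (\<eta> a)))"

definition equivalence_of_categories ::
  "('o, 'm) cat \<Rightarrow> ('o', 'm') cat \<Rightarrow> ('o, 'm, 'o', 'm') ftor \<Rightarrow> bool" where
  "equivalence_of_categories C D P \<longleftrightarrow> is_functor C D P \<and>
     (\<exists>Q. is_functor D C Q \<and>
        naturally_isomorphic C C (comp_ftor Q P) id_ftor \<and>
        naturally_isomorphic D D (comp_ftor P Q) id_ftor)"


section \<open>The categories of VB-groupoids and weak representations, and the action functor\<close>

text \<open>
  In HOL a category consists of structures on subsets of a fixed type of points. For the action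
  groupoid construction to stay inside that type, it must be closed under forming triples (g, x, v)
  with g an arrow of G. The type below is the free such closure of an arbitrary type of atoms 'a; every
  manifold with points in 'a is a manifold with points in it (via Atom).
\<close>

datatype ('g, 'a) point =
    Atom 'a
  | Triple (arrow_part: 'g) (obj_part: "('g, 'a) point") (vec_part: "('g, 'a) point")

type_synonym ('b, 'g, 'a) vbgpd_pt = "(('g, 'a) point, ('g, 'a) point, 'b, 'g) vbgpd"
type_synonym ('b, 'g, 'a) wrep_pt = "('b, 'g, ('g, 'a) point, ('g, 'a) point) wrep"
type_synonym ('g, 'a) vb_mor =
  "(('g, 'a) point \<Rightarrow> ('g, 'a) point) \<times> (('g, 'a) point \<Rightarrow> ('g, 'a) point)"
type_synonym ('g, 'a) wrep_mor =
  "('g, 'a) vb_mor \<times> ('g \<times> ('g, 'a) point \<Rightarrow> ('g, 'a) point)"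

definition VB :: "('b, 'g) lgpd \<Rightarrow> (('b, 'g, 'a) vbgpd_pt, ('g, 'a) vb_mor) cat" where
  "VB G = \<lparr>Objs = {V. vb_groupoid G V},
     Hom = (\<lambda>V W. {f. vb_gpd_map G V W f}),
     Idn = (\<lambda>V. (restrict id (pts (V0 V)), restrict id (pts (V1 V)))),
     Cmp = (\<lambda>U V W k h.
       (compose (pts (V0 U)) (fst k) (fst h), compose (pts (V1 U)) (snd k) (snd h)))\<rparr>"

definition WRep :: "('b, 'g) lgpd \<Rightarrow> (('b, 'g, 'a) wrep_pt, ('g, 'a) wrep_mor) cat" where
  "WRep G = \<lparr>Objs = {R. weak_rep G R},
     Hom = (\<lambda>R S. {m. weak_rep_map G R S m}),
     Idn = (\<lambda>R. ((restrict id (pts (V0 (bnd R))), restrict id (pts (V1 (bnd R)))),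
                 restrict (\<lambda>(g, x). unt (wgpd R) (act0 R g x)) (act_dom G R))),
     Cmp = (\<lambda>R S T ((F0', F1'), \<delta>') ((F0, F1), \<delta>).
       ((compose (pts (V0 (bnd R))) F0' F0, compose (pts (V1 (bnd R))) F1' F1),
        restrict (\<lambda>(g, x). mul (wgpd T) (\<delta>' (g, F0 x)) (F1' (\<delta> (g, x)))) (act_dom G R)))\<rparr>"

text \<open>
  The manifold of arrows carries the structure of a submanifold of
  G_1 \<times> V_0 \<times> V_1, transported along Triple.
\<close>

definition Act_ob :: "('b, 'g) lgpd \<Rightarrow> ('b, 'g, 'a) wrep_pt \<Rightarrow> ('b, 'g, 'a) vbgpd_pt" where
  "Act_ob G R =
     (let V = bnd R in
      \<lparr>gpd =
        \<lparr>Ob = V0 V,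
         Ar = push_mfd (\<lambda>(g, x, v). Triple g x v)
           (sub_mfd (prod_mfd (Ar G) (prod_mfd (V0 V) (V1 V)))
             {(g, x, v). g \<in> pts (Ar G) \<and> x \<in> pts (V0 V) \<and> v \<in> pts (V1 V) \<and>
                src G g = pr0 V x \<and> tgt (gpd V) v = act0 R g x}),
         src = obj_part,
         tgt = (\<lambda>a. src (gpd V) (vec_part a)),
         unt = (\<lambda>x. Triple (unt G (pr0 V x)) x (unt (gpd V) x)),
         mul = (\<lambda>a b. Triple (mul G (arrow_part a) (arrow_part b)) (obj_part b)
           (mul (gpd V)
             (mul (gpd V) (alp R (arrow_part a) (arrow_part b) (obj_part b))
                          (act1 R (arrow_part a) (vec_part b)))
             (vec_part a)))\<rparr>,
       pr0 = pr0 V, add0 = add0 V, scale0 = scale0 V,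
       pr1 = arrow_part,
       add1 = (\<lambda>a b. Triple (arrow_part a) (add0 V (obj_part a) (obj_part b))
                                            (add1 V (vec_part a) (vec_part b))),
       scale1 = (\<lambda>c a. Triple (arrow_part a) (scale0 V c (obj_part a)) (scale1 V c (vec_part a)))\<rparr>)"

definition Act_mor :: "('b, 'g) lgpd \<Rightarrow> ('b, 'g, 'a) wrep_pt \<Rightarrow> ('b, 'g, 'a) wrep_pt \<Rightarrow>
    ('g, 'a) wrep_mor \<Rightarrow> ('g, 'a) vb_mor" where
  "Act_mor G R S = (\<lambda>((F0, F1), \<delta>).
     (F0, restrict (\<lambda>a. Triple (arrow_part a) (F0 (obj_part a))
            (mul (wgpd S) (\<delta> (arrow_part a, obj_part a)) (F1 (vec_part a))))
          (pts (V1 (Act_ob G R)))))"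

definition Act :: "('b, 'g) lgpd \<Rightarrow>
    (('b, 'g, 'a) wrep_pt, ('g, 'a) wrep_mor, ('b, 'g, 'a) vbgpd_pt, ('g, 'a) vb_mor) ftor" where
  "Act G = (Act_ob G, Act_mor G)"

end

theory Submission
 imports "HOL-Homology.Invariance_of_Domain" Defs
begin

text \<open>
  Arrows (g, x, v) of an action groupoid are products of vertical arrows v and horizontal arrows g at x, so
  a map of action groupoids amounts to its restrictions to these, which are F and delta; hence the functor
  is full and faithful. For essential surjectivity one needs a cleavage of a VB-groupoid V: a linear and
  unital choice of arrows C(g, x) over g with source x. It exists locally because the source map is fibrewise
  surjective, and globally by gluing with bump functions on the arrows of G. Then g x = target of C(g, x)
  is a weak representation on the bundle of arrows of V over units, alpha(g, k, x) is
  C(g k, x) C(k, x)^-1 C(g, k x)^-1, and v corresponds to (g, x, C(g, x) v^-1).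
\<close>

text \<open>Smoothness is defined by iterated partial derivatives in charts, and submersions, fibre
  products and bundles are built up from there. A submersion is used only through smooth local
  sections, which compose without charts, and embedded submanifolds are found as equalizers along
  such sections. The arrows (g, x, v) form a vector bundle over G because v splits into the unit at
  g x and a vector in the kernel of the target map; that kernel is a bundle as the image of an
  idempotent. Unitality is the delicate point of the cleavage. Near a unit the local choice is made
  from the unit section; near any other arrow Hausdorffness keeps the units away. Gluing repeatedly
  fills up the missing part of a weight: where a bump function equals 1 the weight becomes exactly 1
  and later steps change nothing, so no infinite sum occurs. The category laws of weak
  representations are inherited: \<open>Act\<close> is injective on morphisms and onto the maps of
  VB-groupoids between action groupoids.\<close>

abbreviation "pd \<equiv> partial_deriv"
abbreviation "opn M \<equiv> openin (mtop M)"
abbreviation "opR n \<equiv> openin (Euclidean_space n)"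
abbreviation iff2 (infixr "<->" 25) where "A <-> B \<equiv> (A::bool) = B"
abbreviation tends (infixr "--->" 55) where "f ---> l \<equiv> filterlim f (nhds l)"
lemmas otop = openin_topspace and opsub = openin_subset and Rn_def = topspace_Euclidean_space

abbreviation "cht M n U f \<equiv> (n, U, f) \<in> charts M"
abbreviation "flat_in f U S k \<equiv> f ` (S \<inter> U) = {x \<in> f ` U. \<forall>i\<ge>k. x i = 0}"
abbreviation "ivi \<equiv> inv_into"
abbreviation "cmp \<equiv> composable"
abbreviation "wsrc R \<equiv> src (wgpd R)"
abbreviation "wtgt R \<equiv> tgt (wgpd R)"
abbreviation "wmul R \<equiv> mul (wgpd R)"
abbreviation "wunt R \<equiv> unt (wgpd R)"
abbreviation "vsrc V \<equiv> src (gpd V)"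
abbreviation "vtgt V \<equiv> tgt (gpd V)"
abbreviation "vmul V \<equiv> mul (gpd V)"
abbreviation "vunt V \<equiv> unt (gpd V)"
abbreviation "vginv V \<equiv> ginv (gpd V)"
abbreviation "AG G R \<equiv> gpd (Act_ob G R)"
abbreviation "arp \<equiv> arrow_part"
abbreviation "obp \<equiv> obj_part"
abbreviation "vcp \<equiv> vec_part"
abbreviation "eucl \<equiv> euclid_mfd"
abbreviation "tgpd \<equiv> trivial_gpd"
abbreviation pt (infix "<:" 50) where "x <: M \<equiv> x \<in> pts M"

section \<open>Topology of Euclidean space inside the space of sequences\<close>

abbreviation Rn :: "nat => (nat => real) set" where
 "Rn n == topspace (Euclidean_space n)"

lemma Rn_iff: "x : Rn n <-> (ALL i>=n. x i = 0)" by (simp add: Rn_def)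

lemma Esp: "Euclidean_space n = top_of_set {x. ALL i>=n. x i = 0}" by (simp add: Euclidean_space_def euclidean_product_topology)

lemma Rn_sub: "opR n W ==> W <= Rn n" by (rule opsub)

lemma cont_Rn_iff:
 fixes f :: "(nat => real) => real"
 assumes "opR n W" shows "continuous_map (subtopology (Euclidean_space n) W) euclideanreal f <-> continuous_on W f"
proof -
 have "subtopology (Euclidean_space n) W = top_of_set W" using Rn_sub[OF assms]
  by (simp add: Esp Rn_def subtopology_subtopology inf_absorb2)
 thus ?thesis by simp
qed

lemma tendsto_fun_iff:
 fixes f :: "'a => nat => real" shows "(f ---> l) F <-> (ALL i. ((%x. f x i) ---> l i) F)"
 using limitin_componentwise[of "%_. euclideanreal" UNIV f l F] by (simp add: euclidean_product_topology)

lemma cont_coord: "continuous_on S (%x. (x::nat => real) i)"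
 by (rule continuous_on_product_then_coordinatewise[OF continuous_on_id,of S i,simplified]) 

lemma continuous_on_fun_iff:
 fixes f :: "'a::topological_space => nat => real" shows "continuous_on S f <-> (ALL i. continuous_on S (%x. f x i))"
 by (auto simp: continuous_on_def tendsto_fun_iff)

text \<open>On \<open>Rn n\<close> the coordinates from n on agree anyway, so among the radii of a
  basic open set of the product topology only the first n matter, and their minimum is a common
  radius.\<close>

lemma openin_Rn_box:
 assumes "opR n W" "p : W"
 obtains e where "e > 0" "!!y. y : Rn n ==> (!!i. i < n ==> abs (y i - p i) < e) ==> y : W"
proof -
 obtain T where T: "open T" "W = Rn n Int T" using assms(1) by (auto simp: Esp Rn_def openin_open)
 hence "openin (product_topology (%_. euclideanreal) UNIV) T" by (simp add: euclidean_product_topology)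
 then obtain U where U: "finite {i. U i ~= UNIV}" "!!i. open (U i)" "p : Pi\<^sub>E UNIV U" "Pi\<^sub>E UNIV U <= T"
  using assms(2) T(2) unfolding openin_product_topology_alt by force
 have "ALL i. EX e>0. ALL t. abs (t - p i) < e --> t : U i" using U(2,3) by (auto simp: open_dist dist_real_def PiE_iff)
 then obtain e where e: "!!i. e i > 0" "!!i t. abs (t - p i) < e i ==> t : U i" by metis
 \<comment> \<open>The 1 keeps the set nonempty when n = 0.\<close>
 define d where "d = Min (insert 1 (e ` {..<n}))"
 have d: "d > 0" "!!i. i < n ==> d <= e i" using e(1) by (auto simp: d_def)
 have "y : W" if y: "y : Rn n" "!!i. i < n ==> abs (y i - p i) < d" for y
 proof -
  have "y i : U i" for i
  proof (cases "i < n")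
   case True
   thus ?thesis using y(2)[OF True] d(2)[OF True] e(2) by fastforce
  next
   case False
   hence "y i = p i" using y(1) assms Rn_sub[OF assms(1)] by (auto simp: Rn_def)
   thus ?thesis using e by simp
  qed
  thus ?thesis using U(4) y(1) T(2) by (auto simp: PiE_iff)
 qed
 thus ?thesis using d(1) that by blast
qed

lemma upd_Rn: "x : Rn n ==> i < n ==> x(i := t) : Rn n" by (auto simp: Rn_def)

lemma eventually_upd_in:
 assumes "opR n W" "x : W" "i < n" shows "\<forall>\<^sub>F t in nhds (x i). x(i := t) : W"
proof -
 obtain e where e: "e > 0" "!!y. y : Rn n ==> (!!i. i < n ==> abs (y i - x i) < e) ==> y : W"
  using openin_Rn_box[OF assms(1,2)] by blast
 have "x(i := t) : W" if "dist t (x i) < e" for t using that e assms(3) Rn_sub[OF assms(1)] assms(2)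
  by (intro e(2)) (auto simp: dist_real_def intro!: upd_Rn)
 thus ?thesis unfolding eventually_nhds_metric using e(1) by blast
qed

section \<open>Calculus of functions of class \<open>C\<^sup>k\<close>\<close>

lemma partial_deriv_eqI:
 "((%t. f (x(i := t))) has_field_derivative D) (at (x i)) ==> pd i f x = D" by (simp add: partial_deriv_def DERIV_imp_deriv)

lemma Ck_cont:
 assumes "opR n W" "Ck n W k f" shows "continuous_on W f" using assms by (cases k) (auto simp: cont_Rn_iff)

lemma Ck_0_iff: "opR n W ==> Ck n W 0 f <-> continuous_on W f" by (simp add: cont_Rn_iff)

lemma Ck_Suc_deriv:
 assumes "Ck n W (Suc k) f" "i < n" "x : W" shows "DERIV (%t. f (x(i := t))) (x i) :> pd i f x"
 using assms by (simp add: partial_deriv_def DERIV_deriv_iff_field_differentiable)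

lemma Ck_Suc_partial: "Ck n W (Suc k) f ==> i < n ==> Ck n W k (pd i f)" by simp

text \<open>Functions read in charts are arbitrary outside the chart image. As W is open, partial
  derivatives at a point of W see only the values in W.\<close>

lemma deriv_upd_cong:
 assumes W: "opR n W" "x : W" "i < n" and eq: "!!x. x : W ==> f x = g x"
 shows "((%t. f (x(i := t))) has_field_derivative D) (at (x i)) <->
     ((%t. g (x(i := t))) has_field_derivative D) (at (x i))"
 by (rule DERIV_cong_ev) (use eventually_upd_in[OF W] eq in "auto elim: eventually_mono")

lemma Ck_cong:
 assumes W: "opR n W" and "!!x. x : W ==> f x = g x" and "Ck n W k f" shows "Ck n W k g" using assms(2,3)
proof (induction k arbitrary: f g)
 case 0
 thus ?case using continuous_on_cong[OF refl,of W f g] by (simp only: Ck_0_iff[OF W]) 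
next
 case (Suc k)
 have c: "continuous_on W g" using Ck_cont[OF W Suc.prems(2)] Suc.prems(1) continuous_on_cong[OF refl,of W f g] by simp
 have d: "DERIV (%t. g (x(i := t))) (x i) :> pd i f x" if "i < n" "x : W" for i x
  using Ck_Suc_deriv[OF Suc.prems(2) that] deriv_upd_cong[OF W that(2,1),of f g] Suc.prems(1) by blast
 have e: "pd i f x = pd i g x" if "i < n" "x : W" for i x using partial_deriv_eqI[OF d[OF that]] by simp
 have "Ck n W k (pd i g)" if "i < n" for i by (rule Suc.IH[OF e[OF that] Ck_Suc_partial[OF Suc.prems(2) that]])
 thus ?case using c d by (auto simp: cont_Rn_iff[OF W] field_differentiable_def)
qed

text \<open>Derivatives may be given by any formula D instead of \<open>partial_deriv\<close>. In
  this form the rules for sums, products and composites go through by induction on k.\<close>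

lemma Ck_SucI:
 assumes W: "opR n W" and "continuous_on W f"
  and "!!i x. i < n ==> x : W ==> ((%t. f (x(i := t))) has_field_derivative D i x) (at (x i))" and "!!i. i < n ==> Ck n W k (D i)"
 shows "Ck n W (Suc k) f"
proof -
 have e: "D i x = pd i f x" if "i < n" "x : W" for i x using partial_deriv_eqI[OF assms(3)[OF that]] by simp
 have "Ck n W k (pd i f)" if "i < n" for i by (rule Ck_cong[OF W e[OF that] assms(4)[OF that]])
 thus ?thesis using assms by (auto simp: cont_Rn_iff[OF W] field_differentiable_def)
qed

text \<open>Order \<open>Suc k\<close> speaks of continuity of f and of the order of its partial
  derivatives, not of order k of f itself; hence the induction.\<close>

lemma Ck_Suc_imp:
 assumes W: "opR n W" and "Ck n W (Suc k) f" shows "Ck n W k f" using assms(2)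
proof (induction k arbitrary: f)
 case 0
 thus ?case by simp
next
 case (Suc k)
 show ?case by (rule Ck_SucI[OF W,where D="%i. pd i f"]) (use Suc Ck_cont[OF W] Ck_Suc_deriv Ck_Suc_partial in "blast+")
qed

lemma Ck_subset:
 assumes "opR n W" "opR n W'" "W' <= W" "Ck n W k f" shows "Ck n W' k f" using assms(4)
proof (induction k arbitrary: f)
 case 0
 thus ?case using assms continuous_on_subset by (auto simp only: Ck_0_iff)
next
 case (Suc k)
 show ?case
 proof (rule Ck_SucI[OF assms(2),where D="%i. pd i f"])
  show "continuous_on W' f" using continuous_on_subset[OF Ck_cont[OF assms(1) Suc.prems] assms(3)] .
  fix i assume i: "i < n"
  show "DERIV (%t. f (x(i := t))) (x i) :> pd i f x" if "x : W'" for x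
   by (rule Ck_Suc_deriv[OF Suc.prems i]) (use that assms(3) in auto)
  show "Ck n W' k (pd i f)" by (rule Suc.IH[OF Ck_Suc_partial[OF Suc.prems i]])
 qed
qed

text \<open>Shrinking the neighbourhoods into W makes the filters at a point within W' and within W
  equal, which settles continuity. Higher orders follow by induction, applied to f and to its
  partial derivatives.\<close>

lemma Ck_local:
 assumes W: "opR n W" and "!!p. p : W ==> EX W'. opR n W' & p : W' & Ck n W' k f" shows "Ck n W k f"
proof -
 have "EX W'. opR n W' & p : W' & W' <= W & Ck n W' k f" if "p : W" for p
 proof -
  obtain W' where "opR n W'" "p : W'" "Ck n W' k f" using assms(2)[OF \<open>p : W\<close>] by blast
  thus ?thesis using W \<open>p : W\<close> by (intro exI[of _ "W' Int W"]) (auto intro: Ck_subset[of _ W'])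
 qed
 thus ?thesis
 proof (induction k arbitrary: f)
  case 0
  have "continuous (at p within W) f" if p: "p : W" for p
  proof -
   obtain W' where W': "opR n W'" "p : W'" "W' <= W" "continuous_on W' f" using 0[OF p] Ck_0_iff by blast
   hence "openin (top_of_set W) W'" using W W'(1,3) by (metis Esp openin_subset_trans Rn_sub Rn_def)
   hence "at p within W = at p within W'" using W'(2,3) by (auto simp: openin_open intro: at_within_nhd)
   thus ?thesis using W' by (simp add: continuous_on_eq_continuous_within)
  qed
  thus ?case using W by (simp add: Ck_0_iff continuous_on_eq_continuous_within del: Ck.simps)
 next
  case (Suc k)
  have ex: "EX W'. opR n W' & p : W' & W' <= W & Ck n W' (Suc k) f" if "p : W" for p by (rule Suc.prems[OF that])
  have c: "Ck n W k f"
  proof (rule Suc.IH)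
   fix p assume "p : W"
   then obtain W' where W': "opR n W'" "p : W'" "W' <= W" "Ck n W' (Suc k) f" using ex by blast
   thus "EX W'. opR n W' & p : W' & W' <= W & Ck n W' k f" using Ck_Suc_imp[OF W'(1,4)] by blast
  qed
  show ?case
  proof (rule Ck_SucI[OF W])
   show "continuous_on W f" by (rule Ck_cont[OF W c])
   fix i assume i: "i < n"
   show "DERIV (%t. f (x(i := t))) (x i) :> pd i f x" if x: "x : W" for x
   proof -
    obtain W' where W': "x : W'" "Ck n W' (Suc k) f" using ex[OF x] by blast
    show ?thesis by (rule Ck_Suc_deriv[OF W'(2) i W'(1)])
   qed
   show "Ck n W k (pd i f)"
   proof (rule Suc.IH)
    fix p assume "p : W"
    then obtain W' where W': "opR n W'" "p : W'" "W' <= W" "Ck n W' (Suc k) f" using ex by blast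
    thus "EX W'. opR n W' & p : W' & W' <= W & Ck n W' k (pd i f)" using Ck_Suc_partial[OF W'(4) i] by blast
   qed
  qed
 qed
qed

text \<open>
  A strong form of differentiability (in the style of Caratheodory) of functions with continuous
  partial derivatives. The filter includes the point itself, so that it can be composed with curves.
\<close>

lemma C1_strong_deriv:
 fixes f :: "(nat => real) => real"
 assumes W: "opR n W" and f: "Ck n W (Suc 0) f" and p: "p : W"
 shows "EX q. (ALL j<n. (q j ---> pd j f p) (inf (nhds p) (principal W))) &
  (\<forall>\<^sub>F y in inf (nhds p) (principal W). f y - f p = (\<Sum>j<n. q j y * (y j - p j)))"
proof -
 let ?N = "inf (nhds p) (principal W)"
 obtain e where e: "e > 0" "!!y. y : Rn n ==> (!!i. i < n ==> abs (y i - p i) < e) ==> y : W" using openin_Rn_box[OF W p] by blast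
 have WR: "W <= Rn n" using Rn_sub[OF W] .
 have pR: "p : Rn n" using p WR by blast
 \<comment> \<open>The point u j y has its first j coordinates from y and the others from p. This is
   a path from p to y along the axes, with one application of the mean value theorem per
   coordinate.\<close>
 define u where "u j y = (%l. if l < j then y l else p l)" for j and y :: "nat => real"
 define B where "B = {y : Rn n. ALL i<n. abs (y i - p i) < e}"
 have step: "EX s. abs (s - p j) <= abs (y j - p j) &
   f (u (Suc j) y) - f (u j y) = pd j f ((u j y)(j := s)) * (y j - p j)" if y: "y : B" and j: "j < n" for y j
 proof -
  let ?g = "%t. f ((u j y)(j := t))"
  have inW: "(u j y)(j := t) : W" if "abs (t - p j) < e" for t using y that pR e j by (intro e(2)) (auto simp: B_def u_def Rn_def)
  have d: "(?g has_field_derivative pd j f ((u j y)(j := t))) (at t)" if "abs (t - p j) < e" for t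
   using Ck_Suc_deriv[OF f j inW[OF that]] by simp
  have e1: "u (Suc j) y = (u j y)(j := y j)" and e2: "u j y = (u j y)(j := p j)" by (auto simp: u_def fun_eq_iff)
  have yj: "abs (y j - p j) < e" using y j by (auto simp: B_def)
  consider "y j = p j" | "p j < y j" | "y j < p j" by linarith
  thus ?thesis
  proof cases
   case 1
   thus ?thesis using e1 e2 by (intro exI[of _ "p j"]) simp
  next
   case 2
   have "EX z>p j. z < y j & ?g (y j) - ?g (p j) = (y j - p j) * pd j f ((u j y)(j := z))"
    by (rule MVT2[OF 2]) (rule d,use yj in linarith)
   then obtain z where z: "p j < z" "z < y j"
    "?g (y j) - ?g (p j) = (y j - p j) * pd j f ((u j y)(j := z))" by blast
   thus ?thesis using e1 e2 by (intro exI[of _ z]) (simp add: algebra_simps)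
  next
   case 3
   have "EX z>y j. z < p j & ?g (p j) - ?g (y j) = (p j - y j) * pd j f ((u j y)(j := z))"
    by (rule MVT2[OF 3]) (rule d,use yj in linarith)
   then obtain z where z: "y j < z" "z < p j"
    "?g (p j) - ?g (y j) = (p j - y j) * pd j f ((u j y)(j := z))" by blast
   thus ?thesis using e1 e2 by (intro exI[of _ z]) (simp add: algebra_simps)
  qed
 qed
 then obtain s where s: "!!y j. y : B ==> j < n ==> abs (s y j - p j) <= abs (y j - p j)"
  "!!y j. y : B ==> j < n ==>
   f (u (Suc j) y) - f (u j y) = pd j f ((u j y)(j := s y j)) * (y j - p j)" by metis
 \<comment> \<open>A partial derivative at an intermediate point. These points tend to p with y, so
   continuity of the partial derivative gives the limit of q j.\<close>
 define q where "q j y = pd j f ((u j y)(j := s y j))" for j y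
 have evB: "\<forall>\<^sub>F y in ?N. y : B"
 proof -
  have "open {y::nat=>real. abs (y i - p i) < e}" for i by (rule open_Collect_less; intro continuous_intros cont_coord)
  hence "\<forall>\<^sub>F y in nhds p. abs (y i - p i) < e" for i
   using e(1) eventually_nhds by (metis (no_types,lifting) abs_zero cancel_comm_monoid_add_class.diff_cancel mem_Collect_eq)
  hence "\<forall>\<^sub>F y in nhds p. ALL i:{..<n}. abs (y i - p i) < e" by (intro eventually_ball_finite) auto
  thus ?thesis unfolding eventually_inf_principal B_def by (rule eventually_mono) (use WR in auto)
 qed
 have coord: "((%y. y l) ---> p l) ?N" for l
 proof (rule tendsto_mono)
  show "?N <= nhds p" by simp
  show "((%y. y l) ---> p l) (nhds p)" using cont_coord[of UNIV l] tendsto_at_iff_tendsto_nhds[of "%y::nat=>real. y l" p]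
   by (simp add: continuous_on_def)
 qed
 have lim: "(q j ---> pd j f p) ?N" if j: "j < n" for j
 proof -
  have a: "((%y. (u j y)(j := s y j)) ---> p) ?N"
  proof (subst tendsto_fun_iff,intro allI)
   fix l
   have "((%y. ((u j y)(j := s y j)) l - p l) ---> 0) ?N"
   proof (rule Lim_null_comparison)
    show "\<forall>\<^sub>F y in ?N. norm (((u j y)(j := s y j)) l - p l) <= abs (y l - p l)"
     using evB by (rule eventually_mono) (use s(1) j in "auto simp: u_def")
    show "((%y. abs (y l - p l)) ---> 0) ?N" using tendsto_rabs[OF tendsto_diff[OF coord[of l] tendsto_const[of "p l"]]] by simp
   qed
   thus "((%y. ((u j y)(j := s y j)) l) ---> p l) ?N" by (simp add: LIM_zero_iff)
  qed
  have "\<forall>\<^sub>F y in ?N. (u j y)(j := s y j) : W" using evB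
  proof (rule eventually_mono)
   fix y assume "y : B"
   thus "(u j y)(j := s y j) : W" using s(1)[OF \<open>y : B\<close> j] pR e(1) j by (intro e(2)) (auto simp: B_def u_def Rn_def)
  qed
  hence b: "filterlim (%y. (u j y)(j := s y j)) ?N ?N" using a by (simp add: filterlim_inf filterlim_principal)
  have "continuous_on W (pd j f)" using Ck_Suc_partial[OF f j] W by (simp add: cont_Rn_iff)
  hence "(pd j f ---> pd j f p) ?N"
   using p by (metis at_within_def continuous_on_def inf_commute nhds_neq_bot tendsto_at_iff_tendsto_nhds_within)
  from filterlim_compose[OF this b] show ?thesis by (simp add: q_def[abs_def])
 qed
 have "\<forall>\<^sub>F y in ?N. f y - f p = (\<Sum>j<n. q j y * (y j - p j))" using evB
 proof (rule eventually_mono)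
  fix y assume y: "y : B"
  have "u n y = y" using y pR by (auto simp: u_def B_def Rn_def fun_eq_iff)
  moreover have "u 0 y = p" by (auto simp: u_def)
  ultimately have "f y - f p = (\<Sum>j<n. f (u (Suc j) y) - f (u j y))"
   using sum_lessThan_telescope[of "%j. f (u j y)" n] by simp
  also have "... = (\<Sum>j<n. q j y * (y j - p j))" using s(2)[OF y] by (simp add: q_def)
  finally show "f y - f p = (\<Sum>j<n. q j y * (y j - p j))" .
 qed
 with lim show ?thesis by blast
qed

text \<open>The identity of \<open>C1_strong_deriv\<close> is evaluated along c and divided by t -
  t0. Coordinates of c from n on vanish near t0, as c stays in W.\<close>

lemma chain_curve:
 assumes W: "opR n W" and f: "Ck n W (Suc 0) f" and c: "\<forall>\<^sub>F t in nhds t0. c t : W"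
  and d: "!!j. j < n ==> ((%t. c t j) has_field_derivative c' j) (at t0)"
 shows "DERIV (%t. f (c t)) t0 :> (\<Sum>j<n. pd j f (c t0) * c' j)"
proof -
 let ?p = "c t0" and ?N = "inf (nhds (c t0)) (principal W)"
 have p: "?p : W" using c by (rule eventually_nhds_x_imp_x)
 obtain q where q: "!!j. j < n ==> (q j ---> pd j f ?p) ?N"
  "\<forall>\<^sub>F y in ?N. f y - f ?p = (\<Sum>j<n. q j y * (y j - ?p j))" using C1_strong_deriv[OF W f p] by blast
 have evc: "\<forall>\<^sub>F t in at t0. c t : W" using c by (simp add: eventually_nhds_conv_at)
 have "(c ---> ?p) (at t0)"
 proof (subst tendsto_fun_iff,intro allI)
  fix l show "((%t. c t l) ---> c t0 l) (at t0)"
  proof (cases "l < n")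
   case True
   thus ?thesis using DERIV_isCont[OF d[OF True]] by (simp add: isCont_def)
  next
   case False
   have "\<forall>\<^sub>F t in at t0. c t0 l = c t l" using evc
   proof (rule eventually_mono)
    fix t assume "c t : W"
    hence "c t : Rn n" "c t0 : Rn n" using p Rn_sub[OF W] by auto
    thus "c t0 l = c t l" using False by (simp add: Rn_def)
   qed
   thus ?thesis by (rule Lim_transform_eventually[OF tendsto_const])
  qed
 qed
 hence lc: "filterlim c ?N (at t0)" using evc by (simp add: filterlim_inf filterlim_principal)
 have "((%t. (f (c t) - f (c t0)) / (t - t0)) ---> (\<Sum>j<n. pd j f ?p * c' j)) (at t0)"
 proof (rule Lim_transform_eventually)
  show "((%t. \<Sum>j<n. q j (c t) * ((c t j - c t0 j) / (t - t0))) ---> (\<Sum>j<n. pd j f ?p * c' j)) (at t0)"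
  proof (intro tendsto_sum tendsto_mult)
   fix j assume "j : {..<n}"
   hence j: "j < n" by simp
   show "((%t. q j (c t)) ---> pd j f ?p) (at t0)" by (rule filterlim_compose[OF q(1)[OF j] lc])
   show "((%t. (c t j - c t0 j) / (t - t0)) ---> c' j) (at t0)" using d[OF j] by (simp add: has_field_derivative_iff)
  qed
  have "\<forall>\<^sub>F t in at t0. f (c t) - f ?p = (\<Sum>j<n. q j (c t) * (c t j - ?p j))"
   by (rule eventually_compose_filterlim[OF q(2) lc])
  thus "\<forall>\<^sub>F t in at t0. (\<Sum>j<n. q j (c t) * ((c t j - c t0 j) / (t - t0))) = (f (c t) - f (c t0)) / (t - t0)"
   by (rule eventually_mono) (simp add: sum_divide_distrib)
 qed
 thus ?thesis by (simp add: has_field_derivative_iff)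
qed

lemma Ck_const: "opR n W ==> Ck n W k (%x. c)"
proof (induction k arbitrary: c)
 case 0
 thus ?case by (simp only: Ck_0_iff continuous_on_const)
next
 case (Suc k)
 show ?case by (rule Ck_SucI[OF Suc.prems,where D="%_ _. 0"]) (use Suc in auto)
qed

lemma Ck_coord: "opR n W ==> Ck n W k (%x. x i)"
proof (cases k)
 case 0
 assume "opR n W"
 thus ?thesis unfolding 0 by (simp only: Ck_0_iff cont_coord)
next
 case (Suc l)
 assume W: "opR n W"
 show ?thesis unfolding Suc by (rule Ck_SucI[OF W,where D="%j _. if j = i then 1 else 0"])
   (auto intro!: Ck_const W cont_coord derivative_eq_intros)
qed

lemma Ck_add:
 assumes W: "opR n W" shows "Ck n W k f ==> Ck n W k g ==> Ck n W k (%x. f x + g x)"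
proof (induction k arbitrary: f g)
 case 0
 thus ?case by (auto simp only: Ck_0_iff[OF W] intro: continuous_on_add)
next
 case (Suc k)
 show ?case
 proof (rule Ck_SucI[OF W,where D="%i x. pd i f x + pd i g x"])
  show "continuous_on W (%x. f x + g x)"
   using Suc.prems by (intro continuous_on_add) (auto intro: Ck_cont[OF W] simp del: Ck.simps)
  fix i assume i: "i < n"
  show "DERIV (%t. f (x(i := t)) + g (x(i := t))) (x i) :> pd i f x + pd i g x" if "x : W" for x
   by (rule DERIV_add[OF Ck_Suc_deriv[OF Suc.prems(1) i that] Ck_Suc_deriv[OF Suc.prems(2) i that]])
  show "Ck n W k (%x. pd i f x + pd i g x)" by (intro Suc.IH Ck_Suc_partial[OF _ i] Suc.prems)
 qed
qed

lemma Ck_mult: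
 assumes W: "opR n W" shows "Ck n W k f ==> Ck n W k g ==> Ck n W k (%x. f x * g x)"
proof (induction k arbitrary: f g)
 case 0
 thus ?case by (auto simp only: Ck_0_iff[OF W] intro: continuous_on_mult)
next
 case (Suc k)
 show ?case
 proof (rule Ck_SucI[OF W,where D="%i x. pd i f x * g x + pd i g x * f x"])
  show "continuous_on W (%x. f x * g x)"
   using Suc.prems by (intro continuous_on_mult) (auto intro: Ck_cont[OF W] simp del: Ck.simps)
  fix i assume i: "i < n"
  show "DERIV (%t. f (x(i := t)) * g (x(i := t))) (x i) :> pd i f x * g x + pd i g x * f x" if "x : W" for x
   using DERIV_mult[OF Ck_Suc_deriv[OF Suc.prems(1) i that] Ck_Suc_deriv[OF Suc.prems(2) i that]] by (simp only: fun_upd_triv)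
  show "Ck n W k (%x. pd i f x * g x + pd i g x * f x)"
   by (intro Ck_add[OF W] Suc.IH Ck_Suc_partial[OF _ i] Suc.prems Ck_Suc_imp[OF W])
 qed
qed

lemma Ck_sum:
 assumes W: "opR n W" and "!!i. i : I ==> Ck n W k (f i)" shows "Ck n W k (%x. \<Sum>i\<in>I. f i x)" using assms(2)
proof (induction I rule: infinite_finite_induct)
 case (insert i I)
 thus ?case using Ck_add[OF W] by simp
qed (simp_all only: sum.infinite sum.empty Ck_const[OF W] not_False_eq_True)

text \<open>Induction on k for all g: by \<open>chain_curve\<close> each partial derivative is a sum
  of products of composites of lower order with partial derivatives of F. Coordinates of F from m on
  are zero because F maps into W'.\<close>

lemma Ck_compose:
 assumes W: "opR n W" and W': "opR m W'" and F: "!!x. x : W ==> F x : W'"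
 shows "Ck m W' k g ==> (!!j. j < m ==> Ck n W k (%x. F x j)) ==> Ck n W k (%x. g (F x))"
proof (induction k arbitrary: g)
 case 0
 have "continuous_on W F"
 proof (subst continuous_on_fun_iff,intro allI)
  fix j show "continuous_on W (%x. F x j)"
  proof (cases "j < m")
   case False
   hence "F x j = 0" if "x : W" for x using F[OF that] Rn_sub[OF W'] by (auto simp: Rn_def)
   thus ?thesis by simp
  qed (use 0 Ck_0_iff[OF W] in blast)
 qed
 moreover have "continuous_on W' g" using 0 Ck_0_iff[OF W'] by blast
 ultimately have "continuous_on W (%x. g (F x))" using continuous_on_compose2[of W' g W F] F by blast
 thus ?case using Ck_0_iff[OF W] by blast
next
 case (Suc k)
 have Fk: "Ck n W k (%x. F x j)" if "j < m" for j using Suc.prems(2)[OF that] Ck_Suc_imp[OF W] by blast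
 have g1: "Ck m W' (Suc 0) g" using Suc.prems(1) by (induction k) (blast dest: Ck_Suc_imp[OF W'])+
 show ?case
 proof (rule Ck_SucI[OF W,where D="%i x. \<Sum>j<m. pd j g (F x) * pd i (%x. F x j) x"])
  have "Ck n W k (%x. g (F x))" by (rule Suc.IH[OF Ck_Suc_imp[OF W' Suc.prems(1)] Fk])
  thus "continuous_on W (%x. g (F x))" by (rule Ck_cont[OF W])
  fix i assume i: "i < n"
  show "((%t. g (F (x(i := t)))) has_field_derivative
    (\<Sum>j<m. pd j g (F x) * pd i (%x. F x j) x)) (at (x i))" if x: "x : W" for x
   using chain_curve[OF W' g1,of "%t. F (x(i := t))" "x i" "%j. pd i (%x. F x j) x"]
    eventually_mono[OF eventually_upd_in[OF W x i] F] Ck_Suc_deriv[OF Suc.prems(2) i x] by simp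
  show "Ck n W k (%x. \<Sum>j<m. pd j g (F x) * pd i (%x. F x j) x)"
  proof (rule Ck_sum[OF W])
   fix j assume "j : {..<m}"
   hence j: "j < m" by simp
   show "Ck n W k (%x. pd j g (F x) * pd i (%x. F x j) x)" by (rule Ck_mult[OF W Suc.IH[OF Ck_Suc_partial[OF Suc.prems(1) j] Fk]
       Ck_Suc_partial[OF Suc.prems(2)[OF j] i]])
  qed
 qed
qed

lemma Ck_uminus:
 assumes W: "opR n W" and "Ck n W k f" shows "Ck n W k (%x. - f x)" using Ck_mult[OF W Ck_const[OF W,of k "-1"] assms(2)] by simp

text \<open>The derivative of 1/f is a polynomial in 1/f and a partial derivative of f, so order k
  of 1/f yields order k + 1.\<close>

lemma Ck_inverse:
 assumes W: "opR n W" and nz: "!!x. x : W ==> f x ~= 0" shows "Ck n W k f ==> Ck n W k (%x. inverse (f x))"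
proof (induction k)
 case 0
 thus ?case using nz by (auto simp only: Ck_0_iff[OF W] intro!: continuous_on_inverse)
next
 case (Suc k)
 have IH: "Ck n W k (%x. inverse (f x))" by (rule Suc.IH[OF Ck_Suc_imp[OF W Suc.prems]])
 show ?case
 proof (rule Ck_SucI[OF W,where D="%i x. - (pd i f x * (inverse (f x) * inverse (f x)))"])
  show "continuous_on W (%x. inverse (f x))" by (rule Ck_cont[OF W IH])
  fix i assume i: "i < n"
  show "DERIV (%t. inverse (f (x(i := t)))) (x i) :> - (pd i f x * (inverse (f x) * inverse (f x)))" if "x : W" for x
   using DERIV_inverse_fun[OF Ck_Suc_deriv[OF Suc.prems i that]] nz[OF that]
   by (simp del: fun_upd_apply add: power2_eq_square inverse_mult_distrib ac_simps)
  show "Ck n W k (%x. - (pd i f x * (inverse (f x) * inverse (f x))))"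
   by (rule Ck_uminus[OF W Ck_mult[OF W Ck_Suc_partial[OF Suc.prems i] Ck_mult[OF W IH IH]]])
 qed
qed

definition Cinf :: "nat => (nat => real) set => ((nat => real) => real) => bool" where
 "Cinf n W f <-> (ALL k. Ck n W k f)"

lemma smooth_euclid_iff: "smooth_euclid n W m f <-> (ALL i<m. Cinf n W (%x. f x i))" by (auto simp: smooth_euclid_def Cinf_def)

lemma Cinf_cong:
 assumes "opR n W" "!!x. x : W ==> f x = g x" "Cinf n W f" shows "Cinf n W g"
 using assms(3) Ck_cong[OF assms(1,2)] by (simp add: Cinf_def)

lemma Cinf_subset:
 assumes "opR n W" "opR n W'" "W' <= W" "Cinf n W f" shows "Cinf n W' f"
 using assms(4) Ck_subset[OF assms(1-3)] by (simp add: Cinf_def)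

lemma Cinf_local:
 assumes "opR n W" and "!!p. p : W ==> EX W'. opR n W' & p : W' & Cinf n W' f" shows "Cinf n W f" unfolding Cinf_def
proof
 fix k show "Ck n W k f" by (rule Ck_local[OF assms(1)]) (use assms(2) in "simp add: Cinf_def,blast")
qed

lemma Cinf_cont: "opR n W ==> Cinf n W f ==> continuous_on W f" unfolding Cinf_def by (rule Ck_cont[of n W 0 f]) blast+

lemma Cinf_const: "opR n W ==> Cinf n W (%x. c)" by (simp add: Cinf_def Ck_const del: Ck.simps)

lemma Cinf_coord: "opR n W ==> Cinf n W (%x. x i)" by (simp add: Cinf_def Ck_coord del: Ck.simps)

lemma Cinf_add: "opR n W ==> Cinf n W f ==> Cinf n W g ==> Cinf n W (%x. f x + g x)" by (simp add: Cinf_def Ck_add del: Ck.simps)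

lemma Cinf_mult: "opR n W ==> Cinf n W f ==> Cinf n W g ==> Cinf n W (%x. f x * g x)"
 by (simp add: Cinf_def Ck_mult del: Ck.simps)

lemma Cinf_uminus: "opR n W ==> Cinf n W f ==> Cinf n W (%x. - f x)" by (simp add: Cinf_def Ck_uminus del: Ck.simps)

lemma Cinf_diff: "opR n W ==> Cinf n W f ==> Cinf n W g ==> Cinf n W (%x. f x - g x)"
 using Cinf_add[of n W f "%x. - g x"] Cinf_uminus by simp

lemma Cinf_inverse:
 "opR n W ==> (!!x. x : W ==> f x ~= 0) ==> Cinf n W f ==> Cinf n W (%x. inverse (f x))"
 by (simp add: Cinf_def Ck_inverse del: Ck.simps)

lemma Cinf_compose:
 assumes "opR n W" "opR m W'"
  "!!x. x : W ==> F x : W'" "Cinf m W' g" "!!j. j < m ==> Cinf n W (%x. F x j)" shows "Cinf n W (%x. g (F x))" unfolding Cinf_def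
proof
 fix k show "Ck n W k (%x. g (F x))"
  by (rule Ck_compose[OF assms(1-3)]) (use assms(4,5) in "simp_all add: Cinf_def del: Ck.simps")
qed

lemma Cinf_partial: "Cinf n W f ==> i < n ==> Cinf n W (pd i f)" unfolding Cinf_def using Ck_Suc_partial by blast

lemma Cinf_deriv:
 "Cinf n W f ==> i < n ==> x : W ==>
  ((%t. f (x(i := t))) has_field_derivative pd i f x) (at (x i))" unfolding Cinf_def by (rule Ck_Suc_deriv[of n W 0]) blast+

section \<open>Bump functions\<close>

text \<open>The functions exp (-1/t) t^(-j), extended by zero. The exponent j is carried along
  because the linear span of the family is closed under differentiation (\<open>flat_deriv\<close>);
  the bump functions themselves use j = 0.\<close>

definition flat :: "nat => real => real" where
 "flat j t = (if t <= 0 then 0 else exp (- inverse t) * inverse t ^ j)"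

lemma flat_tendsto_0: "(flat j ---> 0) (at 0)"
proof -
 \<comment> \<open>The substitution x = 1/t turns the limit at 0 from the right into the decay of
   x^j / exp x at infinity.\<close>
 have "((%x. x ^ j / exp x) ---> (0::real)) at_top" by (rule tendsto_power_div_exp_0)
 from filterlim_compose[OF this filterlim_inverse_at_top_right]
 have "((%t. inverse t ^ j / exp (inverse t)) ---> (0::real)) (at_right 0)" .
 hence r: "(flat j ---> 0) (at_right 0)" by (rule Lim_transform_eventually)
   (auto simp: flat_def eventually_at_filter exp_minus field_simps)
 have "(flat j ---> 0) (at_left 0)" by (rule Lim_transform_eventually[OF tendsto_const])
   (auto simp: flat_def eventually_at_filter)
 with r show ?thesis by (simp add: filterlim_at_split)
qed

lemma flat_deriv: "(flat j has_field_derivative (flat (j + 2) t - real j * flat (j + 1) t)) (at t)"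
proof -
 consider "t < 0" | "t = 0" | "t > 0" by linarith
 thus ?thesis
 proof cases
  case 1
  have "DERIV (%_. 0) t :> 0" by simp
  hence "(flat j has_field_derivative 0) (at t)"
   by (rule has_field_derivative_transform_within_open[where S="{..<0}"]) (use 1 in "auto simp: flat_def")
  thus ?thesis using 1 by (simp add: flat_def)
 next
  case 2
  \<comment> \<open>Away from 0 the difference quotient of \<open>flat j\<close> at 0 is
    \<open>flat (Suc j)\<close>, whose limit is known.\<close>
  have "((%t. (flat j t - flat j 0) / (t - 0)) ---> 0) (at 0)" by (rule Lim_transform_eventually[OF flat_tendsto_0[of "Suc j"]])
    (auto simp: flat_def eventually_at_filter field_simps)
  thus ?thesis using 2 by (simp add: has_field_derivative_iff flat_def)
 next
  case 3
  have "((%t. exp (- inverse t) * inverse t ^ j) has_field_derivative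
   exp (- inverse t) * inverse t ^ (j+2) - real j * (exp (- inverse t) * inverse t ^ (j+1))) (at t)"
  proof (cases j)
   case 0
   thus ?thesis using 3 by (auto intro!: derivative_eq_intros simp: power2_eq_square)
  next
   case (Suc i)
   thus ?thesis using 3 by (auto intro!: derivative_eq_intros simp: power2_eq_square algebra_simps)
     (metis One_nat_def power_eq_if)
  qed
  hence "(flat j has_field_derivative
   exp (- inverse t) * inverse t ^ (j+2) - real j * (exp (- inverse t) * inverse t ^ (j+1))) (at t)"
   by (rule has_field_derivative_transform_within_open[where S="{0<..}"]) (use 3 in "auto simp: flat_def")
  thus ?thesis using 3 by (simp add: flat_def)
 qed
qed

text \<open>Order k is proved for all j at once, since differentiation raises j.\<close>

lemma Ck_flat:
 assumes W: "opR n W" shows "Ck n W k f ==> Ck n W k (%x. flat j (f x))"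
proof (induction k arbitrary: j)
 case 0
 have "continuous_on UNIV (flat j)" using DERIV_isCont[OF flat_deriv] by (simp add: continuous_on_eq_continuous_at)
 moreover have "continuous_on W f" using 0 Ck_0_iff[OF W] by blast
 ultimately have "continuous_on W (%x. flat j (f x))" using continuous_on_compose2[of UNIV "flat j" W f] by blast
 thus ?case using Ck_0_iff[OF W] by blast
next
 case (Suc k)
 have IH: "Ck n W k (%x. flat j (f x))" for j by (rule Suc.IH[OF Ck_Suc_imp[OF W Suc.prems]])
 show ?case
 proof (rule Ck_SucI[OF W,where D="%i x. (flat (j + 2) (f x) + (- real j) * flat (j + 1) (f x)) * pd i f x"])
  show "continuous_on W (%x. flat j (f x))" by (rule Ck_cont[OF W IH])
  fix i assume i: "i < n"
  show "DERIV (%t. flat j (f (x(i := t)))) (x i) :> (flat (j + 2) (f x) + (- real j) * flat (j + 1) (f x)) * pd i f x" if "x : W" for x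
   using DERIV_chain2[OF flat_deriv Ck_Suc_deriv[OF Suc.prems i that],of j] by (simp del: fun_upd_apply)
  show "Ck n W k (%x. (flat (j + 2) (f x) + (- real j) * flat (j + 1) (f x)) * pd i f x)"
   by (rule Ck_mult[OF W Ck_add[OF W IH Ck_mult[OF W Ck_const[OF W] IH]] Ck_Suc_partial[OF Suc.prems i]])
 qed
qed

lemma flat_nonneg: "flat j t >= 0" and flat_pos: "t > 0 ==> flat j t > 0" and flat_zero: "t <= 0 ==> flat j t = 0"
 by (auto simp: flat_def)

definition smooth_step :: "real => real" where
 "smooth_step t = flat 0 t / (flat 0 t + flat 0 (1 - t))"

lemma smooth_step_denom: "flat 0 t + flat 0 (1 - t) > 0"
 using flat_nonneg[of 0 t] flat_nonneg[of 0 "1 - t"] flat_pos[of t 0] flat_pos[of "1 - t" 0] by linarith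

lemma smooth_step_0: "t <= 0 ==> smooth_step t = 0" by (simp add: smooth_step_def flat_zero)

lemma smooth_step_1: "t >= 1 ==> smooth_step t = 1" using smooth_step_denom[of t] by (simp add: smooth_step_def flat_zero)

lemma Cinf_smooth_step:
 assumes W: "opR n W" and f: "Cinf n W f" shows "Cinf n W (%x. smooth_step (f x))"
proof -
 have F: "Cinf n W (%x. flat 0 (g x))" if "Cinf n W g" for g using that Ck_flat[OF W] by (simp add: Cinf_def del: Ck.simps)
 note a = F[OF f] and b = F[OF Cinf_diff[OF W Cinf_const[OF W,of 1] f]]
 have nz: "flat 0 (f x) + flat 0 (1 - f x) ~= 0" for x using smooth_step_denom[of "f x"] by linarith
 have "Cinf n W (%x. flat 0 (f x) * inverse (flat 0 (f x) + flat 0 (1 - f x)))"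
  by (rule Cinf_mult[OF W a Cinf_inverse[OF W nz Cinf_add[OF W a b]]])
 thus ?thesis by (simp add: smooth_step_def divide_inverse)
qed

section \<open>Changing one coordinate\<close>

lemma Rn_preim:
 assumes W: "opR n W" and f: "continuous_on W f" and "open T" shows "opR n {x : W. f x : T}"
proof -
 have "openin (top_of_set W) {x : W. f x : T}"
  using continuous_openin_preimage_gen[OF f \<open>open T\<close>] by (simp add: vimage_def Int_def)
 hence "openin (subtopology (Euclidean_space n) W) {x : W. f x : T}" using Rn_sub[OF W]
  by (simp add: Esp Rn_def subtopology_subtopology inf_absorb2)
 thus ?thesis using W openin_open_subtopology by blast
qed

lemma openin_Rn_box_I:
 "opR n {y : Rn n. ALL i<n. abs (y i - p i) < r i}"
proof -
 have "open {y::nat=>real. abs (y i - p i) < r i}" for i by (rule open_Collect_less; intro continuous_intros cont_coord)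
 hence "open (\<Inter>i\<in>{..<n}. {y::nat=>real. abs (y i - p i) < r i})" by (intro open_INT) auto
 moreover have "{y : Rn n. ALL i<n. abs (y i - p i) < r i} = Rn n Int (\<Inter>i\<in>{..<n}. {y. abs (y i - p i) < r i})" by auto
 ultimately show ?thesis by (auto simp: Esp Rn_def openin_open)
qed

text \<open>
  The inverse function theorem for maps changing a single coordinate. It suffices for the normal
  form of submersions, one equation at a time; the inverse is continuous by invariance of domain.
\<close>

lemma coord_change:
 assumes W: "opR n W" and F: "Cinf n W F" and p: "p : W" and j: "j < n" and nz: "pd j F p ~= 0"
 obtains U V G where "opR n U" "p : U" "U <= W" "opR n V"
  "!!x. x : U ==> x(j := F x) : V & G (x(j := F x)) = x"
  "!!y. y : V ==> G y : U & (G y)(j := F (G y)) = y"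
  "!!i. Cinf n V (%y. G y i)"
proof -
 \<comment> \<open>With this sign s F increases in the j-th coordinate on the box U, where
   \<open>s * pd j F\<close> stays positive. This gives injectivity of the coordinate
   change.\<close>
 define s where "s = sgn (pd j F p)"
 define B where "B = {x : W. s * pd j F x : {0<..}}"
 have cF: "continuous_on W F" by (rule Cinf_cont[OF W F])
 have B: "opR n B" unfolding B_def by (intro Rn_preim[OF W] continuous_on_mult continuous_on_const
    Cinf_cont[OF W Cinf_partial[OF F j]]) simp
 have "p : B" using p nz by (auto simp: B_def s_def sgn_if)
 obtain e where e: "e > 0" "!!y. y : Rn n ==> (!!i. i < n ==> abs (y i - p i) < e) ==> y : B"
  using openin_Rn_box[OF B \<open>p : B\<close>] by blast
 define U where "U = {x : Rn n. ALL i<n. abs (x i - p i) < e}"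
 have U: "opR n U" unfolding U_def by (rule openin_Rn_box_I)
 have UB: "U <= B" using e(2) by (auto simp: U_def)
 have UW: "U <= W" using UB by (auto simp: B_def)
 let ?c = "%x. x(j := F x)"
 have mono: "s * F x < s * F (x(j := t))" if x: "x : U" "x(j := t) : U" "x j < t" for x t
 proof -
  have "s * F (x(j := x j)) < s * F (x(j := t))"
  proof (rule DERIV_pos_imp_increasing[OF x(3)])
   fix z assume z: "x j <= z" "z <= t"
   have "abs (x j - p j) < e" "abs (t - p j) < e" using x(1,2) j by (auto simp: U_def)
   hence "x(j := z) : U" using x(1) z j by (auto simp: U_def Rn_iff)
   hence zB: "x(j := z) : B" using UB by blast
   hence "DERIV (%u. F (x(j := u))) z :> pd j F (x(j := z))" using Cinf_deriv[OF F j,of "x(j := z)"] by (auto simp: B_def)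
   hence "DERIV (%u. s * F (x(j := u))) z :> s * pd j F (x(j := z))" by (rule DERIV_cmult)
   thus "EX y. ((%u. s * F (x(j := u))) has_field_derivative y) (at z) & 0 < y" using zB by (auto simp: B_def)
  qed
  thus ?thesis by simp
 qed
 have inj: "inj_on ?c U"
 proof (rule inj_onI)
  fix x y assume x: "x : U" and y: "y : U" and eq: "x(j := F x) = y(j := F y)"
  have Fe: "F x = F y" using fun_cong[OF eq,of j] by simp
  have u: "x(j := t) = y(j := t)" for t using arg_cong[OF eq,of "%z. z(j := t)"] by simp
  have "s * F x < s * F y" if "x j < y j" using mono[OF x _ that] u[of "y j"] y by simp
  moreover have "s * F y < s * F x" if "y j < x j" using mono[OF y _ that] u[of "x j",symmetric] x by simp
  ultimately have "x j = y j" using Fe by fastforce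
  thus "x = y" using u[of "y j"] by (metis fun_upd_triv)
 qed
 \<comment> \<open>The coordinate change is injective and continuous, hence open by invariance of
   domain; continuity of h, the j-th coordinate of the inverse, is read off from this.\<close>
 have img: "opR n (?c ` T)" if T: "T <= U" "opR n T" for T
 proof (rule invariance_of_domain_Euclidean_space[OF T(2) _ inj_on_subset[OF inj T(1)]])
  have "continuous_on T ?c"
  proof (subst continuous_on_fun_iff,intro allI)
   fix i show "continuous_on T (%x. (x(j := F x)) i)"
    using continuous_on_subset[OF cF] T(1) UW by (cases "i = j") (auto simp: cont_coord)
  qed
  thus "continuous_map (subtopology (Euclidean_space n) T) (Euclidean_space n) ?c" using Rn_sub[OF T(2)] j
   by (auto simp: Esp Rn_def subtopology_subtopology inf_absorb2)
 qed
 define V where "V = ?c ` U"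
 have V: "opR n V" using img[OF _ U] by (simp add: V_def)
 define h where "h y = ivi U ?c y j" for y
 define G where "G y = y(j := h y)" for y
 have hc: "h (?c x) = x j" if "x : U" for x using inv_into_f_f[OF inj that] by (simp add: h_def)
 have UV: "x(j := F x) : V & G (x(j := F x)) = x" if "x : U" for x using that by (simp add: V_def G_def hc)
 have GU: "G y : U & (G y)(j := F (G y)) = y" if "y : V" for y using that UV unfolding V_def by force
 have h: "F (y(j := h y)) = y j" if "y : V" for y using fun_cong[OF conjunct2[OF GU[OF that]],of j] by (simp add: G_def)
 have ch: "continuous_on V h" unfolding cont_Rn_iff[OF V,symmetric] continuous_map_def
 proof (intro conjI allI impI)
  fix T :: "real set" assume "openin euclideanreal T"
  hence "opR n {x : U. x j : T}" by (intro Rn_preim[OF U cont_coord]) simp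
  moreover have "{y : V. h y : T} = ?c ` {x : U. x j : T}" by (auto simp: V_def hc)
  ultimately have "opR n {y : V. h y : T}" by (simp add: img)
  thus "openin (subtopology (Euclidean_space n) V) {y : topspace (subtopology (Euclidean_space n) V). h y : T}"
   using V Rn_sub[OF V] by (simp add: openin_open_subtopology topspace_subtopology inf_absorb2)
 qed simp
 \<comment> \<open>Implicit differentiation of \<open>F (y(j := h y)) = y j\<close>: the derivative
   of h in direction j is 1 / F_j, and in another direction i it is - F_i / F_j, where F_i are the
   partial derivatives at G y.\<close>
 define D where "D i y = (if i = j then 1 else - pd i F (G y)) * inverse (pd j F (G y))" for i y
 have nzU: "pd j F (G y) ~= 0" if "y : V" for y using GU[OF that] UB by (auto simp: B_def)
 have dh: "DERIV (%t. h (y(i := t))) (y i) :> D i y" if i: "i < n" and y: "y : V" for i y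
 proof -
  let ?x = "G y" and ?N = "inf (nhds (G y)) (principal W)" and ?c = "%t. y(i := t)"
  have xW: "?x : W" using GU[OF y] UW by blast
  have "Ck n W (Suc 0) F" using F by (simp add: Cinf_def del: Ck.simps)
  from C1_strong_deriv[OF W this xW] obtain q where
   q: "!!l. l < n ==> (q l ---> pd l F ?x) ?N"
    "\<forall>\<^sub>F z in ?N. F z - F ?x = (\<Sum>l<n. q l z * (z l - ?x l))" by blast
  have ev: "\<forall>\<^sub>F t in at (y i). ?c t : V" using eventually_upd_in[OF V y i] by (simp add: eventually_nhds_conv_at)
  have lc: "filterlim ?c (at y within V) (at (y i))" unfolding filterlim_at
  proof (intro conjI)
   show "\<forall>\<^sub>F t in at (y i). ?c t : V & ?c t ~= y"
    using ev by (auto simp: eventually_at_filter fun_eq_iff elim: eventually_mono)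
   show "(?c ---> y) (at (y i))"
   proof (subst tendsto_fun_iff,intro allI)
    fix l show "((%t. (y(i := t)) l) ---> y l) (at (y i))" by (cases "l = i") simp_all
   qed
  qed
  have hl: "((%t. h (?c t)) ---> h y) (at (y i))" by (rule filterlim_compose[OF _ lc]) (use ch y in "simp add: continuous_on_def")
  have "((%t. G (?c t)) ---> G y) (at (y i))"
  proof (subst tendsto_fun_iff,intro allI)
   fix l show "((%t. G (?c t) l) ---> G y l) (at (y i))" using hl by (cases "l = j"; cases "l = i") (simp_all add: G_def)
  qed
  moreover have "\<forall>\<^sub>F t in at (y i). G (?c t) : W" using ev by (rule eventually_mono) (use GU UW in blast)
  ultimately have lG: "filterlim (%t. G (?c t)) ?N (at (y i))" by (simp add: filterlim_inf filterlim_principal)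
  have ql: "((%t. q l (G (?c t))) ---> pd l F ?x) (at (y i))" if "l < n" for l by (rule filterlim_compose[OF q(1)[OF that] lG])
  have eq: "\<forall>\<^sub>F t in at (y i). F (G (?c t)) - F ?x = (\<Sum>l<n. q l (G (?c t)) * (G (?c t) l - ?x l))"
   by (rule eventually_compose_filterlim[OF q(2) lG])
  \<comment> \<open>Close to y the factor q j is nonzero, so the strong derivative identity can be
    solved for the increment of h.\<close>
  have qnz: "\<forall>\<^sub>F t in at (y i). q j (G (?c t)) ~= 0" by (rule tendsto_imp_eventually_ne[OF ql[OF j] nzU[OF y]])
  have ne: "\<forall>\<^sub>F t in at (y i). t ~= y i" by (simp add: eventually_at_filter)
  have "((%t. (h (?c t) - h y) / (t - y i)) ---> D i y) (at (y i))"
  proof (rule Lim_transform_eventually)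
   show "((%t. (if i = j then 1 else - q i (G (?c t))) * inverse (q j (G (?c t)))) ---> D i y) (at (y i))"
    unfolding D_def using ql[OF i] ql[OF j] nzU[OF y] by (auto intro!: tendsto_intros)
   show "\<forall>\<^sub>F t in at (y i). (if i = j then 1 else - q i (G (?c t))) * inverse (q j (G (?c t))) = (h (?c t) - h y) / (t - y i)"
    using ev eq qnz ne
   proof eventually_elim
    case (elim t)
    have lhs: "F (G (?c t)) - F ?x = (if i = j then t - y i else 0)" using h[OF elim(1)] h[OF y] by (simp add: G_def)
    have summand: "q l (G (?c t)) * (G (?c t) l - ?x l) =
      (if l = j then q j (G (?c t)) * (h (?c t) - h y) else 0) + (if l = i then if i = j then 0 else q i (G (?c t)) * (t - y i) else 0)" for l
     by (simp add: G_def)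
    have "(\<Sum>l<n. q l (G (?c t)) * (G (?c t) l - ?x l)) =
      q j (G (?c t)) * (h (?c t) - h y) + (if i = j then 0 else q i (G (?c t)) * (t - y i))"
     unfolding summand sum.distrib using i j by (simp add: sum.delta)
    with lhs elim(2) have "q j (G (?c t)) * (h (?c t) - h y) = (if i = j then t - y i else - q i (G (?c t)) * (t - y i))"
     by (auto split: if_splits)
    thus ?case using elim(3,4) by (auto simp: field_simps)
   qed
  qed
  thus ?thesis by (simp add: has_field_derivative_iff)
 qed
 \<comment> \<open>Bootstrapping: the derivatives D of h are built from partial derivatives of F
   composed with G, so if h has order k then so do they, and h has order k + 1.\<close>
 have hk: "Ck n V k h" for k
 proof (induction k)
  case 0
  thus ?case using ch Ck_0_iff[OF V] by blast
 next
  case (Suc k)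
  have Gk: "Ck n V k (%y. G y l)" for l using Suc Ck_coord[OF V,of k l] by (cases "l = j") (simp_all add: G_def del: Ck.simps)
  have pk: "Ck n V k (%y. pd i F (G y))" if "i < n" for i
   by (rule Ck_compose[OF V W _ _ Gk]) (use GU UW Cinf_partial[OF F that] in "auto simp: Cinf_def simp del: Ck.simps")
  show ?case
  proof (rule Ck_SucI[OF V ch dh])
   fix i assume i: "i < n"
   have "Ck n V k (%y. if i = j then 1 else - pd i F (G y))"
    using Ck_const[OF V,of k 1] Ck_uminus[OF V pk[OF i]] by (cases "i = j") (simp_all del: Ck.simps)
   thus "Ck n V k (D i)" unfolding D_def by (rule Ck_mult[OF V _ Ck_inverse[OF V nzU pk[OF j]]])
  qed
 qed
 show thesis
 proof (rule that[OF U _ UW V UV GU])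
  show "p : U" using e(1) p Rn_sub[OF W] by (auto simp: U_def)
  fix i show "Cinf n V (%y. G y i)" using hk Ck_coord[OF V,of _ i] by (cases "i = j") (simp_all add: Cinf_def G_def del: Ck.simps)
 qed
qed

section \<open>Charts and atlases\<close>

lemma is_chartD:
 assumes "is_chart X (n,U,ph)" shows "openin X U" "opR n (ph ` U)" "inj_on ph U" and "!!T. openin X T ==> opR n (ph ` (U Int T))"
  and "!!T. opR n T ==> openin X {p : U. ph p : T}"
proof -
 let ?X = "subtopology X U" and ?Y = "subtopology (Euclidean_space n) (ph ` U)"
 show U: "openin X U" and V: "opR n (ph ` U)" using assms by (auto simp: is_chart_def)
 have h: "homeomorphic_map ?X ?Y ph" using assms by (auto simp: is_chart_def)
 have tX: "topspace ?X = U" using opsub[OF U] by auto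
 have tY: "topspace ?Y = ph ` U" using opsub[OF V] by auto
 show "inj_on ph U" using homeomorphic_imp_injective_map[OF h] tX by simp
 show "opR n (ph ` (U Int T))" if "openin X T" for T
 proof -
  have "openin ?X (U Int T)" using that by (simp add: openin_subtopology_Int2)
  hence "openin ?Y (ph ` (U Int T))" using homeomorphic_imp_open_map[OF h] by (simp add: open_map_def)
  thus ?thesis using openin_open_subtopology[OF V] by simp
 qed
 show "openin X {p : U. ph p : T}" if "opR n T" for T
 proof -
  have "openin ?Y (ph ` U Int T)" using that by (simp add: openin_subtopology_Int2)
  hence "openin ?X {p : topspace ?X. ph p : ph ` U Int T}"
   using homeomorphic_imp_continuous_map[OF h] by (rule openin_continuous_map_preimage[rotated])
  moreover have "{p : topspace ?X. ph p : ph ` U Int T} = {p : U. ph p : T}" using tX by auto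
  ultimately show ?thesis using openin_open_subtopology[OF U] by simp
 qed
qed

lemma is_chartI:
 assumes U: "openin X U" and V: "opR n (ph ` U)" and "inj_on ph U" and o: "!!T. openin X T ==> opR n (ph ` (U Int T))"
  and c: "!!T. opR n T ==> openin X {p : U. ph p : T}" shows "is_chart X (n,U,ph)"
proof -
 let ?X = "subtopology X U" and ?Y = "subtopology (Euclidean_space n) (ph ` U)"
 have tX: "topspace ?X = U" using opsub[OF U] by auto
 have tY: "topspace ?Y = ph ` U" using opsub[OF V] by auto
 have "continuous_map ?X ?Y ph" unfolding continuous_map_def tX tY
 proof (intro conjI allI impI)
  fix T assume "openin ?Y T"
  hence "opR n T" using openin_open_subtopology[OF V] by simp
  from c[OF this] show "openin ?X {x : U. ph x : T}" using U by (simp add: openin_open_subtopology)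
 qed auto
 moreover have "open_map ?X ?Y ph" unfolding open_map_def
 proof (intro allI impI)
  fix T assume "openin ?X T"
  hence "openin X T" "T <= U" using openin_open_subtopology[OF U] by simp_all
  thus "openin ?Y (ph ` T)" using o[of T] V by (simp add: openin_open_subtopology inf_absorb2 image_mono)
 qed
 ultimately have "homeomorphic_map ?X ?Y ph" using assms(3) tX tY by (intro bijective_open_imp_homeomorphic_map) auto
 thus ?thesis using U V by (simp add: is_chart_def)
qed

text \<open>Continuity into \<open>Rn n\<close> may be tested on the n coordinates, because box
  neighbourhoods are finite intersections of conditions on single coordinates.\<close>

lemma coords_open:
 assumes U: "openin X U" and ka: "!!p. p : U ==> ka p : Rn n" and c: "!!i T. i < n ==> open T ==> openin X {p : U. ka p i : T}"
  and T: "opR n T" shows "openin X {p : U. ka p : T}"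
proof (subst openin_subopen,intro ballI)
 fix p assume "p : {p : U. ka p : T}"
 hence p: "p : U" "ka p : T" by auto
 obtain e where e: "e > 0" "!!y. y : Rn n ==> (!!i. i < n ==> abs (y i - ka p i) < e) ==> y : T"
  using openin_Rn_box[OF T p(2)] by blast
 define I where "I = insert U ((%i. {q : U. ka q i : {ka p i - e <..< ka p i + e}}) ` {..<n})"
 have "openin X (\<Inter> I)"
 proof (rule openin_Inter)
  fix S assume "S : I"
  then consider "S = U" | i where "i < n" "S = {q : U. ka q i : {ka p i - e <..< ka p i + e}}" unfolding I_def by blast
  thus "openin X S"
  proof cases
   case 2
   thus ?thesis using c[OF 2(1) open_greaterThanLessThan] by simp
  qed (use U in simp)
 qed (auto simp: I_def)
 moreover have "p : \<Inter> I" using p e by (auto simp: I_def)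
 moreover have "\<Inter> I <= {p : U. ka p : T}"
 proof
  fix q assume q: "q : \<Inter> I"
  hence "q : U" by (auto simp: I_def)
  moreover have "abs (ka q i - ka p i) < e" if "i < n" for i
  proof -
   have "ka q i : {ka p i - e <..< ka p i + e}" using q that by (auto simp: I_def)
   thus ?thesis by auto
  qed
  ultimately show "q : {p : U. ka p : T}" using e(2)[of "ka q"] ka by blast
 qed
 ultimately show "EX T'. openin X T' & p : T' & T' <= {p : U. ka p : T}" by blast
qed

lemma compatibleD:
 assumes "compatible (n,U,ph) (m,V,ps)" shows "i < m ==> Cinf n (ph ` (U Int V)) (%x. ps (ivi U ph x) i)"
  and "i < n ==> Cinf m (ps ` (U Int V)) (%x. ph (ivi V ps x) i)" using assms by (auto simp: compatible_def smooth_euclid_iff)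

lemma compatibleI:
 assumes "!!i. i < m ==> Cinf n (ph ` (U Int V)) (%x. ps (ivi U ph x) i)"
  and "!!i. i < n ==> Cinf m (ps ` (U Int V)) (%x. ph (ivi V ps x) i)" shows "compatible (n,U,ph) (m,V,ps)"
 using assms by (auto simp: compatible_def smooth_euclid_iff)

text \<open>Near each point the transition map factors through a chart of \<A> with which both given
  charts are compatible.\<close>

lemma transition_trans:
 assumes c: "is_chart X (n,U,ph)" and d: "is_chart X (m,V,ps)"
  and at: "!!p. p : U Int V ==> EX (k,Q,ka):\<A>. p : Q & is_chart X (k,Q,ka) &
   compatible (n,U,ph) (k,Q,ka) & compatible (m,V,ps) (k,Q,ka)" and i: "i < m"
 shows "Cinf n (ph ` (U Int V)) (%x. ps (ivi U ph x) i)"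
proof (rule Cinf_local)
 note cD = is_chartD[OF c] and dD = is_chartD[OF d]
 show oUV: "opR n (ph ` (U Int V))" using cD(4)[OF dD(1)] .
 fix y assume "y : ph ` (U Int V)"
 then obtain p where p: "p : U" "p : V" "y = ph p" by auto
 obtain k O' ka where a: "(k,O',ka) : \<A>" "p : O'" "is_chart X (k,O',ka)"
  "compatible (n,U,ph) (k,O',ka)" "compatible (m,V,ps) (k,O',ka)" using at p(1,2) by fastforce
 note aD = is_chartD[OF a(3)]
 let ?W = "U Int (V Int O')" and ?W' = "O' Int (V Int U)"
 have oW: "opR n (ph ` ?W)" by (rule cD(4)) (use aD dD in blast)
 have oW': "opR k (ka ` ?W')" by (rule aD(4)) (use cD dD in blast)
 have oUO: "opR n (ph ` (U Int O'))" by (rule cD(4)) (use aD in blast)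
 have oVO: "opR k (ka ` (V Int O'))" using aD(4)[OF dD(1)] by (simp add: Int_commute)
 have inv: "ivi U ph (ph q) = q" if "q : U" for q using that cD(3) by simp
 have inv': "ivi O' ka (ka q) = q" if "q : O'" for q using that aD(3) by simp
 have "Cinf n (ph ` ?W) (%x. ps (ivi O' ka (ka (ivi U ph x))) i)"
 proof (rule Cinf_compose[OF oW oW',where F="%x. ka (ivi U ph x)" and g="%z. ps (ivi O' ka z) i"])
  show "ka (ivi U ph x) : ka ` ?W'" if "x : ph ` ?W" for x using that inv by auto
  show "Cinf k (ka ` ?W') (%z. ps (ivi O' ka z) i)" by (rule Cinf_subset[OF oVO oW' _ compatibleD(2)[OF a(5) i]]) auto
  show "Cinf n (ph ` ?W) (%x. ka (ivi U ph x) j)" if "j < k" for j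
   by (rule Cinf_subset[OF oUO oW _ compatibleD(1)[OF a(4) that]]) auto
 qed
 hence "Cinf n (ph ` ?W) (%x. ps (ivi U ph x) i)" by (rule Cinf_cong[OF oW,rotated]) (use inv inv' in auto)
 thus "EX W'. opR n W' & y : W' & Cinf n W' (%x. ps (ivi U ph x) i)" using oW p a(2) by blast
qed

lemma compatible_trans:
 assumes c: "is_chart X (n,U,ph)" and d: "is_chart X (m,V,ps)"
  and at: "!!p. p : U Int V ==> EX (k,Q,ka):\<A>. p : Q & is_chart X (k,Q,ka) &
   compatible (n,U,ph) (k,Q,ka) & compatible (m,V,ps) (k,Q,ka)" shows "compatible (n,U,ph) (m,V,ps)"
proof (rule compatibleI)
 fix i assume "i < m"
 from transition_trans[OF c d at this] show "Cinf n (ph ` (U Int V)) (%x. ps (ivi U ph x) i)" .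
next
 fix i assume i: "i < n"
 have at': "EX (k,Q,ka):\<A>. p : Q & is_chart X (k,Q,ka) &
   compatible (m,V,ps) (k,Q,ka) & compatible (n,U,ph) (k,Q,ka)" if "p : V Int U" for p using at[of p] that by fastforce
 from transition_trans[OF d c at' i] show "Cinf m (ps ` (U Int V)) (%x. ph (ivi V ps x) i)" by (simp add: Int_commute)
qed

text \<open>Products and submanifolds are defined as \<open>max_atlas\<close> of a generating family
  of charts. This collects what has to be checked of that family.\<close>

definition atlas :: "'a topology => 'a chart set => bool" where
 "atlas X \<A> <-> Hausdorff_space X & second_countable X & (ALL c:\<A>. is_chart X c) &
   (ALL p:topspace X. EX (n,U,ph):\<A>. p : U) & (ALL c:\<A>. ALL d:\<A>. compatible c d)"

text \<open>Charts compatible with a covering atlas are compatible with each other by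
  \<open>compatible_trans\<close>, so forming the maximal atlas a second time adds nothing and loses
  nothing.\<close>

lemma atlas_manifold:
 assumes "atlas X \<A>" and M: "mtop M = X" "charts M = max_atlas X \<A>" shows "manifold M" "\<A> <= charts M"
proof -
 have ch: "!!c. c : \<A> ==> is_chart X c" and cov: "!!p. p : topspace X ==> EX (n,U,ph):\<A>. p : U"
  and co: "!!c d. c : \<A> ==> d : \<A> ==> compatible c d" using assms(1) by (auto simp: atlas_def)
 show sub: "\<A> <= charts M" using ch co by (auto simp: M max_atlas_def)
 have comp: "compatible c d" if c: "c : max_atlas X \<A>" and d: "d : max_atlas X \<A>" for c d
 proof -
  obtain n U ph m V ps where eq: "c = (n,U,ph)" "d = (m,V,ps)" by (metis prod_cases3)
  have cc: "is_chart X (n,U,ph)" "is_chart X (m,V,ps)" using c d eq by (auto simp: max_atlas_def)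
  have "EX (k,Q,ka):\<A>. p : Q & is_chart X (k,Q,ka) &
   compatible (n,U,ph) (k,Q,ka) & compatible (m,V,ps) (k,Q,ka)" if "p : U Int V" for p
  proof -
   have "p : topspace X" using that is_chartD(1)[OF cc(1)] opsub by blast
   then obtain k O' ka where "(k,O',ka) : \<A>" "p : O'" using cov by blast
   thus ?thesis using c d eq ch by (intro bexI[of _ "(k,O',ka)"]) (auto simp: max_atlas_def)
  qed
  from compatible_trans[OF cc this] show ?thesis by (simp add: eq)
 qed
 have "max_atlas X \<A> = max_atlas X (max_atlas X \<A>)"
 proof
  show "max_atlas X \<A> <= max_atlas X (max_atlas X \<A>)"
   using comp by (auto simp: max_atlas_def[of _ "max_atlas _ _"]) (auto simp: max_atlas_def)
  show "max_atlas X (max_atlas X \<A>) <= max_atlas X \<A>" using sub by (auto simp: M max_atlas_def)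
 qed
 moreover have "(\<Union>(n,U,ph)\<in>max_atlas X \<A>. U) = topspace X"
 proof
  show "(\<Union>(n,U,ph)\<in>max_atlas X \<A>. U) <= topspace X" by (auto simp: max_atlas_def dest!: is_chartD(1) opsub)
  show "topspace X <= (\<Union>(n,U,ph)\<in>max_atlas X \<A>. U)" using cov sub by (fastforce simp: M)
 qed
 ultimately show "manifold M" using assms(1) by (simp add: manifold_def M atlas_def)
qed

context
 fixes M :: "'a mfd"
 assumes M: "manifold M"
begin

lemma charts_ischart: "c : charts M ==> is_chart (mtop M) c" using M by (auto simp: manifold_def max_atlas_def)

lemma ch_comp: "c : charts M ==> d : charts M ==> compatible c d" using M by (auto simp: manifold_def max_atlas_def)

lemma chartsI: "is_chart (mtop M) c ==> (!!d. d : charts M ==> compatible c d) ==> c : charts M"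
 using M by (auto simp: manifold_def max_atlas_def)

lemma chart_at:
 assumes "p <: M"
 obtains n U ph where "cht M n U ph" "p : U" using assms M unfolding manifold_def by blast

lemma ch_open: "cht M n U ph ==> opn M U" using is_chartD(1) charts_ischart by blast

lemma ch_sub: "cht M n U ph ==> U <= pts M" using ch_open opsub by blast

lemma chart_io: "cht M n U ph ==> opn M T ==> opR n (ph ` (U Int T))" using is_chartD(4) charts_ischart by blast

lemma ch_range: "cht M n U ph ==> opR n (ph ` U)" using is_chartD(2) charts_ischart by blast

lemma chart_Rn: "cht M n U ph ==> p : U ==> ph p : Rn n" using ch_range Rn_sub by blast

lemma ch_inv: "cht M n U ph ==> p : U ==> ivi U ph (ph p) = p" using is_chartD(3) charts_ischart inv_into_f_f by metis

lemma chart_preimage_open: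
 "cht M n U ph ==> opR n T ==> opn M {p : U. ph p : T}" using is_chartD(5) charts_ischart by blast

text \<open>Follows from maximality: a restricted chart has the same transition functions on smaller
  domains.\<close>

lemma chart_restrict:
 assumes c: "cht M n U ph" and S: "opn M S" shows "(n,U Int S,ph) : charts M"
proof (rule chartsI)
 note D = is_chartD[OF charts_ischart[OF c]]
 have inv: "ivi (U Int S) ph (ph q) = q" "ivi U ph (ph q) = q" if "q : U" "q : S" for q
  using that D(3) by (auto intro!: inv_into_f_f inj_on_subset[OF D(3)])
 show "is_chart (mtop M) (n,U Int S,ph)"
 proof (rule is_chartI)
  show "opn M (U Int S)" using D(1) S by blast
  show "opR n (ph ` (U Int S))" using D(4)[OF S] .
  show "inj_on ph (U Int S)" using D(3) inj_on_subset by blast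
  show "opR n (ph ` (U Int S Int T))" if "opn M T" for T using D(4)[of "S Int T"] S that by (simp add: Int_assoc openin_Int)
  show "opn M {p : U Int S. ph p : T}" if "opR n T" for T
  proof -
   have "{p : U Int S. ph p : T} = {p : U. ph p : T} Int S" by auto
   thus ?thesis using D(5)[OF that] S by auto
  qed
 qed
 fix d assume d: "d : charts M"
 obtain m V ps where eq: "d = (m,V,ps)" by (cases d)
 note dD = is_chartD[OF charts_ischart[OF d[unfolded eq]]]
 note co = compatibleD[OF ch_comp[OF c d[unfolded eq]]]
 have o: "opR n (ph ` (U Int V))" "opR m (ps ` (U Int V))" using D(4)[OF dD(1)] dD(4)[OF D(1)] by (auto simp: Int_commute)
 have VS: "opn M (V Int S)" "opn M (U Int S)" using dD(1) D(1) S by auto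
 have o': "opR n (ph ` (U Int S Int V))" "opR m (ps ` (U Int S Int V))"
  using D(4)[OF VS(1)] dD(4)[OF VS(2)] by (auto simp: Int_ac)
 show "compatible (n,U Int S,ph) d" unfolding eq
 proof (rule compatibleI)
  fix i assume "i < m"
  have "Cinf n (ph ` (U Int S Int V)) (%x. ps (ivi U ph x) i)"
   by (rule Cinf_subset[OF o(1) o'(1) _ co(1)[OF \<open>i < m\<close>]]) auto
  thus "Cinf n (ph ` (U Int S Int V)) (%x. ps (ivi (U Int S) ph x) i)" by (rule Cinf_cong[OF o'(1),rotated]) (use inv in auto)
 next
  fix i assume "i < n"
  show "Cinf m (ps ` (U Int S Int V)) (%x. ph (ivi V ps x) i)"
   by (rule Cinf_subset[OF o(2) o'(2) _ co(2)[OF \<open>i < n\<close>]]) auto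
 qed
qed

end

section \<open>Smooth functions\<close>

text \<open>Real functions carry all smoothness arguments: a map into a manifold is tested through
  the coordinates of charts of its target.\<close>

definition fsm :: "'a mfd => 'a set => ('a => real) => bool" where
 "fsm M S f <-> opn M S &
   (ALL (n,U,ph):charts M. Cinf n (ph ` (U Int S)) (%x. f (ivi U ph x)))"

lemma fsm_open: "fsm M S f ==> opn M S" by (simp add: fsm_def)

lemma fsm_chart:
 "fsm M S f ==> cht M n U ph ==> Cinf n (ph ` (U Int S)) (%x. f (ivi U ph x))" by (auto simp: fsm_def)

context
 fixes M :: "'a mfd"
 assumes M: "manifold M"
begin

text \<open>One chart around each point suffices; every other chart is reached through a smooth
  transition map.\<close>

lemma fsmI:
 assumes S: "opn M S" and loc: "!!p. p : S ==> EX (n,U,ph):charts M. p : U & U <= S & Cinf n (ph ` U) (%x. f (ivi U ph x))"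
 shows "fsm M S f" unfolding fsm_def
proof (intro conjI S ballI,clarify)
 fix n U ph assume c: "cht M n U ph"
 show "Cinf n (ph ` (U Int S)) (%x. f (ivi U ph x))"
 proof (rule Cinf_local)
  show "opR n (ph ` (U Int S))" by (rule chart_io[OF M c S])
  fix y assume "y : ph ` (U Int S)"
  then obtain p where p: "p : U" "p : S" "y = ph p" by auto
  then obtain m V ps where d: "cht M m V ps" "p : V" "V <= S" "Cinf m (ps ` V) (%x. f (ivi V ps x))" using loc[OF p(2)] by blast
  have o: "opR n (ph ` (U Int V))" by (rule chart_io[OF M c ch_open[OF M d(1)]])
  have "Cinf n (ph ` (U Int V)) (%x. f (ivi V ps (ps (ivi U ph x))))"
  proof (rule Cinf_compose[OF o ch_range[OF M d(1)],where F="%x. ps (ivi U ph x)" and g="%z. f (ivi V ps z)"])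
   show "ps (ivi U ph x) : ps ` V" if "x : ph ` (U Int V)" for x using that ch_inv[OF M c] by auto
   show "Cinf n (ph ` (U Int V)) (%x. ps (ivi U ph x) j)" if "j < m" for j by (rule compatibleD(1)[OF ch_comp[OF M c d(1)] that])
  qed (rule d(4))
  hence "Cinf n (ph ` (U Int V)) (%x. f (ivi U ph x))"
   by (rule Cinf_cong[OF o,rotated]) (use ch_inv[OF M c] ch_inv[OF M d(1)] in auto)
  thus "EX W'. opR n W' & y : W' & Cinf n W' (%x. f (ivi U ph x))" using o p d(2) by blast
 qed
qed

lemma fsm_local:
 assumes "!!p. p : S ==> EX T. p : T & T <= S & fsm M T f" shows "fsm M S f"
proof (rule fsmI)
 show "opn M S"
 proof (subst openin_subopen,intro ballI)
  fix p assume "p : S"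
  then obtain T where "p : T" "T <= S" "fsm M T f" using assms by blast
  thus "EX T. opn M T & p : T & T <= S" using fsm_open[of M T f] by blast
 qed
 fix p assume "p : S"
 then obtain T where T: "p : T" "T <= S" "fsm M T f" using assms by blast
 hence o: "opn M T" by (simp add: fsm_open)
 hence "p <: M" using T(1) opsub by blast
 then obtain n U ph where c: "cht M n U ph" "p : U" by (rule chart_at[OF M])
 let ?U = "U Int T"
 have c': "(n,?U,ph) : charts M" by (rule chart_restrict[OF M c(1) o])
 have "Cinf n (ph ` (?U Int T)) (%x. f (ivi ?U ph x))" by (rule fsm_chart[OF T(3) c'])
 hence "Cinf n (ph ` ?U) (%x. f (ivi ?U ph x))" by (simp add: Int_assoc)
 thus "EX (n,U,ph):charts M. p : U & U <= S & Cinf n (ph ` U) (%x. f (ivi U ph x))"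
  using c' c(2) T by (intro bexI[of _ "(n,?U,ph)"]) auto
qed

lemma fsm_chartI:
 assumes c: "cht M n U ph" and "Cinf n (ph ` U) (%x. f (ivi U ph x))" shows "fsm M U f"
 by (rule fsmI[OF ch_open[OF M c]]) (use assms in blast)

lemma fsm_subset:
 assumes "fsm M S f" "opn M T" "T <= S" shows "fsm M T f" unfolding fsm_def
proof (intro conjI assms ballI,clarify)
 fix n U ph assume c: "cht M n U ph"
 show "Cinf n (ph ` (U Int T)) (%x. f (ivi U ph x))"
  by (rule Cinf_subset[OF chart_io[OF M c fsm_open[OF assms(1)]] chart_io[OF M c assms(2)] _ fsm_chart[OF assms(1) c]])
   (use assms(3) in auto)
qed

lemma fsm_cong:
 assumes "fsm M S f" "!!p. p : S ==> f p = g p" shows "fsm M S g" unfolding fsm_def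
proof (intro conjI fsm_open[OF assms(1)] ballI,clarify)
 fix n U ph assume c: "cht M n U ph"
 show "Cinf n (ph ` (U Int S)) (%x. g (ivi U ph x))"
  by (rule Cinf_cong[OF chart_io[OF M c fsm_open[OF assms(1)]] _ fsm_chart[OF assms(1) c]]) (use assms(2) ch_inv[OF M c] in auto)
qed

lemma fsm_compose:
 assumes S: "opn M S" and W: "opR m W" and F: "!!p. p : S ==> F p : W" "!!j. j < m ==> fsm M S (%p. F p j)" and g: "Cinf m W g"
 shows "fsm M S (%p. g (F p))" unfolding fsm_def
proof (intro conjI S ballI,clarify)
 fix n U ph assume c: "cht M n U ph"
 show "Cinf n (ph ` (U Int S)) (%x. g (F (ivi U ph x)))"
  by (rule Cinf_compose[OF chart_io[OF M c S] W,where F="%x. F (ivi U ph x)"])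
   (use F g ch_inv[OF M c] fsm_chart[OF F(2) c] in auto)
qed

lemma fsm_lift1:
 assumes "fsm M S f" and "!!n W f. opR n W ==> Cinf n W f ==> Cinf n W (%x. h (f x))" shows "fsm M S (%p. h (f p))"
 unfolding fsm_def using assms fsm_chart[OF assms(1)] chart_io[OF M _ fsm_open[OF assms(1)]] by (auto simp: fsm_open)

lemma fsm_lift2:
 assumes "fsm M S f" "fsm M S g" and "!!n W f g. opR n W ==> Cinf n W f ==> Cinf n W g ==> Cinf n W (%x. h (f x) (g x))"
 shows "fsm M S (%p. h (f p) (g p))" unfolding fsm_def
 using assms(3) fsm_chart[OF assms(1)] fsm_chart[OF assms(2)] chart_io[OF M _ fsm_open[OF assms(1)]] fsm_open[OF assms(1)] by auto

lemma fsm_const: "opn M S ==> fsm M S (%p. c)" unfolding fsm_def using chart_io[OF M] Cinf_const by auto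

lemma fsm_add: "fsm M S f ==> fsm M S g ==> fsm M S (%p. f p + g p)" by (rule fsm_lift2) (auto intro: Cinf_add)

lemma fsm_diff: "fsm M S f ==> fsm M S g ==> fsm M S (%p. f p - g p)" by (rule fsm_lift2) (auto intro: Cinf_diff)

lemma fsm_mult: "fsm M S f ==> fsm M S g ==> fsm M S (%p. f p * g p)" by (rule fsm_lift2) (auto intro: Cinf_mult)

lemma fsm_smooth_step: "fsm M S f ==> fsm M S (%p. smooth_step (f p))" by (rule fsm_lift1) (auto intro: Cinf_smooth_step)

lemma fsm_sum: 
 assumes "opn M S" "!!i. i : I ==> fsm M S (f i)" shows "fsm M S (%p. \<Sum>i\<in>I. f i p)" using assms(2)
 by (induction I rule: infinite_finite_induct) (auto intro: fsm_const[OF assms(1)] fsm_add)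

lemma chart_fsm:
 assumes c: "cht M n U ph" shows "fsm M U (%p. ph p i)"
proof (rule fsm_chartI[OF c])
 have o: "opR n (ph ` U)" by (rule ch_range[OF M c])
 show "Cinf n (ph ` U) (%x. ph (ivi U ph x) i)" by (rule Cinf_cong[OF o _ Cinf_coord[OF o,of i]]) (use ch_inv[OF M c] in auto)
qed

lemma fsm_open_pre:
 assumes f: "fsm M S f" and T: "open T" shows "opn M {p : S. f p : T}"
proof (subst openin_subopen,intro ballI)
 fix p assume "p : {p : S. f p : T}"
 hence p: "p : S" "f p : T" by auto
 hence "p <: M" using opsub[OF fsm_open[OF f]] by blast
 then obtain n U ph where c: "cht M n U ph" "p : U" by (rule chart_at[OF M])
 have o: "opR n (ph ` (U Int S))" by (rule chart_io[OF M c(1) fsm_open[OF f]])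
 have "opR n {x : ph ` (U Int S). f (ivi U ph x) : T}" by (rule Rn_preim[OF o Cinf_cont[OF o fsm_chart[OF f c(1)]] T])
 from chart_preimage_open[OF M c(1) this]
 have "opn M {p : U. ph p : {x : ph ` (U Int S). f (ivi U ph x) : T}}" .
 moreover have "{p : U. ph p : {x : ph ` (U Int S). f (ivi U ph x) : T}} = {p : U Int S. f p : T}"
  using ch_inv[OF M c(1)] by (auto) (metis IntD1 IntD2 ch_inv[OF M c(1)])+
 ultimately show "EX Q. opn M Q & p : Q & Q <= {p : S. f p : T}" using p c(2) by (intro exI[of _ "{p : U Int S. f p : T}"]) auto
qed

text \<open>Admits a coordinate system to the maximal atlas once it and its inverse g are smooth
  relative to a single known chart; compatibility with the remaining charts follows by composing
  transitions. It serves for all later changes of coordinates.\<close>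

lemma new_chart:
 assumes c: "cht M n U0 ph" and U: "opn M U" "U <= U0" and W: "opR m W"
  and ka: "!!p. p : U ==> ka p : W & g (ka p) = p" "!!y. y : W ==> g y : U & ka (g y) = y"
  and s: "!!i. i < m ==> fsm M U (%p. ka p i)" "!!i. i < n ==> Cinf m W (%y. ph (g y) i)"
 shows "cht M m U ka" "ka ` U = W" "!!y. y : W ==> ivi U ka y = g y"
proof -
 show im: "ka ` U = W" using ka by force
 have inj: "inj_on ka U" by (rule inj_on_inverseI[of _ g]) (use ka in auto)
 show inv: "ivi U ka y = g y" if "y : W" for y using ka(2)[OF that] inj by (metis inv_into_f_f)
 \<comment> \<open>This is continuity of g, tested in the coordinates of the known chart.\<close>
 have gop: "opR m {y : W. g y : T}" if T: "opn M T" for T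
 proof -
  have "opR m {y : W. ph (g y) : ph ` (U0 Int T)}"
  proof (rule coords_open[OF W _ _ chart_io[OF M c T]])
   show "ph (g y) : Rn n" if "y : W" for y using chart_Rn[OF M c] ka(2)[OF that] U(2) by blast
   show "opR m {p : W. ph (g p) i : T}" if "i < n" "open T" for i T
    by (rule Rn_preim[OF W Cinf_cont[OF W s(2)[OF that(1)]] that(2)])
  qed
  moreover have "ph (g y) : ph ` (U0 Int T) <-> g y : T" if "y : W" for y
  proof
   have gU: "g y : U0" using ka(2)[OF that] U(2) by blast
   assume "ph (g y) : ph ` (U0 Int T)"
   then obtain q where q: "q : U0" "q : T" "ph (g y) = ph q" by blast
   hence "g y = q" using ch_inv[OF M c gU] ch_inv[OF M c q(1)] by metis
   thus "g y : T" using q by simp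
  next
   assume "g y : T"
   thus "ph (g y) : ph ` (U0 Int T)" using ka(2)[OF that] U(2) by blast
  qed
  ultimately show ?thesis by (metis (no_types,lifting) Collect_cong)
 qed
 show "cht M m U ka"
 proof (rule chartsI[OF M])
  show "is_chart (mtop M) (m,U,ka)"
  proof (rule is_chartI[OF U(1) _ inj])
   show "opR m (ka ` U)" using W im by simp
   show "opR m (ka ` (U Int T))" if "opn M T" for T
   proof -
    have "ka ` (U Int T) = {y : W. g y : T}" using ka by force
    thus ?thesis using gop[OF that] by simp
   qed
   show "opn M {p : U. ka p : T}" if "opR m T" for T by (rule coords_open[OF U(1) _ _ that])
     (use ka(1) Rn_sub[OF W] fsm_open_pre[OF s(1)] in auto)
  qed
  fix d assume d: "d : charts M"
  obtain k V ps where eq: "d = (k,V,ps)" by (cases d)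
  note d' = d[unfolded eq]
  show "compatible (m,U,ka) d" unfolding eq
  proof (rule compatibleI)
   fix i assume "i < m"
   show "Cinf k (ps ` (U Int V)) (%x. ka (ivi V ps x) i)"
    using fsm_chart[OF s(1)[OF \<open>i < m\<close>] d'] by (simp add: Int_commute)
  next
   fix i assume i: "i < k"
   have eqW: "ka ` (U Int V) = {y : W. g y : V}" using ka by force
   have o: "opR m (ka ` (U Int V))" unfolding eqW by (rule gop[OF ch_open[OF M d']])
   have o2: "opR n (ph ` (U0 Int V))" by (rule chart_io[OF M c ch_open[OF M d']])
   have "Cinf m (ka ` (U Int V)) (%y. ps (ivi U0 ph (ph (g y))) i)"
   proof (rule Cinf_compose[OF o o2,where F="%y. ph (g y)"])
    show "ph (g y) : ph ` (U0 Int V)" if "y : ka ` (U Int V)" for y using that ka U(2) by auto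
    show "Cinf n (ph ` (U0 Int V)) (%z. ps (ivi U0 ph z) i)" by (rule compatibleD(1)[OF ch_comp[OF M c d'] i])
    show "Cinf m (ka ` (U Int V)) (%y. ph (g y) j)" if "j < n" for j
     by (rule Cinf_subset[OF W o _ s(2)[OF that]]) (use eqW in auto)
   qed
   thus "Cinf m (ka ` (U Int V)) (%y. ps (ivi U ka y) i)"
   proof (rule Cinf_cong[OF o,rotated])
    fix y assume "y : ka ` (U Int V)"
    hence "y : W" using eqW by auto
    thus "ps (ivi U0 ph (ph (g y))) i = ps (ivi U ka y) i" using inv ka(2) U(2) ch_inv[OF M c] by (metis subsetD)
   qed
  qed
 qed
qed

end

section \<open>Smooth maps\<close>

text \<open>Allows open domains without making them manifolds of their own. Charts are chosen in the
  target alone, the source being dealt with by \<open>fsm\<close>.\<close>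

definition sm_on :: "'a mfd => 'a set => 'b mfd => ('a => 'b) => bool" where
 "sm_on M S N f <-> opn M S &
   (ALL p:S. EX (m,V,ps):charts N. EX T. opn M T & p : T & T <= S & f ` T <= V &
    (ALL i<m. fsm M T (%q. ps (f q) i)))"

abbreviation "smooth M \<equiv> sm_on M (pts M)"

lemma smooth_onI:
 assumes "opn M S" and "!!p. p : S ==> EX m V ps T. cht N m V ps & opn M T & p : T & T <= S &
   f ` T <= V & (ALL i<m. fsm M T (%q. ps (f q) i))" shows "sm_on M S N f" unfolding sm_on_def
proof (intro conjI ballI assms(1))
 fix p assume "p : S"
 then obtain m V ps T where "cht N m V ps" "opn M T & p : T & T <= S &
   f ` T <= V & (ALL i<m. fsm M T (%q. ps (f q) i))" using assms(2) by blast
 thus "EX (m,V,ps):charts N. EX T. opn M T & p : T & T <= S & f ` T <= V &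
    (ALL i<m. fsm M T (%q. ps (f q) i))" by (intro bexI[of _ "(m,V,ps)"] case_prodI exI[of _ T])
qed

lemma smooth_onE:
 assumes "sm_on M S N f" "p : S"
 obtains m V ps T where "cht N m V ps" "opn M T" "p : T" "T <= S" "f ` T <= V"
  "!!i. i < m ==> fsm M T (%q. ps (f q) i)"
proof -
 obtain c where c: "c : charts N" "case c of (m,V,ps) => EX T. opn M T & p : T & T <= S & f ` T <= V &
    (ALL i<m. fsm M T (%q. ps (f q) i))" using assms unfolding sm_on_def by blast
 obtain m V ps where e: "c = (m,V,ps)" by (cases c)
 show thesis using c that[of m V ps] unfolding e by auto
qed

lemma sm_open: "sm_on M S N f ==> opn M S" by (simp add: sm_on_def)

lemma sm_pts:
 assumes "manifold N" "sm_on M S N f" "p : S" shows "f p <: N"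
 using assms(2,3) by (rule smooth_onE) (use ch_sub[OF assms(1)] in blast)

lemma smap_iff:
 assumes M: "manifold M" shows "smooth_map M N f <-> smooth M N f"
proof
 assume l: "smooth_map M N f"
 show "smooth M N f"
 proof (rule smooth_onI)
  fix p assume "p <: M"
  then obtain n U ph m V ps where c: "cht M n U ph" "cht N m V ps" "p : U" "f ` U <= V"
   "smooth_euclid n (ph ` U) m (%x. ps (f (ivi U ph x)))" using l unfolding smooth_map_def by fastforce
  hence "fsm M U (%q. ps (f q) i)" if "i < m" for i using that by (intro fsm_chartI[OF M c(1)]) (auto simp: smooth_euclid_iff)
  thus "EX m V ps T. cht N m V ps & opn M T & p : T & T <= pts M &
   f ` T <= V & (ALL i<m. fsm M T (%q. ps (f q) i))" using c ch_open[OF M c(1)] ch_sub[OF M c(1)] by blast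
 qed simp
next
 assume r: "smooth M N f"
 show "smooth_map M N f" unfolding smooth_map_def
 proof
  fix p assume p: "p <: M"
  obtain m V ps T where c: "cht N m V ps" "opn M T" "p : T" "f ` T <= V"
   "!!i. i < m ==> fsm M T (%q. ps (f q) i)" by (rule smooth_onE[OF r p]) blast
  obtain n U ph where d: "cht M n U ph" "p : U" by (rule chart_at[OF M p])
  have d': "(n,U Int T,ph) : charts M" by (rule chart_restrict[OF M d(1) c(2)])
  have "Cinf n (ph ` (U Int T)) (%x. ps (f (ivi (U Int T) ph x)) i)" if "i < m" for i
   using fsm_chart[OF c(5)[OF that] d'] by (simp add: Int_assoc)
  thus "EX (n,U,ph):charts M. EX (m,V,ps):charts N.
    p : U & f ` U <= V & smooth_euclid n (ph ` U) m (%x. ps (f (ivi U ph x)))"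
   using d d' c by (intro bexI[of _ "(n,U Int T,ph)"] bexI[of _ "(m,V,ps)"] case_prodI)
    (auto simp: smooth_euclid_iff)
 qed
qed

text \<open>Openness of the preimage is part of the conclusion, since \<open>fsm\<close> includes
  it; \<open>sm_preim\<close> reads it off from a constant function. The inverse of a chart around f
  p is used to compose in coordinates.\<close>

lemma fsm_pullback:
 assumes M: "manifold M" and N: "manifold N" and f: "sm_on M S N f" and h: "fsm N T h"
 shows "fsm M {p : S. f p : T} (%p. h (f p))"
proof (rule fsm_local[OF M])
 fix p assume p: "p : {p : S. f p : T}"
 hence "p : S" by simp
 then obtain m V ps A where c: "cht N m V ps" "opn M A" "p : A" "A <= S" "f ` A <= V"
   "!!i. i < m ==> fsm M A (%q. ps (f q) i)" by (rule smooth_onE[OF f]) blast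
 let ?W = "ps ` (V Int T)"
 have W: "opR m ?W" by (rule chart_io[OF N c(1) fsm_open[OF h]])
 define B where "B = {q : A. ps (f q) : ?W}"
 have B: "opn M B" unfolding B_def by (rule coords_open[OF c(2) _ _ W])
   (use chart_Rn[OF N c(1)] c(5) fsm_open_pre[OF M c(6)] in auto)
 have inv: "ivi V ps (ps (f q)) = f q" if "q : A" for q using that c(5) ch_inv[OF N c(1)] by auto
 have BT: "f q : T" if "q : B" for q
 proof -
  obtain z where z: "z : V" "z : T" "ps (f q) = ps z" using \<open>q : B\<close> by (auto simp: B_def)
  have "q : A" using that by (simp add: B_def)
  from inv[OF this] have "f q = z" using z(3) ch_inv[OF N c(1) z(1)] by metis
  thus ?thesis using z by simp
 qed
 have "fsm M B (%q. h (ivi V ps (ps (f q))))"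
 proof (rule fsm_compose[OF M B W,where F="%q. ps (f q)"])
  show "ps (f p) : ps ` (V Int T)" if "p : B" for p using that by (simp add: B_def)
  show "fsm M B (%p. ps (f p) j)" if "j < m" for j by (rule fsm_subset[OF M c(6)[OF that] B]) (auto simp: B_def)
  show "Cinf m (ps ` (V Int T)) (%z. h (ivi V ps z))" by (rule fsm_chart[OF h c(1)])
 qed
 hence "fsm M B (%q. h (f q))" by (rule fsm_cong[OF M]) (use inv in "simp add: B_def")
 moreover have "p : B" using p c by (auto simp: B_def)
 moreover have "B <= {p : S. f p : T}" using BT c(4) by (auto simp: B_def)
 ultimately show "EX A. p : A & A <= {p : S. f p : T} & fsm M A (%p. h (f p))" by blast
qed

lemma sm_preim:
 assumes "manifold M" "manifold N" "sm_on M S N f" "opn N T" shows "opn M {p : S. f p : T}"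
 by (rule fsm_open[OF fsm_pullback[OF assms(1-3) fsm_const[OF assms(2,4),of 0]]])

lemma fsm_comp:
 assumes "manifold M" "manifold N" "sm_on M S N f" "fsm N T h" "!!p. p : S ==> f p : T" shows "fsm M S (%p. h (f p))"
proof -
 have "{p : S. f p : T} = S" using assms(5) by auto
 thus ?thesis using fsm_pullback[OF assms(1-4)] by simp
qed

lemma sm_o:
 assumes M: "manifold M" and N: "manifold N" and f: "sm_on M S N f" and g: "sm_on N T P g" and ST: "!!p. p : S ==> f p : T"
 shows "sm_on M S P (%p. g (f p))"
proof (rule smooth_onI[OF sm_open[OF f]])
 fix p assume p: "p : S"
 from g ST[OF p] obtain m V ps A where c: "cht P m V ps" "opn N A" "f p : A" "A <= T" "g ` A <= V"
   "!!i. i < m ==> fsm N A (%q. ps (g q) i)" by (rule smooth_onE) blast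
 show "EX m V ps T. cht P m V ps & opn M T & p : T & T <= S &
   (%p. g (f p)) ` T <= V & (ALL i<m. fsm M T (%q. ps (g (f q)) i))" using c p fsm_pullback[OF M N f c(6)] sm_preim[OF M N f c(2)]
  by (intro exI[of _ m] exI[of _ V] exI[of _ ps] exI[of _ "{q : S. f q : A}"]) auto
qed

lemma sm_sub:
 assumes M: "manifold M" and f: "sm_on M S N f" and T: "opn M T" "T <= S" shows "sm_on M T N f"
proof (rule smooth_onI[OF T(1)])
 fix p assume p: "p : T"
 hence "p : S" using T by blast
 from f this obtain m V ps A where c: "cht N m V ps" "opn M A" "p : A" "A <= S" "f ` A <= V"
   "!!i. i < m ==> fsm M A (%q. ps (f q) i)" by (rule smooth_onE) blast
 have o: "opn M (A Int T)" using c(2) T(1) by blast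
 show "EX m V ps A. cht N m V ps & opn M A & p : A & A <= T &
   f ` A <= V & (ALL i<m. fsm M A (%q. ps (f q) i))" using c p o fsm_subset[OF M c(6) o]
  by (intro exI[of _ m] exI[of _ V] exI[of _ ps] exI[of _ "A Int T"]) auto
qed

lemma smooth_on_local:
 assumes M: "manifold M" and "!!p. p : S ==> EX T. p : T & T <= S & sm_on M T N f" shows "sm_on M S N f"
proof (rule smooth_onI)
 show "opn M S"
 proof (subst openin_subopen,intro ballI)
  fix p assume "p : S"
  then obtain T where "p : T" "T <= S" "sm_on M T N f" using assms by blast
  thus "EX T. opn M T & p : T & T <= S" using sm_open[of M T N f] by blast
 qed
 fix p assume "p : S"
 then obtain T where T: "p : T" "T <= S" "sm_on M T N f" using assms by blast
 from T(3,1) obtain m V ps A where c: "cht N m V ps" "opn M A" "p : A" "A <= T" "f ` A <= V"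
   "!!i. i < m ==> fsm M A (%q. ps (f q) i)" by (rule smooth_onE) blast
 thus "EX m V ps A. cht N m V ps & opn M A & p : A & A <= S &
   f ` A <= V & (ALL i<m. fsm M A (%q. ps (f q) i))" using T(2) by blast
qed

lemma sm_cong:
 assumes M: "manifold M" and f: "sm_on M S N f" and eq: "!!p. p : S ==> f p = g p" shows "sm_on M S N g"
proof (rule smooth_onI[OF sm_open[OF f]])
 fix p assume "p : S"
 with f obtain m V ps A where c: "cht N m V ps" "opn M A" "p : A" "A <= S" "f ` A <= V"
   "!!i. i < m ==> fsm M A (%q. ps (f q) i)" by (rule smooth_onE) blast
 have "fsm M A (%q. ps (g q) i)" if "i < m" for i by (rule fsm_cong[OF M c(6)[OF that]]) (use eq c(4) in auto)
 moreover have "g ` A <= V" using c(4,5) eq by force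
 ultimately show "EX m V ps A. cht N m V ps & opn M A & p : A & A <= S &
   g ` A <= V & (ALL i<m. fsm M A (%q. ps (g q) i))" using c by blast
qed

lemma sm_id:
 assumes M: "manifold M" and S: "opn M S" shows "sm_on M S M (%p. p)"
proof (rule smooth_onI[OF S])
 fix p assume p: "p : S"
 hence "p <: M" using S opsub by blast
 then obtain n U ph where d: "cht M n U ph" "p : U" by (rule chart_at[OF M])
 have o: "opn M (U Int S)" using ch_open[OF M d(1)] S by blast
 show "EX m V ps A. cht M m V ps & opn M A & p : A & A <= S &
   (%p. p) ` A <= V & (ALL i<m. fsm M A (%q. ps q i))" using d p o fsm_subset[OF M chart_fsm[OF M d(1)] o]
  by (intro exI[of _ n] exI[of _ U] exI[of _ ph] exI[of _ "U Int S"]) auto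
qed

lemma smooth_on_const:
 assumes M: "manifold M" and N: "manifold N" and S: "opn M S" and c: "c <: N" shows "sm_on M S N (%p. c)"
proof (rule smooth_onI[OF S])
 fix p assume p: "p : S"
 obtain n U ph where d: "cht N n U ph" "c : U" using c by (rule chart_at[OF N])
 show "EX m V ps A. cht N m V ps & opn M A & p : A & A <= S &
   (%p. c) ` A <= V & (ALL i<m. fsm M A (%q. ps c i))" using d p S fsm_const[OF M S]
  by (intro exI[of _ n] exI[of _ U] exI[of _ ph] exI[of _ S]) auto
qed

section \<open>Euclidean space as a manifold\<close>

lemma second_countable_Rn: "second_countable (Euclidean_space n)"
proof -
 obtain B :: "(nat => real) set set" where B: "countable B" "!!b. b : B ==> open b"
  "!!S. open S ==> EX B'<=B. S = \<Union> B'"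
  using ex_countable_basis[where 'a="nat => real"] unfolding topological_basis_def by metis
 have "second_countable (euclidean :: (nat => real) topology)" unfolding second_countable_def
 proof (intro exI[of _ B] conjI allI impI ballI)
  fix U and x :: "nat => real" assume "openin euclidean U & x : U"
  then obtain B' where "B' <= B" "U = \<Union> B'" "x : U" using B(3) by (metis open_openin)
  thus "EX V:B. x : V & V <= U" by blast
 qed (use B in auto)
 thus ?thesis unfolding Esp by (rule second_countable_subtopology)
qed

lemma Hausdorff_Rn: "Hausdorff_space (Euclidean_space n)"
 unfolding Esp by (rule Hausdorff_space_subtopology) (rule Hausdorff_space_euclidean)

lemma id_is_chart: "is_chart (Euclidean_space n) (n,Rn n,id)" by (rule is_chartI) (auto simp: openin_Int Collect_conj_eq)

lemma compatible_id: "compatible (n,Rn n,id) (n,Rn n,id)"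
proof -
 have "Cinf n (Rn n) (%x. ivi (Rn n) id x i)" for i by (rule Cinf_cong[OF otop _ Cinf_coord[OF otop]]) simp
 thus ?thesis by (intro compatibleI) simp_all
qed

lemma euclid_atlas: "atlas (Euclidean_space n) {(n,Rn n,id)}"
 unfolding atlas_def using Hausdorff_Rn second_countable_Rn id_is_chart compatible_id by auto

lemma eucls: "mtop (eucl n) = Euclidean_space n"
 "charts (eucl n) = max_atlas (Euclidean_space n) {(n,Rn n,id)}" by (simp_all add: euclid_mfd_def)

lemma mfE: "manifold (eucl n)" and euclid_chart: "(n,Rn n,id) : charts (eucl n)"
 using atlas_manifold[OF euclid_atlas eucls] by auto

lemma fsm_euclid: "fsm (eucl n) W f <-> opR n W & Cinf n W f"
proof
 assume a: "fsm (eucl n) W f"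
 hence o: "opR n W" using fsm_open eucls by metis
 hence "Rn n Int W = W" using Rn_sub by blast
 hence "Cinf n W (%x. f (ivi (Rn n) id x))" using fsm_chart[OF a euclid_chart] by simp
 hence "Cinf n W f" by (rule Cinf_cong[OF o,rotated]) (use Rn_sub[OF o] in auto)
 with o show "opR n W & Cinf n W f" by blast
next
 assume a: "opR n W & Cinf n W f"
 hence W: "opn (eucl n) W" by (simp add: eucls)
 hence c: "(n,Rn n Int W,id) : charts (eucl n)" by (rule chart_restrict[OF mfE euclid_chart])
 have eq: "Rn n Int W = W" using a Rn_sub by blast
 have "Cinf n W (%x. f (ivi W id x))" by (rule Cinf_cong[of n W f]) (use a in auto)
 thus "fsm (eucl n) W f" using c unfolding eq by (intro fsm_chartI[OF mfE]) auto
qed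

lemma sm_euclid:
 assumes M: "manifold M" shows "sm_on M S (eucl m) f <->
  opn M S & (ALL p:S. f p : Rn m) & (ALL i<m. fsm M S (%p. f p i))" (is "?l <-> ?r")
proof
 assume l: ?l
 have "f p : Rn m" if "p : S" for p using sm_pts[OF mfE l that] by (simp add: eucls)
 moreover have "fsm M S (%p. f p i)" for i by (rule fsm_comp[OF M mfE l,of "Rn m" "%x. x i"])
   (use calculation in "auto simp: fsm_euclid Cinf_coord")
 ultimately show ?r using sm_open[OF l] by blast
next
 assume r: ?r
 show ?l
 proof (rule smooth_onI)
  fix p assume "p : S"
  thus "EX k V ps A. cht (eucl m) k V ps & opn M A & p : A & A <= S &
   f ` A <= V & (ALL i<k. fsm M A (%q. ps (f q) i))"
   using r euclid_chart[of m] by (intro exI[of _ m] exI[of _ "Rn m"] exI[of _ id] exI[of _ S]) auto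
 qed (use r in blast)
qed

lemma chart_inv_smooth:
 assumes M: "manifold M" and c: "cht M n U ph" shows "sm_on (eucl n) (ph ` U) M (ivi U ph)"
proof (rule smooth_onI)
 have o: "opR n (ph ` U)" by (rule ch_range[OF M c])
 thus o': "opn (eucl n) (ph ` U)" by (simp add: eucls)
 have "fsm (eucl n) (ph ` U) (%x. ph (ivi U ph x) i)" for i
  using o fsm_chart[OF chart_fsm[OF M c] c,of i] by (simp add: fsm_euclid)
 thus "EX m V ps T. cht M m V ps & opn (eucl n) T & p : T & T <= ph ` U &
   ivi U ph ` T <= V & (ALL i<m. fsm (eucl n) T (%q. ps (ivi U ph q) i))" if "p : ph ` U" for p using that o' c ch_inv[OF M c]
  by (intro exI[of _ n] exI[of _ U] exI[of _ ph] exI[of _ "ph ` U"]) (auto simp: inv_into_into)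
qed

lemma fsm_of_smooth: 
 assumes M: "manifold M" and "sm_on M S (eucl m) f" shows "fsm M S (%p. f p i)"
proof (cases "i < m")
 case True
 thus ?thesis using assms by (simp add: sm_euclid)
next
 case False
 have "fsm M S (%p. 0)" using assms by (intro fsm_const) (auto simp: sm_open)
 thus ?thesis by (rule fsm_cong[OF M]) (use assms False in "simp add: sm_euclid Rn_iff")
qed

section \<open>Products\<close>

text \<open>Take, drop and concatenate: the identification of R^(n+m) with R^n \<times> R^m used by
  the charts of \<open>prod_mfd\<close>, with the last m coordinates shifted down to start at
  0.\<close>

definition tk :: "nat => (nat => real) => nat => real" where
 "tk n z = (%i. if i < n then z i else 0)"
definition dr :: "nat => (nat => real) => nat => real" where
 "dr n z = (%i. z (i + n))"
definition cat :: "nat => (nat => real) => (nat => real) => nat => real" where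
 "cat n x y = (%i. if i < n then x i else y (i - n))"

lemma tk_Rn: "tk n z : Rn n" and dr_Rn: "z : Rn (n + m) ==> dr n z : Rn m" and cat_Rn: "y : Rn m ==> cat n x y : Rn (n + m)"
 and tk_cat: "x : Rn n ==> tk n (cat n x y) = x" and dr_cat: "dr n (cat n x y) = y" and cat_tk_dr: "cat n (tk n z) (dr n z) = z"
 and tk_id: "x : Rn n ==> tk n x = x" by (auto simp: tk_def dr_def cat_def Rn_iff fun_eq_iff not_less)

lemma Cinf_tk: "opR k W ==> Cinf k W (%z. tk n z i)" and Cinf_dr: "opR k W ==> Cinf k W (%z. dr n z i)"
 by (cases "i < n") (simp_all add: tk_def dr_def Cinf_coord Cinf_const)

lemma openin_tk_dr:
 assumes A: "opR n A" and B: "opR m B" shows "opR (n + m) {z : Rn (n + m). tk n z : A & dr n z : B}"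
proof -
 have "opR (n + m) {z : Rn (n + m). tk n z : A}" by (rule coords_open[OF otop tk_Rn _ A])
   (rule Rn_preim[OF otop Cinf_cont[OF otop Cinf_tk[OF otop]]])
 moreover have "opR (n + m) {z : Rn (n + m). dr n z : B}" by (rule coords_open[OF otop dr_Rn _ B])
   (assumption,rule Rn_preim[OF otop Cinf_cont[OF otop Cinf_dr[OF otop]]])
 ultimately have "opR (n + m) ({z : Rn (n + m). tk n z : A} Int {z : Rn (n + m). dr n z : B})" by (rule openin_Int)
 moreover have "{z : Rn (n + m). tk n z : A} Int {z : Rn (n + m). dr n z : B} =
   {z : Rn (n + m). tk n z : A & dr n z : B}" by blast
 ultimately show ?thesis by simp
qed

lemma second_countable_prod:
 assumes "second_countable X" "second_countable Y" shows "second_countable (prod_topology X Y)"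
proof -
 obtain A where A: "countable A" "!!V. V : A ==> openin X V"
  "!!U x. openin X U & x : U ==> EX V:A. x : V & V <= U" using assms(1) unfolding second_countable_def by blast
 obtain B where B: "countable B" "!!V. V : B ==> openin Y V"
  "!!U x. openin Y U & x : U ==> EX V:B. x : V & V <= U" using assms(2) unfolding second_countable_def by blast
 show ?thesis unfolding second_countable_def
 proof (intro exI[of _ "(%(a,b). a \<times> b) ` (A \<times> B)"] conjI allI impI ballI)
  show "countable ((%(a,b). a \<times> b) ` (A \<times> B))" using A(1) B(1) by auto
  show "openin (prod_topology X Y) V" if "V : (%(a,b). a \<times> b) ` (A \<times> B)" for V
   using that A(2) B(2) by (auto simp: openin_prod_Times_iff)
  fix U and z :: "'a \<times> 'b" assume "openin (prod_topology X Y) U & z : U"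
  then obtain S T where "openin X S" "openin Y T" "fst z : S" "snd z : T" "S \<times> T <= U"
   unfolding openin_prod_topology_alt by (metis prod.collapse)
  then obtain a b where "a : A" "fst z : a" "a <= S" "b : B" "snd z : b" "b <= T" using A(3) B(3) by meson
  thus "EX V:(%(a,b). a \<times> b) ` (A \<times> B). z : V & V <= U"
   using \<open>S \<times> T <= U\<close> by (intro bexI[of _ "a \<times> b"]) (auto simp: mem_Times_iff)
 qed
qed

abbreviation chpr :: "nat => ('a => nat => real) => ('b => nat => real) => 'a \<times> 'b => nat => real" where
 "chpr n ph ps == %(p,q) i. if i < n then ph p i else ps q (i - n)"

lemma chart_prod_eq: "chpr n ph ps z = cat n (ph (fst z)) (ps (snd z))" by (auto simp: cat_def split: prod.split)

context
 fixes M :: "'a mfd" and N :: "'b mfd"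
 assumes M: "manifold M" and N: "manifold N"
begin

lemma chart_prod_image:
 assumes c: "cht M n U ph" and d: "cht N m V ps" and "A <= U" "B <= V"
 shows "chpr n ph ps ` (A \<times> B) = {z : Rn (n + m). tk n z : ph ` A & dr n z : ps ` B}"
proof
 show "chpr n ph ps ` (A \<times> B) <= {z : Rn (n + m). tk n z : ph ` A & dr n z : ps ` B}"
 proof
  fix z assume "z : chpr n ph ps ` (A \<times> B)"
  then obtain p q where pq: "p : A" "q : B" "z = cat n (ph p) (ps q)" unfolding chart_prod_eq by auto
  thus "z : {z : Rn (n + m). tk n z : ph ` A & dr n z : ps ` B}" using assms chart_Rn[OF M c,of p] chart_Rn[OF N d,of q]
   by (auto simp: tk_cat dr_cat intro!: cat_Rn)
 qed
 show "{z : Rn (n + m). tk n z : ph ` A & dr n z : ps ` B} <= chpr n ph ps ` (A \<times> B)"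
 proof
  fix z assume z: "z : {z : Rn (n + m). tk n z : ph ` A & dr n z : ps ` B}"
  then obtain p q where "p : A" "q : B" "tk n z = ph p" "dr n z = ps q" by auto
  thus "z : chpr n ph ps ` (A \<times> B)" using cat_tk_dr[of n z] by (intro image_eqI[of _ _ "(p,q)"]) (auto simp: chart_prod_eq)
 qed
qed

lemma chart_prod_is_chart:
 assumes c: "cht M n U ph" and d: "cht N m V ps"
 shows "is_chart (prod_topology (mtop M) (mtop N)) (n + m,U \<times> V,chpr n ph ps)"
proof (rule is_chartI)
 let ?X = "prod_topology (mtop M) (mtop N)"
 have op: "opR (n + m) (chpr n ph ps ` (A \<times> B))" if "opn M A" "A <= U" "opn N B" "B <= V" for A B
  using openin_tk_dr[OF chart_io[OF M c that(1)] chart_io[OF N d that(3)]] that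
  by (simp add: chart_prod_image[OF c d that(2,4)] inf_absorb2)
 show UV: "openin ?X (U \<times> V)" using ch_open[OF M c] ch_open[OF N d] by (simp add: openin_prod_Times_iff)
 show "opR (n + m) (chpr n ph ps ` (U \<times> V))" by (rule op) (use ch_open[OF M c] ch_open[OF N d] in auto)
 show "inj_on (chpr n ph ps) (U \<times> V)"
 proof (rule inj_on_inverseI[where g="%z. (ivi U ph (tk n z),ivi V ps (dr n z))"])
  fix z assume "z : U \<times> V"
  thus "(ivi U ph (tk n (chpr n ph ps z)),ivi V ps (dr n (chpr n ph ps z))) = z"
   using chart_Rn[OF M c] by (auto simp: chart_prod_eq tk_cat dr_cat ch_inv[OF M c] ch_inv[OF N d])
 qed
 show "opR (n + m) (chpr n ph ps ` ((U \<times> V) Int T))" if T: "openin ?X T" for T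
 proof (subst openin_subopen,intro ballI)
  fix z assume "z : chpr n ph ps ` ((U \<times> V) Int T)"
  then obtain p q where pq: "p : U" "q : V" "(p,q) : T" "z = chpr n ph ps (p,q)" by auto
  then obtain A B where AB: "opn M A" "opn N B" "p : A" "q : B" "A \<times> B <= T"
   using T unfolding openin_prod_topology_alt by meson
  have "opR (n + m) (chpr n ph ps ` ((U Int A) \<times> (V Int B)))" by (rule op) (use ch_open[OF M c] ch_open[OF N d] AB in auto)
  moreover have "z : chpr n ph ps ` ((U Int A) \<times> (V Int B))" using pq AB by blast
  moreover have "chpr n ph ps ` ((U Int A) \<times> (V Int B)) <= chpr n ph ps ` ((U \<times> V) Int T)"
   using AB by (intro image_mono) auto
  ultimately show "EX Ta. opR (n + m) Ta & z : Ta & Ta <= chpr n ph ps ` ((U \<times> V) Int T)" by blast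
 qed
 show "openin ?X {p : U \<times> V. chpr n ph ps p : T}" if T: "opR (n + m) T" for T
 proof (rule coords_open[OF UV _ _ T])
  show "chpr n ph ps p : Rn (n + m)" if "p : U \<times> V" for p
   using that chart_Rn[OF N d] unfolding chart_prod_eq by (intro cat_Rn) auto
  show "openin ?X {p : U \<times> V. chpr n ph ps p i : T}" if "open T" for i T
  proof (cases "i < n")
   case True
   hence "{p : U \<times> V. chpr n ph ps p i : T} = {p : U. ph p i : T} \<times> V" by auto
   thus ?thesis using fsm_open_pre[OF M chart_fsm[OF M c] that,of i] ch_open[OF N d] by (simp add: openin_prod_Times_iff)
  next
   case False
   hence "{p : U \<times> V. chpr n ph ps p i : T} = U \<times> {q : V. ps q (i - n) : T}" by auto
   thus ?thesis using fsm_open_pre[OF N chart_fsm[OF N d] that,of "i - n"] ch_open[OF M c] by (simp add: openin_prod_Times_iff)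
  qed
 qed
qed

lemma chart_prod_transition:
 assumes c: "cht M n U ph" and d: "cht N m V ps" and c': "cht M n' U' ph'" and d': "cht N m' V' ps'" and i: "i < n' + m'"
 shows "Cinf (n + m) (chpr n ph ps ` (U \<times> V Int U' \<times> V'))
  (%z. chpr n' ph' ps' (ivi (U \<times> V) (chpr n ph ps) z) i)"
proof -
 let ?W = "chpr n ph ps ` (U \<times> V Int U' \<times> V')"
 have A: "opR n (ph ` (U Int U'))" by (rule chart_io[OF M c ch_open[OF M c']])
 have B: "opR m (ps ` (V Int V'))" by (rule chart_io[OF N d ch_open[OF N d']])
 have Weq: "?W = {z : Rn (n + m). tk n z : ph ` (U Int U') & dr n z : ps ` (V Int V')}"
  unfolding Times_Int_Times by (rule chart_prod_image[OF c d]) auto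
 have W: "opR (n + m) ?W" unfolding Weq by (rule openin_tk_dr[OF A B])
 have inv: "ivi (U \<times> V) (chpr n ph ps) z = (ivi U ph (tk n z),ivi V ps (dr n z))" if zW: "z : ?W" for z
 proof -
  obtain r where "r : U \<times> V" "z = chpr n ph ps r" using zW by blast
  then obtain p q where pq: "p : U" "q : V" "z = chpr n ph ps (p,q)" by blast
  have "ivi (U \<times> V) (chpr n ph ps) (chpr n ph ps (p,q)) = (p,q)"
   by (rule inv_into_f_f) (use pq is_chartD(3)[OF chart_prod_is_chart[OF c d]] in auto)
  thus ?thesis using pq chart_Rn[OF M c]
   by (simp only: pq(3)) (simp add: chart_prod_eq tk_cat dr_cat ch_inv[OF M c] ch_inv[OF N d])
 qed
 have "Cinf (n + m) ?W (%z. if i < n' then ph' (ivi U ph (tk n z)) i else ps' (ivi V ps (dr n z)) (i - n'))"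
 proof (cases "i < n'")
  case True
  have "Cinf (n + m) ?W (%z. ph' (ivi U ph (tk n z)) i)" by (rule Cinf_compose[OF W A,where F="tk n"])
    (use Weq compatibleD(1)[OF ch_comp[OF M c c'] True] Cinf_tk[OF W] in auto)
  thus ?thesis using True by simp
 next
  case False
  hence "i - n' < m'" using i by simp
  from compatibleD(1)[OF ch_comp[OF N d d'] this]
  have "Cinf (n + m) ?W (%z. ps' (ivi V ps (dr n z)) (i - n'))" by (rule Cinf_compose[OF W B,where F="dr n",rotated])
    (use Weq Cinf_dr[OF W] in auto)
  thus ?thesis using False by simp
 qed
 thus ?thesis by (rule Cinf_cong[OF W,rotated]) (use inv in simp)
qed

lemma prod_mfd_simps:
 "mtop (prod_mfd M N) = prod_topology (mtop M) (mtop N)"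
 "charts (prod_mfd M N) = max_atlas (prod_topology (mtop M) (mtop N))
    {(n + m,U \<times> V,chpr n ph ps) | n U ph m V ps. cht M n U ph & cht N m V ps}" by (simp_all add: prod_mfd_def)

lemma prod_atlas:
 "atlas (prod_topology (mtop M) (mtop N))
   {(n + m,U \<times> V,chpr n ph ps) | n U ph m V ps. cht M n U ph & cht N m V ps}"
 (is "atlas ?X ?A") unfolding atlas_def
proof (intro conjI ballI)
 show "Hausdorff_space ?X" "second_countable ?X"
  using M N Hausdorff_space_prod_topology second_countable_prod by (auto simp: manifold_def)
 show "is_chart ?X c" if "c : ?A" for c using that chart_prod_is_chart by auto
 show "EX (n,U,ph):?A. p : U" if "p : topspace ?X" for p
 proof -
  have "fst p <: M" "snd p <: N" using that by auto
  then obtain n U ph m V ps where "cht M n U ph" "fst p : U" "cht N m V ps" "snd p : V"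
   using chart_at[OF M] chart_at[OF N] by metis
  hence "(n + m,U \<times> V,chpr n ph ps) : ?A" "p : U \<times> V" by (blast,simp add: mem_Times_iff)
  thus ?thesis by (intro bexI[of _ "(n + m,U \<times> V,chpr n ph ps)"]) simp_all
 qed
 fix c d assume "c : ?A" "d : ?A"
 then obtain n U ph m V ps n' U' ph' m' V' ps' where eq: "c = (n + m,U \<times> V,chpr n ph ps)"
  "d = (n' + m',U' \<times> V',chpr n' ph' ps')" and c: "cht M n U ph" "cht N m V ps" "cht M n' U' ph'" "cht N m' V' ps'" by auto
 show "compatible c d" unfolding eq by (rule compatibleI)
   (use chart_prod_transition[OF c] chart_prod_transition[OF c(3,4,1,2)] in "auto simp: Int_commute")
qed

lemma mf_prod: "manifold (prod_mfd M N)" and prod_chart: "cht M n U ph ==> cht N m V ps ==>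
  (n + m,U \<times> V,chpr n ph ps) : charts (prod_mfd M N)" using atlas_manifold[OF prod_atlas prod_mfd_simps] by blast+

lemma pts_prod: "pts (prod_mfd M N) = pts M \<times> pts N" by (simp add: prod_mfd_simps)

lemma smooth_fst: "sm_on (prod_mfd M N) (pts M \<times> pts N) M fst"
proof (rule smooth_onI)
 show "opn (prod_mfd M N) (pts M \<times> pts N)" by (simp add: prod_mfd_simps openin_prod_Times_iff)
 fix z assume "z : pts M \<times> pts N"
 then obtain p q where z: "z = (p,q)" "p <: M" "q <: N" by auto
 obtain n U ph where c: "cht M n U ph" "p : U" using z(2) by (rule chart_at[OF M])
 obtain m V ps where d: "cht N m V ps" "q : V" using z(3) by (rule chart_at[OF N])
 note e = prod_chart[OF c(1) d(1)]
 have "fsm (prod_mfd M N) (U \<times> V) (%z. ph (fst z) i)" if "i < n" for i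
  by (rule fsm_cong[OF mf_prod chart_fsm[OF mf_prod e,of i]]) (use that in auto)
 thus "EX m V ps T. cht M m V ps & opn (prod_mfd M N) T & z : T & T <= pts M \<times> pts N &
   fst ` T <= V & (ALL i<m. fsm (prod_mfd M N) T (%q. ps (fst q) i))"
  using c d z ch_open[OF mf_prod e] ch_sub[OF M c(1)] ch_sub[OF N d(1)]
  by (intro exI[of _ n] exI[of _ U] exI[of _ ph] exI[of _ "U \<times> V"]) auto
qed

lemma smooth_snd: "sm_on (prod_mfd M N) (pts M \<times> pts N) N snd"
proof (rule smooth_onI)
 show "opn (prod_mfd M N) (pts M \<times> pts N)" by (simp add: prod_mfd_simps openin_prod_Times_iff)
 fix z assume "z : pts M \<times> pts N"
 then obtain p q where z: "z = (p,q)" "p <: M" "q <: N" by auto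
 obtain n U ph where c: "cht M n U ph" "p : U" using z(2) by (rule chart_at[OF M])
 obtain m V ps where d: "cht N m V ps" "q : V" using z(3) by (rule chart_at[OF N])
 note e = prod_chart[OF c(1) d(1)]
 have "fsm (prod_mfd M N) (U \<times> V) (%z. ps (snd z) i)" for i
  by (rule fsm_cong[OF mf_prod chart_fsm[OF mf_prod e,of "n + i"]]) auto
 thus "EX m V ps T. cht N m V ps & opn (prod_mfd M N) T & z : T & T <= pts M \<times> pts N &
   snd ` T <= V & (ALL i<m. fsm (prod_mfd M N) T (%q. ps (snd q) i))"
  using c d z ch_open[OF mf_prod e] ch_sub[OF M c(1)] ch_sub[OF N d(1)]
  by (intro exI[of _ m] exI[of _ V] exI[of _ ps] exI[of _ "U \<times> V"]) auto
qed

lemma smooth_pair: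
 assumes P: "manifold P" and f: "sm_on P S M f" and g: "sm_on P S N g" shows "sm_on P S (prod_mfd M N) (%p. (f p,g p))"
proof (rule smooth_onI[OF sm_open[OF f]])
 fix p assume p: "p : S"
 obtain n U ph where c: "cht M n U ph" "f p : U" by (rule chart_at[OF M sm_pts[OF M f p]])
 obtain m V ps where d: "cht N m V ps" "g p : V" by (rule chart_at[OF N sm_pts[OF N g p]])
 define T where "T = {q : S. f q : U} Int {q : S. g q : V}"
 have T: "opn P T" unfolding T_def using sm_preim[OF P M f ch_open[OF M c(1)]] sm_preim[OF P N g ch_open[OF N d(1)]] by blast
 have "fsm P T (%q. ph (f q) i)" for i by (rule fsm_subset[OF P fsm_pullback[OF P M f chart_fsm[OF M c(1)]] T]) (auto simp: T_def)
 moreover have "fsm P T (%q. ps (g q) i)" for i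
  by (rule fsm_subset[OF P fsm_pullback[OF P N g chart_fsm[OF N d(1)]] T]) (auto simp: T_def)
 ultimately have "fsm P T (%q. chpr n ph ps (f q,g q) i)" for i by (cases "i < n") simp_all
 thus "EX m V ps T. cht (prod_mfd M N) m V ps & opn P T & p : T & T <= S &
   (%p. (f p,g p)) ` T <= V & (ALL i<m. fsm P T (%q. ps (f q,g q) i))" using p c d T prod_chart[OF c(1) d(1)]
  by (intro exI[of _ "n + m"] exI[of _ "U \<times> V"] exI[of _ "chpr n ph ps"] exI[of _ T]) (auto simp: T_def)
qed

end

section \<open>Embedded submanifolds\<close>

text \<open>Slice charts around every point of S are what makes the generating family of
  \<open>sub_mfd\<close> cover S, hence an atlas.\<close>

definition embedded :: "'a mfd => 'a set => bool" where
 "embedded M S <-> S <= pts M &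
   (ALL p:S. EX n U ph k. cht M n U ph & p : U & k <= n & flat_in ph U S k)"

text \<open>As R^k is literally a subset of R^n, restricting to a slice needs no renumbering of
  coordinates.\<close>

lemma openin_Rn_restrict:
 assumes "opR n W" and kn: "k <= n" shows "opR k {x : W. ALL i>=k. x i = 0}"
proof -
 obtain T where T: "open T" "W = Rn n Int T" using assms(1) by (auto simp: Esp Rn_def openin_open)
 have "{x : W. ALL i>=k. x i = 0} = {x. ALL i>=k. x i = 0} Int T" using kn unfolding T(2) Rn_def by auto
 thus ?thesis using T(1) by (auto simp: Esp openin_open)
qed

lemma Cinf_restrict:
 assumes "opR n W" "Cinf n W f" "k <= n" shows "Cinf k {x : W. ALL i>=k. x i = 0} f"
 by (rule Cinf_compose[OF openin_Rn_restrict[OF assms(1,3)] assms(1) _ assms(2),where F="%x. x"])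
  (auto intro: Cinf_coord openin_Rn_restrict[OF assms(1,3)])

definition slices :: "'a mfd => 'a set => 'a chart set" where
 "slices M S = {(k,S Int U,ph) | n U ph k. cht M n U ph & k <= n & flat_in ph U S k}"

lemma slicesI: "cht M n U ph ==> k <= n ==> flat_in ph U S k ==> (k,S Int U,ph) : slices M S"
 unfolding slices_def by (intro CollectI exI conjI) (rule refl)

lemma slicesE:
 assumes "c : slices M S"
 obtains n U ph k where "c = (k,S Int U,ph)" "cht M n U ph" "k <= n"
   "flat_in ph U S k" using assms unfolding slices_def by (elim CollectE exE conjE)

context
 fixes M :: "'a mfd" and S :: "'a set"
 assumes M: "manifold M"
begin

lemma slice_image:
 assumes c: "cht M n U ph" and s: "flat_in ph U S k" shows "ph ` (S Int (U Int T)) = {x : ph ` (U Int T). ALL i>=k. x i = 0}"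
proof
 show "ph ` (S Int (U Int T)) <= {x : ph ` (U Int T). ALL i>=k. x i = 0}" using s by blast
 show "{x : ph ` (U Int T). ALL i>=k. x i = 0} <= ph ` (S Int (U Int T))"
 proof
  fix x assume x: "x : {x : ph ` (U Int T). ALL i>=k. x i = 0}"
  hence "x : ph ` (S Int U)" using s by auto
  then obtain q where q: "q : S" "q : U" "x = ph q" by blast
  obtain q' where q': "q' : U" "q' : T" "x = ph q'" using x by blast
  have "q = q'" using ch_inv[OF M c q(2)] ch_inv[OF M c q'(1)] q(3) q'(3) by metis
  thus "x : ph ` (S Int (U Int T))" using q q' by blast
 qed
qed

lemma slice_is_chart:
 assumes c: "cht M n U ph" and s: "flat_in ph U S k" and k: "k <= n" shows "is_chart (subtopology (mtop M) S) (k,S Int U,ph)"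
proof (rule is_chartI)
 let ?X = "subtopology (mtop M) S"
 show o: "openin ?X (S Int U)" using ch_open[OF M c] by (simp add: openin_subtopology_Int2)
 show "opR k (ph ` (S Int U))" unfolding s by (rule openin_Rn_restrict[OF ch_range[OF M c] k])
 show "inj_on ph (S Int U)" using is_chartD(3)[OF charts_ischart[OF M c]] inj_on_subset by blast
 show "opR k (ph ` (S Int U Int T))" if T: "openin ?X T" for T
 proof -
  obtain T' where T': "opn M T'" "T = T' Int S" using T by (auto simp: openin_subtopology)
  have "S Int U Int T = S Int (U Int T')" using T' by blast
  hence "ph ` (S Int U Int T) = {x : ph ` (U Int T'). ALL i>=k. x i = 0}" using slice_image[OF c s] by metis
  thus ?thesis using openin_Rn_restrict[OF chart_io[OF M c T'(1)] k] by simp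
 qed
 show "openin ?X {p : S Int U. ph p : T}" if T: "opR k T" for T
 proof (rule coords_open[OF o _ _ T])
  show "ph p : Rn k" if "p : S Int U" for p
  proof -
   have "ph p : ph ` (S Int U)" using that by blast
   thus ?thesis unfolding s by (simp add: Rn_iff)
  qed
  fix i T assume "open (T :: real set)"
  from fsm_open_pre[OF M chart_fsm[OF M c] this]
  have "opn M {p : U. ph p i : T}" .
  hence "openin ?X (S Int {p : U. ph p i : T})" by (rule openin_subtopology_Int2)
  moreover have "S Int {p : U. ph p i : T} = {p : S Int U. ph p i : T}" by blast
  ultimately show "openin ?X {p : S Int U. ph p i : T}" by simp
 qed
qed

lemma slice_transition:
 assumes c: "cht M n U ph" and s: "flat_in ph U S k" and k: "k <= n" and d: "cht M m V ps" and i: "i < m"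
 shows "Cinf k (ph ` (S Int U Int (S Int V))) (%x. ps (ivi (S Int U) ph x) i)"
proof -
 let ?W = "ph ` (S Int U Int (S Int V))"
 have "S Int U Int (S Int V) = S Int (U Int V)" by blast
 hence W: "?W = {x : ph ` (U Int V). ALL i>=k. x i = 0}" using slice_image[OF c s] by metis
 have o: "opR n (ph ` (U Int V))" by (rule chart_io[OF M c ch_open[OF M d]])
 have a: "Cinf k ?W (%x. ps (ivi U ph x) i)" unfolding W by (rule Cinf_restrict[OF o compatibleD(1)[OF ch_comp[OF M c d] i] k])
 have b: "opR k ?W" unfolding W by (rule openin_Rn_restrict[OF o k])
 have e: "ps (ivi U ph x) i = ps (ivi (S Int U) ph x) i" if x: "x : ?W" for x
 proof -
  obtain q where q: "q : S Int U" "x = ph q" using x by blast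
  have "inj_on ph (S Int U)" using is_chartD(3)[OF charts_ischart[OF M c]] inj_on_subset by blast
  hence "ivi (S Int U) ph x = q" using q by simp
  thus ?thesis using q ch_inv[OF M c] by simp
 qed
 show ?thesis by (rule Cinf_cong[OF b e a])
qed

lemma sub_mfd_simps:
 "mtop (sub_mfd M S) = subtopology (mtop M) S"
 "charts (sub_mfd M S) = max_atlas (subtopology (mtop M) S)
   (slices M S)" by (simp_all add: sub_mfd_def slices_def)

lemma pts_sub: "S <= pts M ==> pts (sub_mfd M S) = S" by (auto simp: sub_mfd_simps)

context
 assumes S: "embedded M S"
begin

lemma sub_atlas:
 "atlas (subtopology (mtop M) S)
   (slices M S)"
 (is "atlas ?X ?A") unfolding atlas_def
proof (intro conjI ballI)
 show "Hausdorff_space ?X" "second_countable ?X"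
  using M Hausdorff_space_subtopology second_countable_subtopology by (auto simp: manifold_def)
 show "is_chart ?X c" if c: "c : ?A" for c using c by (rule slicesE) (simp only: slice_is_chart)
 show "EX (n,U,ph):?A. p : U" if "p : topspace ?X" for p
 proof -
  have p: "p : S" using that by simp
  then obtain n U ph k where "cht M n U ph" "p : U" "k <= n" "flat_in ph U S k" using S unfolding embedded_def by blast
  hence "(k,S Int U,ph) : ?A" "p : S Int U" using p by (simp_all add: slicesI)
  thus ?thesis by (intro bexI[of _ "(k,S Int U,ph)"]) simp_all
 qed
 fix c d assume "c : ?A" "d : ?A"
 obtain n U ph k where 1: "c = (k,S Int U,ph)" and c: "cht M n U ph" "k <= n" "flat_in ph U S k"
  using \<open>c : ?A\<close> by (rule slicesE)
 obtain n' U' ph' k' where 2: "d = (k',S Int U',ph')"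
  and d: "cht M n' U' ph'" "k' <= n'" "ph' ` (S Int U') = {x : ph' ` U'. ALL i>=k'. x i = 0}"
  using \<open>d : ?A\<close> by (rule slicesE)
 show "compatible c d" unfolding 1 2
 proof (rule compatibleI)
  fix i assume "i < k'"
  hence "i < n'" using d by simp
  thus "Cinf k (ph ` (S Int U Int (S Int U'))) (%x. ph' (ivi (S Int U) ph x) i)" by (rule slice_transition[OF c(1,3,2) d(1)])
 next
  fix i assume "i < k"
  hence "i < n" using c by simp
  from slice_transition[OF d(1,3,2) c(1) this]
  show "Cinf k' (ph' ` (S Int U Int (S Int U'))) (%x. ph (ivi (S Int U') ph' x) i)" by (simp add: Int_commute)
 qed
qed

lemma mf_sub: "manifold (sub_mfd M S)" and sub_chart: "cht M n U ph ==> k <= n ==> flat_in ph U S k ==>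
  (k,S Int U,ph) : charts (sub_mfd M S)" by (fact atlas_manifold(1)[OF sub_atlas sub_mfd_simps],
   rule subsetD[OF atlas_manifold(2)[OF sub_atlas sub_mfd_simps]],rule slicesI)

lemma sub_openin: "opn M T ==> opn (sub_mfd M S) (S Int T)" by (simp add: sub_mfd_simps openin_subtopology_Int2)

lemma smooth_incl: "sm_on (sub_mfd M S) S M (%p. p)"
proof (rule smooth_onI)
 have "S <= pts M" using S by (simp add: embedded_def)
 thus "opn (sub_mfd M S) S" using sub_openin[of "pts M"] by (simp add: inf_absorb1)
 fix p assume p: "p : S"
 then obtain n U ph k where c: "cht M n U ph" "p : U" "k <= n" "flat_in ph U S k" using S unfolding embedded_def by blast
 show "EX m V ps T. cht M m V ps & opn (sub_mfd M S) T & p : T & T <= S &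
   (%p. p) ` T <= V & (ALL i<m. fsm (sub_mfd M S) T (%q. ps q i))"
  using c p sub_openin[OF ch_open[OF M c(1)]] chart_fsm[OF mf_sub sub_chart[OF c(1,3,4)]]
  by (intro exI[of _ n] exI[of _ U] exI[of _ ph] exI[of _ "S Int U"]) auto
qed

text \<open>A slice chart consists of coordinate functions of the ambient manifold, which are smooth
  along f already.\<close>

lemma smooth_into_sub:
 assumes P: "manifold P" and f: "sm_on P T M f" and fS: "!!p. p : T ==> f p : S" shows "sm_on P T (sub_mfd M S) f"
proof (rule smooth_onI[OF sm_open[OF f]])
 fix p assume p: "p : T"
 then obtain n U ph k where c: "cht M n U ph" "f p : U" "k <= n" "flat_in ph U S k"
  using S fS[OF p] unfolding embedded_def by blast
 have "fsm P {q : T. f q : U} (%q. ph (f q) i)" for i by (rule fsm_pullback[OF P M f chart_fsm[OF M c(1)]])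
 thus "EX m V ps A. cht (sub_mfd M S) m V ps & opn P A & p : A & A <= T &
   f ` A <= V & (ALL i<m. fsm P A (%q. ps (f q) i))" using c p fS sub_chart[OF c(1,3,4)] sm_preim[OF P M f ch_open[OF M c(1)]]
  by (intro exI[of _ k] exI[of _ "S Int U"] exI[of _ ph] exI[of _ "{q : T. f q : U}"]) auto
qed

end
end

lemma embedded_open:
 assumes M: "manifold M" and U: "opn M U" shows "embedded M U" unfolding embedded_def
proof (intro conjI ballI)
 show "U <= pts M" using U by (rule opsub)
 fix p assume "p : U"
 hence "p <: M" using opsub[OF U] by blast
 then obtain n A ph where c: "cht M n A ph" "p : A" by (rule chart_at[OF M])
 note c' = chart_restrict[OF M c(1) U]
 have "ph ` (U Int (A Int U)) = {x : ph ` (A Int U). ALL i>=n. x i = 0}" using chart_Rn[OF M c'] by (auto simp: Rn_iff)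
 thus "EX n A ph k. cht M n A ph & p : A & k <= n & flat_in ph A U k"
  using c(2) c' \<open>p : U\<close> by (intro exI[of _ n] exI[of _ "A Int U"] exI[of _ ph]) auto
qed

lemma smooth_on_open_sub:
 assumes M: "manifold M" and U: "opn M U" and "sm_on (sub_mfd M U) U N f" shows "sm_on M U N f"
 using sm_o[OF M mf_sub[OF M embedded_open[OF M U]]
   smooth_into_sub[OF M embedded_open[OF M U] M sm_id[OF M U]] assms(3)] by simp

section \<open>Transport along injections\<close>

text \<open>A variant of \<open>push_mfd\<close> for maps injective on the points of M but perhaps
  not on the whole type. It is applied later to the projection \<open>snd\<close> of a fibre product
  along the unit map.\<close>

definition imfd :: "('a => 'b) => 'a mfd => 'b mfd" where
 "imfd e M = \<lparr>mtop = pullback_topology (e ` pts M) (ivi (pts M) e) (mtop M),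
   charts = {(n,U,ph). U <= e ` pts M & (n,{p : pts M. e p : U},ph o e) : charts M}\<rparr>"

lemma chart_cong:
 assumes M: "manifold M" and c: "cht M n U ph" and eq: "!!p. p : U ==> ph p = ph' p" shows "cht M n U ph'"
proof (rule new_chart(1)[OF M c ch_open[OF M c] subset_refl ch_range[OF M c],where g="ivi U ph"])
 show "ph' p : ph ` U & ivi U ph (ph' p) = p" if "p : U" for p using eq[OF that] ch_inv[OF M c that] that by (metis imageI)
 show "ivi U ph y : U & ph' (ivi U ph y) = y" if "y : ph ` U" for y
  using that eq ch_inv[OF M c] by (metis f_inv_into_f inv_into_into)
 show "fsm M U (%p. ph' p i)" for i by (rule fsm_cong[OF M chart_fsm[OF M c,of i]]) (use eq in simp)
 show "Cinf n (ph ` U) (%y. ph (ivi U ph y) i)" for i using fsm_chart[OF chart_fsm[OF M c] c,of i] by simp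
qed

context
 fixes M :: "'a mfd" and e :: "'a => 'b"
 assumes M: "manifold M" and e: "inj_on e (pts M)"
begin

lemma im_open: "opn (imfd e M) T <-> T <= e ` pts M & opn M {p : pts M. e p : T}"
proof
 assume "opn (imfd e M) T"
 then obtain U where U: "opn M U" "T = ivi (pts M) e -` U Int e ` pts M" by (auto simp: imfd_def openin_pullback_topology)
 have "e p : T <-> p : U" if "p <: M" for p using U(2) e that by simp
 hence "{p : pts M. e p : T} = U" using opsub[OF U(1)] by blast
 thus "T <= e ` pts M & opn M {p : pts M. e p : T}" using U by auto
next
 assume T: "T <= e ` pts M & opn M {p : pts M. e p : T}"
 have "T = ivi (pts M) e -` {p : pts M. e p : T} Int e ` pts M" using T e by (auto simp: inv_into_into f_inv_into_f)
 thus "opn (imfd e M) T" using T by (auto simp: imfd_def openin_pullback_topology)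
qed

lemma pts_image: "pts (imfd e M) = e ` pts M"
proof
 show "pts (imfd e M) <= e ` pts M" using im_open[of "pts (imfd e M)"] by simp
 have "{p : pts M. e p : e ` pts M} = pts M" by blast
 hence "opn (imfd e M) (e ` pts M)" using im_open[of "e ` pts M"] by simp
 thus "e ` pts M <= pts (imfd e M)" by (rule opsub)
qed

lemma image_charts: "cht (imfd e M) n U ph <-> U <= e ` pts M & (n,{p : pts M. e p : U},ph o e) : charts M"
 by (simp add: imfd_def)

lemma image_pull: "U <= e ` pts M ==> e ` {p : pts M. e p : U} = U" by blast

lemma image_is_chart:
 assumes U: "U <= e ` pts M" shows "is_chart (mtop (imfd e M)) (n,U,ph) <-> is_chart (mtop M) (n,{p : pts M. e p : U},ph o e)"
  (is "?l <-> ?r")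
proof -
 let ?U = "{p : pts M. e p : U}"
 have im: "(ph o e) ` (?U Int {p : pts M. e p : T}) = ph ` (U Int T)" for T using U by (force simp: image_iff)
 have im0: "(ph o e) ` ?U = ph ` U" using im[of UNIV] by auto
 have eU: "inj_on e ?U" using e by (rule inj_on_subset) auto
 show ?thesis
 proof
  assume l: ?l
  note D = is_chartD[OF l]
  show ?r
  proof (rule is_chartI)
   show "opn M ?U" using D(1) im_open by blast
   show "opR n ((ph o e) ` ?U)" using D(2) im0 by simp
   show "inj_on (ph o e) ?U" using D(3) eU image_pull[OF U] by (simp add: comp_inj_on)
   show "opR n ((ph o e) ` (?U Int T))" if T: "opn M T" for T
   proof -
    have TM: "T <= pts M" using T by (rule opsub)
    hence t: "{p : pts M. e p : e ` T} = T" using e by (auto simp: inj_on_def)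
    hence "opn (imfd e M) (e ` T)" using T TM im_open by auto
    from D(4)[OF this] show ?thesis using im[of "e ` T"] t by simp
   qed
   show "opn M {p : ?U. (ph o e) p : T}" if "opR n T" for T
   proof -
    have "opn M {p : pts M. e p : {q : U. ph q : T}}" using D(5)[OF that] im_open by blast
    moreover have "{p : pts M. e p : {q : U. ph q : T}} = {p : ?U. (ph o e) p : T}" by auto
    ultimately show ?thesis by simp
   qed
  qed
 next
  assume r: ?r
  note D = is_chartD[OF r]
  show ?l
  proof (rule is_chartI)
   show "opn (imfd e M) U" using D(1) im_open U by blast
   show "opR n (ph ` U)" using D(2) im0 by simp
   show "inj_on ph U" using D(3) image_pull[OF U] inj_on_imageI[of ph e ?U] by simp
   show "opR n (ph ` (U Int T))" if "opn (imfd e M) T" for T using D(4)[of "{p : pts M. e p : T}"] that im_open im by simp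
   show "opn (imfd e M) {q : U. ph q : T}" if "opR n T" for T
   proof -
    have "{p : pts M. e p : {q : U. ph q : T}} = {p : ?U. (ph o e) p : T}" by auto
    thus ?thesis using D(5)[OF that] U im_open[of "{q : U. ph q : T}"] by auto
   qed
  qed
 qed
qed

lemma image_compatible:
 assumes U: "U <= e ` pts M" "inj_on ph U" "opR n (ph ` (U Int V))" and V: "V <= e ` pts M" "inj_on ps V" "opR m (ps ` (U Int V))"
 shows "compatible (n,U,ph) (m,V,ps) <->
  compatible (n,{p : pts M. e p : U},ph o e) (m,{p : pts M. e p : V},ps o e)"
proof -
 let ?U = "{p : pts M. e p : U}" and ?V = "{p : pts M. e p : V}"
 have im: "(ph o e) ` (?U Int ?V) = ph ` (U Int V)" "(ps o e) ` (?U Int ?V) = ps ` (U Int V)"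
  using U(1) by (force simp: image_iff)+
 have inv: "e (ivi {p : pts M. e p : A} (th o e) x) = ivi A th x"
  if A: "A <= e ` pts M" "inj_on th A" "x : th ` A" for A x and th :: "'b => nat => real"
 proof -
  obtain q where q: "q : A" "x = th q" using A by blast
  then obtain p where p: "p <: M" "q = e p" using A by blast
  have "inj_on (th o e) {p : pts M. e p : A}"
  proof (rule comp_inj_on)
   show "inj_on e {p : pts M. e p : A}" using e by (rule inj_on_subset) auto
   show "inj_on th (e ` {p : pts M. e p : A})" using A image_pull by simp
  qed
  hence "ivi {p : pts M. e p : A} (th o e) ((th o e) p) = p" using p q by (intro inv_into_f_f) auto
  moreover have "ivi A th x = q" using q A by simp
  ultimately show ?thesis using p q by simp
 qed
 have 1: "Cinf n (ph ` (U Int V)) (%x. ps (ivi U ph x) i) <->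
   Cinf n (ph ` (U Int V)) (%x. (ps o e) (ivi ?U (ph o e) x) i)" for i
 proof -
  have "e (ivi ?U (ph o e) x) = ivi U ph x" if "x : ph ` (U Int V)" for x by (rule inv[OF U(1,2)]) (use that in blast)
  thus ?thesis by (intro iffI) (erule Cinf_cong[OF U(3),rotated],simp)+
 qed
 have 2: "Cinf m (ps ` (U Int V)) (%x. ph (ivi V ps x) i) <->
   Cinf m (ps ` (U Int V)) (%x. (ph o e) (ivi ?V (ps o e) x) i)" for i
 proof -
  have "e (ivi ?V (ps o e) x) = ivi V ps x" if "x : ps ` (U Int V)" for x by (rule inv[OF V(1,2)]) (use that in blast)
  thus ?thesis by (intro iffI) (erule Cinf_cong[OF V(3),rotated],simp)+
 qed
 show ?thesis unfolding compatible_def smooth_euclid_iff case_prod_conv im 1 2 ..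
qed

lemma image_chart:
 assumes c: "cht M n U ph" shows "(n,e ` U,ph o ivi (pts M) e) : charts (imfd e M)"
  "!!p. p : U ==> (ph o ivi (pts M) e) (e p) = ph p"
proof -
 have U: "U <= pts M" by (rule ch_sub[OF M c])
 hence eq: "{p : pts M. e p : e ` U} = U" using e by (auto simp: inj_on_def)
 show *: "(ph o ivi (pts M) e) (e p) = ph p" if "p : U" for p using that U e by (simp add: subset_iff)
 have "(n,U,ph o ivi (pts M) e o e) : charts M" by (rule chart_cong[OF M c]) (use * in simp)
 thus "(n,e ` U,ph o ivi (pts M) e) : charts (imfd e M)" using U eq by (auto simp: image_charts)
qed

lemma manifold_image: "manifold (imfd e M)" unfolding manifold_def
proof (intro conjI)
 have op: "opn (imfd e M) (e ` T)" if "opn M T" for T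
 proof -
  have TM: "T <= pts M" using that by (rule opsub)
  hence "{p : pts M. e p : e ` T} = T" using e by (auto simp: inj_on_def)
  thus ?thesis using that TM im_open by auto
 qed
 have "homeomorphic_map (mtop M) (mtop (imfd e M)) e"
 proof (rule bijective_open_imp_homeomorphic_map)
  show "continuous_map (mtop M) (mtop (imfd e M)) e" unfolding continuous_map_def using im_open pts_image by auto
  show "open_map (mtop M) (mtop (imfd e M)) e" using op by (simp add: open_map_def)
 qed (use e pts_image in auto)
 hence h: "mtop M homeomorphic_space mtop (imfd e M)" using homeomorphic_map_imp_homeomorphic_space by blast
 show "Hausdorff_space (mtop (imfd e M))" using h M homeomorphic_Hausdorff_space unfolding manifold_def by blast
 show "second_countable (mtop (imfd e M))" by (rule second_countable_open_map_image[of "mtop M" _ e])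
   (use M op pts_image im_open in "auto simp: manifold_def open_map_def continuous_map_def")
 show "(\<Union>(n,U,ph)\<in>charts (imfd e M). U) = pts (imfd e M)"
 proof
  show "(\<Union>(n,U,ph)\<in>charts (imfd e M). U) <= pts (imfd e M)" using pts_image by (auto simp: image_charts)
  show "pts (imfd e M) <= (\<Union>(n,U,ph)\<in>charts (imfd e M). U)"
  proof
   fix q assume "q <: imfd e M"
   then obtain p where p: "p <: M" "q = e p" using pts_image by blast
   obtain n U ph where c: "cht M n U ph" "p : U" using p(1) by (rule chart_at[OF M])
   show "q : (\<Union>(n,U,ph)\<in>charts (imfd e M). U)" using image_chart(1)[OF c(1)] c(2) p(2) by (intro UN_I) auto
  qed
 qed
 have isch: "is_chart (mtop (imfd e M)) c" if "c : charts (imfd e M)" for c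
  using that image_is_chart charts_ischart[OF M] by (cases c) (auto simp: image_charts)
 have comp: "compatible (n,U,ph) (m,V,ps) <->
  compatible (n,{p : pts M. e p : U},ph o e) (m,{p : pts M. e p : V},ps o e)"
  if c: "is_chart (mtop (imfd e M)) (n,U,ph)" and d: "is_chart (mtop (imfd e M)) (m,V,ps)" for n U ph m V ps
 proof (rule image_compatible)
  show "U <= e ` pts M" "V <= e ` pts M" using is_chartD(1)[OF c] is_chartD(1)[OF d] im_open by blast+
  show "opR n (ph ` (U Int V))" using is_chartD(4)[OF c is_chartD(1)[OF d]] .
  show "opR m (ps ` (U Int V))" using is_chartD(4)[OF d is_chartD(1)[OF c]] by (simp add: Int_commute)
  show "inj_on ph U" "inj_on ps V" using is_chartD(3)[OF c] is_chartD(3)[OF d] .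
 qed
 show "charts (imfd e M) = max_atlas (mtop (imfd e M)) (charts (imfd e M))"
 proof
  show "charts (imfd e M) <= max_atlas (mtop (imfd e M)) (charts (imfd e M))"
  proof
   fix c assume c: "c : charts (imfd e M)"
   have "compatible c d" if d: "d : charts (imfd e M)" for d
   proof -
    obtain n U ph where 1: "c = (n,U,ph)" by (cases c)
    obtain m V ps where 2: "d = (m,V,ps)" by (cases d)
    have "compatible (n,{p : pts M. e p : U},ph o e) (m,{p : pts M. e p : V},ps o e)"
     using c d unfolding 1 2 image_charts by (intro ch_comp[OF M]) auto
    thus ?thesis unfolding 1 2 using comp[OF isch[OF c,unfolded 1] isch[OF d,unfolded 2]] by simp
   qed
   thus "c : max_atlas (mtop (imfd e M)) (charts (imfd e M))" using isch[OF c] by (simp add: max_atlas_def)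
  qed
  show "max_atlas (mtop (imfd e M)) (charts (imfd e M)) <= charts (imfd e M)"
  proof
   fix c assume c: "c : max_atlas (mtop (imfd e M)) (charts (imfd e M))"
   obtain n U ph where 1: "c = (n,U,ph)" by (cases c)
   have ic: "is_chart (mtop (imfd e M)) (n,U,ph)" using c by (simp add: max_atlas_def 1)
   have U: "U <= e ` pts M" using is_chartD(1)[OF ic] im_open by blast
   \<comment> \<open>Maximality is inherited: a chart compatible with all transported charts of M
     pulls back to one compatible with all charts of M, which therefore belongs to M.\<close>
   have "(n,{p : pts M. e p : U},ph o e) : charts M"
   proof (rule chartsI[OF M])
    show i: "is_chart (mtop M) (n,{p : pts M. e p : U},ph o e)" using image_is_chart[OF U] ic by simp
    fix d assume d: "d : charts M"
    obtain m V ps where 2: "d = (m,V,ps)" by (cases d)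
    note d' = d[unfolded 2]
    have V: "V <= pts M" by (rule ch_sub[OF M d'])
    have eV: "{p : pts M. e p : e ` V} = V" using e V by (auto simp: inj_on_def)
    let ?ps = "ps o ivi (pts M) e"
    have "compatible (n,U,ph) (m,e ` V,?ps)" using c image_chart(1)[OF d'] by (auto simp: max_atlas_def 1)
    hence co: "compatible (n,{p : pts M. e p : U},ph o e) (m,V,?ps o e)"
     using comp[OF ic isch[OF image_chart(1)[OF d']]] unfolding eV by simp
    let ?A = "{p : pts M. e p : U}"
    have inj: "inj_on ps V" using is_chartD(3)[OF charts_ischart[OF M d']] .
    have eq: "(?ps o e) p = ps p" if "p : V" for p using image_chart(2)[OF d' that] by simp
    have im: "(?ps o e) ` V = ps ` V" "(?ps o e) ` (?A Int V) = ps ` (?A Int V)" by (rule image_cong; use eq in simp)+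
    have injp: "inj_on (?ps o e) V" using inj inj_on_cong[of V "?ps o e" ps] eq by blast
    have inv: "ivi V (?ps o e) y = ivi V ps y" if "y : ps ` V" for y
    proof -
     obtain p where p: "p : V" "y = ps p" using \<open>y : ps ` V\<close> by blast
     have "ivi V ps (ps p) = p" "ivi V (?ps o e) ((?ps o e) p) = p"
      by (rule inv_into_f_f[OF inj p(1)],rule inv_into_f_f[OF injp p(1)])
     thus ?thesis using eq[OF p(1)] p(2) by metis
    qed
    note iD = is_chartD[OF i]
    have o1: "opR n ((ph o e) ` (?A Int V))" by (rule iD(4)[OF ch_open[OF M d']])
    have o2: "opR m (ps ` (?A Int V))" using chart_io[OF M d' iD(1)] by (simp add: Int_commute)
    show "compatible (n,?A,ph o e) d" unfolding 2
    proof (rule compatibleI)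
     fix i assume "i < m"
     have iv: "ivi ?A (ph o e) x : V" if x: "x : (ph o e) ` (?A Int V)" for x
     proof -
      obtain p where p: "p : ?A" "p : V" "x = (ph o e) p" using x by blast
      hence "ivi ?A (ph o e) x = p" using inv_into_f_f[OF iD(3) p(1)] by (simp only:)
      thus ?thesis using p by simp
     qed
     show "Cinf n ((ph o e) ` (?A Int V)) (%x. ps (ivi ?A (ph o e) x) i)"
      by (rule Cinf_cong[OF o1 _ compatibleD(1)[OF co \<open>i < m\<close>]]) (use eq iv in simp)
    next
     fix i assume "i < n"
     from compatibleD(2)[OF co this] have "Cinf m (ps ` (?A Int V)) (%x. (ph o e) (ivi V (?ps o e) x) i)" unfolding im .
     thus "Cinf m (ps ` (?A Int V)) (%x. (ph o e) (ivi V ps x) i)" by (rule Cinf_cong[OF o2,rotated]) (use inv in force)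
    qed
   qed
   thus "c : charts (imfd e M)" using U 1 by (simp add: image_charts)
  qed
 qed
qed

lemma smooth_image: "smooth M (imfd e M) e"
proof (rule smooth_onI)
 fix p assume "p <: M"
 then obtain n U ph where c: "cht M n U ph" "p : U" by (rule chart_at[OF M])
 have "fsm M U (%q. (ph o ivi (pts M) e) (e q) i)" for i
  by (rule fsm_cong[OF M chart_fsm[OF M c(1),of i]]) (use image_chart(2)[OF c(1)] in simp)
 thus "EX m V ps T. cht (imfd e M) m V ps & opn M T & p : T & T <= pts M &
   e ` T <= V & (ALL i<m. fsm M T (%q. ps (e q) i))" using image_chart(1)[OF c(1)] c ch_open[OF M c(1)] ch_sub[OF M c(1)] by blast
qed simp

lemma smooth_image_inv: "sm_on (imfd e M) (e ` pts M) M (ivi (pts M) e)"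
proof (rule smooth_onI)
 show "opn (imfd e M) (e ` pts M)" using otop[of "mtop (imfd e M)"] pts_image by simp
 fix q assume "q : e ` pts M"
 then obtain p where p: "p <: M" "q = e p" by blast
 obtain n U ph where c: "cht M n U ph" "p : U" using p(1) by (rule chart_at[OF M])
 have U: "U <= pts M" by (rule ch_sub[OF M c(1)])
 note ic = image_chart(1)[OF c(1)]
 have "ivi (pts M) e ` (e ` U) <= U" using U e by (auto simp: subset_iff)
 thus "EX m V ps T. cht M m V ps & opn (imfd e M) T & q : T & T <= e ` pts M &
   ivi (pts M) e ` T <= V & (ALL i<m. fsm (imfd e M) T (%q. ps (ivi (pts M) e q) i))"
  using p c U ch_open[OF manifold_image ic] chart_fsm[OF manifold_image ic]
  by (intro exI[of _ n] exI[of _ U] exI[of _ ph] exI[of _ "e ` U"]) (auto simp: o_def)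
qed

end

lemma push_mfd_eq:
 assumes M: "manifold M" and e: "inj e" shows "push_mfd e M = imfd e M"
proof -
 have e': "inj_on e (pts M)" using e inj_on_subset by blast
 have "openin (pullback_topology (range e) (ivi UNIV e) (mtop M)) T <->
  opn (imfd e M) T" for T
 proof -
  have "openin (pullback_topology (range e) (ivi UNIV e) (mtop M)) T <-> (EX U. opn M U & T = e ` U)"
  proof -
   have "ivi UNIV e -` U Int range e = e ` U" for U using e by auto
   thus ?thesis by (simp add: openin_pullback_topology)
  qed
  also have "... <-> T <= e ` pts M & opn M {p : pts M. e p : T}"
  proof
   assume "EX U. opn M U & T = e ` U"
   then obtain U where U: "opn M U" "T = e ` U" by blast
   hence "{p : pts M. e p : T} = U" using e opsub[OF U(1)] by (auto simp: inj_def)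
   thus "T <= e ` pts M & opn M {p : pts M. e p : T}" using U opsub[OF U(1)] by auto
  next
   assume "T <= e ` pts M & opn M {p : pts M. e p : T}"
   thus "EX U. opn M U & T = e ` U" by (intro exI[of _ "{p : pts M. e p : T}"]) blast
  qed
  finally show ?thesis using im_open[OF M e'] by simp
 qed
 hence t: "pullback_topology (range e) (ivi UNIV e) (mtop M) = mtop (imfd e M)" by (simp add: topology_eq)
 have "{(n,U,ph). U <= range e & (n,e -` U,ph o e) : charts M} = charts (imfd e M)"
 proof (intro Set.set_eqI,clarify)
  fix n U and ph :: "'b => nat => real"
  have "U <= range e & (n,e -` U,ph o e) : charts M <->
    U <= e ` pts M & (n,{p : pts M. e p : U},ph o e) : charts M" (is "?l <-> ?r")
  proof
   assume l: ?l
   hence "e -` U <= pts M" using ch_sub[OF M] by blast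
   hence "{p : pts M. e p : U} = e -` U" "U <= e ` pts M" using l by (blast,blast)
   thus ?r using l by simp
  next
   assume r: ?r
   hence "{p : pts M. e p : U} = e -` U" using injD[OF e] by blast
   thus ?l using r by auto
  qed
  thus "((n,U,ph) : {(n,U,ph). U <= range e & (n,e -` U,ph o e) : charts M}) =
   (cht (imfd e M) n U ph)" by (simp add: image_charts[OF M e'])
 qed
 thus ?thesis using t unfolding push_mfd_def by (simp add: imfd_def)
qed

section \<open>Submersions\<close>

text \<open>The surjectivity clause of \<open>submersion\<close> at one point, for a map given by m
  real functions on an open set and for charts inside that set.\<close>

definition jac_onto :: "'a mfd => 'a set => ('a => nat => real) => nat => 'a => bool" where
 "jac_onto M S F m p <-> (ALL n U ph. cht M n U ph --> p : U --> U <= S -->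
   (ALL w::nat => real. EX v. ALL i<m. (\<Sum>j<n. pd j (%x. F (ivi U ph x) i) (ph p) * v j) = w i))"

lemma partial_deriv_coord:
 assumes W: "opR n W" "x : W" "l < n" and eq: "!!x. x : W ==> f x = x i" shows "pd l f x = (if l = i then 1 else 0)"
proof (rule partial_deriv_eqI)
 have "DERIV (%t. (x(l := t)) i) (x l) :> (if l = i then 1 else 0)" by (cases "l = i") (auto intro!: derivative_eq_intros)
 thus "DERIV (%t. f (x(l := t))) (x l) :> (if l = i then 1 else 0)" using deriv_upd_cong[OF W,of f "%x. x i"] eq by blast
qed

text \<open>The equations are made into coordinates one after the other.\<close>

lemma adapted_chart:
 assumes M: "manifold M" and p: "p : S" and S: "opn M S" and F: "!!i. i < m ==> fsm M S (%q. F q i)" and J: "jac_onto M S F m p"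
 shows "EX n U ph. cht M n U ph & p : U & U <= S & m <= n & (ALL q:U. ALL i<m. ph q i = F q i)"
proof -
 have "k <= m ==> EX n U ph. cht M n U ph & p : U & U <= S & k <= n & (ALL q:U. ALL i<k. ph q i = F q i)" for k
 proof (induction k)
  case 0
  have "p <: M" using p S opsub by blast
  then obtain n U ph where "cht M n U ph" "p : U" by (rule chart_at[OF M])
  thus ?case using chart_restrict[OF M _ S] p by (intro exI[of _ n] exI[of _ "U Int S"] exI[of _ ph]) auto
 next
  case (Suc j)
  then obtain n U ph where c: "cht M n U ph" "p : U" "U <= S" "j <= n" "!!q i. q : U ==> i < j ==> ph q i = F q i"
   by (metis Suc_leD)
  have jm: "j < m" using Suc.prems by simp
  define W where "W = ph ` U"
  have W: "opR n W" unfolding W_def by (rule ch_range[OF M c(1)])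
  define f where "f i x = F (ivi U ph x) i" for i x
  have pW: "ph p : W" using c(2) by (simp add: W_def)
  have inv: "ivi U ph x : U" "ph (ivi U ph x) = x" if "x : W" for x using that by (auto simp: W_def inv_into_into f_inv_into_f)
  have US: "U Int S = U" using c(3) by blast
  have fC: "Cinf n W (f i)" if "i < m" for i using fsm_chart[OF F[OF that] c(1)] unfolding US W_def f_def[abs_def] .
  have pd: "pd l (f i) (ph p) = (if l = i then 1 else 0)" if "i < j" "l < n" for i l
   by (rule partial_deriv_coord[OF W pW that(2)]) (use c(5)[OF inv(1) that(1)] inv(2) in "simp add: f_def")
  \<comment> \<open>v solves the linearised equations with the j-th basis vector on the right. The
    first j functions already are coordinates, so the first j entries of v vanish; hence the j-th
    function has a nonzero partial derivative in some direction l \<ge> j.\<close>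
  obtain v where v: "!!i. i < m ==> (\<Sum>l<n. pd l (f i) (ph p) * v l) = (if i = j then 1 else 0)"
   using J[unfolded jac_onto_def,rule_format,OF c(1-3),of "%i. if i = j then 1 else 0"] unfolding f_def[abs_def] by blast
  have v0: "v i = 0" if i: "i < j" for i
  proof -
   have "(\<Sum>l<n. pd l (f i) (ph p) * v l) = (\<Sum>l<n. if l = i then v l else 0)" by (rule sum.cong) (use pd[OF i] in auto)
   also have "... = v i" using i c(4) by (simp add: sum.delta)
   finally show ?thesis using v[of i] i jm by simp
  qed
  have "EX l<n. j <= l & pd l (f j) (ph p) ~= 0"
  proof (rule ccontr)
   assume "~ ?thesis"
   hence "pd l (f j) (ph p) * v l = 0" if "l < n" for l using v0[of l] that by (cases "l < j") auto
   hence "(\<Sum>l<n. pd l (f j) (ph p) * v l) = 0" by (intro sum.neutral) simp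
   thus False using v[OF jm] by simp
  qed
  then obtain l where l: "l < n" "j <= l" "pd l (f j) (ph p) ~= 0" by blast
  obtain U' V' G where cc: "opR n U'" "ph p : U'" "U' <= W" "opR n V'"
   "!!x. x : U' ==> x(l := f j x) : V' & G (x(l := f j x)) = x"
   "!!y. y : V' ==> G y : U' & (G y)(l := f j (G y)) = y"
   "!!i. Cinf n V' (%y. G y i)" by (rule coord_change[OF W fC[OF jm] pW l(1) l(3)]) blast
  \<comment> \<open>The j-th function replaces coordinate l by \<open>coord_change\<close>; the
    transposition then moves it to position j without disturbing the earlier ones.\<close>
  let ?t = "Transposition.transpose j l"
  define sw where "sw x = (%i. x (?t i))" for x :: "nat => real"
  have sw_sw: "sw (sw x) = x" for x by (simp add: sw_def)
  have jn: "j < n" using l by simp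
  have tn: "?t i < n <-> i < n" for i using jn l(1) by (auto simp: Transposition.transpose_def)
  have swR: "sw x : Rn n" if "x : Rn n" for x using that tn by (auto simp: Rn_iff sw_def) (meson leD not_le_imp_less)
  define U2 where "U2 = {q : U. ph q : U'}"
  define W2 where "W2 = {y : Rn n. sw y : V'}"
  define ka where "ka q = sw ((ph q)(l := F q j))" for q
  define g where "g y = ivi U ph (G (sw y))" for y
  have U2: "opn M U2" unfolding U2_def by (rule chart_preimage_open[OF M c(1) cc(1)])
  have W2: "opR n W2" unfolding W2_def
  proof (rule coords_open[OF otop swR _ cc(4)])
   show "opR n {p : Rn n. sw p i : T}" if "open T" for i T unfolding sw_def by (rule Rn_preim[OF otop cont_coord that])
  qed
  have fj: "f j (ph q) = F q j" if "q : U" for q using ch_inv[OF M c(1) that] by (simp add: f_def)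
  have V'R: "V' <= Rn n" by (rule Rn_sub[OF cc(4)])
  have k1: "ka q : W2 & g (ka q) = q" if q: "q : U2" for q
  proof -
   have qU: "q : U" "ph q : U'" using q by (auto simp: U2_def)
   have a: "(ph q)(l := F q j) : V'" "G ((ph q)(l := F q j)) = ph q" using cc(5)[OF qU(2)] fj[OF qU(1)] by auto
   thus ?thesis using V'R ch_inv[OF M c(1) qU(1)] swR by (auto simp: ka_def W2_def g_def sw_sw)
  qed
  have gy: "G (sw y) : U'" "G (sw y) : W" "g y : U" "ph (g y) = G (sw y)" if y: "y : W2" for y
  proof -
   show 1: "G (sw y) : U'" using cc(6) y by (simp add: W2_def)
   thus 2: "G (sw y) : W" using cc(3) by blast
   show "g y : U" "ph (g y) = G (sw y)" using inv[OF 2] by (auto simp: g_def)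
  qed
  have k2: "g y : U2 & ka (g y) = y" if y: "y : W2" for y
  proof -
   have "(G (sw y))(l := f j (G (sw y))) = sw y" using cc(6) y by (simp add: W2_def)
   moreover have "f j (G (sw y)) = F (g y) j" by (simp add: f_def g_def)
   ultimately have "ka (g y) = y" using gy(4)[OF y] by (simp add: ka_def sw_sw)
   thus ?thesis using gy[OF y] by (simp add: U2_def)
  qed
  have kf: "fsm M U2 (%q. ka q i)" for i
  proof (cases "?t i = l")
   case True
   have "fsm M U2 (%q. F q j)" by (rule fsm_subset[OF M F[OF jm] U2]) (use c(3) in "auto simp: U2_def")
   thus ?thesis using True by (simp add: ka_def sw_def)
  next
   case False
   have "fsm M U2 (%q. ph q (?t i))" by (rule fsm_subset[OF M chart_fsm[OF M c(1)] U2]) (auto simp: U2_def)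
   thus ?thesis using False by (simp add: ka_def sw_def)
  qed
  have gC: "Cinf n W2 (%y. ph (g y) i)" for i
  proof -
   have "Cinf n W2 (%y. G (sw y) i)"
   proof (rule Cinf_compose[OF W2 cc(4),where F=sw and g="%y. G y i"])
    show "sw x : V'" if "x : W2" for x using that by (simp add: W2_def)
    show "Cinf n W2 (%x. sw x k)" for k unfolding sw_def by (rule Cinf_coord[OF W2])
   qed (rule cc(7))
   thus ?thesis by (rule Cinf_cong[OF W2,rotated]) (use gy(4) in simp)
  qed
  have "cht M n U2 ka" by (rule new_chart(1)[OF M c(1) U2 _ W2 k1 k2 kf gC]) (auto simp: U2_def)
  moreover have "ka q i = F q i" if "q : U2" "i < Suc j" for q i
  proof (cases "i = j")
   case True
   thus ?thesis by (simp add: ka_def sw_def)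
  next
   case False
   hence i: "i < j" "i ~= l" using that l by auto
   hence "?t i = i" by (simp add: Transposition.transpose_def)
   thus ?thesis using i c(5)[of q i] that by (simp add: ka_def sw_def U2_def)
  qed
  ultimately show ?case using c(2,3) cc(2) jn by (intro exI[of _ n] exI[of _ U2] exI[of _ ka]) (auto simp: U2_def)
 qed
 thus ?thesis by blast
qed

text \<open>Differentiating F (s z) = z by the chain rule shows that the Jacobian of s at z0 is a
  right inverse of that of F at p. Its columns are a l, and v is the image of w under it.\<close>

lemma jac_onto_section:
 assumes M: "manifold M" and F: "!!i. i < m ==> fsm M S (%q. F q i)"
  and W: "opR m W" "z0 : W" and s: "sm_on (eucl m) W M s" "s z0 = p"
  and Fs: "!!z. z : W ==> s z : S" "!!z i. z : W ==> i < m ==> F (s z) i = z i" shows "jac_onto M S F m p" unfolding jac_onto_def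
proof (intro allI impI)
 fix n U ph and w :: "nat => real"
 assume c: "cht M n U ph" and p: "p : U" and US: "U <= S"
 define W' where "W' = {z : W. s z : U}"
 have W': "opR m W'" using sm_preim[OF mfE M s(1) ch_open[OF M c]] by (simp add: W'_def eucls)
 have z0: "z0 : W'" using W s p by (simp add: W'_def)
 have cs: "Cinf m W' (%z. ph (s z) j)" for j
  using fsm_pullback[OF mfE M s(1) chart_fsm[OF M c,of j]] by (simp add: fsm_euclid W'_def)
 have o: "opR n (ph ` U)" by (rule ch_range[OF M c])
 define f where "f i x = F (ivi U ph x) i" for i x
 have eqU: "U Int S = U" using US by blast
 have fC: "Cinf n (ph ` U) (f i)" if "i < m" for i using fsm_chart[OF F[OF that] c] unfolding eqU f_def[abs_def] .
 define a where "a l j = pd l (%z. ph (s z) j) z0" for l j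
 have eq: "(\<Sum>j<n. pd j (f i) (ph p) * a l j) = (if l = i then 1 else 0)" if i: "i < m" and l: "l < m" for i l
 proof -
  have f1: "Ck n (ph ` U) (Suc 0) (f i)" using fC[OF i] unfolding Cinf_def by blast
  have ev: "\<forall>\<^sub>F t in nhds (z0 l). ph (s (z0(l := t))) : ph ` U"
   using eventually_upd_in[OF W' z0 l] by (rule eventually_mono) (simp add: W'_def)
  have d: "DERIV (%t. ph (s (z0(l := t))) j) (z0 l) :> a l j" for j unfolding a_def by (rule Cinf_deriv[OF cs l z0])
  have "((%t. f i (ph (s (z0(l := t))))) has_field_derivative
   (\<Sum>j<n. pd j (f i) (ph (s (z0(l := z0 l)))) * a l j)) (at (z0 l))" by (rule chain_curve[OF o f1 ev d])
  hence d1: "((%t. f i (ph (s (z0(l := t))))) has_field_derivative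
   (\<Sum>j<n. pd j (f i) (ph p) * a l j)) (at (z0 l))" by (simp add: s(2) del: fun_upd_apply)
  have "f i (ph (s z)) = z i" if "z : W'" for z using that Fs(2)[OF _ i] ch_inv[OF M c] by (simp add: f_def W'_def)
  hence "pd l (%z. f i (ph (s z))) z0 = (if l = i then 1 else 0)" by (rule partial_deriv_coord[OF W' z0 l])
  thus ?thesis using partial_deriv_eqI[OF d1] by simp
 qed
 define v where "v j = (\<Sum>l<m. w l * a l j)" for j
 have "(\<Sum>j<n. pd j (f i) (ph p) * v j) = w i" if i: "i < m" for i
 proof -
  have "(\<Sum>j<n. pd j (f i) (ph p) * v j) = (\<Sum>j<n. \<Sum>l<m. w l * (pd j (f i) (ph p) * a l j))"
   by (simp add: v_def sum_distrib_left ac_simps)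
  also have "... = (\<Sum>l<m. w l * (\<Sum>j<n. pd j (f i) (ph p) * a l j))" by (subst sum.swap) (simp add: sum_distrib_left)
  also have "... = (\<Sum>l<m. if l = i then w l else 0)" by (rule sum.cong) (use eq[OF i] in auto)
  also have "... = w i" using i by (simp add: sum.delta)
  finally show ?thesis .
 qed
 thus "EX v. ALL i<m. (\<Sum>j<n. pd j (%x. F (ivi U ph x) i) (ph p) * v j) = w i" unfolding f_def[abs_def] by blast
qed

text \<open>Smooth local sections through every point. This form of the submersion property is free
  of charts and Jacobians, and is the only one used from here on.\<close>

definition sections :: "'a mfd => 'b mfd => ('a => 'b) => bool" where
 "sections M N f <-> (ALL p:pts M. EX V s. opn N V & f p : V & sm_on N V M s & s (f p) = p &
   (ALL y:V. f (s y) = y))"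

lemma sectionsE:
 assumes "sections M N f" "p <: M"
 obtains V s where "opn N V" "f p : V" "sm_on N V M s" "s (f p) = p" "!!y. y : V ==> f (s y) = y"
 using assms unfolding sections_def by metis

text \<open>In an adapted chart f is the projection to the first m coordinates, and freezing the
  others at their values at p gives a section. Conversely a section differentiates to a right
  inverse of the Jacobian.\<close>

lemma submersion_iff:
 assumes M: "manifold M" and N: "manifold N" shows "submersion M N f <-> smooth M N f & sections M N f"
proof
 assume sub: "submersion M N f"
 hence f: "smooth M N f" by (simp add: submersion_def smap_iff[OF M])
 have "sections M N f" unfolding sections_def
 proof
  fix p assume p: "p <: M"
  obtain m V ps where d: "cht N m V ps" "f p : V" by (rule chart_at[OF N sm_pts[OF N f p]])
  define S where "S = {q : pts M. f q : V}"
  have S: "opn M S" unfolding S_def by (rule sm_preim[OF M N f ch_open[OF N d(1)]])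
  have F: "fsm M S (%q. ps (f q) i)" for i unfolding S_def by (rule fsm_pullback[OF M N f chart_fsm[OF N d(1)]])
  have J: "jac_onto M S (%q. ps (f q)) m p" unfolding jac_onto_def
  proof (intro allI impI)
   fix n U ph and w :: "nat => real" assume "cht M n U ph" "p : U" "U <= S"
   thus "EX v. ALL i<m. (\<Sum>j<n. pd j (%x. ps (f (ivi U ph x)) i) (ph p) * v j) = w i"
    using sub d unfolding submersion_def by fast
  qed
  obtain n U ph where c: "cht M n U ph" "p : U" "U <= S" "m <= n" "!!q i. q : U ==> i < m ==> ph q i = ps (f q) i"
   using adapted_chart[OF M _ S F J] p d(2) unfolding S_def by blast
  define h where "h y = (%i. if i < m then ps y i else ph p i)" for y
  define V' where "V' = {y : V. h y : ph ` U}"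
  have hR: "h y : Rn n" for y using c(4) chart_Rn[OF M c(1,2)] by (auto simp: h_def Rn_iff)
  have hs: "fsm N V (%y. h y i)" for i
   using chart_fsm[OF N d(1),of i] fsm_const[OF N ch_open[OF N d(1)]] by (cases "i < m") (simp_all add: h_def)
  have V': "opn N V'" unfolding V'_def by (rule coords_open[OF ch_open[OF N d(1)] hR _ ch_range[OF M c(1)]])
    (rule fsm_open_pre[OF N hs])
  have hs': "sm_on N V' (eucl n) h" unfolding sm_euclid[OF N] using V' hR fsm_subset[OF N hs V'] by (auto simp: V'_def)
  define s where "s y = ivi U ph (h y)" for y
  have ss: "sm_on N V' M s" unfolding s_def by (rule sm_o[OF N mfE hs' chart_inv_smooth[OF M c(1)]]) (simp add: V'_def)
  have hp: "h (f p) = ph p" using c(5)[OF c(2)] by (auto simp: h_def)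
  have "f (s y) = y" if y: "y : V'" for y
  proof -
   have sU: "s y : U" "ph (s y) = h y" using y by (auto simp: V'_def s_def inv_into_into f_inv_into_f)
   hence fV: "f (s y) : V" using c(3) by (auto simp: S_def)
   have yV: "y : V" using y by (simp add: V'_def)
   have "ps (f (s y)) i = ps y i" for i
   proof (cases "i < m")
    case True
    thus ?thesis using c(5)[OF sU(1) True] sU(2) by (simp add: h_def)
   next
    case False
    thus ?thesis using chart_Rn[OF N d(1) fV] chart_Rn[OF N d(1) yV] by (simp add: Rn_iff)
   qed
   hence "ps (f (s y)) = ps y" by blast
   thus ?thesis using ch_inv[OF N d(1) fV] ch_inv[OF N d(1) yV] by metis
  qed
  moreover have "f p : V'" using d(2) hp c(2) by (simp add: V'_def)
  moreover have "s (f p) = p" using hp ch_inv[OF M c(1,2)] by (simp add: s_def)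
  ultimately show "EX V s. opn N V & f p : V & sm_on N V M s & s (f p) = p & (ALL y:V. f (s y) = y)" using V' ss by blast
 qed
 with f show "smooth M N f & sections M N f" ..
next
 assume r: "smooth M N f & sections M N f"
 hence f: "smooth M N f" and sec: "sections M N f" by auto
 show "submersion M N f" unfolding submersion_def smap_iff[OF M]
 proof (intro conjI f ballI,clarify)
  fix n U ph m V ps p and w :: "nat => real"
  assume c: "cht M n U ph" and d: "cht N m V ps" and p: "p : U" "f p : V"
  have pM: "p <: M" using p ch_sub[OF M c] by blast
  from sec pM obtain A s where A: "opn N A" "f p : A" "sm_on N A M s" "s (f p) = p" "!!y. y : A ==> f (s y) = y"
   by (rule sectionsE) blast
  define S where "S = {q : pts M. f q : V}"
  have S: "opn M S" unfolding S_def by (rule sm_preim[OF M N f ch_open[OF N d]])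
  have F: "fsm M S (%q. ps (f q) i)" for i unfolding S_def by (rule fsm_pullback[OF M N f chart_fsm[OF N d]])
  define W where "W = ps ` (V Int A)"
  have W: "opR m W" unfolding W_def by (rule chart_io[OF N d A(1)])
  have inv: "ivi V ps z : V Int A & ps (ivi V ps z) = z" if z: "z : W" for z
  proof -
   obtain y where "y : V Int A" "z = ps y" using z unfolding W_def by blast
   thus ?thesis using ch_inv[OF N d] by auto
  qed
  have "sm_on (eucl m) W N (ivi V ps)" by (rule sm_sub[OF mfE chart_inv_smooth[OF N d]]) (use W in "auto simp: eucls W_def")
  hence ss: "sm_on (eucl m) W M (%z. s (ivi V ps z))" by (rule sm_o[OF mfE N _ A(3)]) (use inv in blast)
  have fs: "f (s (ivi V ps z)) = ivi V ps z" if "z : W" for z using inv[OF that] A(5) by blast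
  have J: "jac_onto M S (%q. ps (f q)) m p"
  proof (rule jac_onto_section[OF M F W _ ss])
   show "ps (f p) : W" using p A(2) by (simp add: W_def)
   show "s (ivi V ps (ps (f p))) = p" using ch_inv[OF N d p(2)] A(4) by simp
   show "s (ivi V ps z) : S" if "z : W" for z using sm_pts[OF M ss that] fs[OF that] inv[OF that] by (simp add: S_def)
   show "ps (f (s (ivi V ps z))) i = z i" if "z : W" for z i using fs[OF that] inv[OF that] by simp
  qed
  \<comment> \<open>\<open>jac_onto\<close> speaks of charts inside S, so the given chart is cut
    down to S; the partial derivatives at p stay the same.\<close>
  define B where "B = U Int S"
  have cB: "cht M n B ph" "p : B" "B <= S" unfolding B_def using chart_restrict[OF M c S] p pM by (auto simp: S_def)
  from J[unfolded jac_onto_def,rule_format,OF cB,of w] obtain v where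
   v: "!!i. i < m ==> (\<Sum>j<n. pd j (%x. ps (f (ivi B ph x)) i) (ph p) * v j) = w i" by blast
  have o: "opR n (ph ` B)" by (rule ch_range[OF M cB(1)])
  have "pd j (%x. ps (f (ivi U ph x)) i) (ph p) = pd j (%x. ps (f (ivi B ph x)) i) (ph p)" if "j < n" "i < m" for i j
  proof (rule partial_deriv_eqI)
   have BS: "B Int S = B" using cB(3) by blast
   have C: "Cinf n (ph ` B) (%x. ps (f (ivi B ph x)) i)" using fsm_chart[OF F cB(1),of i] unfolding BS .
   have "ps (f (ivi B ph x)) i = ps (f (ivi U ph x)) i" if "x : ph ` B" for x
   proof -
    obtain q where "q : B" "x = ph q" using \<open>x : ph ` B\<close> by blast
    thus ?thesis using ch_inv[OF M cB(1)] ch_inv[OF M c] by (simp add: B_def)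
   qed
   thus "((%t. ps (f (ivi U ph ((ph p)(j := t)))) i) has_field_derivative
    pd j (%x. ps (f (ivi B ph x)) i) (ph p)) (at (ph p j))" using Cinf_deriv[OF C that(1),of "ph p"] cB(2)
     deriv_upd_cong[OF o _ that(1),of "ph p" "%x. ps (f (ivi B ph x)) i" "%x. ps (f (ivi U ph x)) i"] by blast
  qed
  thus "EX v. ALL i<m. (\<Sum>j<n. pd j (%x. ps (f (ivi U ph x)) i) (ph p) * v j) = w i" using v by (intro exI[of _ v]) simp
 qed
qed

section \<open>Equalizers and fibre products\<close>

text \<open>The section s makes the Jacobian of the equations F onto at p, so F can be completed to
  a chart, in which Z is a coordinate subspace.\<close>

lemma embedded_zero:
 assumes M: "manifold M" and ZM: "Z <= pts M"
  and loc: "!!p. p : Z ==> EX S m F W s. opn M S & p : S & (ALL i<m. fsm M S (%q. F q i)) &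
   Z Int S = {q : S. ALL i<m. F q i = 0} & opR m W & (%_. 0) : W &
   sm_on (eucl m) W M s & s (%_. 0) = p & (ALL z:W. s z : S & (ALL i<m. F (s z) i = z i))" shows "embedded M Z"
 unfolding embedded_def
proof (intro conjI ZM ballI)
 fix p assume "p : Z"
 from loc[OF this] obtain S m F W s where a: "opn M S" "p : S" "ALL i<m. fsm M S (%q. F q i)"
  "Z Int S = {q : S. ALL i<m. F q i = 0}" "opR m W" "(%_. 0) : W"
  "sm_on (eucl m) W M s" "s (%_. 0) = p" "ALL z:W. s z : S & (ALL i<m. F (s z) i = z i)" by (elim exE conjE) (rule that)
 have F: "fsm M S (%q. F q i)" if "i < m" for i using a(3) that by blast
 have J: "jac_onto M S F m p" by (rule jac_onto_section[OF M F a(5-8)]) (use a(9) in auto)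
 obtain n U ph where c: "cht M n U ph" "p : U" "U <= S" "m <= n" "!!q i. q : U ==> i < m ==> ph q i = F q i"
  using adapted_chart[OF M a(2,1) F J] by blast
 let ?k = "n - m"
 \<comment> \<open>\<open>adapted_chart\<close> puts the m equations first, while slice charts want
   the vanishing coordinates last. The map r rotates them to the end, and r' is its inverse on
   \<open>Rn n\<close>.\<close>
 define r where "r x = (%i. if i < n - m then x (i + m) else if i < n then x (i - (n - m)) else 0)" for x :: "nat => real"
 define r' where "r' x = (%i. if i < m then x (i + (n - m)) else if i < n then x (i - m) else 0)" for x :: "nat => real"
 have rR: "r x : Rn n" "r' x : Rn n" for x using c(4) by (auto simp: r_def r'_def Rn_iff)
 have rr: "r' (r x) = x" "r (r' x) = x" if "x : Rn n" for x using that c(4) by (auto simp: r_def r'_def Rn_iff fun_eq_iff)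
 define W2 where "W2 = {y : Rn n. r' y : ph ` U}"
 have rc: "continuous_on (Rn n) (%y. r' y i)" for i unfolding r'_def by (cases "i < m"; cases "i < n") (simp_all add: cont_coord)
 have W2: "opR n W2" unfolding W2_def by (rule coords_open[OF otop rR(2) _ ch_range[OF M c(1)]])
   (rule Rn_preim[OF otop rc])
 have ch: "(n,U,%q. r (ph q)) : charts M"
 proof (rule new_chart(1)[OF M c(1) ch_open[OF M c(1)] subset_refl W2,where g="%y. ivi U ph (r' y)"])
  show "r (ph q) : W2 & ivi U ph (r' (r (ph q))) = q" if "q : U" for q
   using that rr(1)[OF chart_Rn[OF M c(1) that]] ch_inv[OF M c(1) that] rR by (simp add: W2_def)
  show "ivi U ph (r' y) : U & r (ph (ivi U ph (r' y))) = y" if "y : W2" for y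
   using that rr(2) by (auto simp: W2_def inv_into_into f_inv_into_f)
  show "fsm M U (%p. r (ph p) i)" for i using chart_fsm[OF M c(1)] fsm_const[OF M ch_open[OF M c(1)]]
   unfolding r_def by (cases "i < n - m"; cases "i < n") simp_all
  show "Cinf n W2 (%y. ph (ivi U ph (r' y)) i)" for i
  proof (rule Cinf_cong[OF W2])
   show "r' y i = ph (ivi U ph (r' y)) i" if "y : W2" for y using that by (simp add: W2_def f_inv_into_f)
   show "Cinf n W2 (%y. r' y i)"
    unfolding r'_def using Cinf_coord[OF W2] Cinf_const[OF W2] by (cases "i < m"; cases "i < n") simp_all
  qed
 qed
 have key: "q : Z <-> (ALL i>=?k. r (ph q) i = 0)" if q: "q : U" for q
 proof -
  have "q : Z <-> (ALL i<m. F q i = 0)" using a(4) c(3) q by blast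
  also have "... <-> (ALL i<m. ph q i = 0)" using c(5)[OF q] by simp
  also have "... <-> (ALL i>=?k. r (ph q) i = 0)"
  proof
   assume l: "ALL i<m. ph q i = 0"
   show "ALL i>=?k. r (ph q) i = 0" using l c(4) by (auto simp: r_def)
  next
   assume l: "ALL i>=?k. r (ph q) i = 0"
   show "ALL i<m. ph q i = 0"
   proof (intro allI impI)
    fix i assume "i < m"
    obtain d where d: "n = m + d" using c(4) le_Suc_ex by blast
    show "ph q i = 0" using l[rule_format,of "i + d"] \<open>i < m\<close> by (simp add: r_def d)
   qed
  qed
  finally show ?thesis .
 qed
 have "(%q. r (ph q)) ` (Z Int U) = {x : (%q. r (ph q)) ` U. ALL i>=?k. x i = 0}" using key by blast
 thus "EX n U ph k. cht M n U ph & p : U & k <= n & flat_in ph U Z k"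
  using ch c(2) by (intro exI[of _ n] exI[of _ U] exI[of _ "%q. r (ph q)"] exI[of _ ?k]) simp
qed

text \<open>A chart of N turns H q = K q into the vanishing of differences of coordinates. Along s
  the map K is constant, so these differences are a translate of the coordinates of H, and s
  supplies the section that \<open>embedded_zero\<close> asks for.\<close>

lemma embedded_equalizer:
 assumes M: "manifold M" and N: "manifold N" and ZM: "Z <= pts M"
  and loc: "!!p. p : Z ==> EX S H K W s. opn M S & p : S & sm_on M S N H & sm_on M S N K &
   Z Int S = {q : S. H q = K q} & opn N W & H p : W & sm_on N W M s & s (H p) = p &
   (ALL y:W. s y : S & H (s y) = y & K (s y) = K p)" shows "embedded M Z"
proof (rule embedded_zero[OF M ZM])
 fix p assume p: "p : Z"
 from loc[OF this] obtain S H K W s where a: "opn M S" "p : S" and H: "sm_on M S N H" and K: "sm_on M S N K"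
  and Z: "Z Int S = {q : S. H q = K q}" and W: "opn N W" "H p : W" and s: "sm_on N W M s" "s (H p) = p"
  and sy: "ALL y:W. s y : S & H (s y) = y & K (s y) = K p" by (elim exE conjE) (rule that)
 have HK: "H p = K p" using p a Z by blast
 obtain m V ps where d: "cht N m V ps" "H p : V" by (rule chart_at[OF N sm_pts[OF N H a(2)]])
 define S' where "S' = {q : S. H q : V} Int {q : S. K q : V}"
 have S': "opn M S'" unfolding S'_def using sm_preim[OF M N H ch_open[OF N d(1)]] sm_preim[OF M N K ch_open[OF N d(1)]] by blast
 define F where "F q i = ps (H q) i - ps (K q) i" for q i
 have F: "fsm M S' (%q. F q i)" for i unfolding F_def by (rule fsm_diff[OF M])
   (rule fsm_subset[OF M fsm_pullback[OF M N H chart_fsm[OF N d(1)]] S'],simp add: S'_def,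
    rule fsm_subset[OF M fsm_pullback[OF M N K chart_fsm[OF N d(1)]] S'],simp add: S'_def)
 have ZS: "Z Int S' = {q : S'. ALL i<m. F q i = 0}"
 proof (intro Set.set_eqI iffI)
  fix q assume "q : Z Int S'"
  hence "H q = K q" "q : S'" using Z by (auto simp: S'_def)
  thus "q : {q : S'. ALL i<m. F q i = 0}" by (simp add: F_def)
 next
  fix q assume q: "q : {q : S'. ALL i<m. F q i = 0}"
  hence V: "H q : V" "K q : V" "q : S" by (auto simp: S'_def)
  have "ps (H q) i = ps (K q) i" for i
   using q chart_Rn[OF N d(1) V(1)] chart_Rn[OF N d(1) V(2)] by (cases "i < m") (auto simp: F_def Rn_iff)
  hence "ps (H q) = ps (K q)" by blast
  hence "H q = K q" using ch_inv[OF N d(1) V(1)] ch_inv[OF N d(1) V(2)] by metis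
  thus "q : Z Int S'" using Z q V by blast
 qed
 \<comment> \<open>The common chart value of H and K at p. Translating by b makes the equations take
   the value z at the point of the section over z + b, so that p lies over 0.\<close>
 define b where "b = ps (H p)"
 have bR: "b : Rn m" unfolding b_def by (rule chart_Rn[OF N d])
 define tr where "tr z = (%i. z i + b i)" for z
 define W0 where "W0 = {z : Rn m. tr z : ps ` (V Int W)}"
 have trR: "tr z : Rn m" if "z : Rn m" for z using that bR by (auto simp: tr_def Rn_iff)
 have W0: "opR m W0" unfolding W0_def
 proof (rule coords_open[OF otop trR _ chart_io[OF N d(1) W(1)]])
  show "opR m {p : Rn m. tr p i : T}" if "open T" for i T
   unfolding tr_def by (rule Rn_preim[OF otop _ that]) (intro continuous_on_add cont_coord continuous_on_const)
 qed
 have inv: "ivi V ps (tr z) : V Int W & ps (ivi V ps (tr z)) = tr z" if z: "z : W0" for z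
 proof -
  obtain y where "y : V Int W" "tr z = ps y" using z unfolding W0_def by blast
  thus ?thesis using ch_inv[OF N d(1)] by auto
 qed
 have tr_s: "sm_on (eucl m) W0 (eucl m) tr" unfolding sm_euclid[OF mfE] eucls fsm_euclid
  using W0 trR Cinf_add[OF W0 Cinf_coord[OF W0] Cinf_const[OF W0]] by (auto simp: tr_def W0_def)
 have ss: "sm_on (eucl m) W0 M (%z. s (ivi V ps (tr z)))"
 proof (rule sm_o[OF mfE N _ s(1)])
  show "sm_on (eucl m) W0 N (%z. ivi V ps (tr z))" by (rule sm_o[OF mfE mfE tr_s chart_inv_smooth[OF N d(1)]])
    (auto simp: W0_def)
 qed (use inv in blast)
 have tr0: "tr (%_. 0) = b" by (simp add: tr_def)
 have ibp: "ivi V ps b = H p" unfolding b_def by (rule ch_inv[OF N d])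
 show "EX S m F W s. opn M S & p : S & (ALL i<m. fsm M S (%q. F q i)) &
   Z Int S = {q : S. ALL i<m. F q i = 0} & opR m W & (%_. 0) : W &
   sm_on (eucl m) W M s & s (%_. 0) = p & (ALL z:W. s z : S & (ALL i<m. F (s z) i = z i))"
 proof (intro exI conjI ballI allI impI)
  show "opn M S'" "fsm M S' (%q. F q i)" "Z Int S' = {q : S'. ALL i<m. F q i = 0}"
   "opR m W0" "sm_on (eucl m) W0 M (%z. s (ivi V ps (tr z)))" for i by (fact S' F ZS W0 ss)+
  show "p : S'" using a d HK by (simp add: S'_def)
  show "(%_. 0) : W0" using d W tr0 by (auto simp: W0_def b_def Rn_iff)
  show "s (ivi V ps (tr (%_. 0))) = p" by (simp add: tr0 ibp s)
  fix z assume z: "z : W0"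
  show "s (ivi V ps (tr z)) : S'" using inv[OF z] sy HK d(2) by (simp add: S'_def)
  show "F (s (ivi V ps (tr z))) i = z i" for i using inv[OF z] sy HK by (simp add: F_def tr_def b_def)
 qed
qed

context
 fixes M :: "'a mfd" and N :: "'b mfd" and B :: "'c mfd" and f h
 assumes M: "manifold M" and N: "manifold N" and B: "manifold B" and f: "smooth M B f" and h: "submersion N B h"
begin

text \<open>The section through (p, q) keeps p fixed and moves q along a section of h; so f of the
  first component is constant along it, as \<open>embedded_equalizer\<close> requires.\<close>

lemma fibre_prod_embedded: "embedded (prod_mfd M N) (fibre_prod_set M f N h)"
proof (rule embedded_equalizer[OF mf_prod[OF M N] B])
 show "fibre_prod_set M f N h <= pts (prod_mfd M N)" by (auto simp: fibre_prod_set_def pts_prod[OF M N])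
 have hs: "smooth N B h" and sec: "sections N B h" using h submersion_iff[OF N B] by auto
 have H: "sm_on (prod_mfd M N) (pts M \<times> pts N) B (%z. h (snd z))"
  by (rule sm_o[OF mf_prod[OF M N] N smooth_snd[OF M N] hs]) auto
 have K: "sm_on (prod_mfd M N) (pts M \<times> pts N) B (%z. f (fst z))"
  by (rule sm_o[OF mf_prod[OF M N] M smooth_fst[OF M N] f]) auto
 fix z assume "z : fibre_prod_set M f N h"
 then obtain p q where z: "z = (p,q)" "p <: M" "q <: N" "f p = h q" by (auto simp: fibre_prod_set_def)
 from sec z(3) obtain W s where W: "opn B W" "h q : W" "sm_on B W N s" "s (h q) = q" "!!y. y : W ==> h (s y) = y"
  by (rule sectionsE) blast
 show "EX S H K W s. opn (prod_mfd M N) S & z : S & sm_on (prod_mfd M N) S B H & sm_on (prod_mfd M N) S B K &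
   fibre_prod_set M f N h Int S = {q : S. H q = K q} & opn B W & H z : W & sm_on B W (prod_mfd M N) s & s (H z) = z &
   (ALL y:W. s y : S & H (s y) = y & K (s y) = K z)"
 proof (intro exI conjI ballI)
  show "sm_on (prod_mfd M N) (pts M \<times> pts N) B (%z. h (snd z))"
   "sm_on (prod_mfd M N) (pts M \<times> pts N) B (%z. f (fst z))" by (fact H K)+
  show "opn (prod_mfd M N) (pts M \<times> pts N)" by (rule sm_open[OF H])
  show "fibre_prod_set M f N h Int (pts M \<times> pts N) = {z : pts M \<times> pts N. h (snd z) = f (fst z)}"
   by (auto simp: fibre_prod_set_def)
  show "sm_on B W (prod_mfd M N) (%y. (p,s y))" by (rule smooth_pair[OF M N B smooth_on_const[OF B M W(1) z(2)] W(3)])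
  show "opn B W" by (fact W)
 qed (use z W sm_pts[OF N W(3)] in auto)
qed

lemma mf_fibre: "manifold (fibre_prod M f N h)" unfolding fibre_prod_def by (rule mf_sub[OF mf_prod[OF M N] fibre_prod_embedded])

lemma fib_pts: "pts (fibre_prod M f N h) = {(p,q). p <: M & q <: N & f p = h q}" unfolding fibre_prod_def
 by (subst pts_sub[OF mf_prod[OF M N]]) (auto simp: fibre_prod_set_def pts_prod[OF M N])

lemma fib_fst: "smooth (fibre_prod M f N h) M fst" and fib_snd: "smooth (fibre_prod M f N h) N snd"
proof -
 have e: "pts (fibre_prod M f N h) = fibre_prod_set M f N h" by (simp add: fib_pts fibre_prod_set_def)
 have i: "sm_on (fibre_prod M f N h) (fibre_prod_set M f N h) (prod_mfd M N) (%p. p)"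
  unfolding fibre_prod_def by (rule smooth_incl[OF mf_prod[OF M N] fibre_prod_embedded])
 show "smooth (fibre_prod M f N h) M fst" unfolding e by (rule sm_o[OF mf_fibre mf_prod[OF M N] i smooth_fst[OF M N]])
   (auto simp: fibre_prod_set_def)
 show "smooth (fibre_prod M f N h) N snd" unfolding e by (rule sm_o[OF mf_fibre mf_prod[OF M N] i smooth_snd[OF M N]])
   (auto simp: fibre_prod_set_def)
qed

lemma fib_pair:
 assumes P: "manifold P" and a: "sm_on P S M a" and b: "sm_on P S N b" and eq: "!!p. p : S ==> f (a p) = h (b p)"
 shows "sm_on P S (fibre_prod M f N h) (%p. (a p,b p))" unfolding fibre_prod_def
 by (rule smooth_into_sub[OF mf_prod[OF M N] fibre_prod_embedded P smooth_pair[OF M N P a b]])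
  (use sm_pts[OF M a] sm_pts[OF N b] eq in "auto simp: fibre_prod_set_def")

end

section \<open>Smooth families of linear maps\<close>

definition lin :: "nat => nat => ((nat => real) => nat => real) => bool" where
 "lin k m f <-> (ALL x:Rn k. f x : Rn m) &
   (ALL x:Rn k. ALL y:Rn k. f (%i. x i + y i) = (%i. f x i + f y i)) &
   (ALL c. ALL x:Rn k. f (%i. c * x i) = (%i. c * f x i))"

definition ei :: "nat => nat => real" where
 "ei j = (%i. if i = j then 1 else 0)"

lemma ei_Rn: "j < k ==> ei j : Rn k" by (auto simp: ei_def Rn_iff)

lemma Rn_add: "x : Rn k ==> y : Rn k ==> (%i. x i + y i) : Rn k"
 and Rn_scale: "x : Rn k ==> (%i. c * x i) : Rn k" and Rn_0: "(%i. 0) : Rn k" by (auto simp: Rn_iff)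

lemma lin_Rn: "lin k m f ==> x : Rn k ==> f x : Rn m"
 and lin_add: "lin k m f ==> x : Rn k ==> y : Rn k ==> f (%i. x i + y i) = (%i. f x i + f y i)"
 and lin_scale: "lin k m f ==> x : Rn k ==> f (%i. c * x i) = (%i. c * f x i)" by (auto simp: lin_def)

lemma lin_0: "lin k m f ==> f (%i. 0) = (%i. 0)" using lin_scale[of k m f "%i. 0" 0] by (simp add: Rn_0)

lemma lin_diff:
 assumes "lin k m f" "x : Rn k" "y : Rn k" shows "f (%i. x i - y i) = (%i. f x i - f y i)"
 using lin_add[OF assms(1,2) Rn_scale[OF assms(3),of "-1"]] lin_scale[OF assms(1,3),of "-1"] by simp

lemma lin_compose: "lin k m f ==> lin m l g ==> lin k l (%x. g (f x))" by (auto simp: lin_def)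

lemma lin_expand:
 assumes f: "lin k m f" and x: "x : Rn k" shows "f x i = (\<Sum>j<k. f (ei j) i * x j)"
proof -
 have "n <= k ==> f (tk n x) i = (\<Sum>j<n. f (ei j) i * x j)" for n
 proof (induction n)
  case 0
  have "tk 0 x = (%i. 0)" by (simp add: tk_def)
  thus ?case using lin_0[OF f] by simp
 next
  case (Suc n)
  have a: "tk n x : Rn k" using Suc.prems by (auto simp: tk_def Rn_iff)
  have b: "ei n : Rn k" using Suc.prems by (intro ei_Rn) simp
  have "tk (Suc n) x = (%i. tk n x i + x n * ei n i)" by (auto simp: tk_def ei_def fun_eq_iff less_Suc_eq)
  hence "f (tk (Suc n) x) = (%i. f (tk n x) i + x n * f (ei n) i)"
   using lin_add[OF f a Rn_scale[OF b,of "x n"]] lin_scale[OF f b,of "x n"] by simp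
  thus ?case using Suc by simp
 qed
 from this[of k] show ?thesis using tk_id[OF x] by simp
qed

lemma lin_cong_basis:
 assumes "lin k m f" "lin k m g" "!!j. j < k ==> f (ei j) = g (ei j)" "x : Rn k" shows "f x = g x"
 using lin_expand[OF assms(1,4)] lin_expand[OF assms(2,4)] assms(3) by (auto simp: fun_eq_iff)

text \<open>A subspace S of R^k is identified with some R^r by linear maps of which A is defined on
  all of R^k. Induction on k: either S lies in R^(k-1), or it contains a vector b with last
  coordinate 1, and subtracting multiples of b projects S to its part in R^(k-1).\<close>

lemma subspace_coords:
 assumes "S <= Rn k" "(%i. 0) : S" "!!x y. x : S ==> y : S ==> (%i. x i + y i) : S" "!!c x. x : S ==> (%i. c * x i) : S"
 shows "EX r A B. lin k r A & lin r k B & (ALL y:Rn r. B y : S & A (B y) = y) & (ALL x:S. B (A x) = x)" using assms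
proof (induction k arbitrary: S)
 case 0
 have z: "x = (%i. 0)" if "x : Rn 0" for x using that by (auto simp: Rn_iff)
 show ?case using "0.prems" by (intro exI[of _ 0] exI[of _ "%x i. 0"]) (auto simp: lin_def Rn_0 dest: z)
next
 case (Suc k)
 have tkl: "lin (Suc k) k (tk k)" by (auto simp: lin_def tk_Rn) (auto simp: tk_def)
 define S' where "S' = {x : S. x k = 0}"
 have S'R: "S' <= Rn k"
 proof
  fix x assume "x : S'"
  hence "x : Rn (Suc k)" "x k = 0" using Suc.prems(1) by (auto simp: S'_def)
  thus "x : Rn k" unfolding Rn_iff by (metis le_antisym not_less_eq_eq)
 qed
 have "EX r A B. lin k r A & lin r k B & (ALL y:Rn r. B y : S' & A (B y) = y) & (ALL x:S'. B (A x) = x)"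
  by (rule Suc.IH[OF S'R]) (use Suc.prems(2-4) in "auto simp: S'_def")
 then obtain r A B where A: "lin k r A" and B: "lin r k B" and BA: "!!y. y : Rn r ==> B y : S'" "!!y. y : Rn r ==> A (B y) = y"
  and AB: "!!x. x : S' ==> B (A x) = x" by blast
 have kS: "x : Rn (Suc k)" if "x : Rn k" for x using that by (auto simp: Rn_iff)
 show ?case
 proof (cases "EX b:S. b k ~= 0")
  case False
  hence eq: "S = S'" by (auto simp: S'_def)
  have "lin r (Suc k) B" using B kS by (auto simp: lin_def)
  moreover have "lin (Suc k) r (%x. A (tk k x))" by (rule lin_compose[OF tkl A])
  moreover have "A (tk k (B y)) = y" if "y : Rn r" for y using BA[OF that] S'R tk_id by (metis subsetD)
  moreover have "B (A (tk k x)) = x" if "x : S'" for x using AB[OF that] S'R that tk_id by (metis subsetD)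
  ultimately show ?thesis using BA unfolding eq by (intro exI[of _ r] exI[of _ "%x. A (tk k x)"] exI[of _ B]) auto
 next
  case True
  then obtain b0 where b0: "b0 : S" "b0 k ~= 0" by blast
  define b where "b = (%i. inverse (b0 k) * b0 i)"
  have b: "b : S" "b k = 1" using Suc.prems(4)[OF b0(1)] b0(2) by (auto simp: b_def)
  have bR: "b : Rn (Suc k)" using b Suc.prems(1) by blast
  define pr where "pr x = (%i. x i - x k * b i)" for x
  have prS: "pr x : S'" if "x : S" for x
   using Suc.prems(3)[OF that Suc.prems(4)[OF b(1),of "- x k"]] b(2) by (simp add: pr_def S'_def)
  have prR: "pr x : Rn k" if "x : Rn (Suc k)" for x unfolding Rn_iff
  proof (intro allI impI)
   fix i assume "k <= i"
   thus "pr x i = 0" using that bR b(2) by (cases "i = k") (auto simp: pr_def Rn_iff)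
  qed
  have prl: "lin (Suc k) k pr" using prR by (auto simp: lin_def pr_def fun_eq_iff algebra_simps)
  \<comment> \<open>The new coordinate, at position r, records the coefficient of b.\<close>
  define A' where "A' x = (A (pr x))(r := x k)" for x
  define B' where "B' y = (%i. B (tk r y) i + y r * b i)" for y
  have Apr: "lin (Suc k) r (%x. A (pr x))" by (rule lin_compose[OF prl A])
  have A': "lin (Suc k) (Suc r) A'" unfolding lin_def
  proof (intro conjI ballI allI)
   show "A' x : Rn (Suc r)" if "x : Rn (Suc k)" for x using lin_Rn[OF Apr that] by (auto simp: A'_def Rn_iff)
   show "A' (%i. x i + y i) = (%i. A' x i + A' y i)" if "x : Rn (Suc k)" "y : Rn (Suc k)" for x y
    using lin_add[OF Apr that] by (simp add: A'_def fun_eq_iff)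
   show "A' (%i. c * x i) = (%i. c * A' x i)" if "x : Rn (Suc k)" for c x
    using lin_scale[OF Apr that] by (simp add: A'_def fun_eq_iff)
  qed
  have tkr: "lin (Suc r) r (tk r)" by (auto simp: lin_def tk_Rn) (auto simp: tk_def)
  have Btk: "lin (Suc r) k (%y. B (tk r y))" by (rule lin_compose[OF tkr B])
  have B': "lin (Suc r) (Suc k) B'" unfolding lin_def
  proof (intro conjI ballI allI)
   show "B' x : Rn (Suc k)" if "x : Rn (Suc r)" for x using lin_Rn[OF Btk that] bR by (auto simp: B'_def Rn_iff)
   show "B' (%i. x i + y i) = (%i. B' x i + B' y i)" if "x : Rn (Suc r)" "y : Rn (Suc r)" for x y
    using lin_add[OF Btk that] by (simp add: B'_def fun_eq_iff algebra_simps)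
   show "B' (%i. c * x i) = (%i. c * B' x i)" if "x : Rn (Suc r)" for c x
    using lin_scale[OF Btk that] by (simp add: B'_def fun_eq_iff algebra_simps)
  qed
  have "B' y : S & A' (B' y) = y" if y: "y : Rn (Suc r)" for y
  proof
   have t: "tk r y : Rn r" by (rule tk_Rn)
   have BS: "B (tk r y) : S" "B (tk r y) k = 0" using BA(1)[OF t] by (auto simp: S'_def)
   show "B' y : S" unfolding B'_def by (rule Suc.prems(3)[OF BS(1) Suc.prems(4)[OF b(1)]])
   have "B' y k = y r" using BS b by (simp add: B'_def)
   hence "pr (B' y) = B (tk r y)" by (simp add: pr_def) (simp add: B'_def)
   hence "A' (B' y) = (tk r y)(r := y r)" using BA(2)[OF t] \<open>B' y k = y r\<close> by (simp add: A'_def)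
   also have "... = y" using y by (auto simp: tk_def fun_eq_iff Rn_iff not_less_iff_gr_or_eq)
   finally show "A' (B' y) = y" .
  qed
  moreover have "B' (A' x) = x" if x: "x : S" for x
  proof -
   have "A (pr x) : Rn r" using lin_Rn[OF Apr] x Suc.prems(1) by blast
   hence "tk r (A' x) = A (pr x)" by (auto simp: A'_def tk_def fun_eq_iff Rn_iff)
   thus ?thesis using AB[OF prS[OF x]] by (simp add: B'_def A'_def pr_def)
  qed
  ultimately show ?thesis using A' B' by blast
 qed
qed

text \<open>Smoothness is asked of the matrix entries; by \<open>lin_expand\<close> this gives
  smooth values on all smoothly varying arguments (\<open>linfam_apply\<close>).\<close>

definition linfam :: "'a mfd => 'a set => nat => nat => ('a => (nat => real) => nat => real) => bool" where
 "linfam M U k m L <-> opn M U & (ALL p:U. lin k m (L p)) & (ALL j<k. ALL i. fsm M U (%p. L p (ei j) i))"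

lemma lfam_lin: "linfam M U k m L ==> p : U ==> lin k m (L p)" and linfam_open: "linfam M U k m L ==> opn M U"
 and linfam_fsm: "linfam M U k m L ==> j < k ==> fsm M U (%p. L p (ei j) i)" by (auto simp: linfam_def)

lemma linfam_apply:
 assumes P: "manifold P" and M: "manifold M" and L: "linfam M U k m L" and a: "sm_on P S M a" "!!q. q : S ==> a q : U"
  and x: "!!q. q : S ==> x q : Rn k" "!!j. j < k ==> fsm P S (%q. x q j)" shows "fsm P S (%q. L (a q) (x q) i)"
proof -
 have "fsm P S (%q. \<Sum>j<k. L (a q) (ei j) i * x q j)"
 proof (rule fsm_sum[OF P sm_open[OF a(1)]])
  fix j assume "j : {..<k}"
  hence j: "j < k" by simp
  show "fsm P S (%q. L (a q) (ei j) i * x q j)" by (rule fsm_mult[OF P fsm_comp[OF P M a(1) linfam_fsm[OF L j] a(2)] x(2)[OF j]])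
 qed
 thus ?thesis by (rule fsm_cong[OF P]) (use lin_expand[OF lfam_lin[OF L a(2)] x(1)] in simp)
qed

lemma linfam_compose:
 assumes M: "manifold M" and L: "linfam M U k m L" and K: "linfam M U m l K" shows "linfam M U k l (%p x. K p (L p x))"
 unfolding linfam_def
proof (intro conjI ballI allI impI)
 show "opn M U" by (rule linfam_open[OF L])
 show "lin k l (%x. K p (L p x))" if "p : U" for p by (rule lin_compose[OF lfam_lin[OF L that] lfam_lin[OF K that]])
 show "fsm M U (%p. K p (L p (ei j)) i)" if "j < k" for i j by (rule linfam_apply[OF M M K sm_id[OF M linfam_open[OF L]]])
   (use lin_Rn[OF lfam_lin[OF L] ei_Rn[OF that]] linfam_fsm[OF L that] in auto)
qed

lemma linfam_subset:
 assumes M: "manifold M" and L: "linfam M U k m L" and V: "opn M V" "V <= U" shows "linfam M V k m L"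
 using assms unfolding linfam_def by (blast intro: fsm_subset[OF M _ V])

lemma linfam_const:
 assumes M: "manifold M" and U: "opn M U" and L: "lin k m L" shows "linfam M U k m (%p. L)"
 using U L fsm_const[OF M U] by (simp add: linfam_def)

lemma linfam_add:
 assumes M: "manifold M" and L: "linfam M U k m L" and K: "linfam M U k m K" shows "linfam M U k m (%p x i. L p x i + K p x i)"
 unfolding linfam_def
proof (intro conjI ballI allI impI)
 show "opn M U" by (rule linfam_open[OF L])
 show "lin k m (%x i. L p x i + K p x i)" if "p : U" for p using lfam_lin[OF L that] lfam_lin[OF K that] unfolding lin_def
  by (auto intro: Rn_add simp: algebra_simps fun_eq_iff)
 show "fsm M U (%p. L p (ei j) i + K p (ei j) i)" if "j < k" for i j
  by (rule fsm_add[OF M linfam_fsm[OF L that] linfam_fsm[OF K that]])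
qed

lemma linfam_uminus:
 assumes M: "manifold M" and L: "linfam M U k m L" shows "linfam M U k m (%p x i. - L p x i)" unfolding linfam_def
proof (intro conjI ballI allI impI)
 show "opn M U" by (rule linfam_open[OF L])
 show "lin k m (%x i. - L p x i)" if "p : U" for p
  using lfam_lin[OF L that] unfolding lin_def by (auto simp: Rn_iff algebra_simps fun_eq_iff)
 show "fsm M U (%p. - L p (ei j) i)" if "j < k" for i j
  using fsm_diff[OF M fsm_const[OF M linfam_open[OF L],of 0] linfam_fsm[OF L that]] by simp
qed

lemma lin_id: "lin k k (%x. x)" by (auto simp: lin_def)

lemma fsm_inverse:
 assumes M: "manifold M" and f: "fsm M S f" and nz: "!!p. p : S ==> f p ~= 0" shows "fsm M S (%p. inverse (f p))"
 unfolding fsm_def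
proof (intro conjI fsm_open[OF f] ballI,clarify)
 fix n U ph assume c: "cht M n U ph"
 show "Cinf n (ph ` (U Int S)) (%x. inverse (f (ivi U ph x)))"
  by (rule Cinf_inverse[OF chart_io[OF M c fsm_open[OF f]] _ fsm_chart[OF f c]]) (use nz ch_inv[OF M c] in auto)
qed

text \<open>Gauss-Jordan elimination, column by column, near a point where the family is the identity.\<close>

lemma linfam_inverse:
 assumes M: "manifold M" and L: "linfam M U k k L" and p0: "p0 : U" and id: "!!x. x : Rn k ==> L p0 x = x"
 obtains V R where "opn M V" "p0 : V" "V <= U" "linfam M V k k R"
  "!!p x. p : V ==> x : Rn k ==> L p (R p x) = x" "!!p x. p : V ==> x : Rn k ==> R p (L p x) = x"
proof -
 have "m <= k ==> EX V R. V <= U & p0 : V & linfam M V k k R & (ALL x:Rn k. R p0 x = x) &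
   (ALL p:V. inj_on (R p) (Rn k)) & (ALL p:V. ALL j<m. R p (L p (ei j)) = ei j)" for m
 proof (induction m)
  case 0
  show ?case using p0 linfam_const[OF M linfam_open[OF L] lin_id] by (intro exI[of _ U] exI[of _ "%p x. x"]) auto
 next
  case (Suc m)
  then obtain V R where V: "V <= U" "p0 : V" and R: "linfam M V k k R" and Rid: "!!x. x : Rn k ==> R p0 x = x"
   and inj: "!!p. p : V ==> inj_on (R p) (Rn k)" and RL: "!!p j. p : V ==> j < m ==> R p (L p (ei j)) = ei j" by (metis Suc_leD)
  have mk: "m < k" using Suc.prems by simp
  have N: "linfam M V k k (%p x. R p (L p x))" by (rule linfam_compose[OF M linfam_subset[OF M L linfam_open[OF R] V(1)] R])
  define c where "c p = R p (L p (ei m))" for p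
  have cs: "fsm M V (%p. c p i)" for i unfolding c_def by (rule linfam_fsm[OF N mk])
  have cR: "c p : Rn k" if "p : V" for p unfolding c_def by (rule lin_Rn[OF lfam_lin[OF N that] ei_Rn[OF mk]])
  have c0: "c p0 = ei m" unfolding c_def using Rid id ei_Rn[OF mk] by simp
  define V' where "V' = {p : V. c p m : - {0}}"
  have V': "opn M V'" "V' <= V" "p0 : V'" unfolding V'_def using fsm_open_pre[OF M cs,of "- {0}" m] V(2) c0 by (auto simp: ei_def)
  have nz: "c p m ~= 0" if "p : V'" for p using that by (simp add: V'_def)
  \<comment> \<open>The elementary transformation that sends c p to the m-th basis vector and fixes
    the other basis vectors, so that the columns cleared before stay cleared.\<close>
  define T where "T p x = (%i. x i - (c p i - ei m i) * (x m * inverse (c p m)))" for p x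
  have T: "linfam M V' k k T" unfolding linfam_def
  proof (intro conjI ballI allI impI V'(1))
   show "lin k k (T p)" if "p : V'" for p using cR[of p] that V' mk unfolding lin_def T_def
    by (auto simp: Rn_iff ei_def fun_eq_iff algebra_simps)
   show "fsm M V' (%p. T p (ei j) i)" if "j < k" for i j unfolding T_def
    by (intro fsm_diff[OF M] fsm_mult[OF M] fsm_const[OF M V'(1)] fsm_inverse[OF M] fsm_subset[OF M cs V'(1,2)] nz)
  qed
  have Tm: "T p x m = x m * inverse (c p m)" if "p : V'" for p x using nz[OF that] by (simp add: T_def ei_def field_simps)
  have Tinj: "x = y" if p: "p : V'" and e: "T p x = T p y" for p x y
  proof -
   have "x m = y m" using Tm[OF p,of x] Tm[OF p,of y] e nz[OF p] by simp
   thus ?thesis using e by (simp add: T_def fun_eq_iff)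
  qed
  have R': "linfam M V' k k R" by (rule linfam_subset[OF M R V'(1,2)])
  show ?case
  proof (intro exI[of _ V'] exI[of _ "%p x. T p (R p x)"] conjI ballI allI impI)
   show "V' <= U" "p0 : V'" using V V' by auto
   show "linfam M V' k k (%p x. T p (R p x))" by (rule linfam_compose[OF M R' T])
   show "T p0 (R p0 x) = x" if "x : Rn k" for x using Rid[OF that] c0 by (simp add: T_def)
   show "inj_on (%x. T p (R p x)) (Rn k)" if p: "p : V'" for p
   proof (rule inj_onI)
    fix x y assume x: "x : Rn k" "y : Rn k" "T p (R p x) = T p (R p y)"
    hence "R p x = R p y" using Tinj[OF p] by blast
    thus "x = y" using inj[of p] p V'(2) x by (auto dest: inj_onD)
   qed
   show "T p (R p (L p (ei j))) = ei j" if p: "p : V'" and j: "j < Suc m" for p j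
   proof (cases "j = m")
    case True
    have "T p (c p) = ei m" using nz[OF p] by (auto simp: T_def ei_def fun_eq_iff)
    thus ?thesis using True by (simp add: c_def)
   next
    case False
    hence "R p (L p (ei j)) = ei j" using RL[of p j] p V'(2) j by auto
    thus ?thesis using False by (simp add: T_def ei_def fun_eq_iff)
   qed
  qed
 qed
 from this[of k] obtain V R where V: "V <= U" "p0 : V" and R: "linfam M V k k R"
   and inj: "!!p. p : V ==> inj_on (R p) (Rn k)" and RL: "!!p j. p : V ==> j < k ==> R p (L p (ei j)) = ei j" by blast
 have V1: "opn M V" by (rule linfam_open[OF R])
 have LV: "linfam M V k k L" by (rule linfam_subset[OF M L V1 V(1)])
 have 1: "R p (L p x) = x" if p: "p : V" and x: "x : Rn k" for p x
  by (rule lin_cong_basis[OF lfam_lin[OF linfam_compose[OF M LV R] p] lin_id _ x]) (rule RL[OF p])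
 \<comment> \<open>A left inverse that is injective is also a right inverse. For this reason
   injectivity of R p is carried through the elimination.\<close>
 have 2: "L p (R p x) = x" if p: "p : V" and x: "x : Rn k" for p x
 proof -
  have a: "R p x : Rn k" by (rule lin_Rn[OF lfam_lin[OF R p] x])
  have "R p (L p (R p x)) = R p x" by (rule 1[OF p a])
  thus ?thesis using inj_onD[OF inj[OF p] _ lin_Rn[OF lfam_lin[OF LV p] a] x] by blast
 qed
 show thesis by (rule that[OF V1 V(2,1) R 2 1])
qed

section \<open>Vector bundles\<close>

text \<open>A trivialisation ta together with its inverse th, both living on the total space and the
  base themselves, instead of on open submanifolds as in \<open>local_triv\<close>. The base point
  is a separate argument of th.\<close>

definition triv :: "('e,'b) vbun => 'b set => nat => ('e => nat => real) => ('b => (nat => real) => 'e) => bool" where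
 "triv E U k ta th <-> opn (base E) U &
   sm_on (tot E) {e : pts (tot E). proj E e : U} (eucl k) ta &
   sm_on (prod_mfd (base E) (eucl k)) (U \<times> Rn k) (tot E) (%(p,x). th p x) &
   (ALL p:U. ALL x:Rn k. proj E (th p x) = p & ta (th p x) = x) &
   (ALL e:pts (tot E). proj E e : U --> th (proj E e) (ta e) = e) &
   (ALL e:pts (tot E). ALL e':pts (tot E). proj E e : U --> proj E e = proj E e' -->
    ta (vadd E e e') = (%i. ta e i + ta e' i)) &
   (ALL c. ALL e:pts (tot E). proj E e : U --> ta (vscale E c e) = (%i. c * ta e i))"

lemma trivD:
 assumes "triv E U k ta th" shows "opn (base E) U"
  "sm_on (tot E) {e : pts (tot E). proj E e : U} (eucl k) ta"
  "sm_on (prod_mfd (base E) (eucl k)) (U \<times> Rn k) (tot E) (%(p,x). th p x)"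
  "!!p x. p : U ==> x : Rn k ==> proj E (th p x) = p"
  "!!p x. p : U ==> x : Rn k ==> ta (th p x) = x"
  "!!e. e <: tot E ==> proj E e : U ==> th (proj E e) (ta e) = e"
  "!!e e'. e <: tot E ==> e' <: tot E ==> proj E e : U ==> proj E e = proj E e' ==>
    ta (vadd E e e') = (%i. ta e i + ta e' i)"
  "!!c e. e <: tot E ==> proj E e : U ==> ta (vscale E c e) = (%i. c * ta e i)" using assms unfolding triv_def by blast+

lemma triv_eqI:
 assumes "triv E U k ta th" "e <: tot E" "e' <: tot E" "proj E e : U" "proj E e = proj E e'" "ta e = ta e'" shows "e = e'"
 using trivD(6)[OF assms(1,2)] trivD(6)[OF assms(1,3)] assms(4-6) by metis

lemma prod_open:
 "manifold M ==> manifold N ==> opn M U ==> opn N V ==> opn (prod_mfd M N) (U \<times> V)"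
 by (simp add: prod_mfd_simps openin_prod_Times_iff)

text \<open>The open submanifolds in \<open>local_triv\<close> are removed and put back by composing
  with their inclusions, which are smooth in both directions.\<close>

lemma local_triv_iff:
 assumes T: "manifold (tot E)" and B: "manifold (base E)" and pr: "smooth (tot E) (base E) (proj E)" and U: "opn (base E) U"
 shows "local_triv E U k Ph ==> EX ta th. triv E U k ta th" and "triv E U k ta th ==> local_triv E U k (%e. (proj E e,ta e))"
proof -
 let ?EU = "{e : pts (tot E). proj E e : U}"
 let ?TU = "sub_mfd (tot E) ?EU" and ?BU = "sub_mfd (base E) U" and ?R = "eucl k"
 have EU: "opn (tot E) ?EU" by (rule sm_preim[OF T B pr U])
 have TU: "manifold ?TU" and BU: "manifold ?BU" using mf_sub[OF T embedded_open[OF T EU]] mf_sub[OF B embedded_open[OF B U]] .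
 have pTU: "pts ?TU = ?EU" by (rule pts_sub[OF T]) auto
 have UB: "U <= pts (base E)" by (rule opsub[OF U])
 have pBU: "pts ?BU = U" by (rule pts_sub[OF B UB])
 note R = mfE[of k]
 have pR: "pts ?R = Rn k" by (simp add: eucls)
 have oR: "opn ?R (Rn k)" by (simp add: eucls)
 have PM: "manifold (prod_mfd ?BU ?R)" by (rule mf_prod[OF BU R])
 have PB: "manifold (prod_mfd (base E) ?R)" by (rule mf_prod[OF B R])
 have pPM: "pts (prod_mfd ?BU ?R) = U \<times> Rn k" using pts_prod[OF BU R] pBU pR by simp
 have oUR: "opn (prod_mfd (base E) ?R) (U \<times> Rn k)" by (rule prod_open[OF B R U oR])
 have f: "sm_on (prod_mfd (base E) ?R) (U \<times> Rn k) (base E) fst"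
  by (rule sm_sub[OF PB smooth_fst[OF B R] oUR]) (use UB pR in auto)
 have s: "sm_on (prod_mfd (base E) ?R) (U \<times> Rn k) ?R snd"
  by (rule sm_sub[OF PB smooth_snd[OF B R] oUR]) (use UB pR in auto)
 {
  assume lt: "local_triv E U k Ph"
  hence df: "diffeo ?TU (prod_mfd ?BU ?R) Ph" and fstPh: "!!e. e : ?EU ==> fst (Ph e) = proj E e"
   and ad: "!!e e'. e : ?EU ==> e' : ?EU ==> proj E e = proj E e' ==> snd (Ph (vadd E e e')) = (%i. snd (Ph e) i + snd (Ph e') i)"
   and sc: "!!c e. e : ?EU ==> snd (Ph (vscale E c e)) = (%i. c * snd (Ph e) i)" unfolding local_triv_def Let_def by auto
  from df obtain h where Phs: "sm_on ?TU ?EU (prod_mfd ?BU ?R) Ph" and hs: "sm_on (prod_mfd ?BU ?R) (U \<times> Rn k) ?TU h"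
   and hPh: "!!e. e : ?EU ==> h (Ph e) = e" and Phh: "!!q. q : U \<times> Rn k ==> Ph (h q) = q"
   unfolding diffeo_def smap_iff[OF TU] smap_iff[OF PM] pTU pPM by blast
  have Ph2: "sm_on (tot E) ?EU (prod_mfd ?BU ?R) Ph" by (rule smooth_on_open_sub[OF T EU Phs])
  have a: "sm_on (tot E) ?EU ?R (%e. snd (Ph e))" by (rule sm_o[OF T PM Ph2 smooth_snd[OF BU R]])
    (use sm_pts[OF PM Ph2] pts_prod[OF BU R] in auto)
  have j: "sm_on (prod_mfd (base E) ?R) (U \<times> Rn k) (prod_mfd ?BU ?R) (%q. (fst q,snd q))"
   by (rule smooth_pair[OF BU R PB smooth_into_sub[OF B embedded_open[OF B U] PB f] s]) auto
  have h1: "sm_on (prod_mfd (base E) ?R) (U \<times> Rn k) ?TU (%q. h (fst q,snd q))" by (rule sm_o[OF PB PM j hs]) auto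
  have hEU: "h q : ?EU" if "q : U \<times> Rn k" for q using sm_pts[OF TU hs that] pTU by simp
  have b: "sm_on (prod_mfd (base E) ?R) (U \<times> Rn k) (tot E) (%q. h (fst q,snd q))"
   by (rule sm_o[OF PB TU h1 smooth_incl[OF T embedded_open[OF T EU]]])
    (simp only: prod.collapse,rule hEU)
  have "triv E U k (%e. snd (Ph e)) (%p x. h (p,x))" unfolding triv_def
  proof (intro conjI ballI allI impI U a)
   show "sm_on (prod_mfd (base E) ?R) (U \<times> Rn k) (tot E) (%(p,x). h (p,x))" using b by (simp add: case_prod_beta')
   fix p x assume "p : U" "x : Rn k"
   hence q: "(p,x) : U \<times> Rn k" by simp
   show "proj E (h (p,x)) = p" "snd (Ph (h (p,x))) = x" using fstPh[OF hEU[OF q]] Phh[OF q] by auto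
  next
   fix e assume "e <: tot E" "proj E e : U"
   hence e: "e : ?EU" by simp
   show "h (proj E e,snd (Ph e)) = e" using hPh[OF e] fstPh[OF e] by (metis prod.collapse)
  qed (use ad sc in auto)
  thus "EX ta th. triv E U k ta th" by blast
 }
 {
  assume tr: "triv E U k ta th"
  note D = trivD[OF tr]
  have i: "sm_on ?TU ?EU (tot E) (%e. e)" by (rule smooth_incl[OF T embedded_open[OF T EU]])
  have a: "sm_on ?TU ?EU ?R ta" using sm_o[OF TU T i D(2)] by simp
  have p': "sm_on ?TU ?EU (base E) (proj E)" using sm_o[OF TU T i pr] by simp
  have p: "sm_on ?TU ?EU ?BU (proj E)" by (rule smooth_into_sub[OF B embedded_open[OF B U] TU p']) auto
  have Phs: "sm_on ?TU ?EU (prod_mfd ?BU ?R) (%e. (proj E e,ta e))" by (rule smooth_pair[OF BU R TU p a])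
  have oP: "U \<times> Rn k = pts ?BU \<times> pts ?R" using pBU pR by simp
  have f1: "sm_on (prod_mfd ?BU ?R) (U \<times> Rn k) ?BU fst" and s1: "sm_on (prod_mfd ?BU ?R) (U \<times> Rn k) ?R snd"
   unfolding oP by (rule smooth_fst[OF BU R],rule smooth_snd[OF BU R])
  have f2: "sm_on (prod_mfd ?BU ?R) (U \<times> Rn k) (base E) fst"
   by (rule sm_o[OF PM BU f1 smooth_incl[OF B embedded_open[OF B U]]]) auto
  have j: "sm_on (prod_mfd ?BU ?R) (U \<times> Rn k) (prod_mfd (base E) ?R) (%q. (fst q,snd q))"
   by (rule smooth_pair[OF B R PM f2 s1])
  have h1: "sm_on (prod_mfd ?BU ?R) (U \<times> Rn k) (tot E) (%q. case (fst q,snd q) of (p,x) => th p x)"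
   by (rule sm_o[OF PM PB j D(3)]) auto
  have tp: "th p x <: tot E" if "p : U" "x : Rn k" for p x using sm_pts[OF T D(3),of "(p,x)"] that by simp
  have hs: "sm_on (prod_mfd ?BU ?R) (U \<times> Rn k) ?TU (%q. case (fst q,snd q) of (p,x) => th p x)"
   by (rule smooth_into_sub[OF T embedded_open[OF T EU] PM h1]) (use D(4) tp in auto)
  have taR: "ta e : Rn k" if "e : ?EU" for e using sm_pts[OF R D(2) that] pR by simp
  have "diffeo ?TU (prod_mfd ?BU ?R) (%e. (proj E e,ta e))" unfolding diffeo_def smap_iff[OF TU] smap_iff[OF PM] pTU pPM
   using Phs hs D(4-6) by (intro conjI exI[of _ "%q. case (fst q,snd q) of (p,x) => th p x"]) auto
  thus "local_triv E U k (%e. (proj E e,ta e))" unfolding local_triv_def Let_def using D(7,8) by auto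
 }
qed

text \<open>The vector space axioms of a fibre are those of R^k, carried over by a trivialisation
  that is injective on the fibre; what remains to be given is closure under the operations.\<close>

lemma vector_bundleI:
 assumes T: "manifold (tot E)" and B: "manifold (base E)" and pr: "smooth (tot E) (base E) (proj E)"
  and ad: "!!e e'. e <: tot E ==> e' <: tot E ==> proj E e = proj E e' ==> vadd E e e' <: tot E & proj E (vadd E e e') = proj E e"
  and sc: "!!c e. e <: tot E ==> vscale E c e <: tot E & proj E (vscale E c e) = proj E e"
  and tr: "!!p. p <: base E ==> EX U k ta th. p : U & triv E U k ta th" shows "vector_bundle E"
 unfolding vector_bundle_def smap_iff[OF T]
proof (intro conjI ballI T B pr)
 fix p assume "p <: base E"
 from tr[OF this] obtain U k ta th where p: "p : U" and t: "triv E U k ta th" by blast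
 note D = trivD[OF t]
 show "EX U k Ph. opn (base E) U & p : U & local_triv E U k Ph" using p D(1) local_triv_iff(2)[OF T B pr D(1) t] by blast
 let ?S = "{e : pts (tot E). proj E e = p}"
 have eqI: "e = e'" if "e : ?S" "e' : ?S" "ta e = ta e'" for e e' using triv_eqI[OF t,of e e'] that p by auto
 have adS: "vadd E e e' : ?S" "ta (vadd E e e') = (%i. ta e i + ta e' i)" if "e : ?S" "e' : ?S" for e e'
  using ad[of e e'] D(7)[of e e'] that p by auto
 have scS: "vscale E c e : ?S" "ta (vscale E c e) = (%i. c * ta e i)" if "e : ?S" for c e
  using sc[of e c] D(8)[of e c] that p by auto
 have thS: "th p x : ?S" "ta (th p x) = x" if "x : Rn k" for x using sm_pts[OF T D(3),of "(p,x)"] D(4,5) that p by auto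
 have taR: "ta e : Rn k" if "e : ?S" for e using sm_pts[OF mfE D(2),of e] that p by (simp add: eucls)
 have z: "th p (%_. 0) : ?S" "ta (th p (%_. 0)) = (%_. 0)" using thS[OF Rn_0] by auto
 show "real_vector_space_on ?S (vadd E) (vscale E)" unfolding real_vector_space_on_def
 proof (intro conjI ballI allI)
  show "vadd E x y = vadd E y x" if "x : ?S" "y : ?S" for x y by (rule eqI) (use that adS in "auto simp: add.commute")
  show "vadd E (vadd E x y) w = vadd E x (vadd E y w)" if "x : ?S" "y : ?S" "w : ?S" for x y w
   by (rule eqI) (use that adS in "simp_all add: add.assoc")
  show "EX z:?S. ALL x:?S. vadd E z x = x & (EX y:?S. vadd E x y = z)"
  proof (rule bexI[OF _ z(1)],intro ballI conjI)
   fix x assume x: "x : ?S"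
   show "vadd E (th p (%_. 0)) x = x" by (rule eqI) (use x z adS in simp_all)
   have "vadd E x (vscale E (-1) x) = th p (%_. 0)" by (rule eqI) (use x z adS scS in simp_all)
   thus "EX y:?S. vadd E x y = th p (%_. 0)" using scS(1)[OF x] by blast
  qed
  show "vscale E c (vadd E x y) = vadd E (vscale E c x) (vscale E c y)" if "x : ?S" "y : ?S" for c x y
   by (rule eqI) (use that adS scS in "simp_all add: algebra_simps")
  show "vscale E (c + d) x = vadd E (vscale E c x) (vscale E d x)" if "x : ?S" for c d x
   by (rule eqI) (use that adS scS in "simp_all add: algebra_simps")
  show "vscale E (c * d) x = vscale E c (vscale E d x)" if "x : ?S" for c d x
   by (rule eqI) (use that adS scS in "simp_all add: algebra_simps")
  show "vscale E 1 x = x" if "x : ?S" for x by (rule eqI) (use that adS scS in simp_all)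
 qed (use adS scS in blast)+
qed

context
 fixes E :: "('e,'b) vbun"
 assumes E: "vector_bundle E"
begin

lemma vb_tot: "manifold (tot E)" and vb_base: "manifold (base E)" and vb_proj: "smooth (tot E) (base E) (proj E)"
 using E smap_iff[of "tot E"] by (auto simp: vector_bundle_def)

lemma vb_proj_pts: "e <: tot E ==> proj E e <: base E" by (rule sm_pts[OF vb_base vb_proj])

lemma vb_triv:
 assumes "p <: base E"
 obtains U k ta th where "p : U" "triv E U k ta th"
proof -
 obtain U k Ph where "opn (base E) U" "p : U" "local_triv E U k Ph" using E assms unfolding vector_bundle_def by blast
 thus thesis using local_triv_iff(1)[OF vb_tot vb_base vb_proj] that by blast
qed

lemma vb_add_pts:
 assumes "e <: tot E" "e' <: tot E" "proj E e = proj E e'" shows "vadd E e e' <: tot E" "proj E (vadd E e e') = proj E e'"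
 using E assms vb_proj_pts[OF assms(1)] unfolding vector_bundle_def real_vector_space_on_def by auto

lemma vb_scale_pts:
 assumes "e <: tot E" shows "vscale E c e <: tot E" "proj E (vscale E c e) = proj E e"
 using E assms vb_proj_pts[OF assms(1)] unfolding vector_bundle_def real_vector_space_on_def by auto

context
 fixes U k ta th
 assumes t: "triv E U k ta th"
begin

lemma triv_Rn: "e <: tot E ==> proj E e : U ==> ta e : Rn k" using sm_pts[OF mfE trivD(2)[OF t]] by (simp add: eucls)

lemma triv_pts: "p : U ==> x : Rn k ==> th p x <: tot E" using sm_pts[OF vb_tot trivD(3)[OF t],of "(p,x)"] by simp

lemma triv_fsm:
 assumes P: "manifold P" and a: "sm_on P S (tot E) a" and U: "!!q. q : S ==> proj E (a q) : U" shows "fsm P S (%q. ta (a q) i)"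
 by (rule fsm_of_smooth[OF P sm_o[OF P vb_tot a trivD(2)[OF t]]]) (use sm_pts[OF vb_tot a] U in auto)

lemma triv_smooth:
 assumes P: "manifold P" and a: "sm_on P S (base E) a" and U: "!!q. q : S ==> a q : U"
  and x: "!!q. q : S ==> x q : Rn k" "!!i. i < k ==> fsm P S (%q. x q i)" shows "sm_on P S (tot E) (%q. th (a q) (x q))"
proof -
 have xs: "sm_on P S (eucl k) x" unfolding sm_euclid[OF P] using x sm_open[OF a] by blast
 have "sm_on P S (tot E) (%q. case (a q,x q) of (p,x) => th p x)"
  by (rule sm_o[OF P mf_prod[OF vb_base mfE] smooth_pair[OF vb_base mfE P a xs] trivD(3)[OF t]]) (use U x in auto)
 thus ?thesis by simp
qed

lemma triv_theta_add:
 assumes "p : U" "x : Rn k" "y : Rn k" shows "th p (%i. x i + y i) = vadd E (th p x) (th p y)" by (rule triv_eqI[OF t])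
  (use assms trivD(4,5,7)[OF t] triv_pts vb_add_pts in "simp_all add: Rn_add")

lemma triv_theta_scale:
 assumes "p : U" "x : Rn k" shows "th p (%i. c * x i) = vscale E c (th p x)" by (rule triv_eqI[OF t])
  (use assms trivD(4,5,8)[OF t] triv_pts vb_scale_pts in "simp_all add: Rn_scale")

end

text \<open>Keeping the fibre coordinates of e while the base point moves is a section through
  e.\<close>

lemma vb_sections: "sections (tot E) (base E) (proj E)" unfolding sections_def
proof
 fix e assume e: "e <: tot E"
 obtain U k ta th where t: "proj E e : U" "triv E U k ta th" by (rule vb_triv[OF vb_proj_pts[OF e]])
 have "sm_on (base E) U (tot E) (%p. th p (ta e))" by (rule triv_smooth[OF t(2) vb_base sm_id[OF vb_base trivD(1)[OF t(2)]]])
   (use triv_Rn[OF t(2) e t(1)] fsm_const[OF vb_base trivD(1)[OF t(2)]] in auto)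
 thus "EX V s. opn (base E) V & proj E e : V & sm_on (base E) V (tot E) s & s (proj E e) = e &
   (ALL y:V. proj E (s y) = y)"
  using t trivD[OF t(2)] triv_Rn[OF t(2) e t(1)] e by (intro exI[of _ U] exI[of _ "%p. th p (ta e)"]) auto
qed

lemma vb_submersion: "submersion (tot E) (base E) (proj E)"
 unfolding submersion_iff[OF vb_tot vb_base] using vb_proj vb_sections by blast

text \<open>Addition is treated as an operation on pairs of smooth maps with equal base points,
  which avoids forming the fibre product of the bundle with itself.\<close>

lemma smooth_vadd:
 assumes P: "manifold P" and a: "sm_on P S (tot E) a" and b: "sm_on P S (tot E) b"
  and eq: "!!q. q : S ==> proj E (a q) = proj E (b q)" shows "sm_on P S (tot E) (%q. vadd E (a q) (b q))"
proof (rule smooth_on_local[OF P])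
 fix q assume q: "q : S"
 have pa: "sm_on P S (base E) (%q. proj E (a q))" by (rule sm_o[OF P vb_tot a vb_proj]) (rule sm_pts[OF vb_tot a])
 obtain U k ta th where t: "proj E (a q) : U" "triv E U k ta th" by (rule vb_triv[OF vb_proj_pts[OF sm_pts[OF vb_tot a q]]])
 define S' where "S' = {q : S. proj E (a q) : U}"
 have S': "opn P S'" "S' <= S" unfolding S'_def using sm_preim[OF P vb_base pa trivD(1)[OF t(2)]] by auto
 note a' = sm_sub[OF P a S'] and b' = sm_sub[OF P b S'] and pa' = sm_sub[OF P pa S']
 have U: "proj E (a q) : U" "proj E (b q) : U" "a q <: tot E" "b q <: tot E" if "q : S'" for q
  using that eq[of q] sm_pts[OF vb_tot a] sm_pts[OF vb_tot b] by (auto simp: S'_def)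
 have "sm_on P S' (tot E) (%q. th (proj E (a q)) (%i. ta (a q) i + ta (b q) i))" by (rule triv_smooth[OF t(2) P pa'])
   (use U triv_Rn[OF t(2)] triv_fsm[OF t(2) P a'] triv_fsm[OF t(2) P b'] in "auto intro: Rn_add fsm_add[OF P]")
 hence "sm_on P S' (tot E) (%q. vadd E (a q) (b q))"
 proof (rule sm_cong[OF P])
  fix q assume q: "q : S'"
  hence e: "proj E (a q) = proj E (b q)" using eq S' by blast
  show "th (proj E (a q)) (%i. ta (a q) i + ta (b q) i) = vadd E (a q) (b q)"
   using triv_theta_add[OF t(2) U(1)[OF q] triv_Rn[OF t(2) U(3,1)[OF q]] triv_Rn[OF t(2) U(4,2)[OF q]]]
    trivD(6)[OF t(2) U(3,1)[OF q]] trivD(6)[OF t(2) U(4,2)[OF q]] e by simp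
 qed
 thus "EX T. q : T & T <= S & sm_on P T (tot E) (%q. vadd E (a q) (b q))" using q t S' by (intro exI[of _ S']) (auto simp: S'_def)
qed

lemma smooth_vscale:
 assumes P: "manifold P" and a: "sm_on P S (tot E) a" and c: "fsm P S c" shows "sm_on P S (tot E) (%q. vscale E (c q) (a q))"
proof (rule smooth_on_local[OF P])
 fix q assume q: "q : S"
 have pa: "sm_on P S (base E) (%q. proj E (a q))" by (rule sm_o[OF P vb_tot a vb_proj]) (rule sm_pts[OF vb_tot a])
 obtain U k ta th where t: "proj E (a q) : U" "triv E U k ta th" by (rule vb_triv[OF vb_proj_pts[OF sm_pts[OF vb_tot a q]]])
 define S' where "S' = {q : S. proj E (a q) : U}"
 have S': "opn P S'" "S' <= S" unfolding S'_def using sm_preim[OF P vb_base pa trivD(1)[OF t(2)]] by auto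
 note a' = sm_sub[OF P a S'] and pa' = sm_sub[OF P pa S']
 have U: "proj E (a q) : U" "a q <: tot E" if "q : S'" for q using that sm_pts[OF vb_tot a] by (auto simp: S'_def)
 have "sm_on P S' (tot E) (%q. th (proj E (a q)) (%i. c q * ta (a q) i))" by (rule triv_smooth[OF t(2) P pa'])
   (use U triv_Rn[OF t(2)] triv_fsm[OF t(2) P a'] fsm_subset[OF P c S'] in "auto intro: Rn_scale fsm_mult[OF P]")
 hence "sm_on P S' (tot E) (%q. vscale E (c q) (a q))"
 proof (rule sm_cong[OF P])
  fix q assume q: "q : S'"
  show "th (proj E (a q)) (%i. c q * ta (a q) i) = vscale E (c q) (a q)"
   using triv_theta_scale[OF t(2) U(1)[OF q] triv_Rn[OF t(2) U(2,1)[OF q]]]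
    trivD(6)[OF t(2) U(2,1)[OF q]] by simp
 qed
 thus "EX T. q : T & T <= S & sm_on P T (tot E) (%q. vscale E (c q) (a q))"
  using q t S' by (intro exI[of _ S']) (auto simp: S'_def)
qed

text \<open>The zero section, obtained as 0 times an arbitrary vector of the fibre; by
  \<open>vzero_triv\<close> its coordinates vanish in every trivialisation.\<close>

definition vzero :: "'b => 'e" where
 "vzero p = vscale E 0 (SOME e. e <: tot E & proj E e = p)"

lemma vzero_triv:
 assumes p: "p <: base E" shows "vzero p <: tot E" "proj E (vzero p) = p"
  "!!U k ta th. triv E U k ta th ==> p : U ==> ta (vzero p) = (%i. 0)"
proof -
 obtain U k ta th where t: "p : U" "triv E U k ta th" by (rule vb_triv[OF p])
 have "th p (%i. 0) <: tot E & proj E (th p (%i. 0)) = p" using triv_pts[OF t(2,1) Rn_0] trivD(4)[OF t(2,1) Rn_0] by blast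
 hence s: "(SOME e. e <: tot E & proj E e = p) <: tot E" "proj E (SOME e. e <: tot E & proj E e = p) = p"
  using someI[of "%e. e <: tot E & proj E e = p"] by blast+
 show "vzero p <: tot E" "proj E (vzero p) = p" using vb_scale_pts[OF s(1)] s(2) by (auto simp: vzero_def)
 show "ta (vzero p) = (%i. 0)" if "triv E U k ta th" "p : U" for U k ta th
  using trivD(8)[OF that(1) s(1),of 0] s(2) that(2) by (simp add: vzero_def)
qed

lemma smooth_vzero: "smooth (base E) (tot E) vzero"
proof (rule smooth_on_local[OF vb_base])
 fix p assume p: "p <: base E"
 obtain U k ta th where t: "p : U" "triv E U k ta th" by (rule vb_triv[OF p])
 have U: "U <= pts (base E)" by (rule opsub[OF trivD(1)[OF t(2)]])
 have "sm_on (base E) U (tot E) (%p. th p (%i. 0))" by (rule triv_smooth[OF t(2) vb_base sm_id[OF vb_base trivD(1)[OF t(2)]]])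
   (use fsm_const[OF vb_base trivD(1)[OF t(2)]] in "auto simp: Rn_0")
 hence "sm_on (base E) U (tot E) vzero"
 proof (rule sm_cong[OF vb_base])
  fix q assume q: "q : U"
  hence qB: "q <: base E" using U by blast
  note v = vzero_triv[OF qB]
  show "th q (%i. 0) = vzero q" using trivD(6)[OF t(2) v(1)] v(2) v(3)[OF t(2) q] q by simp
 qed
 thus "EX T. p : T & T <= pts (base E) & sm_on (base E) T (tot E) vzero" using t U by blast
qed

end

section \<open>Groupoids\<close>

context
 fixes G :: "('b,'g) lgpd"
 assumes G: "groupoid G"
begin

lemma gp_src: "g <: Ar G ==> src G g <: Ob G" and gp_tgt: "g <: Ar G ==> tgt G g <: Ob G"
 and gp_unt: "x <: Ob G ==> unt G x <: Ar G" and gp_src_unt: "x <: Ob G ==> src G (unt G x) = x"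
 and gp_tgt_unt: "x <: Ob G ==> tgt G (unt G x) = x" and gp_mul: "cmp G g h ==> mul G g h <: Ar G"
 and gp_src_mul: "cmp G g h ==> src G (mul G g h) = src G h" and gp_tgt_mul: "cmp G g h ==> tgt G (mul G g h) = tgt G g"
 and gp_idr: "g <: Ar G ==> mul G g (unt G (src G g)) = g" and gp_idl: "g <: Ar G ==> mul G (unt G (tgt G g)) g = g"
 using G unfolding groupoid_def by simp_all

lemma gp_assoc: "cmp G g h ==> cmp G h k ==> mul G (mul G g h) k = mul G g (mul G h k)" using G unfolding groupoid_def by blast

lemma gp_inv_unique:
 assumes i: "is_inverse G g h" shows "ginv G g = h" unfolding ginv_def
proof (rule the_equality[where P="is_inverse G g",OF i])
 fix h' assume i': "is_inverse G g h'"
 have "h' = mul G h' (unt G (tgt G g))" using i' gp_idr[of h'] by (simp add: is_inverse_def)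
 also have "... = mul G h' (mul G g h)" using i by (simp add: is_inverse_def)
 also have "... = mul G (mul G h' g) h" using gp_assoc[of h' g h] i i' by (simp add: is_inverse_def)
 also have "... = mul G (unt G (tgt G h)) h" using i i' by (simp add: is_inverse_def)
 also have "... = h" using gp_idl i by (simp add: is_inverse_def)
 finally show "h' = h" .
qed

lemma gp_is_inverse: "g <: Ar G ==> is_inverse G g (ginv G g)" using G gp_inv_unique unfolding groupoid_def by metis

lemma gp_inv: "g <: Ar G ==> ginv G g <: Ar G" and gp_src_inv: "g <: Ar G ==> src G (ginv G g) = tgt G g"
 and gp_tgt_inv: "g <: Ar G ==> tgt G (ginv G g) = src G g" and gp_mul_inv: "g <: Ar G ==> mul G g (ginv G g) = unt G (tgt G g)"
 and gp_inv_mul_self: "g <: Ar G ==> mul G (ginv G g) g = unt G (src G g)" by (drule gp_is_inverse,simp add: is_inverse_def)+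

lemmas gp_simps = gp_src gp_tgt gp_unt gp_src_unt gp_tgt_unt gp_mul gp_src_mul gp_tgt_mul gp_idr gp_idl
 gp_inv gp_src_inv gp_tgt_inv gp_mul_inv gp_inv_mul_self

lemma gp_inv_cancel: "cmp G g h ==> mul G (ginv G g) (mul G g h) = h" using gp_assoc[of "ginv G g" g h] by (simp add: gp_simps)

lemma gp_cancel_inv:
 assumes "g <: Ar G" "h <: Ar G" "tgt G g = tgt G h" shows "mul G g (mul G (ginv G g) h) = h"
 using gp_assoc[of g "ginv G g" h] assms gp_idl[of h] by (simp add: gp_simps)

lemma gp_inv_cancel_right:
 assumes "cmp G g h" shows "mul G (mul G g h) (ginv G h) = g"
 using gp_assoc[of g h "ginv G h"] assms gp_idr[of g] by (simp add: gp_simps)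

lemma gp_inv_unt: "x <: Ob G ==> ginv G (unt G x) = unt G x"
 by (rule gp_inv_unique) (use gp_idl[of "unt G x"] in \<open>simp add: is_inverse_def gp_simps\<close>)

lemma gp_inv_inv: "g <: Ar G ==> ginv G (ginv G g) = g" by (rule gp_inv_unique) (simp add: is_inverse_def gp_simps)

lemma gp_inv_mul:
 assumes c: "cmp G g h" shows "ginv G (mul G g h) = mul G (ginv G h) (ginv G g)"
proof (rule gp_inv_unique)
 have "mul G (mul G g h) (mul G (ginv G h) (ginv G g)) = mul G g (mul G h (mul G (ginv G h) (ginv G g)))"
  using c by (intro gp_assoc) (simp_all add: gp_simps)
 also have "mul G h (mul G (ginv G h) (ginv G g)) = ginv G g" using c by (intro gp_cancel_inv) (simp_all add: gp_simps)
 finally have 1: "mul G (mul G g h) (mul G (ginv G h) (ginv G g)) = unt G (tgt G g)" using c by (simp add: gp_simps)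
 have "mul G (mul G (ginv G h) (ginv G g)) (mul G g h) = mul G (ginv G h) (mul G (ginv G g) (mul G g h))"
  using c by (intro gp_assoc) (simp_all add: gp_simps)
 also have "mul G (ginv G g) (mul G g h) = h" by (rule gp_inv_cancel[OF c])
 finally have 2: "mul G (mul G (ginv G h) (ginv G g)) (mul G g h) = unt G (src G h)" using c by (simp add: gp_simps)
 show "is_inverse G (mul G g h) (mul G (ginv G h) (ginv G g))" using c 1 2 by (simp add: is_inverse_def gp_simps)
qed

end

section \<open>Lie groupoids\<close>

lemma smcomp:
 assumes "manifold P" "manifold M" "sm_on P S M a" "smooth M N f" shows "sm_on P S N (%q. f (a q))"
 by (rule sm_o[OF assms]) (rule sm_pts[OF assms(2,3)])

lemma sections_id:
 assumes "manifold M" shows "sections M M (%x. x)"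
 unfolding sections_def using sm_id[OF assms otop] by (intro ballI exI[of _ "pts M"] exI[of _ "%x. x"]) auto

context
 fixes G :: "('b,'g) lgpd"
 assumes G: "lie_groupoid G"
begin

lemma lg_Ob: "manifold (Ob G)" and lg_Ar: "manifold (Ar G)" and lg_gpd: "groupoid G"
 and lg_sub_src: "submersion (Ar G) (Ob G) (src G)" and lg_sub_tgt: "submersion (Ar G) (Ob G) (tgt G)"
 using G by (auto simp: lie_groupoid_def)

lemma lg_src: "smooth (Ar G) (Ob G) (src G)" and lg_sec_src: "sections (Ar G) (Ob G) (src G)"
 and lg_tgt: "smooth (Ar G) (Ob G) (tgt G)" and lg_sec_tgt: "sections (Ar G) (Ob G) (tgt G)"
 using lg_sub_src lg_sub_tgt submersion_iff[OF lg_Ar lg_Ob] by auto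

lemma lg_unt: "smooth (Ob G) (Ar G) (unt G)" and lg_inv: "smooth (Ar G) (Ar G) (ginv G)"
 using G by (auto simp: lie_groupoid_def smap_iff[OF lg_Ob,symmetric] smap_iff[OF lg_Ar,symmetric])

lemma lg_Ar2: "manifold (Ar2 G)" and lg_pts_Ar2: "pts (Ar2 G) = {(g,h). cmp G g h}"
 unfolding Ar2_def using mf_fibre[OF lg_Ar lg_Ar lg_Ob lg_src lg_sub_tgt]
  fib_pts[OF lg_Ar lg_Ar lg_Ob lg_src lg_sub_tgt] by auto

lemma lg_fst: "smooth (Ar2 G) (Ar G) fst" and lg_snd: "smooth (Ar2 G) (Ar G) snd"
 unfolding Ar2_def using fib_fst[OF lg_Ar lg_Ar lg_Ob lg_src lg_sub_tgt]
  fib_snd[OF lg_Ar lg_Ar lg_Ob lg_src lg_sub_tgt] by auto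

lemma lg_pair:
 assumes "manifold P" "sm_on P S (Ar G) a" "sm_on P S (Ar G) b" "!!q. q : S ==> src G (a q) = tgt G (b q)"
 shows "sm_on P S (Ar2 G) (%q. (a q,b q))" unfolding Ar2_def using fib_pair[OF lg_Ar lg_Ar lg_Ob lg_src lg_sub_tgt assms] .

lemma lg_mul: "smooth (Ar2 G) (Ar G) (%(g,h). mul G g h)" using G by (auto simp: lie_groupoid_def smap_iff[OF lg_Ar2])

lemma sm_src: "manifold P ==> sm_on P S (Ar G) a ==> sm_on P S (Ob G) (%q. src G (a q))" by (rule smcomp[OF _ lg_Ar _ lg_src])

lemma sm_tgt: "manifold P ==> sm_on P S (Ar G) a ==> sm_on P S (Ob G) (%q. tgt G (a q))" by (rule smcomp[OF _ lg_Ar _ lg_tgt])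

lemma sm_unt: "manifold P ==> sm_on P S (Ob G) a ==> sm_on P S (Ar G) (%q. unt G (a q))" by (rule smcomp[OF _ lg_Ob _ lg_unt])

lemma sm_inv: "manifold P ==> sm_on P S (Ar G) a ==> sm_on P S (Ar G) (%q. ginv G (a q))" by (rule smcomp[OF _ lg_Ar _ lg_inv])

lemma sm_mul:
 assumes "manifold P" "sm_on P S (Ar G) a" "sm_on P S (Ar G) b" "!!q. q : S ==> src G (a q) = tgt G (b q)"
 shows "sm_on P S (Ar G) (%q. mul G (a q) (b q))" using smcomp[OF assms(1) lg_Ar2 lg_pair[OF assms] lg_mul] by simp

end

text \<open>The target map is the source map after inversion, so inverted sections of the source are
  sections of the target. Smoothness of multiplication is asked for under the assumption that
  \<open>Ar2\<close> is a manifold with smooth projections, because this is known only after the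
  target is seen to be a submersion.\<close>

lemma lie_groupoidI:
 assumes O: "manifold (Ob G)" and A: "manifold (Ar G)" and G: "groupoid G"
  and s: "smooth (Ar G) (Ob G) (src G)" and sec: "sections (Ar G) (Ob G) (src G)" and u: "smooth (Ob G) (Ar G) (unt G)"
  and i: "smooth (Ar G) (Ar G) (ginv G)" and m: "manifold (Ar2 G) ==> smooth (Ar2 G) (Ar G) fst ==> smooth (Ar2 G) (Ar G) snd ==>
   (!!q. q <: Ar2 G ==> cmp G (fst q) (snd q)) ==>
   smooth (Ar2 G) (Ar G) (%q. mul G (fst q) (snd q))" shows "lie_groupoid G"
proof -
 have t: "smooth (Ar G) (Ob G) (tgt G)" by (rule sm_cong[OF A smcomp[OF A A i s]]) (rule gp_src_inv[OF G])
 have "sections (Ar G) (Ob G) (tgt G)" unfolding sections_def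
 proof
  fix g assume g: "g <: Ar G"
  from sec gp_inv[OF G g] obtain V r where r: "opn (Ob G) V" "src G (ginv G g) : V" "sm_on (Ob G) V (Ar G) r"
   "r (src G (ginv G g)) = ginv G g" "!!y. y : V ==> src G (r y) = y" by (rule sectionsE) blast
  show "EX V s. opn (Ob G) V & tgt G g : V & sm_on (Ob G) V (Ar G) s & s (tgt G g) = g & (ALL y:V. tgt G (s y) = y)"
  proof (intro exI[of _ V] exI[of _ "%y. ginv G (r y)"] conjI ballI)
   show "sm_on (Ob G) V (Ar G) (%y. ginv G (r y))" by (rule smcomp[OF O A r(3) i])
   show "tgt G (ginv G (r y)) = y" if "y : V" for y using gp_tgt_inv[OF G sm_pts[OF A r(3) that]] r(5)[OF that] by simp
  qed (use r g gp_src_inv[OF G g] gp_inv_inv[OF G g] in auto)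
 qed
 hence sub: "submersion (Ar G) (Ob G) (tgt G)" "submersion (Ar G) (Ob G) (src G)"
  unfolding submersion_iff[OF A O] using t s sec by auto
 note fp = A A O s sub(1)
 have M2: "manifold (Ar2 G)" unfolding Ar2_def by (rule mf_fibre[OF fp])
 have "smooth (Ar2 G) (Ar G) (%q. mul G (fst q) (snd q))"
 proof (rule m[OF M2])
  show "smooth (Ar2 G) (Ar G) fst" "smooth (Ar2 G) (Ar G) snd" unfolding Ar2_def by (rule fib_fst[OF fp],rule fib_snd[OF fp])
  show "cmp G (fst q) (snd q)" if "q <: Ar2 G" for q using that unfolding Ar2_def fib_pts[OF fp] by auto
 qed
 thus ?thesis unfolding lie_groupoid_def smap_iff[OF O] smap_iff[OF A] smap_iff[OF M2]
  using O A G sub u i by (simp add: case_prod_beta')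
qed

lemma trivs: "Ob (tgpd M) = M" "Ar (tgpd M) = M" "src (tgpd M) x = x"
 "tgt (tgpd M) x = x" "unt (tgpd M) x = x" "mul (tgpd M) x y = x" by (simp_all add: trivial_gpd_def)

lemma trivial_groupoid: "groupoid (tgpd M)" by (auto simp: groupoid_def trivs is_inverse_def)

lemma trivial_ginv: "x <: M ==> ginv (tgpd M) x = x" by (rule gp_inv_unique[OF trivial_groupoid]) (simp add: is_inverse_def trivs)

lemma trivial_lie_groupoid:
 assumes M: "manifold M" shows "lie_groupoid (tgpd M)"
proof (rule lie_groupoidI)
 have id: "smooth M M (%x. x)" by (rule sm_id[OF M otop])
 have e: "src (tgpd M) = (%x. x)" "unt (tgpd M) = (%x. x)" by (auto simp: trivs)
 show "smooth (Ar (tgpd M)) (Ob (tgpd M)) (src (tgpd M))"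
  "smooth (Ob (tgpd M)) (Ar (tgpd M)) (unt (tgpd M))" using id by (simp_all add: trivs e)
 show "sections (Ar (tgpd M)) (Ob (tgpd M)) (src (tgpd M))" using sections_id[OF M] by (simp add: trivs e)
 show "smooth (Ar (tgpd M)) (Ar (tgpd M)) (ginv (tgpd M))" unfolding trivs by (rule sm_cong[OF M id]) (simp add: trivial_ginv)
qed (simp_all add: trivs M trivial_groupoid)

section \<open>VB-groupoids\<close>

lemma buns: "tot (bun0 G V) = V0 V" "base (bun0 G V) = Ob G" "proj (bun0 G V) = pr0 V" "vadd (bun0 G V) = add0 V" "vscale (bun0 G V) = scale0 V"
 "tot (bun1 G V) = V1 V" "base (bun1 G V) = Ar G" "proj (bun1 G V) = pr1 V" "vadd (bun1 G V) = add1 V" "vscale (bun1 G V) = scale1 V"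
 "tot (bun2 G V) = Ar2 (gpd V)" "base (bun2 G V) = Ar2 G" "proj (bun2 G V) = map_prod (pr1 V) (pr1 V)"
 "vadd (bun2 G V) (v,w) (v',w') = (add1 V v v',add1 V w w')" "vscale (bun2 G V) c (v,w) = (scale1 V c v,scale1 V c w)"
 by (simp_all add: bun0_def bun1_def bun2_def)

context
 fixes G :: "('b,'g) lgpd" and V :: "('x,'y,'b,'g) vbgpd"
 assumes V: "vb_groupoid G V"
begin

lemma vg_G: "lie_groupoid G" and vg_V: "lie_groupoid (gpd V)"
 and vg_b0: "vector_bundle (bun0 G V)" and vg_b1: "vector_bundle (bun1 G V)" using V by (auto simp: vb_groupoid_def)

lemmas vg_gG = lg_gpd[OF vg_G] and vg_gV = lg_gpd[OF vg_V]
lemmas vg_V0 = lg_Ob[OF vg_V] and vg_V1 = lg_Ar[OF vg_V] and vg_G0 = lg_Ob[OF vg_G] and vg_G1 = lg_Ar[OF vg_G]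

lemma vg_pr0: "smooth (V0 V) (Ob G) (pr0 V)" and vg_pr1: "smooth (V1 V) (Ar G) (pr1 V)"
 using vb_proj[OF vg_b0] vb_proj[OF vg_b1] by (simp_all add: buns)

lemma vg_pr0_pts: "x <: V0 V ==> pr0 V x <: Ob G" and vg_pr1_pts: "v <: V1 V ==> pr1 V v <: Ar G"
 by (rule sm_pts[OF vg_G0 vg_pr0],assumption,rule sm_pts[OF vg_G1 vg_pr1])

lemma vg_pr_src: "v <: V1 V ==> pr0 V (vsrc V v) = src G (pr1 V v)"
 and vg_pr_tgt: "v <: V1 V ==> pr0 V (vtgt V v) = tgt G (pr1 V v)"
 and vg_pr_unt: "x <: V0 V ==> pr1 V (vunt V x) = unt G (pr0 V x)"
 and vg_pr_mul: "cmp (gpd V) v w ==> pr1 V (vmul V v w) = mul G (pr1 V v) (pr1 V w)"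
 using V unfolding vb_groupoid_def lgpd_map_def by auto

lemma vg_pr_inv:
 assumes v: "v <: V1 V" shows "pr1 V (vginv V v) = ginv G (pr1 V v)"
proof (rule gp_inv_unique[OF vg_gG,symmetric])
 note s = gp_simps[OF vg_gV]
 show "is_inverse G (pr1 V v) (pr1 V (vginv V v))" unfolding is_inverse_def
  using v vg_pr1_pts vg_pr_src[OF v] vg_pr_tgt[OF v] vg_pr_src[OF s(11)[OF v]] vg_pr_tgt[OF s(11)[OF v]]
   vg_pr_mul[of v "vginv V v"] vg_pr_mul[of "vginv V v" v] vg_pr_unt by (simp add: s)
qed

lemma vg_add0: "x <: V0 V ==> y <: V0 V ==> pr0 V x = pr0 V y ==> add0 V x y <: V0 V"
 and vg_pr_add0: "x <: V0 V ==> y <: V0 V ==> pr0 V x = pr0 V y ==> pr0 V (add0 V x y) = pr0 V y"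
 and vg_scale0: "x <: V0 V ==> scale0 V c x <: V0 V" and vg_pr_scale0: "x <: V0 V ==> pr0 V (scale0 V c x) = pr0 V x"
 and vg_add1: "v <: V1 V ==> w <: V1 V ==> pr1 V v = pr1 V w ==> add1 V v w <: V1 V"
 and vg_pr_add1: "v <: V1 V ==> w <: V1 V ==> pr1 V v = pr1 V w ==> pr1 V (add1 V v w) = pr1 V w"
 and vg_scale1: "v <: V1 V ==> scale1 V c v <: V1 V" and vg_pr_scale1: "v <: V1 V ==> pr1 V (scale1 V c v) = pr1 V v"
 using vb_add_pts[OF vg_b0] vb_scale_pts[OF vg_b0] vb_add_pts[OF vg_b1] vb_scale_pts[OF vg_b1] by (simp_all add: buns)

lemma vg_src_add: "v <: V1 V ==> w <: V1 V ==> pr1 V v = pr1 V w ==> vsrc V (add1 V v w) = add0 V (vsrc V v) (vsrc V w)"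
 and vg_tgt_add: "v <: V1 V ==> w <: V1 V ==> pr1 V v = pr1 V w ==> vtgt V (add1 V v w) = add0 V (vtgt V v) (vtgt V w)"
 and vg_inv_add: "v <: V1 V ==> w <: V1 V ==> pr1 V v = pr1 V w ==> vginv V (add1 V v w) = add1 V (vginv V v) (vginv V w)"
 and vg_unt_add: "x <: V0 V ==> y <: V0 V ==> pr0 V x = pr0 V y ==> vunt V (add0 V x y) = add1 V (vunt V x) (vunt V y)"
 and vg_src_scale: "v <: V1 V ==> vsrc V (scale1 V c v) = scale0 V c (vsrc V v)"
 and vg_tgt_scale: "v <: V1 V ==> vtgt V (scale1 V c v) = scale0 V c (vtgt V v)"
 and vg_inv_scale: "v <: V1 V ==> vginv V (scale1 V c v) = scale1 V c (vginv V v)"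
 and vg_unt_scale: "x <: V0 V ==> vunt V (scale0 V c x) = scale1 V c (vunt V x)"
 using V unfolding vb_groupoid_def vb_map_def buns by simp_all

lemma vg_mul_add:
 assumes "cmp (gpd V) v w" "cmp (gpd V) v' w'" "pr1 V v = pr1 V v'" "pr1 V w = pr1 V w'"
 shows "vmul V (add1 V v v') (add1 V w w') = add1 V (vmul V v w) (vmul V v' w')"
proof -
 have "vb_map (bun2 G V) (bun1 G V) (%(v,w). vmul V v w) (%(g,h). mul G g h)" using V by (simp add: vb_groupoid_def)
 hence "(%(v,w). vmul V v w) (vadd (bun2 G V) (v,w) (v',w')) =
   vadd (bun1 G V) ((%(v,w). vmul V v w) (v,w)) ((%(v,w). vmul V v w) (v',w'))"
  using assms unfolding vb_map_def by (auto simp: buns lg_pts_Ar2[OF vg_V])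
 thus ?thesis by (simp add: buns)
qed

lemma vg_mul_scale:
 assumes "cmp (gpd V) v w" shows "vmul V (scale1 V c v) (scale1 V c w) = scale1 V c (vmul V v w)"
proof -
 have "vb_map (bun2 G V) (bun1 G V) (%(v,w). vmul V v w) (%(g,h). mul G g h)" using V by (simp add: vb_groupoid_def)
 hence "(%(v,w). vmul V v w) (vscale (bun2 G V) c (v,w)) =
   vscale (bun1 G V) c ((%(v,w). vmul V v w) (v,w))" using assms unfolding vb_map_def by (auto simp: buns lg_pts_Ar2[OF vg_V])
 thus ?thesis by (simp add: buns)
qed

lemma vg_sm_pr0: "manifold P ==> sm_on P S (V0 V) a ==> sm_on P S (Ob G) (%q. pr0 V (a q))"
 and vg_sm_pr1: "manifold P ==> sm_on P S (V1 V) b ==> sm_on P S (Ar G) (%q. pr1 V (b q))"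
 by (rule smcomp[OF _ vg_V0 _ vg_pr0],assumption+,rule smcomp[OF _ vg_V1 _ vg_pr1])

lemma vg_sub_pr0: "submersion (V0 V) (Ob G) (pr0 V)" and vg_sub_pr1: "submersion (V1 V) (Ar G) (pr1 V)"
 using vb_submersion[OF vg_b0] vb_submersion[OF vg_b1] by (simp_all add: buns)

lemma vg_sm_add1:
 "manifold P ==> sm_on P S (V1 V) a ==> sm_on P S (V1 V) b ==> (!!q. q : S ==> pr1 V (a q) = pr1 V (b q)) ==>
  sm_on P S (V1 V) (%q. add1 V (a q) (b q))" using smooth_vadd[OF vg_b1,of P S a b] by (simp add: buns)

lemma vg_sm_scale0: "manifold P ==> sm_on P S (V0 V) a ==> fsm P S c ==> sm_on P S (V0 V) (%q. scale0 V (c q) (a q))"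
 and vg_sm_scale1: "manifold P ==> sm_on P S (V1 V) b ==> fsm P S c ==> sm_on P S (V1 V) (%q. scale1 V (c q) (b q))"
 using smooth_vscale[OF vg_b0,of P S a c] smooth_vscale[OF vg_b1,of P S b c] by (simp_all add: buns)

end

text \<open>Linearity of inversion comes out as a consequence: by the interchange law of addition
  and multiplication the sum of two inverses is an inverse of the sum, and inverses are
  unique.\<close>

lemma vb_groupoidI:
 assumes G: "lie_groupoid G" and V: "lie_groupoid (gpd V)" and b0: "vector_bundle (bun0 G V)" and b1: "vector_bundle (bun1 G V)"
  and ps: "!!v. v <: V1 V ==> pr0 V (vsrc V v) = src G (pr1 V v)" and pt: "!!v. v <: V1 V ==> pr0 V (vtgt V v) = tgt G (pr1 V v)"
  and pu: "!!x. x <: V0 V ==> pr1 V (vunt V x) = unt G (pr0 V x)"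
  and pm: "!!v w. cmp (gpd V) v w ==> pr1 V (vmul V v w) = mul G (pr1 V v) (pr1 V w)"
  and sa: "!!v w. v <: V1 V ==> w <: V1 V ==> pr1 V v = pr1 V w ==> vsrc V (add1 V v w) = add0 V (vsrc V v) (vsrc V w)"
  and ta: "!!v w. v <: V1 V ==> w <: V1 V ==> pr1 V v = pr1 V w ==> vtgt V (add1 V v w) = add0 V (vtgt V v) (vtgt V w)"
  and ua: "!!x y. x <: V0 V ==> y <: V0 V ==> pr0 V x = pr0 V y ==> vunt V (add0 V x y) = add1 V (vunt V x) (vunt V y)"
  and ss: "!!c v. v <: V1 V ==> vsrc V (scale1 V c v) = scale0 V c (vsrc V v)"
  and ts: "!!c v. v <: V1 V ==> vtgt V (scale1 V c v) = scale0 V c (vtgt V v)"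
  and us: "!!c x. x <: V0 V ==> vunt V (scale0 V c x) = scale1 V c (vunt V x)"
  and ma: "!!v w v' w'. cmp (gpd V) v w ==> cmp (gpd V) v' w' ==> pr1 V v = pr1 V v' ==> pr1 V w = pr1 V w' ==>
   vmul V (add1 V v v') (add1 V w w') = add1 V (vmul V v w) (vmul V v' w')"
  and ms: "!!c v w. cmp (gpd V) v w ==> vmul V (scale1 V c v) (scale1 V c w) = scale1 V c (vmul V v w)" shows "vb_groupoid G V"
proof -
 note gV = lg_gpd[OF V] and gG = lg_gpd[OF G]
 note s = gp_simps[OF gV]
 have a0: "add0 V x y <: V0 V" "pr0 V (add0 V x y) = pr0 V y" if "x <: V0 V" "y <: V0 V" "pr0 V x = pr0 V y" for x y
  using vb_add_pts[OF b0] that by (simp_all add: buns)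
 have a1: "add1 V x y <: V1 V" "pr1 V (add1 V x y) = pr1 V y" if "x <: V1 V" "y <: V1 V" "pr1 V x = pr1 V y" for x y
  using vb_add_pts[OF b1] that by (simp_all add: buns)
 have c1: "scale1 V c x <: V1 V" "pr1 V (scale1 V c x) = pr1 V x" if "x <: V1 V" for x c
  using vb_scale_pts[OF b1] that by (simp_all add: buns)
 have p0: "pr0 V x <: Ob G" if "x <: V0 V" for x using vb_proj_pts[OF b0] that by (simp add: buns)
 have p1: "pr1 V x <: Ar G" if "x <: V1 V" for x using vb_proj_pts[OF b1] that by (simp add: buns)
 have pri: "pr1 V (vginv V v) = ginv G (pr1 V v)" if v: "v <: V1 V" for v by (rule gp_inv_unique[OF gG,symmetric])
   (use v p1 ps[OF v] pt[OF v] ps[OF s(11)[OF v]] pt[OF s(11)[OF v]] pm[of v "vginv V v"] pm[of "vginv V v" v] pu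
    in \<open>simp add: is_inverse_def s\<close>)
 have ia: "vginv V (add1 V v w) = add1 V (vginv V v) (vginv V w)" if v: "v <: V1 V" "w <: V1 V" "pr1 V v = pr1 V w" for v w
 proof (rule gp_inv_unique[OF gV])
  have i: "vginv V v <: V1 V" "vginv V w <: V1 V" "pr1 V (vginv V v) = pr1 V (vginv V w)" using v by (simp_all add: s pri)
  have pe: "pr0 V (vtgt V v) = pr0 V (vtgt V w)" "pr0 V (vsrc V v) = pr0 V (vsrc V w)" using v by (simp_all add: ps pt)
  show "is_inverse (gpd V) (add1 V v w) (add1 V (vginv V v) (vginv V w))" unfolding is_inverse_def
   using v i pe a1[OF v] a1[OF i] ma[of v "vginv V v" w "vginv V w"] ma[of "vginv V v" v "vginv V w" w] ua by (simp add: s sa ta)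
 qed
 have isc: "vginv V (scale1 V c v) = scale1 V c (vginv V v)" if v: "v <: V1 V" for c v by (rule gp_inv_unique[OF gV])
   (use v c1[OF v] c1[OF s(11)[OF v]] ms[of v "vginv V v"] ms[of "vginv V v" v] us in \<open>simp add: is_inverse_def s ss ts\<close>)
 have sm: "smooth_map (V0 V) (Ob G) (pr0 V)" "smooth_map (V1 V) (Ar G) (pr1 V)"
  using b0 b1 by (simp_all add: vector_bundle_def buns)
 show ?thesis unfolding vb_groupoid_def
 proof (intro conjI G V b0 b1)
  show "lgpd_map (gpd V) G (pr0 V,pr1 V)" unfolding lgpd_map_def using sm ps pt pu pm by simp
  have gs: "smooth_map (Ar G) (Ob G) (src G)" "smooth_map (Ar G) (Ob G) (tgt G)" "smooth_map (Ob G) (Ar G) (unt G)"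
   "smooth_map (Ar2 G) (Ar G) (%(g,h). mul G g h)" "smooth_map (Ar G) (Ar G) (ginv G)"
   using G unfolding lie_groupoid_def submersion_def by auto
  have vs: "smooth_map (V1 V) (V0 V) (vsrc V)" "smooth_map (V1 V) (V0 V) (vtgt V)" "smooth_map (V0 V) (V1 V) (vunt V)"
   "smooth_map (Ar2 (gpd V)) (V1 V) (%(g,h). vmul V g h)" "smooth_map (V1 V) (V1 V) (vginv V)"
   using V unfolding lie_groupoid_def submersion_def by auto
  show "vb_map (bun1 G V) (bun0 G V) (vsrc V) (src G)" unfolding vb_map_def buns using gs vs ps sa ss by blast
  show "vb_map (bun1 G V) (bun0 G V) (vtgt V) (tgt G)" unfolding vb_map_def buns using gs vs pt ta ts by blast
  show "vb_map (bun0 G V) (bun1 G V) (vunt V) (unt G)" unfolding vb_map_def buns using gs vs pu ua us by blast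
  show "vb_map (bun1 G V) (bun1 G V) (vginv V) (ginv G)" unfolding vb_map_def buns using gs vs pri ia isc by blast
  show "vb_map (bun2 G V) (bun1 G V) (%(v,w). vmul V v w) (%(g,h). mul G g h)" unfolding vb_map_def
  proof (intro conjI ballI allI impI)
   show "smooth_map (tot (bun2 G V)) (tot (bun1 G V)) (%(v,w). vmul V v w)"
    "smooth_map (base (bun2 G V)) (base (bun1 G V)) (%(g,h). mul G g h)" using gs vs by (simp_all add: buns)
   fix e assume "e <: tot (bun2 G V)"
   then obtain v w where e: "e = (v,w)" "cmp (gpd V) v w" by (auto simp: buns lg_pts_Ar2[OF V])
   show "proj (bun1 G V) (case e of (v,w) => vmul V v w) = (case proj (bun2 G V) e of (g,h) => mul G g h)"
    using e pm by (simp add: buns)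
   show "(case vscale (bun2 G V) c e of (v,w) => vmul V v w) = vscale (bun1 G V) c (case e of (v,w) => vmul V v w)" for c
    using e ms by (simp add: buns)
   fix e' assume "e' <: tot (bun2 G V)" and pe: "proj (bun2 G V) e = proj (bun2 G V) e'"
   then obtain v' w' where e': "e' = (v',w')" "cmp (gpd V) v' w'" by (auto simp: buns lg_pts_Ar2[OF V])
   have "pr1 V v = pr1 V v'" "pr1 V w = pr1 V w'" using pe by (simp_all add: e e' buns)
   thus "(case vadd (bun2 G V) e e' of (v,w) => vmul V v w) =
     vadd (bun1 G V) (case e of (v,w) => vmul V v w) (case e' of (v,w) => vmul V v w)"
    using ma[OF e(2) e'(2)] by (simp add: e e' buns)
  qed
 qed
qed

section \<open>The category of VB-groupoids\<close>

text \<open>The content of \<open>vb_gpd_map\<close> in terms of \<open>sm_on\<close>, with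
  extensionality taken away, so that maps given by formulas can be composed and inverted and are
  restricted only at the end.\<close>

definition vgmap :: "('x,'y,'b,'g) vbgpd => ('x','y','b,'g) vbgpd => ('x => 'x') => ('y => 'y') => bool" where
 "vgmap V W f0 f1 <->
   smooth (V0 V) (V0 W) f0 & smooth (V1 V) (V1 W) f1 &
   (ALL v:pts (V1 V). vsrc W (f1 v) = f0 (vsrc V v) & vtgt W (f1 v) = f0 (vtgt V v) & pr1 W (f1 v) = pr1 V v) &
   (ALL x:pts (V0 V). f1 (vunt V x) = vunt W (f0 x) & pr0 W (f0 x) = pr0 V x) &
   (ALL v w. cmp (gpd V) v w --> f1 (vmul V v w) = vmul W (f1 v) (f1 w)) &
   (ALL x:pts (V0 V). ALL y:pts (V0 V). pr0 V x = pr0 V y --> f0 (add0 V x y) = add0 W (f0 x) (f0 y)) &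
   (ALL x:pts (V1 V). ALL y:pts (V1 V). pr1 V x = pr1 V y --> f1 (add1 V x y) = add1 W (f1 x) (f1 y)) &
   (ALL c. ALL x:pts (V0 V). f0 (scale0 V c x) = scale0 W c (f0 x)) &
   (ALL c. ALL x:pts (V1 V). f1 (scale1 V c x) = scale1 W c (f1 x))"

lemma vb_gpd_map_iff:
 assumes V: "vb_groupoid G V"
 shows "vb_gpd_map G V W (f0,f1) <-> vgmap V W f0 f1 & f0 : extensional (pts (V0 V)) & f1 : extensional (pts (V1 V))"
proof -
 have "smooth (Ob G) (Ob G) id" "smooth (Ar G) (Ar G) id"
  using sm_id[OF vg_G0[OF V] otop] sm_id[OF vg_G1[OF V] otop] by (simp_all add: id_def)
 thus ?thesis unfolding vb_gpd_map_def lgpd_map_def vb_map_def vgmap_def buns smap_iff[OF vg_V0[OF V]]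
   smap_iff[OF vg_V1[OF V]] smap_iff[OF vg_G0[OF V]] smap_iff[OF vg_G1[OF V]] by auto
qed

lemma vgmap_smooth:
 assumes "vgmap V W f0 f1" shows "smooth (V0 V) (V0 W) f0" "smooth (V1 V) (V1 W) f1" using assms by (simp_all add: vgmap_def)

lemma vgmap_pts:
 assumes W: "vb_groupoid G W" and f: "vgmap V W f0 f1" shows "x <: V0 V ==> f0 x <: V0 W" "v <: V1 V ==> f1 v <: V1 W"
 by (rule sm_pts[OF vg_V0[OF W] vgmap_smooth(1)[OF f]],assumption,
   rule sm_pts[OF vg_V1[OF W] vgmap_smooth(2)[OF f]])

lemma vgmap_cong:
 assumes V: "vb_groupoid G V" and f: "vgmap V W f0 f1"
  and e0: "!!x. x <: V0 V ==> f0 x = g0 x" and e1: "!!v. v <: V1 V ==> f1 v = g1 v" shows "vgmap V W g0 g1"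
proof -
 note s = gp_simps[OF vg_gV[OF V]]
 have "smooth (V0 V) (V0 W) g0" "smooth (V1 V) (V1 W) g1" by (rule sm_cong[OF vg_V0[OF V] vgmap_smooth(1)[OF f] e0],assumption,
    rule sm_cong[OF vg_V1[OF V] vgmap_smooth(2)[OF f] e1])
 thus ?thesis using f e0 e1 s vg_add0[OF V] vg_add1[OF V] vg_scale0[OF V] vg_scale1[OF V] unfolding vgmap_def by simp
qed

lemma vgmap_id:
 assumes V: "vb_groupoid G V" shows "vgmap V V (%x. x) (%v. v)"
 unfolding vgmap_def using sm_id[OF vg_V0[OF V] otop] sm_id[OF vg_V1[OF V] otop] by simp

lemma vgmap_comp:
 assumes V: "vb_groupoid G V" and W: "vb_groupoid G W" and f: "vgmap V W f0 f1" and h: "vgmap W X h0 h1"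
 shows "vgmap V X (%x. h0 (f0 x)) (%v. h1 (f1 v))"
proof -
 have "smooth (V0 V) (V0 X) (%x. h0 (f0 x))" "smooth (V1 V) (V1 X) (%v. h1 (f1 v))"
  by (rule smcomp[OF vg_V0[OF V] vg_V0[OF W] vgmap_smooth(1)[OF f] vgmap_smooth(1)[OF h]],
    rule smcomp[OF vg_V1[OF V] vg_V1[OF W] vgmap_smooth(2)[OF f] vgmap_smooth(2)[OF h]])
 thus ?thesis using f h vgmap_pts[OF W f] unfolding vgmap_def by simp
qed

lemma VB_simps: "Objs (VB G) = {V. vb_groupoid G V}" "Hom (VB G) V W = {f. vb_gpd_map G V W f}"
 "Idn (VB G) V = (restrict id (pts (V0 V)),restrict id (pts (V1 V)))"
 "Cmp (VB G) U V W k h = (compose (pts (V0 U)) (fst k) (fst h),compose (pts (V1 U)) (snd k) (snd h))" by (simp_all add: VB_def)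

lemma VB_category:
 fixes G :: "('b,'g) lgpd" shows "category (VB G :: (('b,'g,'a) vbgpd_pt,('g,'a) vb_mor) cat)" unfolding category_def
proof (intro conjI ballI)
 fix V :: "('b,'g,'a) vbgpd_pt" assume "V : Objs (VB G)"
 hence V: "vb_groupoid G V" by (simp add: VB_simps)
 show "Idn (VB G) V : Hom (VB G) V V"
  using vgmap_cong[OF V vgmap_id[OF V],of "restrict id (pts (V0 V))" "restrict id (pts (V1 V))"]
  by (simp add: VB_simps vb_gpd_map_iff[OF V])
 fix W :: "('b,'g,'a) vbgpd_pt" assume "W : Objs (VB G)"
 hence W: "vb_groupoid G W" by (simp add: VB_simps)
 fix h assume "h : Hom (VB G) V W"
 hence h: "vgmap V W (fst h) (snd h)" "fst h : extensional (pts (V0 V))" "snd h : extensional (pts (V1 V))"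
  using vb_gpd_map_iff[OF V,of W "fst h" "snd h"] by (auto simp: VB_simps)
 show "Cmp (VB G) V V W h (Idn (VB G) V) = h"
  using h by (cases h) (auto simp: VB_simps compose_def restrict_def extensional_def fun_eq_iff)
 show "Cmp (VB G) V W W (Idn (VB G) W) h = h"
  using h vgmap_pts[OF W h(1)] by (cases h) (auto simp: VB_simps compose_def restrict_def extensional_def fun_eq_iff)
 fix X :: "('b,'g,'a) vbgpd_pt" assume "X : Objs (VB G)"
 hence X: "vb_groupoid G X" by (simp add: VB_simps)
 fix k assume "k : Hom (VB G) W X"
 hence k: "vgmap W X (fst k) (snd k)" using vb_gpd_map_iff[OF W,of X "fst k" "snd k"] by (auto simp: VB_simps)
 show "Cmp (VB G) V W X k h : Hom (VB G) V X"
  using vgmap_cong[OF V vgmap_comp[OF V W h(1) k],of "compose (pts (V0 V)) (fst k) (fst h)" "compose (pts (V1 V)) (snd k) (snd h)"]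
  by (simp add: VB_simps vb_gpd_map_iff[OF V] compose_def)
 fix Y :: "('b,'g,'a) vbgpd_pt" and l assume "Y : Objs (VB G)" "l : Hom (VB G) X Y"
 show "Cmp (VB G) V X Y l (Cmp (VB G) V W X k h) = Cmp (VB G) V W Y (Cmp (VB G) W X Y l k) h"
  using vgmap_pts[OF W h(1)] by (auto simp: VB_simps compose_def restrict_def fun_eq_iff)
qed

section \<open>Criteria for groupoids, and linear identities in a fibre\<close>

lemma groupoid_left_inverse:
 assumes G: "groupoid G" and g: "g <: Ar G" and h: "cmp G h g" "mul G h g = unt G (src G g)" shows "ginv G g = h"
proof -
 have "h = mul G (mul G h g) (ginv G g)" by (rule gp_inv_cancel_right[OF G h(1),symmetric])
 also have "... = ginv G g" unfolding h(2) using gp_idl[OF G gp_inv[OF G g]] gp_tgt_inv[OF G g] by simp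
 finally show ?thesis by (rule sym)
qed

text \<open>As for groups, left inverses suffice: if h is a left inverse of g and k one of h, then g
  = k, so h is a right inverse of g as well.\<close>

lemma groupoidI:
 assumes st: "!!g. g <: Ar G ==> src G g <: Ob G & tgt G g <: Ob G"
  and u: "!!x. x <: Ob G ==> unt G x <: Ar G & src G (unt G x) = x & tgt G (unt G x) = x"
  and m: "!!g h. cmp G g h ==> mul G g h <: Ar G & src G (mul G g h) = src G h & tgt G (mul G g h) = tgt G g"
  and as: "!!g h k. cmp G g h ==> cmp G h k ==> mul G (mul G g h) k = mul G g (mul G h k)"
  and id: "!!g. g <: Ar G ==> mul G g (unt G (src G g)) = g & mul G (unt G (tgt G g)) g = g"
  and l: "!!g. g <: Ar G ==> EX h. cmp G h g & mul G h g = unt G (src G g)" shows "groupoid G"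
proof -
 have "EX h. is_inverse G g h" if g: "g <: Ar G" for g
 proof -
  obtain h where h: "cmp G h g" "mul G h g = unt G (src G g)" using l[OF g] by blast
  have th: "tgt G h = src G g" using m[OF h(1)] h(2) u st[OF g] by simp
  obtain k where k: "cmp G k h" "mul G k h = unt G (src G h)" using l h by blast
  have tk: "tgt G k = src G h" using m[OF k(1)] k(2) u st h by simp
  have "g = mul G (mul G k h) g" using id[OF g] k(2) h(1) by metis
  also have "... = mul G k (mul G h g)" by (rule as[OF k(1) h(1)])
  also have "... = k" using id[of k] k h th by simp
  finally have "g = k" .
  thus ?thesis using h k th tk th id[OF g] st[OF g] unfolding is_inverse_def by metis
 qed
 thus ?thesis using assms(1-5) unfolding groupoid_def by blast
qed

text \<open>Each identity holds for vectors in R^k and is checked in the coordinates of a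
  trivialisation; \<open>real_vector_space_on\<close> is not suited to direct calculation.\<close>

lemma vb_cancel:
 assumes E: "vector_bundle E" and e: "e <: tot E" "e' <: tot E" "proj E e = proj E e'"
 shows "vadd E (vadd E e e') (vscale E (-1) e) = e'" "vadd E e (vadd E e' (vscale E (-1) e)) = e'"
  "vadd E e (vadd E e' (vscale E (-1) e')) = e" "vadd E e (vscale E (-1) (vadd E e' (vscale E (-1) e'))) = e"
  "vadd E (vscale E c e) (vscale E a (vscale E c e')) = vscale E c (vadd E e (vscale E a e'))"
  "f <: tot E ==> f' <: tot E ==> proj E f = proj E e' ==> proj E f' = proj E e' ==>
   vadd E (vadd E e e') (vscale E a (vadd E f f')) = vadd E (vadd E e (vscale E a f)) (vadd E e' (vscale E a f'))"
  "vscale E 1 e = e" "vadd E (vscale E a e) (vscale E b (vscale E c e)) = vscale E (a + b * c) e" "vadd E e (vscale E 0 e') = e"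
  "vscale E 0 e = vscale E 0 e'" "vscale E a (vscale E b e) = vscale E (a * b) e" "vscale E a (vadd E e e') = vadd E (vscale E a e) (vscale E a e')"
proof -
 obtain U k ta th where t: "proj E e : U" "triv E U k ta th" by (rule vb_triv[OF E vb_proj_pts[OF E e(1)]])
 note D = trivD[OF t(2)]
 note p = vb_add_pts[OF E] vb_scale_pts[OF E]
 show "vadd E (vadd E e e') (vscale E (-1) e) = e'" "vadd E e (vadd E e' (vscale E (-1) e)) = e'"
  "vadd E e (vadd E e' (vscale E (-1) e')) = e" "vadd E e (vscale E (-1) (vadd E e' (vscale E (-1) e'))) = e"
  "vadd E (vscale E c e) (vscale E a (vscale E c e')) = vscale E c (vadd E e (vscale E a e'))"
  "vscale E 1 e = e" "vadd E (vscale E a e) (vscale E b (vscale E c e)) = vscale E (a + b * c) e" "vadd E e (vscale E 0 e') = e"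
  "vscale E 0 e = vscale E 0 e'" "vscale E a (vscale E b e) = vscale E (a * b) e" "vscale E a (vadd E e e') = vadd E (vscale E a e) (vscale E a e')"
  by (rule triv_eqI[OF t(2)]; use e t(1) p D(7,8) in "simp add: algebra_simps")+
 show "vadd E (vadd E e e') (vscale E a (vadd E f f')) = vadd E (vadd E e (vscale E a f)) (vadd E e' (vscale E a f'))"
  if f: "f <: tot E" "f' <: tot E" "proj E f = proj E e'" "proj E f' = proj E e'"
  by (rule triv_eqI[OF t(2)]; use e f t(1) p D(7,8) in "simp add: algebra_simps")
qed

section \<open>The image of an idempotent endomorphism is locally trivial\<close>

text \<open>In trivialisations a linear bundle map is a smooth family of matrices. The map a allows
  the family to be parametrised by another manifold, for instance by arrows through their
  source.\<close>

lemma linfam_bundle_map: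
 assumes E: "vector_bundle E" and F: "vector_bundle F" and M: "manifold M" and t: "triv E U k ta th" and t': "triv F U' k' ta' th'"
  and a: "sm_on M S (base E) a" "!!p. p : S ==> a p : U" and f: "smooth (tot E) (tot F) f"
  and fU: "!!p e. p : S ==> e <: tot E ==> proj E e = a p ==> proj F (f e) : U'"
  and fa: "!!e e'. e <: tot E ==> e' <: tot E ==> proj E e = proj E e' ==>
   proj F (f e) = proj F (f e') & f (vadd E e e') = vadd F (f e) (f e')"
  and fs: "!!e c. e <: tot E ==> f (vscale E c e) = vscale F c (f e)" shows "linfam M S k k' (%p y. ta' (f (th (a p) y)))"
 unfolding linfam_def lin_def
proof (intro conjI ballI allI impI)
 note D = trivD[OF t] and D' = trivD[OF t'] and B = vb_base[OF E]
 show S: "opn M S" by (rule sm_open[OF a(1)])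
 have th: "th (a p) y <: tot E" "proj E (th (a p) y) = a p" if "p : S" "y : Rn k" for p y
  using triv_pts[OF E t] D(4) that a(2) by auto
 have f1: "f (th (a p) y) <: tot F" "proj F (f (th (a p) y)) : U'" if "p : S" "y : Rn k" for p y
  using sm_pts[OF vb_tot[OF F] f] fU th[OF that] that by auto
 fix p y assume p: "p : S" and y: "y : Rn k"
 show "ta' (f (th (a p) y)) : Rn k'" by (rule triv_Rn[OF F t' f1[OF p y]])
 show "ta' (f (th (a p) (%i. c * y i))) = (%i. c * ta' (f (th (a p) y)) i)" for c
  using triv_theta_scale[OF E t a(2)[OF p] y] fs th[OF p y] D'(8)[OF f1[OF p y]] by simp
 fix z assume z: "z : Rn k"
 show "ta' (f (th (a p) (%i. y i + z i))) = (%i. ta' (f (th (a p) y)) i + ta' (f (th (a p) z)) i)"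
  using triv_theta_add[OF E t a(2)[OF p] y z] fa[of "th (a p) y" "th (a p) z"] th[OF p y] th[OF p z] D'(7)[OF f1(1)[OF p y] f1(1)[OF p z] f1(2)[OF p y]]
  by simp
next
 fix j i assume j: "j < k"
 have "sm_on M S (tot E) (%p. th (a p) (ei j))"
  by (rule triv_smooth[OF E t M a]) (use ei_Rn[OF j] fsm_const[OF M sm_open[OF a(1)]] in auto)
 from smcomp[OF M vb_tot[OF E] this f]
 show "fsm M S (%p. ta' (f (th (a p) (ei j))) i)"
  by (rule triv_fsm[OF F t' M]) (use fU triv_pts[OF E t] trivD(4)[OF t] a(2) ei_Rn[OF j] in auto)
qed

text \<open>
  For projections P and P' the map L = P P' + (1 - P) (1 - P') satisfies L P' = P L. It is the identity
  when P = P', hence nearby it is invertible and carries the image of the constant projection to that of P.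
\<close>

lemma idempotent_frame:
 assumes E: "vector_bundle E" and Q: "smooth (tot E) (tot E) Q" and Qp: "!!e. e <: tot E ==> proj E (Q e) = proj E e"
  and Qa: "!!e e'. e <: tot E ==> e' <: tot E ==> proj E e = proj E e' ==> Q (vadd E e e') = vadd E (Q e) (Q e')"
  and Qs: "!!c e. e <: tot E ==> Q (vscale E c e) = vscale E c (Q e)"
  and QQ: "!!e. e <: tot E ==> Q (Q e) = Q e" and p0: "p0 <: base E"
 obtains U r nu mu where "opn (base E) U" "p0 : U"
  "sm_on (tot E) {e : pts (tot E). proj E e : U} (eucl r) nu"
  "sm_on (prod_mfd (base E) (eucl r)) (U \<times> Rn r) (tot E) (%(p,y). mu p y)"
  "!!p y. p : U ==> y : Rn r ==> proj E (mu p y) = p & Q (mu p y) = mu p y & nu (mu p y) = y"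
  "!!e. e <: tot E ==> proj E e : U ==> Q e = e ==> mu (proj E e) (nu e) = e"
  "!!e e'. e <: tot E ==> e' <: tot E ==> proj E e : U ==> proj E e = proj E e' ==>
   nu (vadd E e e') = (%i. nu e i + nu e' i)"
  "!!c e. e <: tot E ==> proj E e : U ==> nu (vscale E c e) = (%i. c * nu e i)"
proof -
 note T = vb_tot[OF E] and B = vb_base[OF E]
 obtain U0 k ta th where pU0: "p0 : U0" and t: "triv E U0 k ta th" by (rule vb_triv[OF E p0])
 note D = trivD[OF t]
 have thp: "th p x <: tot E" if "p : U0" "x : Rn k" for p x by (rule triv_pts[OF E t that])
 have taR: "ta e : Rn k" if "e <: tot E" "proj E e : U0" for e by (rule triv_Rn[OF E t that])
 have Qt: "Q e <: tot E" if "e <: tot E" for e by (rule sm_pts[OF T Q that])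
 define P where "P p x = ta (Q (th p x))" for p x
 have Pe: "P (proj E e) (ta e) = ta (Q e)" if "e <: tot E" "proj E e : U0" for e using D(6)[OF that] by (simp add: P_def)
 have U0: "opn (base E) U0" by (rule D(1))
 have PF: "linfam (base E) U0 k k P" unfolding P_def[abs_def]
  by (rule linfam_bundle_map[OF E E B t t sm_id[OF B U0] _ Q]) (use Qp Qa Qs in auto)
 note Pl = lfam_lin[OF PF]
 define P0 where "P0 = P p0"
 have P0l: "lin k k P0" unfolding P0_def by (rule Pl[OF pU0])
 \<comment> \<open>The complementary projection 1 - P.\<close>
 define N where "N p x = (%i. x i + - P p x i)" for p x
 have NF: "linfam (base E) U0 k k N" unfolding N_def
  by (rule linfam_add[OF B linfam_const[OF B U0 lin_id] linfam_uminus[OF B PF]])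
 define N0 where "N0 = N p0"
 have N0l: "lin k k N0" unfolding N0_def by (rule lfam_lin[OF NF pU0])
 define L where "L p x = (%i. P p (P0 x) i + N p (N0 x) i)" for p x
 have LF: "linfam (base E) U0 k k L" unfolding L_def
  by (rule linfam_add[OF B linfam_compose[OF B linfam_const[OF B U0 P0l] PF] linfam_compose[OF B linfam_const[OF B U0 N0l] NF]])
 have PP: "P p (P p x) = P p x" if p: "p : U0" and x: "x : Rn k" for p x
 proof -
  have a: "Q (th p x) <: tot E" "proj E (Q (th p x)) = p" using Qt Qp thp[OF p x] D(4)[OF p x] by auto
  thus ?thesis using Pe[OF a(1)] QQ[OF thp[OF p x]] p by (simp add: P_def)
 qed
 have PN: "P p (N p x) = (%i. 0)" if p: "p : U0" and x: "x : Rn k" for p x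
  using lin_diff[OF Pl[OF p] x lin_Rn[OF Pl[OF p] x]] PP[OF p x] by (simp add: N_def)
 have L0: "L p0 x = x" if x: "x : Rn k" for x
  using PP[OF pU0 x] PN[OF pU0 x] by (simp add: L_def P0_def N0_def fun_eq_iff) (simp add: N_def)
 have LP: "L p (P0 x) = P p (L p x)" if p: "p : U0" and x: "x : Rn k" for p x
 proof -
  have x0: "P0 x : Rn k" "N0 x : Rn k" using lin_Rn[OF P0l x] lin_Rn[OF N0l x] .
  have a: "P p (P0 x) : Rn k" "N p (N0 x) : Rn k" using lin_Rn[OF Pl[OF p] x0(1)] lin_Rn[OF lfam_lin[OF NF p] x0(2)] .
  have n: "N0 (P0 x) = (%i. 0)" using PP[OF pU0 x] by (simp add: N0_def P0_def N_def)
  have "L p (P0 x) = P p (P0 x)" using PP[OF pU0 x] n lin_0[OF lfam_lin[OF NF p]] by (simp add: L_def P0_def)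
  moreover have "P p (L p x) = P p (P0 x)" unfolding L_def using lin_add[OF Pl[OF p] a] PP[OF p x0(1)] PN[OF p x0(2)] by simp
  ultimately show ?thesis by simp
 qed
 obtain U R where U: "opn (base E) U" "p0 : U" "U <= U0" and RF: "linfam (base E) U k k R"
  and LR: "!!p x. p : U ==> x : Rn k ==> L p (R p x) = x" and RL: "!!p x. p : U ==> x : Rn k ==> R p (L p x) = x"
  using linfam_inverse[OF B LF pU0 L0] by blast
 \<comment> \<open>The image of the constant projection P0, with linear coordinates A and
   parametrisation C. It is the model fibre of the image bundle.\<close>
 define S where "S = {x : Rn k. P0 x = x}"
 have "EX r A C. lin k r A & lin r k C & (ALL y:Rn r. C y : S & A (C y) = y) & (ALL x:S. C (A x) = x)" by (rule subspace_coords)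
   (use lin_0[OF P0l] lin_add[OF P0l] lin_scale[OF P0l] in "auto simp: S_def Rn_0 Rn_add Rn_scale")
 then obtain r A C where A: "lin k r A" and C: "lin r k C" and CS: "!!y. y : Rn r ==> C y : S" and AC: "!!y. y : Rn r ==> A (C y) = y"
  and CA: "!!x. x : S ==> C (A x) = x" by blast
 have PR: "P0 (R p x) = R p (P p x)" if p: "p : U" and x: "x : Rn k" for p x
 proof -
  have pU: "p : U0" using p U by blast
  have r: "R p x : Rn k" by (rule lin_Rn[OF lfam_lin[OF RF p] x])
  have "L p (P0 (R p x)) = P p x" using LP[OF pU r] LR[OF p x] by simp
  thus ?thesis using RL[OF p lin_Rn[OF P0l r]] by simp
 qed
 \<comment> \<open>The frame mu is the constant subspace S moved by L p, and nu undoes this. As R p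
   and A are defined on all of R^k, nu is linear on whole fibres and not just on the image of
   Q.\<close>
 define nu where "nu e = A (R (proj E e) (ta e))" for e
 define mu where "mu p y = th p (L p (C y))" for p y
 have LU: "linfam (base E) U k k L" by (rule linfam_subset[OF B LF U(1,3)])
 have LC: "L p (C y) : Rn k" if "p : U" "y : Rn r" for p y by (rule lin_Rn[OF lfam_lin[OF LU that(1)] lin_Rn[OF C that(2)]])
 let ?EU = "{e : pts (tot E). proj E e : U}"
 have EU: "opn (tot E) ?EU" by (rule sm_preim[OF T B vb_proj[OF E] U(1)])
 have pS: "sm_on (tot E) ?EU (base E) (proj E)" by (rule sm_sub[OF T vb_proj[OF E] EU]) auto
 have taS: "fsm (tot E) ?EU (%e. ta e i)" for i by (rule triv_fsm[OF E t T sm_id[OF T EU]]) (use U in auto)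
 show thesis
 proof (rule that[of U r nu mu])
  show "opn (base E) U" "p0 : U" by (fact U)+
  have AF: "linfam (base E) U k r (%p x. A (R p x))" by (rule linfam_compose[OF B RF linfam_const[OF B U(1) A]])
  have "fsm (tot E) ?EU (%e. nu e i)" for i unfolding nu_def by (rule linfam_apply[OF T B AF pS _ _ taS]) (use taR U in auto)
  moreover have "nu e : Rn r" if "e : ?EU" for e unfolding nu_def by (rule lin_Rn[OF lfam_lin[OF AF]]) (use that taR U in auto)
  ultimately show "sm_on (tot E) ?EU (eucl r) nu" unfolding sm_euclid[OF T] using EU by blast
  let ?PR = "prod_mfd (base E) (eucl r)"
  have PRm: "manifold ?PR" by (rule mf_prod[OF B mfE])
  have oUR: "opn ?PR (U \<times> Rn r)" by (rule prod_open[OF B mfE U(1)]) (simp add: eucls)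
  have f: "sm_on ?PR (U \<times> Rn r) (base E) fst"
   by (rule sm_sub[OF PRm smooth_fst[OF B mfE] oUR]) (use opsub[OF U(1)] in "auto simp: eucls")
  have s: "sm_on ?PR (U \<times> Rn r) (eucl r) snd"
   by (rule sm_sub[OF PRm smooth_snd[OF B mfE] oUR]) (use opsub[OF U(1)] in "auto simp: eucls")
  have LCF: "linfam (base E) U r k (%p y. L p (C y))" by (rule linfam_compose[OF B linfam_const[OF B U(1) C] LU])
  have "sm_on ?PR (U \<times> Rn r) (tot E) (%q. th (fst q) (L (fst q) (C (snd q))))"
  proof (rule triv_smooth[OF E t PRm f])
   show "fsm ?PR (U \<times> Rn r) (%q. L (fst q) (C (snd q)) i)" for i
    by (rule linfam_apply[OF PRm B LCF f _ _ fsm_of_smooth[OF PRm s]]) auto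
  qed (use U LC in auto)
  thus "sm_on ?PR (U \<times> Rn r) (tot E) (%(p,y). mu p y)" by (simp add: mu_def case_prod_beta')
  show "proj E (mu p y) = p & Q (mu p y) = mu p y & nu (mu p y) = y" if p: "p : U" and y: "y : Rn r" for p y
  proof -
   have pU: "p : U0" using p U by blast
   have c: "C y : Rn k" "P0 (C y) = C y" using CS[OF y] by (auto simp: S_def)
   note l = LC[OF p y]
   have m: "proj E (mu p y) = p" "ta (mu p y) = L p (C y)" "mu p y <: tot E"
    using D(4,5)[OF pU l] thp[OF pU l] by (auto simp: mu_def)
   have "ta (Q (mu p y)) = ta (mu p y)" using Pe[OF m(3)] m(1,2) pU LP[OF pU c(1)] c(2) by simp
   hence "Q (mu p y) = mu p y" by (intro triv_eqI[OF t Qt[OF m(3)] m(3)]) (use Qp[OF m(3)] m(1) pU in auto)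
   moreover have "nu (mu p y) = y" using m RL[OF p c(1)] AC[OF y] by (simp add: nu_def)
   ultimately show ?thesis using m by blast
  qed
  show "mu (proj E e) (nu e) = e" if e: "e <: tot E" "proj E e : U" "Q e = e" for e
  proof -
   have pU: "proj E e : U0" using e U by blast
   note x = taR[OF e(1) pU]
   have "P (proj E e) (ta e) = ta e" using Pe[OF e(1) pU] e(3) by simp
   hence "P0 (R (proj E e) (ta e)) = R (proj E e) (ta e)" using PR[OF e(2) x] by simp
   hence "R (proj E e) (ta e) : S" using lin_Rn[OF lfam_lin[OF RF e(2)] x] by (simp add: S_def)
   thus ?thesis using CA LR[OF e(2) x] D(6)[OF e(1) pU] by (simp add: mu_def nu_def)
  qed
  show "nu (vadd E e e') = (%i. nu e i + nu e' i)" if "e <: tot E" "e' <: tot E" "proj E e : U" "proj E e = proj E e'" for e e'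
  proof -
   have pU: "proj E e : U0" "proj E e' : U0" using that U by auto
   show ?thesis using D(7)[OF that(1,2) pU(1) that(4)] vb_add_pts[OF E that(1,2,4)]
     lin_add[OF lfam_lin[OF AF that(3)] taR[OF that(1) pU(1)] taR[OF that(2) pU(2)]] that(4) by (simp add: nu_def)
  qed
  show "nu (vscale E c e) = (%i. c * nu e i)" if "e <: tot E" "proj E e : U" for c e
  proof -
   have pU: "proj E e : U0" using that U by auto
   show ?thesis using D(8)[OF that(1) pU] vb_scale_pts[OF E that(1)] lin_scale[OF lfam_lin[OF AF that(2)] taR[OF that(1) pU]]
    by (simp add: nu_def)
  qed
 qed
qed

section \<open>Weak representations\<close>

lemma pullback_simps:
 "V0 (pullback P f V) = fibre_prod P f (V0 V) (pr0 V)" "V1 (pullback P f V) = fibre_prod P f (V1 V) (pr1 V)"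
 "src (gpd (pullback P f V)) (p,v) = (p,vsrc V v)" "tgt (gpd (pullback P f V)) (p,v) = (p,vtgt V v)"
 "unt (gpd (pullback P f V)) (p,x) = (p,vunt V x)" "mul (gpd (pullback P f V)) (p,v) (q,w) = (p,vmul V v w)"
 "pr0 (pullback P f V) = fst" "pr1 (pullback P f V) = fst"
 "add0 (pullback P f V) (p,x) (q,y) = (p,add0 V x y)" "scale0 (pullback P f V) c (p,x) = (p,scale0 V c x)"
 "add1 (pullback P f V) (p,v) (q,w) = (p,add1 V v w)" "scale1 (pullback P f V) c (p,v) = (p,scale1 V c v)"
 by (simp_all add: pullback_def)

context
 fixes M :: "'b mfd" and V :: "('x,'y,'b,'b) vbgpd"
 assumes V: "vb_groupoid (tgpd M) V"
begin

lemma l_M: "manifold M" using vg_G0[OF V] by (simp add: trivs)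

lemma l_pr0_pts: "x <: V0 V ==> pr0 V x <: M" and l_pr1_pts: "v <: V1 V ==> pr1 V v <: M"
 and l_pr_src: "v <: V1 V ==> pr0 V (vsrc V v) = pr1 V v" and l_pr_tgt: "v <: V1 V ==> pr0 V (vtgt V v) = pr1 V v"
 and l_pr_unt: "x <: V0 V ==> pr1 V (vunt V x) = pr0 V x" and l_pr_mul: "cmp (gpd V) v w ==> pr1 V (vmul V v w) = pr1 V v"
 using vg_pr0_pts[OF V] vg_pr1_pts[OF V] vg_pr_src[OF V] vg_pr_tgt[OF V] vg_pr_unt[OF V] vg_pr_mul[OF V] by (simp_all add: trivs)

lemma l_pr_comp: "cmp (gpd V) v w ==> pr1 V v = pr1 V w" using l_pr_src[of v] l_pr_tgt[of w] by simp

lemma l_sm_pr0: "smooth (V0 V) M (pr0 V)" and l_sm_pr1: "smooth (V1 V) M (pr1 V)"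
 and l_sub_pr0: "submersion (V0 V) M (pr0 V)" and l_sub_pr1: "submersion (V1 V) M (pr1 V)"
 using vg_pr0[OF V] vg_pr1[OF V] vg_sub_pr0[OF V] vg_sub_pr1[OF V] by (simp_all add: trivs)

context
 fixes P :: "'p mfd" and f :: "'p => 'b"
 assumes P: "manifold P" and f: "smooth P M f"
begin

lemmas pb0 = P vg_V0[OF V] l_M f l_sub_pr0
lemmas pb1 = P vg_V1[OF V] l_M f l_sub_pr1

lemma pullback_map_iff:
 assumes fb: "smooth P N fb" shows "llgb_map P N (pullback P f V) W fb (a,b) <->
   smooth (fibre_prod P f (V0 V) (pr0 V)) (V0 W) a &
   smooth (fibre_prod P f (V1 V) (pr1 V)) (V1 W) b &
   (ALL p:pts P. ALL x:pts (V0 V). f p = pr0 V x --> pr0 W (a (p,x)) = fb p & b (p,vunt V x) = vunt W (a (p,x))) &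
   (ALL p:pts P. ALL v:pts (V1 V). f p = pr1 V v --> pr1 W (b (p,v)) = fb p &
    vsrc W (b (p,v)) = a (p,vsrc V v) & vtgt W (b (p,v)) = a (p,vtgt V v)) &
   (ALL p:pts P. ALL v w. cmp (gpd V) v w --> f p = pr1 V v --> b (p,vmul V v w) = vmul W (b (p,v)) (b (p,w))) &
   (ALL p:pts P. ALL x:pts (V0 V). ALL y:pts (V0 V). f p = pr0 V x --> f p = pr0 V y --> a (p,add0 V x y) = add0 W (a (p,x)) (a (p,y))) &
   (ALL p:pts P. ALL x:pts (V0 V). ALL c. f p = pr0 V x --> a (p,scale0 V c x) = scale0 W c (a (p,x))) &
   (ALL p:pts P. ALL x:pts (V1 V). ALL y:pts (V1 V). f p = pr1 V x --> f p = pr1 V y --> b (p,add1 V x y) = add1 W (b (p,x)) (b (p,y))) &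
   (ALL p:pts P. ALL x:pts (V1 V). ALL c. f p = pr1 V x --> b (p,scale1 V c x) = scale1 W c (b (p,x)))"
 unfolding llgb_map_def lgpd_map_def vb_map_def buns trivs fst_conv snd_conv pullback_simps case_prod_conv
  smap_iff[OF mf_fibre[OF pb0]] smap_iff[OF mf_fibre[OF pb1]] smap_iff[OF P]
  fib_pts[OF pb0] fib_pts[OF pb1] using fb l_pr_comp by (auto simp: pullback_simps)

lemma pullback_nat_iff:
 assumes fb: "smooth P N fb" shows "llgb_nat_trans P N (pullback P f V) W fb F H T <->
   smooth (fibre_prod P f (V0 V) (pr0 V)) (V1 W) T &
   (ALL p:pts P. ALL x:pts (V0 V). f p = pr0 V x --> pr1 W (T (p,x)) = fb p &
    vsrc W (T (p,x)) = fst F (p,x) & vtgt W (T (p,x)) = fst H (p,x)) &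
   (ALL p:pts P. ALL x:pts (V0 V). ALL y:pts (V0 V). f p = pr0 V x --> f p = pr0 V y --> T (p,add0 V x y) = add1 W (T (p,x)) (T (p,y))) &
   (ALL p:pts P. ALL x:pts (V0 V). ALL c. f p = pr0 V x --> T (p,scale0 V c x) = scale1 W c (T (p,x))) &
   (ALL p:pts P. ALL v:pts (V1 V). f p = pr1 V v -->
    vmul W (T (p,vtgt V v)) (snd F (p,v)) = vmul W (snd H (p,v)) (T (p,vsrc V v)))"
 unfolding llgb_nat_trans_def vb_map_def buns trivs pullback_simps
  smap_iff[OF mf_fibre[OF pb0]] smap_iff[OF P]
  fib_pts[OF pb0] fib_pts[OF pb1] using fb by (auto simp: pullback_simps)

end

end

abbreviation "W0 R == Ob (wgpd R)"
abbreviation "W1 R == Ar (wgpd R)"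
abbreviation "p0 R == pr0 (bnd R)"
abbreviation "p1 R == pr1 (bnd R)"
abbreviation "P0 G R == fibre_prod (Ar G) (src G) (W0 R) (p0 R)"
abbreviation "P1 G R == fibre_prod (Ar G) (src G) (W1 R) (p1 R)"
abbreviation "P2 G R == fibre_prod (Ar2 G) (%(g,k). src G k) (W0 R) (p0 R)"

context
 fixes G :: "('b,'g) lgpd" and R :: "('b,'g,'x,'y) wrep"
 assumes G: "lie_groupoid G" and V: "vb_groupoid (tgpd (Ob G)) (bnd R)"
begin

lemma src2_smooth: "smooth (Ar2 G) (Ob G) (%(g,k). src G k)" and tgt2_smooth: "smooth (Ar2 G) (Ob G) (%(g,k). tgt G g)"
 using sm_src[OF G lg_Ar2[OF G] lg_snd[OF G]] sm_tgt[OF G lg_Ar2[OF G] lg_fst[OF G]] by (simp_all add: case_prod_beta')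

lemmas q0 = pb0[OF V lg_Ar[OF G] lg_src[OF G]] and q1 = pb1[OF V lg_Ar[OF G] lg_src[OF G]]
 and q2 = pb0[OF V lg_Ar2[OF G] src2_smooth]

lemmas weak_rep_unfold = weak_rep_def[of G R,unfolded llgb_def pullback_map_iff[OF V lg_Ar[OF G] lg_src[OF G] lg_tgt[OF G]]
 pullback_nat_iff[OF V lg_Ar2[OF G] src2_smooth tgt2_smooth] fst_conv snd_conv case_prod_conv]

end

context
 fixes G :: "('b,'g) lgpd" and R :: "('b,'g,'x,'y) wrep"
 assumes G: "lie_groupoid G" and R: "weak_rep G R"
begin

lemma wr_V: "vb_groupoid (tgpd (Ob G)) (bnd R)" using R by (simp add: weak_rep_def llgb_def)

lemmas wr_unfold = R[unfolded weak_rep_unfold[OF G wr_V] lg_pts_Ar2[OF G]]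
lemmas qr0 = q0[OF G wr_V] and qr1 = q1[OF G wr_V] and qr2 = q2[OF G wr_V]

lemma wr_sm0_raw: "smooth (P0 G R) (W0 R) (%(g,x). act0 R g x)" and wr_sm1_raw: "smooth (P1 G R) (W1 R) (%(g,x). act1 R g x)"
 and wr_sma_raw: "smooth (P2 G R) (W1 R) (%((g,k),x). alp R g k x)" using wr_unfold by blast+

lemma wr_pr_act0: "g <: Ar G ==> x <: W0 R ==> src G g = p0 R x ==> p0 R (act0 R g x) = tgt G g"
 and wr_act_unt: "g <: Ar G ==> x <: W0 R ==> src G g = p0 R x ==> act1 R g (wunt R x) = wunt R (act0 R g x)"
 and wr_pr_act1: "g <: Ar G ==> v <: W1 R ==> src G g = p1 R v ==> p1 R (act1 R g v) = tgt G g"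
 and wr_src_act: "g <: Ar G ==> v <: W1 R ==> src G g = p1 R v ==> wsrc R (act1 R g v) = act0 R g (wsrc R v)"
 and wr_tgt_act: "g <: Ar G ==> v <: W1 R ==> src G g = p1 R v ==> wtgt R (act1 R g v) = act0 R g (wtgt R v)"
 and wr_act_mul: "g <: Ar G ==> cmp (wgpd R) v w ==> src G g = p1 R v ==>
   act1 R g (wmul R v w) = wmul R (act1 R g v) (act1 R g w)"
 and wr_act_add0: "g <: Ar G ==> x <: W0 R ==> y <: W0 R ==> src G g = p0 R x ==> src G g = p0 R y ==>
   act0 R g (add0 (bnd R) x y) = add0 (bnd R) (act0 R g x) (act0 R g y)"
 and wr_act_scale0: "g <: Ar G ==> x <: W0 R ==> src G g = p0 R x ==> act0 R g (scale0 (bnd R) c x) = scale0 (bnd R) c (act0 R g x)"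
 and wr_act_add1: "g <: Ar G ==> v <: W1 R ==> w <: W1 R ==> src G g = p1 R v ==> src G g = p1 R w ==>
   act1 R g (add1 (bnd R) v w) = add1 (bnd R) (act1 R g v) (act1 R g w)"
 and wr_act_scale1: "g <: Ar G ==> v <: W1 R ==> src G g = p1 R v ==> act1 R g (scale1 (bnd R) c v) = scale1 (bnd R) c (act1 R g v)"
 and wr_u0: "x <: W0 R ==> act0 R (unt G (p0 R x)) x = x" and wr_u1: "v <: W1 R ==> act1 R (unt G (p1 R v)) v = v"
 and wr_pr_alp: "cmp G g k ==> x <: W0 R ==> src G k = p0 R x ==> p1 R (alp R g k x) = tgt G g"
 and wr_src_alp: "cmp G g k ==> x <: W0 R ==> src G k = p0 R x ==> wsrc R (alp R g k x) = act0 R g (act0 R k x)"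
 and wr_tgt_alp: "cmp G g k ==> x <: W0 R ==> src G k = p0 R x ==> wtgt R (alp R g k x) = act0 R (mul G g k) x"
 and wr_alp_add: "cmp G g k ==> x <: W0 R ==> y <: W0 R ==> src G k = p0 R x ==> src G k = p0 R y ==>
   alp R g k (add0 (bnd R) x y) = add1 (bnd R) (alp R g k x) (alp R g k y)"
 and wr_alp_scale: "cmp G g k ==> x <: W0 R ==> src G k = p0 R x ==>
   alp R g k (scale0 (bnd R) c x) = scale1 (bnd R) c (alp R g k x)" and wr_nat: "cmp G g k ==> v <: W1 R ==> src G k = p1 R v ==>
   wmul R (alp R g k (wtgt R v)) (act1 R g (act1 R k v)) = wmul R (act1 R (mul G g k) v) (alp R g k (wsrc R v))"
 and wr_cocycle: "cmp G g k ==> cmp G k l ==> x <: W0 R ==> src G l = p0 R x ==>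
   wmul R (alp R g (mul G k l) x) (act1 R g (alp R k l x)) = wmul R (alp R (mul G g k) l x) (alp R g k (act0 R l x))"
 and wr_alp_unt: "g <: Ar G ==> x <: W0 R ==> src G g = p0 R x ==> alp R g (unt G (p0 R x)) x = wunt R (act0 R g x)"
 and wr_unt_alp: "g <: Ar G ==> x <: W0 R ==> src G g = p0 R x ==> alp R (unt G (tgt G g)) g x = wunt R (act0 R g x)"
 using wr_unfold by simp_all

lemma wr_sm0:
 assumes P: "manifold P" and g: "sm_on P S (Ar G) g" and x: "sm_on P S (W0 R) x" and c: "!!q. q : S ==> src G (g q) = p0 R (x q)"
 shows "sm_on P S (W0 R) (%q. act0 R (g q) (x q))" using smcomp[OF P mf_fibre[OF qr0] fib_pair[OF qr0 P g x c] wr_sm0_raw] by simp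

lemma wr_sm1:
 assumes P: "manifold P" and g: "sm_on P S (Ar G) g" and x: "sm_on P S (W1 R) x" and c: "!!q. q : S ==> src G (g q) = p1 R (x q)"
 shows "sm_on P S (W1 R) (%q. act1 R (g q) (x q))" using smcomp[OF P mf_fibre[OF qr1] fib_pair[OF qr1 P g x c] wr_sm1_raw] by simp

lemma wr_sma:
 assumes P: "manifold P" and g: "sm_on P S (Ar G) g" and k: "sm_on P S (Ar G) k" and x: "sm_on P S (W0 R) x"
  and gk: "!!q. q : S ==> src G (g q) = tgt G (k q)" and c: "!!q. q : S ==> src G (k q) = p0 R (x q)"
 shows "sm_on P S (W1 R) (%q. alp R (g q) (k q) (x q))"
proof -
 have "sm_on P S (P2 G R) (%q. ((g q,k q),x q))" by (rule fib_pair[OF qr2 P lg_pair[OF G P g k gk] x]) (simp_all add: c)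
 from smcomp[OF P mf_fibre[OF qr2] this wr_sma_raw] show ?thesis by simp
qed

lemma wr_act0: 
 assumes "g <: Ar G" "x <: W0 R" "src G g = p0 R x" shows "act0 R g x <: W0 R"
 using sm_pts[OF vg_V0[OF wr_V] wr_sm0_raw,of "(g,x)"] assms by (simp add: fib_pts[OF qr0])

lemma wr_act1: 
 assumes "g <: Ar G" "v <: W1 R" "src G g = p1 R v" shows "act1 R g v <: W1 R"
 using sm_pts[OF vg_V1[OF wr_V] wr_sm1_raw,of "(g,v)"] assms by (simp add: fib_pts[OF qr1])

lemma wr_alp: 
 assumes "cmp G g k" "x <: W0 R" "src G k = p0 R x" shows "alp R g k x <: W1 R"
 using sm_pts[OF vg_V1[OF wr_V] wr_sma_raw,of "((g,k),x)"] assms by (simp add: fib_pts[OF qr2] lg_pts_Ar2[OF G])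

end

section \<open>The action groupoid\<close>

locale weak_rep_on =
 fixes G :: "('b,'g) lgpd" and R :: "('b,'g,'a) wrep_pt"
 assumes G: "lie_groupoid G" and R: "weak_rep G R"
begin

lemmas V = wr_V[OF G R]
lemmas E = vg_V[OF V] and gE = vg_gV[OF V] and gG = lg_gpd[OF G]
lemmas M0 = vg_V0[OF V] and M1 = vg_V1[OF V] and MO = lg_Ob[OF G] and MA = lg_Ar[OF G]
lemmas gs = gp_simps[OF gG] and es = gp_simps[OF gE]
lemmas w0 = wr_act0[OF G R] and w1 = wr_act1[OF G R] and wa = wr_alp[OF G R]

definition act_set :: "('g \<times> ('g,'a) point \<times> ('g,'a) point) set" where
 "act_set = {(g,x,v). g <: Ar G & x <: W0 R & v <: W1 R & src G g = p0 R x & wtgt R v = act0 R g x}"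

abbreviation "N1 == prod_mfd (Ar G) (prod_mfd (W0 R) (W1 R))"

lemma N1: "manifold N1" and M01: "manifold (prod_mfd (W0 R) (W1 R))" by (intro mf_prod M0 M1 MA)+

lemma N1_fst: "smooth N1 (Ar G) fst" and N1_snd: "smooth N1 (W0 R) (%q. fst (snd q))"
 and N1_thd: "smooth N1 (W1 R) (%q. snd (snd q))"
proof -
 show "smooth N1 (Ar G) fst" using smooth_fst[OF MA M01] by (simp add: pts_prod M0 M1 MA M01)
 have s: "smooth N1 (prod_mfd (W0 R) (W1 R)) snd" using smooth_snd[OF MA M01] by (simp add: pts_prod M0 M1 MA M01)
 show "smooth N1 (W0 R) (%q. fst (snd q))" "smooth N1 (W1 R) (%q. snd (snd q))"
  by (rule smcomp[OF N1 M01 s],simp add: pts_prod M0 M1 smooth_fst smooth_snd)+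
qed

text \<open>
  The arrow manifold is cut out by two equations; a local trivialisation of V_0 allows g to act on x
  also when the first one fails, so that the second makes sense nearby.
\<close>

lemma act_emb: "embedded N1 act_set"
proof (rule embedded_equalizer[OF N1 mf_prod[OF MO M0]])
 show "act_set <= pts N1" by (auto simp: act_set_def pts_prod M0 M1 MA M01)
 fix p assume "p : act_set"
 then obtain g x v where p: "p = (g,x,v)" and g: "g <: Ar G" and x: "x <: W0 R" and v: "v <: W1 R"
  and c: "src G g = p0 R x" "wtgt R v = act0 R g x" by (auto simp: act_set_def)
 have "p0 R x <: base (bun0 (tgpd (Ob G)) (bnd R))" using l_pr0_pts[OF V x] by (simp add: buns trivs)
 then obtain U k ta th where xU: "p0 R x : U" and t: "triv (bun0 (tgpd (Ob G)) (bnd R)) U k ta th"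
  by (rule vb_triv[OF vg_b0[OF V]]) blast
 note D = trivD[OF t,unfolded buns trivs]
 note T = triv_pts[OF vg_b0[OF V] t,unfolded buns trivs] triv_Rn[OF vg_b0[OF V] t,unfolded buns trivs]
 obtain U' r where U': "opn (W0 R) U'" "wtgt R v : U'" and r: "sm_on (W0 R) U' (W1 R) r" "r (wtgt R v) = v"
  "!!y. y : U' ==> wtgt R (r y) = y" by (rule sectionsE[OF lg_sec_tgt[OF E] v]) blast
 define S where "S = {q : pts N1. src G (fst q) : U & p0 R (fst (snd q)) : U}"
 have "opn N1 ({q : pts N1. src G (fst q) : U} Int {q : pts N1. p0 R (fst (snd q)) : U})"
  by (rule openin_Int; rule sm_preim[OF N1 MO _ D(1)],rule sm_src[OF G N1 N1_fst] vg_sm_pr0[OF V N1 N1_snd,unfolded trivs])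
 hence oS: "opn N1 S" by (simp add: S_def Collect_conj_eq2 Int_def conj_ac cong: conj_cong)
 have SN: "S <= pts N1" by (auto simp: S_def)
 note sub = sm_sub[OF N1 _ oS SN]
 \<comment> \<open>The equation H = K consists of the two equations src g = projection of x and
   target of v = g x. In K the vector x is first moved to the fibre over src g by its coordinates,
   which changes nothing where the first equation holds.\<close>
 define H where "H = (%q :: 'g \<times> ('g,'a) point \<times> ('g,'a) point. (p0 R (fst (snd q)),wtgt R (snd (snd q))))"
 define K where "K = (%q :: 'g \<times> ('g,'a) point \<times> ('g,'a) point. (src G (fst q),act0 R (fst q) (th (src G (fst q)) (ta (fst (snd q))))))"
 \<comment> \<open>The section of H through p: x moves to the fibre over y with fixed coordinates,
   and v moves along a section r of the target map. The arrow g and the coordinates of x do not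
   change, so K is constant along s.\<close>
 define s where "s = (%(y,w). (g,th y (ta x),r w))"
 have sH: "sm_on N1 S (prod_mfd (Ob G) (W0 R)) H" unfolding H_def
  by (rule smooth_pair[OF MO M0 N1 vg_sm_pr0[OF V N1 sub[OF N1_snd],unfolded trivs] sm_tgt[OF E N1 sub[OF N1_thd]]])
 have "sm_on N1 S (W0 R) (%q. th (src G (fst q)) (ta (fst (snd q))))"
 proof (rule triv_smooth[OF vg_b0[OF V] t N1,unfolded buns trivs])
  show "sm_on N1 S (Ob G) (%q. src G (fst q))" by (rule sm_src[OF G N1 sub[OF N1_fst]])
  show "fsm N1 S (%q. ta (fst (snd q)) i)" for i
   by (rule triv_fsm[OF vg_b0[OF V] t N1,unfolded buns trivs]) (use sub[OF N1_snd] in "auto simp: S_def")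
 qed (use T(2) in "auto simp: S_def pts_prod M0 M1 MA M01")
 hence "sm_on N1 S (W0 R) (%q. act0 R (fst q) (th (src G (fst q)) (ta (fst (snd q)))))"
  by (rule wr_sm0[OF G R N1 sub[OF N1_fst]]) (use D(4) T(2) in "auto simp: S_def pts_prod M0 M1 MA M01")
 hence sK: "sm_on N1 S (prod_mfd (Ob G) (W0 R)) K" unfolding K_def
  by (rule smooth_pair[OF MO M0 N1 sm_src[OF G N1 sub[OF N1_fst]]])
 let ?W = "U \<times> U'"
 note MW = mf_prod[OF MO M0]
 have oW: "opn (prod_mfd (Ob G) (W0 R)) ?W" by (rule prod_open[OF MO M0 D(1) U'(1)])
 have WN: "?W <= pts (Ob G) \<times> pts (W0 R)" using opsub[OF D(1)] opsub[OF U'(1)] by auto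
 have f: "sm_on (prod_mfd (Ob G) (W0 R)) ?W (Ob G) fst" "sm_on (prod_mfd (Ob G) (W0 R)) ?W (W0 R) snd"
  by (rule sm_sub[OF MW _ oW WN],rule smooth_fst[OF MO M0] smooth_snd[OF MO M0])+
 have "sm_on (prod_mfd (Ob G) (W0 R)) ?W N1 (%q. (g,th (fst q) (ta x),r (snd q)))"
 proof (intro smooth_pair M0 M1 MA M01 MW)
  show "sm_on (prod_mfd (Ob G) (W0 R)) ?W (Ar G) (%q. g)" by (rule smooth_on_const[OF MW MA oW g])
  show "sm_on (prod_mfd (Ob G) (W0 R)) ?W (W0 R) (%q. th (fst q) (ta x))"
   by (rule triv_smooth[OF vg_b0[OF V] t MW,unfolded buns trivs,OF f(1)]) (use T(2)[OF x xU] fsm_const[OF MW oW] in auto)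
  show "sm_on (prod_mfd (Ob G) (W0 R)) ?W (W1 R) (%q. r (snd q))" by (rule sm_o[OF MW M0 f(2) r(1)]) auto
 qed
 hence ss: "sm_on (prod_mfd (Ob G) (W0 R)) ?W N1 s" by (simp add: s_def case_prod_beta')
 have th: "th y (ta z) = z" if "z <: W0 R" "y : U" "p0 R z = y" for y z using D(6) that by auto
 have ZS: "act_set Int S = {q : S. H q = K q}" by (auto simp: th act_set_def S_def H_def K_def pts_prod M0 M1 MA M01)
 have "ALL y:?W. s y : S & H (s y) = y & K (s y) = K p"
  using sm_pts[OF N1 ss] D(4,5) T(2)[OF x xU] r(3) c(1) xU by (auto simp: S_def H_def K_def s_def p)
 thus "EX S H K W s. opn N1 S & p : S & sm_on N1 S (prod_mfd (Ob G) (W0 R)) H &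
   sm_on N1 S (prod_mfd (Ob G) (W0 R)) K & act_set Int S = {q : S. H q = K q} & opn (prod_mfd (Ob G) (W0 R)) W & H p : W &
   sm_on (prod_mfd (Ob G) (W0 R)) W N1 s & s (H p) = p & (ALL y:W. s y : S & H (s y) = y & K (s y) = K p)"
  by (intro exI[of _ S] exI[of _ H] exI[of _ K] exI[of _ ?W] exI[of _ s] conjI oS sH sK ZS oW ss)
   (use g x v c xU U' r(2) D(6)[OF x xU] in "auto simp: p S_def H_def s_def pts_prod M0 M1 MA M01")
qed

abbreviation "A1 == V1 (Act_ob G R)"

lemma acts: "V0 (Act_ob G R) = W0 R" "src (AG G R) = obp"
 "tgt (AG G R) a = wsrc R (vcp a)" "unt (AG G R) x = Triple (unt G (p0 R x)) x (wunt R x)"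
 "mul (AG G R) a b = Triple (mul G (arp a) (arp b)) (obp b)
   (wmul R (wmul R (alp R (arp a) (arp b) (obp b)) (act1 R (arp a) (vcp b))) (vcp a))"
 "pr0 (Act_ob G R) = p0 R" "add0 (Act_ob G R) = add0 (bnd R)" "scale0 (Act_ob G R) = scale0 (bnd R)" "pr1 (Act_ob G R) = arp"
 "add1 (Act_ob G R) a b = Triple (arp a) (add0 (bnd R) (obp a) (obp b)) (add1 (bnd R) (vcp a) (vcp b))"
 "scale1 (Act_ob G R) c a = Triple (arp a) (scale0 (bnd R) c (obp a)) (scale1 (bnd R) c (vcp a))"
 by (simp_all add: Act_ob_def Let_def)

lemma act_Ar: "A1 = imfd (%(g,x,v). Triple g x v) (sub_mfd N1 act_set)"
proof -
 have i: "inj (%(g,x,v). Triple g x v)" by (auto simp: inj_def)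
 show ?thesis using push_mfd_eq[OF mf_sub[OF N1 act_emb] i] by (simp add: Act_ob_def Let_def act_set_def)
qed

lemma act_inj: "inj_on (%(g,x,v). Triple g x v) (pts (sub_mfd N1 act_set))" by (auto simp: inj_on_def)

lemma act_mfd: "manifold A1" unfolding act_Ar by (rule manifold_image[OF mf_sub[OF N1 act_emb] act_inj])

lemma act_pts: "pts A1 = (%(g,x,v). Triple g x v) ` act_set" unfolding act_Ar pts_image[OF mf_sub[OF N1 act_emb] act_inj]
 using pts_sub[OF N1,of act_set] act_emb by (simp add: embedded_def)

lemma act_iff: "Triple g x v <: A1 <-> g <: Ar G & x <: W0 R & v <: W1 R & src G g = p0 R x & wtgt R v = act0 R g x"
 by (auto simp: act_pts act_set_def image_iff)

lemma act_ptsE: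
 assumes "a <: A1"
 obtains g x v where "a = Triple g x v" "g <: Ar G" "x <: W0 R" "v <: W1 R" "src G g = p0 R x" "wtgt R v = act0 R g x"
  "p1 R v = tgt G g" "wsrc R v <: W0 R" "p0 R (wsrc R v) = tgt G g"
proof -
 obtain g x v where a: "a = Triple g x v" "g <: Ar G" "x <: W0 R" "v <: W1 R" "src G g = p0 R x" "wtgt R v = act0 R g x"
  using assms by (auto simp: act_pts act_set_def)
 have "p1 R v = tgt G g" using l_pr_tgt[OF V a(4)] wr_pr_act0[OF G R a(2,3,5)] a(6) by simp
 thus thesis using that a l_pr_src[OF V a(4)] es(1)[OF a(4)] by simp
qed

lemma act_coords: shows act_arrow: "smooth A1 (Ar G) arp" and act_obj: "smooth A1 (W0 R) obp" and act_vec: "smooth A1 (W1 R) vcp"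
proof -
 let ?T = "%(g,x,v). Triple g x v"
 note S = mf_sub[OF N1 act_emb]
 have ps: "pts (sub_mfd N1 act_set) = act_set" by (rule pts_sub[OF N1]) (use act_emb in "simp add: embedded_def")
 have "smooth A1 (sub_mfd N1 act_set) (ivi act_set ?T)"
  using smooth_image_inv[OF S act_inj] unfolding act_Ar[symmetric] ps act_pts[symmetric] .
 hence i: "smooth A1 N1 (ivi act_set ?T)" by (rule smcomp[OF act_mfd S]) (use smooth_incl[OF N1 act_emb] ps in simp)
 have e: "ivi act_set ?T a = (arp a,obp a,vcp a)" if "a <: A1" for a
 proof -
  have "inj_on ?T act_set" by (auto simp: inj_on_def)
  from inv_into_f_f[OF this] show ?thesis using that by (auto simp: act_pts)
 qed
 show "smooth A1 (Ar G) arp" by (rule sm_cong[OF act_mfd smcomp[OF act_mfd N1 i N1_fst]]) (simp add: e)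
 show "smooth A1 (W0 R) obp" by (rule sm_cong[OF act_mfd smcomp[OF act_mfd N1 i N1_snd]]) (simp add: e)
 show "smooth A1 (W1 R) vcp" by (rule sm_cong[OF act_mfd smcomp[OF act_mfd N1 i N1_thd]]) (simp add: e)
qed

lemma act_sm_arrow: "manifold P ==> sm_on P S A1 a ==> sm_on P S (Ar G) (%q. arp (a q))"
 and act_sm_obj: "manifold P ==> sm_on P S A1 a ==> sm_on P S (W0 R) (%q. obp (a q))"
 and act_sm_vec: "manifold P ==> sm_on P S A1 a ==> sm_on P S (W1 R) (%q. vcp (a q))"
 by (erule (1) smcomp[OF _ act_mfd _ act_arrow] smcomp[OF _ act_mfd _ act_obj] smcomp[OF _ act_mfd _ act_vec])+

text \<open>Together with \<open>act_coords\<close> this replaces charts of the arrow manifold: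
  smoothness of every structure map is read off its formula.\<close>

lemma act_sm_Triple:
 assumes P: "manifold P" and g: "sm_on P S (Ar G) g" and x: "sm_on P S (W0 R) x" and v: "sm_on P S (W1 R) v"
  and c: "!!q. q : S ==> src G (g q) = p0 R (x q)" "!!q. q : S ==> wtgt R (v q) = act0 R (g q) (x q)"
 shows "sm_on P S A1 (%q. Triple (g q) (x q) (v q))"
proof -
 note T = mf_sub[OF N1 act_emb]
 have "sm_on P S (sub_mfd N1 act_set) (%q. (g q,x q,v q))"
  by (rule smooth_into_sub[OF N1 act_emb P smooth_pair[OF MA M01 P g smooth_pair[OF M0 M1 P x v]]])
   (use sm_pts[OF MA g] sm_pts[OF M0 x] sm_pts[OF M1 v] c in "simp add: act_set_def")
 from smcomp[OF P T this smooth_image[OF T act_inj]] show ?thesis by (simp add: act_Ar)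
qed

end

section \<open>Composition, inverses and smooth structure maps of the action groupoid\<close>

context weak_rep_on
begin

lemmas wr_p = wr_pr_act0[OF G R] wr_pr_act1[OF G R] wr_src_act[OF G R] wr_tgt_act[OF G R]
 wr_pr_alp[OF G R] wr_src_alp[OF G R] wr_tgt_alp[OF G R] l_pr_src[OF V] l_pr0_pts[OF V]

text \<open>The third component is bracketed to the right, other than in \<open>Act_ob\<close>,
  which suits the associativity calculation below. The further conclusions record which factors are
  composable.\<close>

lemma act_mul:
 assumes ab: "cmp (AG G R) (Triple g x v) (Triple h y w)" shows "mul (AG G R) (Triple g x v) (Triple h y w) =
   Triple (mul G g h) y (wmul R (alp R g h y) (wmul R (act1 R g w) v))"
  and "cmp (wgpd R) (alp R g h y) (act1 R g w)" "cmp (wgpd R) (act1 R g w) v" "cmp G g h"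
  and "x = wsrc R w" "p1 R w = tgt G h" "p1 R v = tgt G g"
proof -
 have a: "g <: Ar G" "x <: W0 R" "v <: W1 R" "src G g = p0 R x" "wtgt R v = act0 R g x"
  "h <: Ar G" "y <: W0 R" "w <: W1 R" "src G h = p0 R y" "wtgt R w = act0 R h y" "x = wsrc R w"
  using ab act_iff[of g x v] act_iff[of h y w] by (auto simp: acts(2,3))
 have pw: "p1 R w = tgt G h" "p1 R v = tgt G g" using ab by (auto elim!: act_ptsE)
 have sg: "src G g = tgt G h" using a l_pr_src[OF V a(8)] pw by simp
 thus 1: "cmp (wgpd R) (alp R g h y) (act1 R g w)" "cmp (wgpd R) (act1 R g w) v" "cmp G g h"
  using a pw by (simp_all add: wa w1 wr_p)
 show "x = wsrc R w" "p1 R w = tgt G h" "p1 R v = tgt G g" by (fact a pw)+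
 show "mul (AG G R) (Triple g x v) (Triple h y w) =
   Triple (mul G g h) y (wmul R (alp R g h y) (wmul R (act1 R g w) v))" using gp_assoc[OF gE 1(1,2)] by (simp add: acts)
qed

lemma act_mul_pts:
 assumes ab: "cmp (AG G R) (Triple g x v) (Triple h y w)" shows "mul (AG G R) (Triple g x v) (Triple h y w) <: A1"
  "wsrc R (wmul R (alp R g h y) (wmul R (act1 R g w) v)) = wsrc R v"
proof -
 note m = act_mul[OF ab]
 have a: "x <: W0 R" "y <: W0 R" "src G h = p0 R y" using ab by (simp_all add: act_iff)
 show "mul (AG G R) (Triple g x v) (Triple h y w) <: A1" unfolding m(1) using m(2-) a by (simp add: act_iff es gs wr_p)
 show "wsrc R (wmul R (alp R g h y) (wmul R (act1 R g w) v)) = wsrc R v" using m(2-) by (simp add: es)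
qed

text \<open>The third component solves the multiplication formula for a unit: it is the inverse of
  the product of the arrows alp (g^(-1), g, x) and g^(-1) v, which ends at x.\<close>

lemma act_inverse:
 assumes a: "Triple g x v <: A1"
 defines "b == Triple (ginv G g) (wsrc R v)
  (ginv (wgpd R) (wmul R (alp R (ginv G g) g x) (act1 R (ginv G g) v)))" shows "cmp (AG G R) b (Triple g x v)"
  "mul (AG G R) b (Triple g x v) = unt (AG G R) x"
proof -
 have g: "g <: Ar G" "x <: W0 R" "v <: W1 R" "src G g = p0 R x" "wtgt R v = act0 R g x" "p1 R v = tgt G g"
  using a by (auto elim: act_ptsE)
 let ?i = "ginv G g"
 have i: "?i <: Ar G" "src G ?i = tgt G g" "tgt G ?i = src G g" "mul G ?i g = unt G (p0 R x)" using g by (simp_all add: gs)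
 have c: "cmp (wgpd R) (alp R ?i g x) (act1 R ?i v)" using g i by (simp add: wa w1 wr_p)
 define m where "m = wmul R (alp R ?i g x) (act1 R ?i v)"
 have m: "m <: W1 R" "wsrc R m = act0 R ?i (wsrc R v)" "wtgt R m = x"
  using c g i wr_u0[OF G R g(2)] by (simp_all add: m_def es wr_p)
 show b: "cmp (AG G R) b (Triple g x v)" using a g i m by (simp add: b_def m_def[symmetric] act_iff es wr_p acts)
 show "mul (AG G R) b (Triple g x v) = unt (AG G R) x"
  using act_mul(1)[OF b[unfolded b_def]] gp_assoc[OF gE c,of "ginv (wgpd R) m"] act_mul(2,3)[OF b[unfolded b_def]] m i
  by (simp add: b_def acts m_def[symmetric] es)
qed

lemma act_groupoid: "groupoid (AG G R)"
proof (rule groupoidI,unfold acts(1))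
 show "src (AG G R) a <: W0 R & tgt (AG G R) a <: W0 R" if "a <: A1" for a using that by (auto elim!: act_ptsE simp: acts)
 show "unt (AG G R) x <: A1 & src (AG G R) (unt (AG G R) x) = x &
   tgt (AG G R) (unt (AG G R) x) = x" if "x <: W0 R" for x using that wr_u0[OF G R that] by (simp add: acts act_iff es gs wr_p)
 show "mul (AG G R) a b <: A1 & src (AG G R) (mul (AG G R) a b) = src (AG G R) b &
   tgt (AG G R) (mul (AG G R) a b) = tgt (AG G R) a" if ab: "cmp (AG G R) a b" for a b
 proof -
  obtain g x v h y w where e: "a = Triple g x v" "b = Triple h y w" using ab by (metis act_ptsE)
  show ?thesis using act_mul(1)[OF ab[unfolded e]] act_mul_pts[OF ab[unfolded e]] by (simp add: e acts(2,3))
 qed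
 show "mul (AG G R) a (unt (AG G R) (src (AG G R) a)) = a &
   mul (AG G R) (unt (AG G R) (tgt (AG G R) a)) a = a" if a: "a <: A1" for a using a
 proof (rule act_ptsE)
  fix g x v assume g: "a = Triple g x v" "g <: Ar G" "x <: W0 R" "v <: W1 R" "src G g = p0 R x" "wtgt R v = act0 R g x"
   "p1 R v = tgt G g" "wsrc R v <: W0 R" "p0 R (wsrc R v) = tgt G g"
  have "mul G g (unt G (p0 R x)) = g" "mul G (unt G (tgt G g)) g = g" using gs(9)[OF g(2)] gs(10)[OF g(2)] g(5) by simp_all
  moreover have "act0 R g x <: W0 R" by (rule w0[OF g(2,3,5)])
  moreover have "wmul R v (wunt R (wsrc R v)) = v" "wmul R (wunt R (act0 R g x)) v = v"
   using es(9)[OF g(4)] es(10)[OF g(4)] g(6) by simp_all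
  moreover have "wmul R (wunt R (act0 R g x)) (wunt R (act0 R g x)) = wunt R (act0 R g x)"
   using es(10)[OF es(3)[OF w0[OF g(2,3,5)]]] w0[OF g(2,3,5)] by (simp add: es)
  moreover have "act1 R (unt G (tgt G g)) v = v" using wr_u1[OF G R g(4)] g(7) by simp
  ultimately show ?thesis
   using wr_alp_unt[OF G R g(2,3,5)] wr_unt_alp[OF G R g(2,3,5)] wr_act_unt[OF G R g(2,3,5)] g by (simp add: acts)
 qed
 show "EX b. cmp (AG G R) b a & mul (AG G R) b a = unt (AG G R) (src (AG G R) a)" if a: "a <: A1" for a
 proof -
  obtain g x v where e: "a = Triple g x v" using a by (rule act_ptsE)
  show ?thesis using act_inverse[OF a[unfolded e]] unfolding e acts(2) point.sel by (intro exI conjI) auto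
 qed
 fix a b c assume ab: "cmp (AG G R) a b" and bc: "cmp (AG G R) b c"
 obtain g x v h y w k z u where abc: "a = Triple g x v" "b = Triple h y w" "c = Triple k z u" using ab bc by (metis act_ptsE)
 note 1 = act_mul[OF ab[unfolded abc]] and 2 = act_mul[OF bc[unfolded abc]]
 have ab': "mul (AG G R) a b <: A1" using act_mul_pts(1)[OF ab[unfolded abc]] by (simp add: abc)
 have bc': "mul (AG G R) b c <: A1" using act_mul_pts(1)[OF bc[unfolded abc]] by (simp add: abc)
 have 3: "cmp (AG G R) (Triple (mul G g h) y (wmul R (alp R g h y) (wmul R (act1 R g w) v))) (Triple k z u)"
  using ab' bc unfolding abc 1(1) by (simp add: acts(2,3))
 have 4: "cmp (AG G R) (Triple g x v) (Triple (mul G h k) z (wmul R (alp R h k z) (wmul R (act1 R h u) w)))"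
  using bc' ab act_mul_pts(2)[OF bc[unfolded abc]] unfolding abc 2(1) by (auto simp: acts(2,3))
 note m3 = act_mul[OF 3] and m4 = act_mul[OF 4]
 have z: "z <: W0 R" "src G k = p0 R z" "u <: W1 R" "p1 R u = tgt G k" "wtgt R u = act0 R k z" "y <: W0 R" "src G h = p0 R y"
  using bc by (auto simp: abc elim: act_ptsE)
 let ?m = "wmul R"
 note gh = 1(4) and hk = 2(4)
 have A: "alp R g h (act0 R k z) <: W1 R" "act1 R g (act1 R h u) <: W1 R" "act1 R h u <: W1 R"
  "act1 R g (alp R h k z) <: W1 R" "alp R h k z <: W1 R" "act1 R (mul G g h) u <: W1 R" "alp R g h y <: W1 R"
  "alp R g (mul G h k) z <: W1 R" "alp R (mul G g h) k z <: W1 R"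
  "wsrc R u = y" using gh hk z 1(2) 2(5) by (simp_all add: wa w1 w0 wr_p gs)
 have e: "?m (act1 R g (alp R h k z)) (?m (act1 R g (act1 R h u)) (act1 R g w)) = act1 R g (?m (alp R h k z) (?m (act1 R h u) w))"
  using wr_act_mul[OF G R _ 2(3),of g] wr_act_mul[OF G R,of g "alp R h k z" "?m (act1 R h u) w"] 2(2,3) gh hk z
  by (simp add: es wr_p)
 \<comment> \<open>Associativity: naturality of alp at the arrow u moves u past alp (g, h, y), the
   cocycle identity then exchanges the pair of associators, and the result is the image under g of a
   product.\<close>
 have "?m (alp R (mul G g h) k z) (?m (act1 R (mul G g h) u) (?m (alp R g h y) (?m (act1 R g w) v))) =
  ?m (alp R (mul G g h) k z) (?m (?m (act1 R (mul G g h) u) (alp R g h y)) (?m (act1 R g w) v))"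
  using gp_assoc[OF gE,of "act1 R (mul G g h) u" "alp R g h y" "?m (act1 R g w) v"] 1(2,3) A gh hk z by (simp add: es wr_p gs)
 also have "?m (act1 R (mul G g h) u) (alp R g h y) = ?m (alp R g h (act0 R k z)) (act1 R g (act1 R h u))"
  using wr_nat[OF G R gh z(3)] hk z A by simp
 also have "?m (alp R (mul G g h) k z) (?m (?m (alp R g h (act0 R k z)) (act1 R g (act1 R h u))) (?m (act1 R g w) v)) =
   ?m (?m (alp R (mul G g h) k z) (alp R g h (act0 R k z))) (?m (act1 R g (act1 R h u)) (?m (act1 R g w) v))"
  using gp_assoc[OF gE,of "alp R g h (act0 R k z)" "act1 R g (act1 R h u)" "?m (act1 R g w) v"]
   gp_assoc[OF gE,of "alp R (mul G g h) k z" "alp R g h (act0 R k z)" "?m (act1 R g (act1 R h u)) (?m (act1 R g w) v)"] A 1(2,3) gh hk z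
  by (simp add: es wr_p gs w0 w1)
 also have "?m (alp R (mul G g h) k z) (alp R g h (act0 R k z)) = ?m (alp R g (mul G h k) z) (act1 R g (alp R h k z))"
  using wr_cocycle[OF G R gh hk z(1,2)] by simp
 also have "?m (?m (alp R g (mul G h k) z) (act1 R g (alp R h k z))) (?m (act1 R g (act1 R h u)) (?m (act1 R g w) v)) =
   ?m (alp R g (mul G h k) z) (?m (act1 R g (alp R h k z)) (?m (act1 R g (act1 R h u)) (?m (act1 R g w) v)))"
  using A 1(2,3) gh hk z by (intro gp_assoc[OF gE]) (simp_all add: es wr_p gs w0 w1)
 also have "?m (act1 R g (alp R h k z)) (?m (act1 R g (act1 R h u)) (?m (act1 R g w) v)) =
   ?m (?m (act1 R g (alp R h k z)) (?m (act1 R g (act1 R h u)) (act1 R g w))) v"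
  using gp_assoc[OF gE,of "act1 R g (act1 R h u)" "act1 R g w" v]
   gp_assoc[OF gE,of "act1 R g (alp R h k z)" "?m (act1 R g (act1 R h u)) (act1 R g w)" v] A 1(2,3) gh hk z
  by (simp add: es wr_p gs w0 w1)
 finally show "mul (AG G R) (mul (AG G R) a b) c = mul (AG G R) a (mul (AG G R) b c)"
  unfolding abc 1(1) 2(1) m3(1) m4(1) e using gp_assoc[OF gG gh hk] by simp
qed

lemma act_ginv:
 assumes "Triple g x v <: A1" shows "ginv (AG G R) (Triple g x v) = Triple (ginv G g) (wsrc R v)
  (ginv (wgpd R) (wmul R (alp R (ginv G g) g x) (act1 R (ginv G g) v)))"
 using groupoid_left_inverse[OF act_groupoid assms act_inverse(1)[OF assms]] act_inverse(2)[OF assms] by (simp add: acts(2))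

lemma act_lie_groupoid: "lie_groupoid (AG G R)"
proof (rule lie_groupoidI[OF _ act_mfd act_groupoid],unfold acts(1))
 show "manifold (W0 R)" by (rule M0)
 show "smooth A1 (W0 R) (src (AG G R))" unfolding acts by (rule act_obj)
 note id = sm_id[OF M0 otop]
 have pr: "smooth (W0 R) (Ob G) (p0 R)" by (rule l_sm_pr0[OF V])
 have "smooth (W0 R) A1 (%x. Triple (unt G (p0 R x)) x (wunt R x))"
  by (rule act_sm_Triple[OF M0 sm_unt[OF G M0 pr] id sm_unt[OF E M0 id]]) (simp_all add: gs es wr_p wr_u0[OF G R])
 thus "smooth (W0 R) A1 (unt (AG G R))" by (rule sm_cong[OF M0]) (simp add: acts)
 let ?g = arp and ?x = obp and ?v = vcp
 have c: "?g a <: Ar G" "?x a <: W0 R" "?v a <: W1 R" "src G (?g a) = p0 R (?x a)" "p1 R (?v a) = tgt G (?g a)"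
  "wtgt R (?v a) = act0 R (?g a) (?x a)" if "a <: A1" for a using that by (auto elim: act_ptsE)
 note si = sm_inv[OF G act_mfd act_arrow]
 show "smooth A1 A1 (ginv (AG G R))"
 proof (rule sm_cong[OF act_mfd])
  show "smooth A1 A1 (%a. Triple (ginv G (?g a)) (wsrc R (?v a))
    (ginv (wgpd R) (wmul R (alp R (ginv G (?g a)) (?g a) (?x a)) (act1 R (ginv G (?g a)) (?v a)))))"
  proof (intro act_sm_Triple act_mfd si sm_src[OF E] sm_inv[OF E] sm_mul[OF E] act_vec wr_sma[OF G R] wr_sm1[OF G R] act_arrow act_obj)
   fix a assume a: "a <: A1"
   note c = c[OF a]
   have i: "ginv G (?g a) <: Ar G" "src G (ginv G (?g a)) = tgt G (?g a)" "tgt G (ginv G (?g a)) = src G (?g a)" using c by (simp_all add: gs)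
   show "src G (ginv G (?g a)) = tgt G (?g a)" "src G (?g a) = p0 R (?x a)" "src G (ginv G (?g a)) = p1 R (?v a)"
    "src G (ginv G (?g a)) = p0 R (wsrc R (?v a))" using c i by (simp_all add: wr_p)
   show s: "wsrc R (alp R (ginv G (?g a)) (?g a) (?x a)) = wtgt R (act1 R (ginv G (?g a)) (?v a))" using c i by (simp add: wr_p)
   show "wtgt R (ginv (wgpd R) (wmul R (alp R (ginv G (?g a)) (?g a) (?x a)) (act1 R (ginv G (?g a)) (?v a)))) =
     act0 R (ginv G (?g a)) (wsrc R (?v a))" using c i s by (simp add: es wr_p wa w1)
  qed
  show "Triple (ginv G (?g a)) (wsrc R (?v a))
    (ginv (wgpd R) (wmul R (alp R (ginv G (?g a)) (?g a) (?x a)) (act1 R (ginv G (?g a)) (?v a)))) = ginv (AG G R) a"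
   if a: "a <: A1" for a using a by (rule act_ptsE) (use a act_ginv in auto)
 qed
 let ?A2 = "Ar2 (AG G R)"
 assume m: "manifold ?A2" and f: "smooth ?A2 A1 fst" and s: "smooth ?A2 A1 snd"
  and cc: "!!q. q <: ?A2 ==> cmp (AG G R) (fst q) (snd q)"
 have k: "src G (?g (fst q)) = tgt G (?g (snd q))" "wtgt R (act1 R (?g (fst q)) (?v (snd q))) = act0 R (?g (fst q)) (act0 R (?g (snd q)) (?x (snd q)))"
  "wsrc R (act1 R (?g (fst q)) (?v (snd q))) = wtgt R (?v (fst q))" if q: "q <: ?A2" for q
 proof -
  have d: "fst q <: A1" "snd q <: A1" "?x (fst q) = wsrc R (?v (snd q))" using cc[OF q] by (simp_all add: acts(2,3))
  show 1: "src G (?g (fst q)) = tgt G (?g (snd q))" using c(4)[OF d(1)] c(5)[OF d(2)] l_pr_src[OF V c(3)[OF d(2)]] d(3) by simp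
  show "wtgt R (act1 R (?g (fst q)) (?v (snd q))) = act0 R (?g (fst q)) (act0 R (?g (snd q)) (?x (snd q)))"
   "wsrc R (act1 R (?g (fst q)) (?v (snd q))) = wtgt R (?v (fst q))" using 1 c[OF d(1)] c[OF d(2)] d(3) by (simp_all add: wr_p)
 qed
 note fg = act_sm_arrow[OF m f] and fv = act_sm_vec[OF m f] and sg = act_sm_arrow[OF m s] and sx = act_sm_obj[OF m s] and sv = act_sm_vec[OF m s]
 show "smooth ?A2 A1 (%q. mul (AG G R) (fst q) (snd q))" unfolding acts
 proof (intro act_sm_Triple m sm_mul[OF G] sm_mul[OF E] wr_sma[OF G R] wr_sm1[OF G R] fg fv sg sx sv)
  fix q assume q: "q <: ?A2"
  note d = c[of "fst q"] c[of "snd q"] cc[OF q] k[OF q]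
  show "src G (?g (fst q)) = tgt G (?g (snd q))" "src G (?g (snd q)) = p0 R (?x (snd q))" "src G (?g (fst q)) = p1 R (?v (snd q))"
   using d by simp_all
  show "src G (mul G (?g (fst q)) (?g (snd q))) = p0 R (?x (snd q))" using d by (simp add: gs)
  show 1: "wsrc R (alp R (?g (fst q)) (?g (snd q)) (?x (snd q))) = wtgt R (act1 R (?g (fst q)) (?v (snd q)))"
   using d by (simp add: wr_p)
  show 2: "wsrc R (wmul R (alp R (?g (fst q)) (?g (snd q)) (?x (snd q))) (act1 R (?g (fst q)) (?v (snd q)))) = wtgt R (?v (fst q))"
   using d 1 by (simp add: es wa w1)
  show "wtgt R (wmul R (wmul R (alp R (?g (fst q)) (?g (snd q)) (?x (snd q))) (act1 R (?g (fst q)) (?v (snd q)))) (?v (fst q))) =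
    act0 R (mul G (?g (fst q)) (?g (snd q))) (?x (snd q))" using d 1 2 by (simp add: es wa w1 wr_tgt_alp[OF G R])
 qed (rule k(1))
next
 show "sections A1 (W0 R) (src (AG G R))" unfolding sections_def acts
 proof
  fix a assume "a <: A1"
  then obtain g x v where a: "a = Triple g x v" "g <: Ar G" "x <: W0 R" "v <: W1 R" "src G g = p0 R x" "wtgt R v = act0 R g x"
   by (rule act_ptsE)
  obtain U r where U: "opn (Ob G) U" "src G g : U" and r: "sm_on (Ob G) U (Ar G) r" "r (src G g) = g" "!!y. y : U ==> src G (r y) = y"
   by (rule sectionsE[OF lg_sec_src[OF G] a(2)]) blast
  obtain U' r' where U': "opn (W0 R) U'" "wtgt R v : U'" and r': "sm_on (W0 R) U' (W1 R) r'" "r' (wtgt R v) = v"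
   "!!y. y : U' ==> wtgt R (r' y) = y" by (rule sectionsE[OF lg_sec_tgt[OF E] a(4)]) blast
  \<comment> \<open>The section through (g, x, v): near x an arrow of G is chosen by a section r of
    the source map, and then an arrow of V with the required target by a section r' of the target
    map. The set T is where both choices are possible.\<close>
  define S where "S = {y : pts (W0 R). p0 R y : U}"
  have S: "opn (W0 R) S" unfolding S_def by (rule sm_preim[OF M0 MO l_sm_pr0[OF V] U(1)])
  have SW: "S <= pts (W0 R)" by (auto simp: S_def)
  have rS: "sm_on (W0 R) S (Ar G) (%y. r (p0 R y))"
   by (rule sm_o[OF M0 MO sm_sub[OF M0 l_sm_pr0[OF V] S SW] r(1)]) (simp add: S_def)
  have aS: "sm_on (W0 R) S (W0 R) (%y. act0 R (r (p0 R y)) y)"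
   by (rule wr_sm0[OF G R M0 rS sm_id[OF M0 S]]) (use r(3) in "simp add: S_def")
  define T where "T = {y : S. act0 R (r (p0 R y)) y : U'}"
  have T: "opn (W0 R) T" unfolding T_def by (rule sm_preim[OF M0 M0 aS U'(1)])
  have TS: "T <= S" by (auto simp: T_def)
  note rT = sm_sub[OF M0 rS T TS] and aT = sm_sub[OF M0 aS T TS]
  have "sm_on (W0 R) T A1 (%y. Triple (r (p0 R y)) y (r' (act0 R (r (p0 R y)) y)))"
   by (rule act_sm_Triple[OF M0 rT sm_id[OF M0 T] sm_o[OF M0 M0 aT r'(1)]]) (use r(3) r'(3) in "auto simp: T_def S_def")
  thus "EX V s. opn (W0 R) V & obp a : V & sm_on (W0 R) V A1 s & s (obp a) = a & (ALL y:V. obp (s y) = y)"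
   by (intro exI[of _ T] exI[of _ "%y. Triple (r (p0 R y)) y (r' (act0 R (r (p0 R y)) y))"] conjI T)
    (use a U(2) U'(2) r(2) r'(2) in "auto simp: T_def S_def")
 qed
qed

end

section \<open>The arrows of the action groupoid as a vector bundle over the arrows of G\<close>

lemma cat_add: "cat n (%i. a i + b i) (%i. c i + d i) = (%i. cat n a c i + cat n b d i)"
 and cat_scale: "cat n (%i. r * a i) (%i. r * c i) = (%i. r * cat n a c i)" by (auto simp: cat_def)

context weak_rep_on
begin

abbreviation "B0 == bun0 (tgpd (Ob G)) (bnd R)"
abbreviation "B1 == bun1 (tgpd (Ob G)) (bnd R)"

lemma act_bun0: "bun0 G (Act_ob G R) = B0" by (simp add: bun0_def acts trivs)

lemmas bt_simps = buns trivs
lemmas cancel0 = vb_cancel[OF vg_b0[OF V],unfolded bt_simps] and cancel1 = vb_cancel[OF vg_b1[OF V],unfolded bt_simps]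
lemmas vs = vg_add0[OF V] vg_pr_add0[OF V] vg_scale0[OF V] vg_pr_scale0[OF V]
 vg_add1[OF V] vg_pr_add1[OF V] vg_scale1[OF V] vg_pr_scale1[OF V]
 vg_src_add[OF V] vg_tgt_add[OF V] vg_unt_add[OF V] vg_src_scale[OF V] vg_tgt_scale[OF V] vg_unt_scale[OF V]
 l_pr_src[OF V] l_pr_tgt[OF V] l_pr_unt[OF V]

text \<open>The projection of the bundle of arrows onto the kernel of the target map along the
  units.\<close>

definition ker_tgt :: "('g,'a) point => ('g,'a) point" where
 "ker_tgt v = add1 (bnd R) v (scale1 (bnd R) (-1) (wunt R (wtgt R v)))"

lemma ker_tgt:
 assumes v: "v <: W1 R" shows "ker_tgt v <: W1 R" "p1 R (ker_tgt v) = p1 R v" "ker_tgt (ker_tgt v) = ker_tgt v"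
  "w <: W1 R ==> p1 R v = p1 R w ==> ker_tgt (add1 (bnd R) v w) = add1 (bnd R) (ker_tgt v) (ker_tgt w)"
  "ker_tgt (scale1 (bnd R) c v) = scale1 (bnd R) c (ker_tgt v)"
  "y <: W0 R ==> p0 R y = p1 R v ==> add0 (bnd R) y (wtgt R (ker_tgt v)) = y"
proof -
 let ?t = "wtgt R v"
 let ?u = "wunt R ?t"
 have t: "?t <: W0 R" "p0 R ?t = p1 R v" "?u <: W1 R" "p1 R ?u = p1 R v" "wtgt R ?u = ?t" using v by (simp_all add: es vs)
 show k: "ker_tgt v <: W1 R" "p1 R (ker_tgt v) = p1 R v" using v t by (simp_all add: ker_tgt_def vs)
 have e: "wtgt R (ker_tgt v) = add0 (bnd R) ?t (scale0 (bnd R) (-1) ?t)" using v t by (simp add: ker_tgt_def vs)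
 show "ker_tgt (ker_tgt v) = ker_tgt v" using cancel1(4)[OF k(1) t(3)] k t by (subst ker_tgt_def) (simp add: e vs)
 show "ker_tgt (add1 (bnd R) v w) = add1 (bnd R) (ker_tgt v) (ker_tgt w)" if w: "w <: W1 R" "p1 R v = p1 R w"
  using cancel1(6)[OF v w t(3),of "wunt R (wtgt R w)" "-1"] v w t by (simp add: ker_tgt_def vs es)
 show "ker_tgt (scale1 (bnd R) c v) = scale1 (bnd R) c (ker_tgt v)"
  using cancel1(5)[OF v t(3),of c "-1"] v t by (simp add: ker_tgt_def vs)
 show "add0 (bnd R) y (wtgt R (ker_tgt v)) = y" if "y <: W0 R" "p0 R y = p1 R v"
  unfolding e using cancel0(3)[OF that(1) t(1)] that(2) t by simp
qed

lemma ker_tgt_smooth: "smooth (W1 R) (W1 R) ker_tgt" unfolding ker_tgt_def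
 by (intro vg_sm_add1[OF V M1] vg_sm_scale1[OF V M1] sm_id[OF M1 otop] sm_unt[OF E M1] lg_tgt[OF E] fsm_const[OF M1 otop])
  (simp_all add: vs es)

lemma act_add_pts:
 assumes "a <: A1" "b <: A1" "arp a = arp b" shows "add1 (Act_ob G R) a b <: A1" "scale1 (Act_ob G R) c a <: A1"
 using assms by (auto elim!: act_ptsE simp: acts act_iff vs wr_act_add0[OF G R] wr_act_scale0[OF G R])

text \<open>In (g, x, v) the arrow v is the sum of the unit at g x and its kernel part
  \<open>ker_tgt v\<close>, and the kernel part is arbitrary. Thus a frame of V_0 at the source of g
  and a frame of the kernel at its target, given by \<open>idempotent_frame\<close>, trivialise the
  bundle near g.\<close>

lemma act_bun1: "vector_bundle (bun1 G (Act_ob G R))"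
proof (rule vector_bundleI,unfold buns acts(9))
 show "manifold A1" "manifold (Ar G)" by (fact act_mfd,fact MA)
 show "smooth A1 (Ar G) arp" by (rule act_arrow)
 show "add1 (Act_ob G R) a b <: A1 & arp (add1 (Act_ob G R) a b) = arp a" if "a <: A1" "b <: A1" "arp a = arp b" for a b
  using act_add_pts[OF that] by (simp add: acts)
 show "scale1 (Act_ob G R) c a <: A1 & arp (scale1 (Act_ob G R) c a) = arp a" if "a <: A1" for a c
  using act_add_pts[OF that that refl] by (simp add: acts)
 fix g1 assume g1: "g1 <: Ar G"
 have s1: "src G g1 <: Ob G" "tgt G g1 <: Ob G" using g1 by (simp_all add: gs)
 hence "src G g1 <: base B0" by (simp add: bt_simps)
 then obtain U k ta th where sU: "src G g1 : U" and t: "triv B0 U k ta th" by (rule vb_triv[OF vg_b0[OF V]]) blast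
 note D = trivD[OF t,unfolded bt_simps]
 note T = triv_pts[OF vg_b0[OF V] t,unfolded bt_simps] triv_Rn[OF vg_b0[OF V] t,unfolded bt_simps]
 obtain U' r nu mu where U': "opn (Ob G) U'" "tgt G g1 : U'" and nu: "sm_on (W1 R) {e : pts (W1 R). p1 R e : U'} (eucl r) nu"
  and mu: "sm_on (prod_mfd (Ob G) (eucl r)) (U' \<times> Rn r) (W1 R) (%(p,y). mu p y)"
  and mup: "!!p y. p : U' ==> y : Rn r ==> p1 R (mu p y) = p & ker_tgt (mu p y) = mu p y & nu (mu p y) = y"
  and munu: "!!e. e <: W1 R ==> p1 R e : U' ==> ker_tgt e = e ==> mu (p1 R e) (nu e) = e"
  and nua: "!!e e'. e <: W1 R ==> e' <: W1 R ==> p1 R e : U' ==> p1 R e = p1 R e' ==>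
   nu (add1 (bnd R) e e') = (%i. nu e i + nu e' i)"
  and nus: "!!c e. e <: W1 R ==> p1 R e : U' ==> nu (scale1 (bnd R) c e) = (%i. c * nu e i)"
  by (rule idempotent_frame[OF vg_b1[OF V],unfolded bt_simps,OF ker_tgt_smooth ker_tgt(2) ker_tgt(4) ker_tgt(5) ker_tgt(3) s1(2)]; (assumption | (rule that; (assumption | blast))))
 define U1 where "U1 = {g : pts (Ar G). src G g : U} Int {g : pts (Ar G). tgt G g : U'}"
 have oU1: "opn (Ar G) U1" unfolding U1_def
  by (rule openin_Int; rule sm_preim[OF MA MO]) (use lg_src[OF G] lg_tgt[OF G] D(1) U'(1) in auto)
 have U1: "g <: Ar G & src G g : U & tgt G g : U'" if "g : U1" for g using that by (auto simp: U1_def)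
 \<comment> \<open>The coordinates of x in the frame over the source of g, followed by those of the
   kernel part of v in the frame over the target.\<close>
 define ta1 where "ta1 a = cat k (ta (obp a)) (nu (ker_tgt (vcp a)))" for a
 define th1 where "th1 g z = (let x = th (src G g) (tk k z) in
  Triple g x (add1 (bnd R) (wunt R (act0 R g x)) (mu (tgt G g) (dr k z))))" for g z
 have mupts: "mu p y <: W1 R" if "p : U'" "y : Rn r" for p y using sm_pts[OF M1 mu,of "(p,y)"] that by simp
 have nuR: "nu e : Rn r" if "e <: W1 R" "p1 R e : U'" for e using sm_pts[OF mfE nu,of e] that by (simp add: eucls)
 have key: "x <: W0 R" "p0 R x = src G g" "m <: W1 R" "p1 R m = tgt G g" "v <: W1 R" "p1 R v = tgt G g"
   "wtgt R v = act0 R g x" "ker_tgt v = m"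
  if g: "g : U1" and z: "z : Rn (k + r)" and x: "x = th (src G g) (tk k z)" and m: "m = mu (tgt G g) (dr k z)"
   and v: "v = add1 (bnd R) (wunt R (act0 R g x)) m" for g z x m v
 proof -
  note g = U1[OF g]
  show x': "x <: W0 R" "p0 R x = src G g" using T(1)[OF _ tk_Rn] D(4)[OF _ tk_Rn] g by (simp_all add: x)
  have y: "act0 R g x <: W0 R" "p0 R (act0 R g x) = tgt G g" using x' g by (simp_all add: w0 wr_p)
  show m': "m <: W1 R" "p1 R m = tgt G g" using mupts mup dr_Rn[OF z] g by (simp_all add: m)
  have km: "ker_tgt m = m" using mup dr_Rn[OF z] g by (simp add: m)
  show v': "v <: W1 R" "p1 R v = tgt G g" using y m' by (simp_all add: v vs es)
  show tv: "wtgt R v = act0 R g x" using y m' ker_tgt(6)[OF m'(1) y(1)] km by (simp add: v vs es)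
  show "ker_tgt v = m" unfolding ker_tgt_def tv using cancel1(1)[of "wunt R (act0 R g x)" m] y m' by (simp add: v vs es)
 qed
 let ?E = "bun1 G (Act_ob G R)"
 let ?P = "prod_mfd (Ar G) (eucl (k + r))"
 have PM: "manifold ?P" by (rule mf_prod[OF MA mfE])
 have "triv ?E U1 (k + r) ta1 th1" unfolding triv_def buns acts(9)
 proof (intro conjI ballI allI impI oU1)
  let ?S = "{a : pts A1. arp a : U1}"
  have oS: "opn A1 ?S" by (rule sm_preim[OF act_mfd MA act_arrow oU1])
  have SA: "?S <= pts A1" by auto
  have sx: "sm_on A1 ?S (W0 R) obp" by (rule sm_sub[OF act_mfd act_obj oS SA])
  have sv: "sm_on A1 ?S (W1 R) (%a. ker_tgt (vcp a))"
   by (rule smcomp[OF act_mfd M1 sm_sub[OF act_mfd act_vec oS SA] ker_tgt_smooth])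
  have in1: "obp a <: W0 R" "p0 R (obp a) : U" "ker_tgt (vcp a) <: W1 R" "p1 R (ker_tgt (vcp a)) : U'" if "a : ?S" for a
   using that U1[of "arp a"] by (auto elim!: act_ptsE simp: ker_tgt)
  have f1: "fsm A1 ?S (%a. ta (obp a) i)" for i
   by (rule triv_fsm[OF vg_b0[OF V] t act_mfd,unfolded bt_simps,OF sx]) (use in1 in blast)
  have "sm_on A1 ?S (eucl r) (%a. nu (ker_tgt (vcp a)))" by (rule sm_o[OF act_mfd M1 sv nu]) (use in1 in blast)
  hence f2: "fsm A1 ?S (%a. nu (ker_tgt (vcp a)) i)" for i by (rule fsm_of_smooth[OF act_mfd])
  show "sm_on A1 ?S (eucl (k + r)) ta1" unfolding sm_euclid[OF act_mfd]
  proof (intro conjI ballI allI impI oS)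
   show "ta1 a : Rn (k + r)" if "a : ?S" for a unfolding ta1_def by (rule cat_Rn[OF nuR]) (use in1[OF that] in auto)
   show "fsm A1 ?S (%a. ta1 a i)" for i using f1[of i] f2[of "i - k"] by (cases "i < k") (simp_all add: ta1_def cat_def)
  qed
  have oU: "opn ?P (U1 \<times> Rn (k + r))" by (rule prod_open[OF MA mfE oU1]) (simp add: eucls)
  have UP: "U1 \<times> Rn (k + r) <= pts (Ar G) \<times> pts (eucl (k + r))" using U1 by (auto simp: eucls)
  have fs: "sm_on ?P (U1 \<times> Rn (k + r)) (Ar G) fst" "sm_on ?P (U1 \<times> Rn (k + r)) (eucl (k + r)) snd"
   by (rule sm_sub[OF PM _ oU UP],rule smooth_fst[OF MA mfE] smooth_snd[OF MA mfE])+
  note fz = fsm_of_smooth[OF PM fs(2)]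
  have ftk: "fsm ?P (U1 \<times> Rn (k + r)) (%q. tk k (snd q) i)" and fdr: "fsm ?P (U1 \<times> Rn (k + r)) (%q. dr k (snd q) i)" for i
   using fz[of i] fz[of "i + k"] fsm_const[OF PM oU,of 0] by (cases "i < k"; simp add: tk_def dr_def)+
  have X: "sm_on ?P (U1 \<times> Rn (k + r)) (W0 R) (%q. th (src G (fst q)) (tk k (snd q)))"
   by (rule triv_smooth[OF vg_b0[OF V] t PM,unfolded bt_simps,OF sm_src[OF G PM fs(1)] _ _ ftk]) (use U1 tk_Rn in auto)
  have Y: "sm_on ?P (U1 \<times> Rn (k + r)) (W1 R) (%q. wunt R (act0 R (fst q) (th (src G (fst q)) (tk k (snd q)))))"
   by (rule sm_unt[OF E PM wr_sm0[OF G R PM fs(1) X]]) (use U1 D(4)[OF _ tk_Rn] in auto)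
  have "sm_on ?P (U1 \<times> Rn (k + r)) (prod_mfd (Ob G) (eucl r)) (%q. (tgt G (fst q),dr k (snd q)))"
   by (rule smooth_pair[OF MO mfE PM sm_tgt[OF G PM fs(1)]]) (use fdr oU dr_Rn in "auto simp: sm_euclid[OF PM]")
  from sm_o[OF PM mf_prod[OF MO mfE] this mu]
  have Z: "sm_on ?P (U1 \<times> Rn (k + r)) (W1 R) (%q. mu (tgt G (fst q)) (dr k (snd q)))" using U1 dr_Rn by auto
  have "sm_on ?P (U1 \<times> Rn (k + r)) A1 (%q. Triple (fst q) (th (src G (fst q)) (tk k (snd q)))
    (add1 (bnd R) (wunt R (act0 R (fst q) (th (src G (fst q)) (tk k (snd q))))) (mu (tgt G (fst q)) (dr k (snd q)))))"
   by (rule act_sm_Triple[OF PM fs(1) X vg_sm_add1[OF V PM Y Z]])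
    (use key(2,4,7)[OF _ _ refl refl refl] key(1,2)[OF _ _ refl refl refl] in "auto simp: es vs w0 wr_p U1")
  thus "sm_on ?P (U1 \<times> Rn (k + r)) A1 (%(g,z). th1 g z)" by (simp add: th1_def Let_def case_prod_beta')
  show "arp (th1 g z) = g" for g z by (simp add: th1_def Let_def)
  show "ta1 (th1 g z) = z" if "g : U1" "z : Rn (k + r)" for g z
   using key(8)[OF that refl refl refl] D(5)[OF _ tk_Rn] mup[OF _ dr_Rn[OF that(2)]] U1[OF that(1)]
   by (simp add: th1_def ta1_def Let_def cat_tk_dr)
  show "th1 (arp a) (ta1 a) = a" if a: "a <: A1" "arp a : U1" for a
  proof -
   obtain g x v where e: "a = Triple g x v" "g <: Ar G" "x <: W0 R" "v <: W1 R" "src G g = p0 R x" "wtgt R v = act0 R g x"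
    "p1 R v = tgt G g" using a(1) by (rule act_ptsE)
   have u: "src G g : U" "tgt G g : U'" using U1 a(2) e(1) by auto
   have "mu (tgt G g) (nu (ker_tgt v)) = ker_tgt v" using munu[of "ker_tgt v"] ker_tgt[OF e(4)] u e(7) by simp
   moreover have "th (src G g) (ta x) = x" "ta x : Rn k" using D(6)[OF e(3)] T(2)[OF e(3)] u e(5) by simp_all
   moreover have "add1 (bnd R) (wunt R (act0 R g x)) (ker_tgt v) = v"
    using cancel1(2)[of "wunt R (act0 R g x)" v] w0[OF e(2,3,5)] e by (simp add: ker_tgt_def es vs wr_p)
   ultimately show ?thesis by (simp add: e(1) th1_def ta1_def Let_def tk_cat dr_cat)
  qed
  show "ta1 (add1 (Act_ob G R) a b) = (%i. ta1 a i + ta1 b i)" if "a <: A1" "b <: A1" "arp a : U1" "arp a = arp b" for a b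
   using that U1[OF that(3)] by (auto elim!: act_ptsE simp: ta1_def acts ker_tgt D(7) nua cat_add)
  show "ta1 (scale1 (Act_ob G R) c a) = (%i. c * ta1 a i)" if "a <: A1" "arp a : U1" for a c
   using that U1[OF that(2)] by (auto elim!: act_ptsE simp: ta1_def acts ker_tgt D(8) nus cat_scale)
 qed
 thus "EX U k ta th. g1 : U & triv ?E U k ta th"
  by (intro exI[of _ U1] exI[of _ "k + r"] exI[of _ ta1] exI[of _ th1]) (simp add: U1_def g1 sU U')
qed

theorem Act_vb: "vb_groupoid G (Act_ob G R)"
proof (rule vb_groupoidI[OF G act_lie_groupoid _ act_bun1],unfold acts(1,2,6,7,8,9) act_bun0)
 show "vector_bundle B0" by (rule vg_b0[OF V])
 fix a assume a: "a <: A1"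
 show "p0 R (obp a) = src G (arp a)" "p0 R (tgt (AG G R) a) = tgt G (arp a)" using a by (auto elim: act_ptsE simp: acts)
 show "obp (scale1 (Act_ob G R) c a) = scale0 (bnd R) c (obp a)"
  "tgt (AG G R) (scale1 (Act_ob G R) c a) = scale0 (bnd R) c (tgt (AG G R) a)" for c
  using a by (auto elim: act_ptsE simp: acts vs)
 fix b assume b: "b <: A1" "arp a = arp b"
 show "obp (add1 (Act_ob G R) a b) = add0 (bnd R) (obp a) (obp b)"
  "tgt (AG G R) (add1 (Act_ob G R) a b) = add0 (bnd R) (tgt (AG G R) a) (tgt (AG G R) b)"
  using a b by (auto elim!: act_ptsE simp: acts vs)
next
 fix x assume x: "x <: W0 R"
 show "arp (unt (AG G R) x) = unt G (p0 R x)" by (simp add: acts)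
 show "unt (AG G R) (scale0 (bnd R) c x) = scale1 (Act_ob G R) c (unt (AG G R) x)" for c using x by (simp add: acts vs)
 fix y assume y: "y <: W0 R" "p0 R x = p0 R y"
 show "unt (AG G R) (add0 (bnd R) x y) = add1 (Act_ob G R) (unt (AG G R) x) (unt (AG G R) y)" using x y by (simp add: acts vs)
next
 fix a b assume ab: "a <: A1 & b <: A1 & obp a = tgt (AG G R) b"
 show "arp (mul (AG G R) a b) = mul G (arp a) (arp b)" by (simp add: acts)
 obtain g x v h y w where e: "a = Triple g x v" "b = Triple h y w" using ab by (metis act_ptsE)
 have c: "cmp (AG G R) (Triple g x v) (Triple h y w)" using ab unfolding e acts(2) point.sel .
 note m = act_mul[OF c]
 have y: "y <: W0 R" "src G h = p0 R y" using c by (auto simp: act_iff)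
 have c': "cmp (wgpd R) (alp R g h y) (wmul R (act1 R g w) v)" using m(2,3) by (simp add: es)
 have pa: "p1 R (alp R g h y) = tgt G g" "p1 R (act1 R g w) = tgt G g" "w <: W1 R" "src G g = p1 R w"
  "p1 R (wmul R (act1 R g w) v) = tgt G g" using m(3,4,6) y c l_pr_mul[OF V m(3)] by (auto simp: wr_p act_iff)
 have asc: "wmul R (act1 R g (scale1 (bnd R) d w)) (scale1 (bnd R) d v) = scale1 (bnd R) d (wmul R (act1 R g w) v)" for d
  using vg_mul_scale[OF V m(3),of d] wr_act_scale1[OF G R _ pa(3,4)] m(4) by simp
 have cs: "cmp (AG G R) (scale1 (Act_ob G R) d a) (scale1 (Act_ob G R) d b)" for d
  using act_add_pts(2)[of a a d] act_add_pts(2)[of b b d] ab pa(3) by (auto simp: acts(2,3,11) e vs)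
 show "mul (AG G R) (scale1 (Act_ob G R) d a) (scale1 (Act_ob G R) d b) = scale1 (Act_ob G R) d (mul (AG G R) a b)" for d
  using act_mul(1)[OF cs[of d,unfolded e acts(11) point.sel]] asc[of d] vg_mul_scale[OF V c',of d] wr_alp_scale[OF G R m(4) y,of d]
  by (simp add: e m(1) acts(11))
 fix a' b' assume ab': "a' <: A1 & b' <: A1 & obp a' = tgt (AG G R) b'" and ea: "arp a = arp a'" "arp b = arp b'"
 obtain x' v' y' w' where e': "a' = Triple g x' v'" "b' = Triple h y' w'"
  using ab' ea by (cases a'; cases b'; auto simp: e elim: act_ptsE)
 have d: "cmp (AG G R) (Triple g x' v') (Triple h y' w')" using ab' unfolding e' acts(2) point.sel .
 note n = act_mul[OF d]
 have y': "y' <: W0 R" "src G h = p0 R y'" using d by (auto simp: act_iff)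
 have d': "cmp (wgpd R) (alp R g h y') (wmul R (act1 R g w') v')" using n(2,3) by (simp add: es)
 have pa': "p1 R (alp R g h y') = tgt G g" "p1 R (act1 R g w') = tgt G g" "w' <: W1 R" "src G g = p1 R w'"
  "p1 R (wmul R (act1 R g w') v') = tgt G g" using n(3,4,6) y' d l_pr_mul[OF V n(3)] by (simp_all add: wr_p act_iff)
 have cd: "cmp (AG G R) (add1 (Act_ob G R) a a') (add1 (Act_ob G R) b b')"
  using act_add_pts(1)[of a a'] act_add_pts(1)[of b b'] ab ab' ea pa(3,4) pa'(3,4) by (auto simp: acts(2,3,10) e e' vs)
 have aa: "wmul R (act1 R g (add1 (bnd R) w w')) (add1 (bnd R) v v') =
   add1 (bnd R) (wmul R (act1 R g w) v) (wmul R (act1 R g w') v')"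
  using vg_mul_add[OF V m(3) n(3)] wr_act_add1[OF G R _ pa(3) pa'(3) pa(4) pa'(4)] m(4,7) n(7) pa(2) pa'(2) by simp
 show "mul (AG G R) (add1 (Act_ob G R) a a') (add1 (Act_ob G R) b b') =
   add1 (Act_ob G R) (mul (AG G R) a b) (mul (AG G R) a' b')"
  using act_mul(1)[OF cd[unfolded e e' acts(10) point.sel]] aa vg_mul_add[OF V c' d'] wr_alp_add[OF G R m(4) y(1) y'(1) y(2) y'(2)]
   pa(1,5) pa'(1,5) by (simp add: e e' m(1) n(1) acts(10))
qed

end

section \<open>Morphisms of weak representations\<close>

lemma llgb_map_iff:
 assumes V: "vb_groupoid (tgpd M) V" shows "llgb_map M M V W id (f0,f1) <-> vgmap V W f0 f1"
proof -
 have "smooth M M id" using sm_id[OF l_M[OF V] otop] by (simp add: id_def)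
 thus ?thesis unfolding llgb_map_def lgpd_map_def vb_map_def vgmap_def buns trivs smap_iff[OF vg_V0[OF V]]
   smap_iff[OF vg_V1[OF V]] smap_iff[OF l_M[OF V]] by auto
qed

locale weak_rep_pair = R: weak_rep_on G R + S: weak_rep_on G S for G :: "('b,'g) lgpd" and R S :: "('b,'g,'a) wrep_pt"
begin

lemmas G = R.G
lemmas weak_rep_map_unfold = weak_rep_map_def[of G R S,unfolded llgb_map_iff[OF R.V] pullback_nat_iff[OF R.V R.MA lg_src[OF G] lg_tgt[OF G]]
 fst_conv snd_conv case_prod_conv]

definition act_fun :: "(('g,'a) point => ('g,'a) point) => (('g,'a) point => ('g,'a) point) => ('g \<times> ('g,'a) point => ('g,'a) point) =>
  ('g,'a) point => ('g,'a) point" where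
 "act_fun F0 F1 de a = Triple (arp a) (F0 (obp a)) (wmul S (de (arp a,obp a)) (F1 (vcp a)))"

lemma act_fun_simp: "act_fun F0 F1 de (Triple g x v) = Triple g (F0 x) (wmul S (de (g,x)) (F1 v))" by (simp add: act_fun_def)

text \<open>
  Every arrow (g, x, v) of the action groupoid is the product of vert v and horiz g x, so that a map of
  action groupoids is determined by its restriction to these two kinds of arrows.
\<close>

definition vert :: "('g,'a) point => ('g,'a) point" where
 "vert v = Triple (unt G (p1 R v)) (wtgt R v) v"

definition horiz :: "'g => ('g,'a) point => ('g,'a) point" where
 "horiz g x = Triple g x (wunt R (act0 R g x))"

text \<open>The candidate inverse of \<open>Act_mor\<close>: F1 is read off vertical arrows and
  delta off horizontal ones.\<close>

definition act_inv :: "('g,'a) vb_mor => ('g,'a) wrep_mor" where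
 "act_inv f = ((fst f,restrict (%v. vcp (snd f (vert v))) (pts (W1 R))),restrict (%(g,x). vcp (snd f (horiz g x))) (act_dom G R))"

lemma act_dom_iff: "(g,x) : act_dom G R <-> g <: Ar G & x <: W0 R & src G g = p0 R x" by (auto simp: fibre_prod_set_def)

lemma Act_mor_eq: "Act_mor G R S ((F0,F1),de) = (F0,restrict (act_fun F0 F1 de) (pts R.A1))"
 by (simp add: Act_mor_def act_fun_def[abs_def])

lemma weak_rep_map_typing:
 assumes m: "weak_rep_map G R S ((F0,F1),de)"
 shows "F0 : extensional (pts (W0 R))" "F1 : extensional (pts (W1 R))" "de : extensional (act_dom G R)"
  "x <: W0 R ==> F0 x <: W0 S & F1 (wunt R x) = wunt S (F0 x) & de (unt G (p0 R x),x) = wunt S (F0 x)"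
  "v <: W1 R ==> F1 v <: W1 S & wtgt S (F1 v) = F0 (wtgt R v) & wsrc S (F1 v) = F0 (wsrc R v) & p1 S (F1 v) = p1 R v"
  "g <: Ar G ==> x <: W0 R ==> src G g = p0 R x ==>
   de (g,x) <: W1 S & wsrc S (de (g,x)) = F0 (act0 R g x) & wtgt S (de (g,x)) = act0 S g (F0 x) & p1 S (de (g,x)) = tgt G g"
  "cmp (wgpd R) v w ==> F1 (wmul R v w) = wmul S (F1 v) (F1 w)" "x <: W0 R ==> p0 S (F0 x) = p0 R x"
proof -
 note u = m[unfolded weak_rep_map_unfold]
 have F: "vgmap (bnd R) (bnd S) F0 F1" using u by blast
 have sd: "smooth (P0 G R) (W1 S) de" using u by blast
 note p = vgmap_pts[OF S.V F]
 show "F0 : extensional (pts (W0 R))" "F1 : extensional (pts (W1 R))" "de : extensional (act_dom G R)" using u by blast+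
 show "F0 x <: W0 S & F1 (wunt R x) = wunt S (F0 x) & de (unt G (p0 R x),x) = wunt S (F0 x)" "p0 S (F0 x) = p0 R x"
  if "x <: W0 R" using u p that F unfolding vgmap_def by simp_all
 show "F1 v <: W1 S & wtgt S (F1 v) = F0 (wtgt R v) & wsrc S (F1 v) = F0 (wsrc R v) & p1 S (F1 v) = p1 R v"
  if "v <: W1 R" using p that F unfolding vgmap_def by simp
 show "F1 (wmul R v w) = wmul S (F1 v) (F1 w)" if "cmp (wgpd R) v w" using F that unfolding vgmap_def by simp
 show "de (g,x) <: W1 S & wsrc S (de (g,x)) = F0 (act0 R g x) & wtgt S (de (g,x)) = act0 S g (F0 x) & p1 S (de (g,x)) = tgt G g"
  if "g <: Ar G" "x <: W0 R" "src G g = p0 R x"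
  using u that sm_pts[OF S.M1 sd,of "(g,x)"] by (simp add: fib_pts[OF qr0[OF G R.R]])
qed

lemma act_fun_vgmap:
 assumes m: "weak_rep_map G R S ((F0,F1),de)" shows "vgmap (Act_ob G R) (Act_ob G S) F0 (act_fun F0 F1 de)"
proof -
 note u = m[unfolded weak_rep_map_unfold]
 have F: "vgmap (bnd R) (bnd S) F0 F1" using u by blast
 have sd: "smooth (P0 G R) (W1 S) de" using u by blast
 note Fp = vgmap_pts[OF S.V F]
 note F' = F[unfolded vgmap_def] and t = weak_rep_map_typing[OF m]
 note d = t(4-6,8) and Fm = t(7)
 have da: "de (g,add0 (bnd R) x y) = add1 (bnd S) (de (g,x)) (de (g,y))"
  if "g <: Ar G" "x <: W0 R" "y <: W0 R" "src G g = p0 R x" "src G g = p0 R y" for g x y using u that by simp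
 have dn: "wmul S (de (g,wtgt R v)) (F1 (act1 R g v)) = wmul S (act1 S g (F1 v)) (de (g,wsrc R v))"
  if "g <: Ar G" "v <: W1 R" "src G g = p1 R v" for g v using u that by simp
 have dc: "wmul S (wmul S (alp S g k (F0 x)) (act1 S g (de (k,x)))) (de (g,act0 R k x)) =
    wmul S (de (mul G g k,x)) (F1 (alp R g k x))" if "cmp G g k" "x <: W0 R" "src G k = p0 R x" for g k x using u that by blast
 have c: "cmp (wgpd S) (de (g,x)) (F1 v)" "p1 S (de (g,x)) = p1 S (F1 v)" if "Triple g x v <: R.A1" for g x v
  using that by (auto elim!: R.act_ptsE simp: d)
 have c': "wsrc S (de (arp a,obp a)) = wtgt S (F1 (vcp a))" if a: "a <: R.A1" for a
  using a by (rule R.act_ptsE) (use a c(1) in auto)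
 have p: "act_fun F0 F1 de a <: S.A1" if a: "a <: R.A1" for a
 proof -
  obtain g x v where e: "a = Triple g x v" using a by (rule R.act_ptsE)
  show ?thesis using c[of g x v] a by (auto elim!: R.act_ptsE simp: e act_fun_simp S.act_iff S.es d)
 qed
 have sm: "smooth R.A1 S.A1 (act_fun F0 F1 de)" unfolding act_fun_def
 proof (rule S.act_sm_Triple[OF R.act_mfd R.act_arrow])
  have x: "smooth R.A1 (P0 G R) (%a. (arp a,obp a))"
   by (rule fib_pair[OF qr0[OF G R.R] R.act_mfd R.act_arrow R.act_obj]) (auto elim: R.act_ptsE)
  show "smooth R.A1 (W0 S) (%a. F0 (obp a))" by (rule smcomp[OF R.act_mfd R.M0 R.act_obj vgmap_smooth(1)[OF F]])
  show "smooth R.A1 (W1 S) (%a. wmul S (de (arp a,obp a)) (F1 (vcp a)))"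
   by (rule sm_mul[OF S.E R.act_mfd smcomp[OF R.act_mfd mf_fibre[OF qr0[OF G R.R]] x sd]
     smcomp[OF R.act_mfd R.M1 R.act_vec vgmap_smooth(2)[OF F]]]) (rule c')
 qed (use p in "auto simp: act_fun_def S.act_iff")
 show ?thesis unfolding vgmap_def R.acts(1,2,6,7,8,9) S.acts(1,2,6,7,8,9)
 proof (intro conjI ballI allI impI sm vgmap_smooth(1)[OF F])
  fix a assume a: "a <: R.A1"
  show "obp (act_fun F0 F1 de a) = F0 (obp a)" "arp (act_fun F0 F1 de a) = arp a" by (simp_all add: act_fun_def)
  show "tgt (AG G S) (act_fun F0 F1 de a) = F0 (tgt (AG G R) a)"
   using a by (rule R.act_ptsE) (use a c[of "arp a" "obp a" "vcp a"] in \<open>auto simp: act_fun_simp S.acts(3) R.acts(3) S.es d\<close>)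
  obtain g x v where e: "a = Triple g x v" "g <: Ar G" "x <: W0 R" "v <: W1 R" "src G g = p0 R x" "p1 R v = tgt G g"
   using a by (rule R.act_ptsE)
  show "act_fun F0 F1 de (scale1 (Act_ob G R) r a) = scale1 (Act_ob G S) r (act_fun F0 F1 de a)" for r
   using a c[of g x v] vg_mul_scale[OF S.V,of "de (g,x)" "F1 v" r] e F' u by (simp add: act_fun_simp S.acts(11) R.acts(11))
  fix b assume b: "b <: R.A1" "arp a = arp b"
  obtain x' v' where e': "b = Triple g x' v'" "x' <: W0 R" "v' <: W1 R" "src G g = p0 R x'" "p1 R v' = tgt G g"
   using b(1) by (rule R.act_ptsE) (use b(2) e(1) in auto)
  have "wmul S (add1 (bnd S) (de (g,x)) (de (g,x'))) (add1 (bnd S) (F1 v) (F1 v')) =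
    add1 (bnd S) (wmul S (de (g,x)) (F1 v)) (wmul S (de (g,x')) (F1 v'))"
   by (rule vg_mul_add[OF S.V]) (use c[of g x v] c[of g x' v'] a b e e' in "auto simp: d")
  thus "act_fun F0 F1 de (add1 (Act_ob G R) a b) = add1 (Act_ob G S) (act_fun F0 F1 de a) (act_fun F0 F1 de b)"
   using e e' F' by (simp add: act_fun_simp S.acts(10) R.acts(10) da)
 next
  fix x assume x: "x <: W0 R"
  show "p0 S (F0 x) = p0 R x" by (rule t(8)[OF x])
  have "wmul S (wunt S (F0 x)) (wunt S (F0 x)) = wunt S (F0 x)"
   using S.es(10)[OF S.es(3),of "F0 x"] Fp(1)[OF x] by (simp add: S.es)
  thus "act_fun F0 F1 de (unt (AG G R) x) = unt (AG G S) (F0 x)" using x d by (simp add: R.acts S.acts act_fun_simp)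
  show "F0 (scale0 (bnd R) r x) = scale0 (bnd S) r (F0 x)" for r using F' x by blast
  fix y assume "y <: W0 R" "p0 R x = p0 R y"
  thus "F0 (add0 (bnd R) x y) = add0 (bnd S) (F0 x) (F0 y)" using F' x by blast
 next
  fix a b assume ab: "a <: R.A1 & b <: R.A1 & obp a = tgt (AG G R) b"
  obtain g x v h y w where e: "a = Triple g x v" "b = Triple h y w" using ab by (metis R.act_ptsE)
  have cp: "cmp (AG G R) (Triple g x v) (Triple h y w)" using ab unfolding e R.acts(2) point.sel .
  note m = R.act_mul[OF cp]
  have y: "y <: W0 R" "src G h = p0 R y" "w <: W1 R" "v <: W1 R" "wtgt R w = act0 R h y" "x <: W0 R" "src G g = p0 R x"
   using cp by (auto simp: R.act_iff)
  have cS: "cmp (AG G S) (act_fun F0 F1 de (Triple g x v)) (act_fun F0 F1 de (Triple h y w))"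
   using cp p[of "Triple g x v"] p[of "Triple h y w"] c(1)[of h y w] m(5) t(5)[OF y(3)] by (simp add: S.acts(2,3) act_fun_simp S.es)
  note n = S.act_mul[OF cS[unfolded act_fun_simp]]
  let ?m = "wmul S"
  note cc = c[of g x v] c[of h y w]
  have hy: "act0 R h y <: W0 R" "src G g = p0 R (act0 R h y)" using m(4) y by (simp_all add: R.w0 R.wr_p)
  have gw: "act1 R g w <: W1 R" "wsrc R (act1 R g w) = act0 R g x" "wtgt R (act1 R g w) = act0 R g (act0 R h y)"
   "src G g = p1 R w" using m y by (simp_all add: R.w1 R.wr_p)
  have sd: "act1 S g (de (h,y)) <: W1 S" "wsrc S (act1 S g (de (h,y))) = act0 S g (F0 (act0 R h y))"
   "act1 S g (F1 w) <: W1 S" "wsrc S (act1 S g (F1 w)) = act0 S g (F0 x)" "wtgt S (act1 S g (F1 w)) = act0 S g (F0 (act0 R h y))"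
   using m y by (simp_all add: S.w1 d S.wr_p Fp)
  have al: "cmp (wgpd S) (alp S g h (F0 y)) (act1 S g (de (h,y)))" using m(4) y sd by (simp add: S.wa S.wr_p d)
  have dg: "de (g,x) <: W1 S" "de (g,act0 R h y) <: W1 S" "de (mul G g h,y) <: W1 S" using m(4) y hy by (simp_all add: d R.gs)
  note ps = dg sd gw al y hy Fp
  \<comment> \<open>Compatibility with products: naturality of delta at w moves delta (g, x) past
    the image of w, and the coherence of delta turns the resulting composite into delta (g h, y)
    after the image of alp (g, h, y).\<close>
  have "?m (alp S g h (F0 y)) (?m (act1 S g (?m (de (h,y)) (F1 w))) (?m (de (g,x)) (F1 v))) =
    ?m (alp S g h (F0 y)) (?m (act1 S g (de (h,y))) (?m (?m (act1 S g (F1 w)) (de (g,x))) (F1 v)))"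
   using wr_act_mul[OF G S.R _ cc(3),of g] gp_assoc[OF S.gE,of "act1 S g (de (h,y))" "act1 S g (F1 w)" "?m (de (g,x)) (F1 v)"]
    gp_assoc[OF S.gE,of "act1 S g (F1 w)" "de (g,x)" "F1 v"] ps m(4) cc ab e by (auto simp: d S.es)
  also have "?m (act1 S g (F1 w)) (de (g,x)) = ?m (de (g,act0 R h y)) (F1 (act1 R g w))" using dn[of g w] m(4,5) y gw by simp
  also have "?m (alp S g h (F0 y)) (?m (act1 S g (de (h,y))) (?m (?m (de (g,act0 R h y)) (F1 (act1 R g w))) (F1 v))) =
   ?m (?m (?m (alp S g h (F0 y)) (act1 S g (de (h,y)))) (de (g,act0 R h y))) (?m (F1 (act1 R g w)) (F1 v))"
   using gp_assoc[OF S.gE,of "de (g,act0 R h y)" "F1 (act1 R g w)" "F1 v"]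
    gp_assoc[OF S.gE,of "?m (alp S g h (F0 y)) (act1 S g (de (h,y)))" "de (g,act0 R h y)" "?m (F1 (act1 R g w)) (F1 v)"]
    gp_assoc[OF S.gE,of "alp S g h (F0 y)" "act1 S g (de (h,y))" "?m (de (g,act0 R h y)) (?m (F1 (act1 R g w)) (F1 v))"] ps m(3,4)
   by (simp add: d S.es)
  also have "... = ?m (?m (de (mul G g h,y)) (F1 (alp R g h y))) (?m (F1 (act1 R g w)) (F1 v))" using dc[OF m(4) y(1,2)] by simp
  also have "... = ?m (de (mul G g h,y)) (F1 (wmul R (alp R g h y) (wmul R (act1 R g w) v)))"
   using Fm[of "alp R g h y" "wmul R (act1 R g w) v"] Fm[OF m(3)] m(2,3,4) ps
    gp_assoc[OF S.gE,of "de (mul G g h,y)" "F1 (alp R g h y)" "?m (F1 (act1 R g w)) (F1 v)"]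
   by (simp add: R.es S.es R.gs d R.wr_p)
  finally show "act_fun F0 F1 de (mul (AG G R) a b) = mul (AG G S) (act_fun F0 F1 de a) (act_fun F0 F1 de b)"
   unfolding e m(1) act_fun_simp n(1) by simp
 qed
qed

end

section \<open>Recovering a map of weak representations from a map of action groupoids\<close>

context weak_rep_on
begin

text \<open>Composing with a vertical arrow on the left involves alp only with a unit, where it is
  an identity. The factors d and v appear in reverse order because the target of (g, x, d) is the
  source of d.\<close>

lemma unit_mul_Triple:
 assumes c: "cmp (AG G R) (Triple (unt G (tgt G g)) y v) (Triple g x d)"
 shows "mul (AG G R) (Triple (unt G (tgt G g)) y v) (Triple g x d) = Triple g x (wmul R d v)"
proof -
 have g: "g <: Ar G" "x <: W0 R" "src G g = p0 R x" "wtgt R d = act0 R g x" "d <: W1 R" "p1 R d = tgt G g"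
  using c by (auto elim: act_ptsE)
 have u: "act1 R (unt G (tgt G g)) d = d" using wr_u1[OF G R g(5)] g(6) by simp
 note m = act_mul[OF c,unfolded u wr_unt_alp[OF G R g(1,2,3)]]
 have "wmul R (wunt R (act0 R g x)) (wmul R d v) = wmul R d v" using gp_idl[OF gE es(6)[OF m(3)]] es(8)[OF m(3)] g(4) by simp
 thus ?thesis using m(1) gs(10)[OF g(1)] by simp
qed

text \<open>Here the vertical arrow comes first and is moved by g. Comparing this with
  \<open>unit_mul_Triple\<close> yields the naturality square of delta.\<close>

lemma Triple_mul_unit:
 assumes c: "cmp (AG G R) (Triple g x d) (Triple (unt G (src G g)) y w)"
 shows "mul (AG G R) (Triple g x d) (Triple (unt G (src G g)) y w) = Triple g y (wmul R (act1 R g w) d)"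
proof -
 note m = act_mul[OF c]
 have y: "y <: W0 R" "src G (unt G (src G g)) = p0 R y" "w <: W1 R" "wtgt R w = act0 R (unt G (src G g)) y"
  using c by (auto simp: act_iff)
 have g: "g <: Ar G" "src G g = p0 R y" using c y(2) by (auto simp: act_iff gs l_pr0_pts[OF V])
 have a: "alp R g (unt G (src G g)) y = wunt R (act0 R g y)" using wr_alp_unt[OF G R g(1) y(1) g(2)] g(2) by simp
 have t: "wtgt R (act1 R g w) = act0 R g y" using wr_tgt_act[OF G R g(1) y(3)] m(4,6) y(4) g(2) wr_u0[OF G R y(1)] by simp
 have "wmul R (wunt R (act0 R g y)) (wmul R (act1 R g w) d) = wmul R (act1 R g w) d"
  using gp_idl[OF gE es(6)[OF m(3)]] es(8)[OF m(3)] t by simp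
 thus ?thesis using m(1) gs(9)[OF g(1)] a by simp
qed

end

context weak_rep_pair
begin

lemma vert_pts: "v <: W1 R ==> vert v <: R.A1"
 using wr_u0[OF G R.R R.es(2)] l_pr_tgt[OF R.V] l_pr1_pts[OF R.V] by (auto simp: vert_def R.act_iff R.es R.gs)

lemma horiz_pts: "g <: Ar G ==> x <: W0 R ==> src G g = p0 R x ==> horiz g x <: R.A1" by (simp add: horiz_def R.act_iff R.es R.w0)

lemma vert_horiz:
 assumes a: "Triple g x v <: R.A1" shows "mul (AG G R) (vert v) (horiz g x) = Triple g x v" "cmp (AG G R) (vert v) (horiz g x)"
proof -
 have g: "g <: Ar G" "x <: W0 R" "v <: W1 R" "src G g = p0 R x" "wtgt R v = act0 R g x" "p1 R v = tgt G g"
  using a by (auto elim: R.act_ptsE)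
 show c: "cmp (AG G R) (vert v) (horiz g x)"
  using vert_pts[OF g(3)] horiz_pts[OF g(1,2,4)] R.w0[OF g(1,2,4)] g(5) by (simp add: R.acts(2,3)) (simp add: vert_def horiz_def R.es)
 show "mul (AG G R) (vert v) (horiz g x) = Triple g x v"
  using R.unit_mul_Triple[of g "wtgt R v" v x] c gp_idl[OF R.gE g(3)] g(5,6) by (simp add: vert_def horiz_def)
qed

text \<open>A functor evaluated on one product of vertical and horizontal arrows, written in two
  ways, gives one axiom of a map of weak representations. Smoothness and linearity of F1 and delta
  are those of f1 along \<open>vert\<close> and \<open>horiz\<close>.\<close>

lemma act_inv_weak_rep_map:
 assumes f: "vgmap (Act_ob G R) (Act_ob G S) f0 f1" and e0: "f0 : extensional (pts (W0 R))"
 shows "weak_rep_map G R S (act_inv (f0,f1))"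
  "act_inv (f0,f1) = ((f0,F1),de) ==> a <: R.A1 ==> act_fun f0 F1 de a = f1 a"
proof -
 define F1 where "F1 = restrict (%v. vcp (f1 (vert v))) (pts (W1 R))"
 define de where "de = restrict (%(g,x). vcp (f1 (horiz g x))) (act_dom G R)"
 have ai: "act_inv (f0,f1) = ((f0,F1),de)" by (simp add: act_inv_def F1_def de_def)
 note f' = f[unfolded vgmap_def R.acts(1,2,6,7,8,9) S.acts(1,2,6,7,8,9)]
 have fp: "f1 a <: S.A1" "obp (f1 a) = f0 (obp a)" "arp (f1 a) = arp a"
  "wsrc S (vcp (f1 a)) = f0 (wsrc R (vcp a))" if "a <: R.A1" for a
  using f' that sm_pts[OF S.act_mfd,of R.A1 "pts R.A1" f1 a] by (auto simp: R.acts(3) S.acts(3))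
 have fm: "f1 (mul (AG G R) a b) = mul (AG G S) (f1 a) (f1 b)" if "cmp (AG G R) a b" for a b
  using f' that unfolding R.acts(2) by blast
 have fc: "cmp (AG G S) (f1 a) (f1 b)" if "cmp (AG G R) a b" for a b
  using that fp[of a] fp[of b] by (simp add: R.acts(2,3) S.acts(2,3))
 have fu: "f1 (unt (AG G R) x) = unt (AG G S) (f0 x)" "p0 S (f0 x) = p0 R x" if "x <: W0 R" for x using f' that by auto
 have f0p: "f0 x <: W0 S" if "x <: W0 R" for x using f' sm_pts[OF S.M0 _ that] by blast
 have fa: "f1 (add1 (Act_ob G R) a b) = add1 (Act_ob G S) (f1 a) (f1 b)"
  if "a <: R.A1" "b <: R.A1" "arp a = arp b" for a b using f' that by blast
 have fsc: "f1 (scale1 (Act_ob G R) c a) = scale1 (Act_ob G S) c (f1 a)" if "a <: R.A1" for a c using f' that by blast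
 have fv: "f1 (vert v) = Triple (unt G (p1 R v)) (f0 (wtgt R v)) (F1 v)" if v: "v <: W1 R" for v
  using fp(1-3)[OF vert_pts[OF v]] v by (cases "f1 (vert v)") (auto simp: F1_def vert_def elim: S.act_ptsE)
 have fh: "f1 (horiz g x) = Triple g (f0 x) (de (g,x))" if gx: "g <: Ar G" "x <: W0 R" "src G g = p0 R x" for g x
  using fp(1-3)[OF horiz_pts[OF gx]] gx by (cases "f1 (horiz g x)") (auto simp: de_def act_dom_iff horiz_def elim: S.act_ptsE)
 have F: "F1 v <: W1 S" "wsrc S (F1 v) = f0 (wsrc R v)" "wtgt S (F1 v) = f0 (wtgt R v)" "p1 S (F1 v) = p1 R v"
  if v: "v <: W1 R" for v
 proof -
  have 1: "Triple (unt G (p1 R v)) (f0 (wtgt R v)) (F1 v) <: S.A1" using fp(1)[OF vert_pts[OF v]] fv[OF v] by simp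
  have t: "f0 (wtgt R v) <: W0 S" "p0 S (f0 (wtgt R v)) = p1 R v" using f0p fu(2) v by (simp_all add: R.es l_pr_tgt[OF R.V])
  show 2: "F1 v <: W1 S" using 1 by (simp add: S.act_iff)
  show 3: "wtgt S (F1 v) = f0 (wtgt R v)" using 1 wr_u0[OF G S.R t(1)] t(2) by (simp add: S.act_iff)
  show "wsrc S (F1 v) = f0 (wsrc R v)" using fp(4)[OF vert_pts[OF v]] by (simp add: fv[OF v]) (simp add: vert_def)
  show "p1 S (F1 v) = p1 R v" using l_pr_tgt[OF S.V 2] 3 t(2) by simp
 qed
 have D: "de (g,x) <: W1 S" "wsrc S (de (g,x)) = f0 (act0 R g x)" "wtgt S (de (g,x)) = act0 S g (f0 x)" "p1 S (de (g,x)) = tgt G g"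
  if gx: "g <: Ar G" "x <: W0 R" "src G g = p0 R x" for g x
 proof -
  have 1: "Triple g (f0 x) (de (g,x)) <: S.A1" using fp(1)[OF horiz_pts[OF gx]] fh[OF gx] by simp
  thus "de (g,x) <: W1 S" "wtgt S (de (g,x)) = act0 S g (f0 x)" "p1 S (de (g,x)) = tgt G g" by (auto elim: S.act_ptsE)
  show "wsrc S (de (g,x)) = f0 (act0 R g x)"
   using fp(4)[OF horiz_pts[OF gx]] R.w0[OF gx] by (simp add: fh[OF gx]) (simp add: horiz_def R.es)
 qed
 \<comment> \<open>Vertical arrows multiply in reverse order: \<open>vert w\<close> times
   \<open>vert v\<close> is \<open>vert\<close> of v w.\<close>
 have vm: "F1 (wmul R v w) = wmul S (F1 v) (F1 w)" if vw: "cmp (wgpd R) v w" for v w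
 proof -
  have p: "p1 R v = p1 R w" by (rule l_pr_comp[OF R.V vw])
  have t: "tgt G (unt G (p1 R w)) = p1 R w" "p1 R (wmul R v w) = p1 R w" using vw l_pr1_pts[OF R.V] l_pr_mul[OF R.V vw] p by (simp_all add: R.gs)
  have c: "cmp (AG G R) (vert w) (vert v)" using vert_pts vw by (simp add: R.acts(2,3)) (simp add: vert_def)
  have "mul (AG G R) (vert w) (vert v) = vert (wmul R v w)"
   using R.unit_mul_Triple[of "unt G (p1 R v)" "wtgt R w" w "wtgt R v" v] c t p vw by (simp add: vert_def R.es)
  moreover have "mul (AG G S) (f1 (vert w)) (f1 (vert v)) = Triple (unt G (p1 R w)) (f0 (wtgt R v)) (wmul S (F1 v) (F1 w))"
   using S.unit_mul_Triple[of "unt G (p1 R v)" "f0 (wtgt R w)" "F1 w" "f0 (wtgt R v)" "F1 v"] fc[OF c] t p vw by (simp add: fv)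
  ultimately show ?thesis using fm[OF c] fv[of "wmul R v w"] vw by (simp add: R.es)
 qed
 have su: "smooth (W1 R) R.A1 vert" unfolding vert_def
  by (rule R.act_sm_Triple[OF R.M1 sm_unt[OF G R.M1 l_sm_pr1[OF R.V]] lg_tgt[OF R.E] sm_id[OF R.M1 otop]])
   (use vert_pts in "auto simp: vert_def R.act_iff")
 have sF: "smooth (W1 R) (W1 S) F1"
  by (rule sm_cong[OF R.M1 S.act_sm_vec[OF R.M1 smcomp[OF R.M1 R.act_mfd su]],of f1]) (use f' in "auto simp: F1_def")
 note PM = mf_fibre[OF qr0[OF G R.R]]
 have pP: "pts (P0 G R) = act_dom G R" by (auto simp: fib_pts[OF qr0[OF G R.R]] fibre_prod_set_def)
 have fx: "smooth (P0 G R) (Ar G) fst" "smooth (P0 G R) (W0 R) snd"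
  by (rule fib_fst[OF qr0[OF G R.R]],rule fib_snd[OF qr0[OF G R.R]])
 have sh: "smooth (P0 G R) R.A1 (%q. horiz (fst q) (snd q))" unfolding horiz_def
  by (rule R.act_sm_Triple[OF PM fx sm_unt[OF R.E PM wr_sm0[OF G R.R PM fx]]]) (auto simp: pP act_dom_iff R.w0 R.es)
 have sd: "smooth (P0 G R) (W1 S) de"
  by (rule sm_cong[OF PM S.act_sm_vec[OF PM smcomp[OF PM R.act_mfd sh]],of f1]) (use f' in "auto simp: de_def pP")
 have vgF: "vgmap (bnd R) (bnd S) f0 F1" unfolding vgmap_def
 proof (intro conjI ballI allI impI sF vm; (simp add: F fu; fail)?)
  show "smooth (W0 R) (W0 S) f0" using f' by blast
  fix v assume v: "v <: W1 R"
  show "F1 (scale1 (bnd R) c v) = scale1 (bnd S) c (F1 v)" for c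
   using fsc[OF vert_pts[OF v],of c] fv[OF v] fv[of "scale1 (bnd R) c v"] v by (simp add: R.acts(11) S.acts(11) vert_def R.vs)
  fix w assume w: "w <: W1 R" "p1 R v = p1 R w"
  show "F1 (add1 (bnd R) v w) = add1 (bnd S) (F1 v) (F1 w)"
   using fa[OF vert_pts[OF v] vert_pts[OF w(1)]] fv[OF v] fv[OF w(1)] fv[of "add1 (bnd R) v w"] v w
   by (simp add: R.acts(10) S.acts(10) vert_def R.vs)
 next
  fix x assume x: "x <: W0 R"
  have "vert (wunt R x) = unt (AG G R) x" using x by (simp add: vert_def R.acts R.es l_pr_unt[OF R.V])
  thus "F1 (wunt R x) = wunt S (f0 x)" using fv[of "wunt R x"] fu(1)[OF x] x by (simp add: R.es S.acts)
  show "f0 (scale0 (bnd R) c x) = scale0 (bnd S) c (f0 x)" for c using f' x by blast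
  fix y assume "y <: W0 R" "p0 R x = p0 R y"
  thus "f0 (add0 (bnd R) x y) = add0 (bnd S) (f0 x) (f0 y)" using f' x by blast
 qed
 have vh: "mul (AG G S) (f1 (vert v)) (f1 (horiz g x)) = Triple g (f0 x) (wmul S (de (g,x)) (F1 v))"
  if a: "Triple g x v <: R.A1" for g x v
 proof -
  have g: "g <: Ar G" "x <: W0 R" "v <: W1 R" "src G g = p0 R x" "p1 R v = tgt G g" using a by (auto elim: R.act_ptsE)
  show ?thesis using S.unit_mul_Triple[of g "f0 (wtgt R v)" "F1 v" "f0 x" "de (g,x)"] fc[OF vert_horiz(2)[OF a]] g
   by (simp add: fv fh)
 qed
 show "act_fun f0 F1' de' a = f1 a" if i: "act_inv (f0,f1) = ((f0,F1'),de')" "a <: R.A1" for F1' de' a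
 proof -
  have F': "F1' = F1" "de' = de" using i(1) ai by auto
  obtain g x v where a: "a = Triple g x v" using i(2) by (rule R.act_ptsE)
  show ?thesis using fm[OF vert_horiz(2)] vert_horiz(1) vh i(2) by (simp add: a act_fun_simp F')
 qed
 \<comment> \<open>Naturality: \<open>horiz\<close> at the source of v times \<open>vert v\<close>
   equals (g, target of v, g v), which is also \<open>vert\<close> of g v times \<open>horiz\<close>
   at the target of v. The map f1 is applied to both products.\<close>
 have nat: "wmul S (de (g,wtgt R v)) (F1 (act1 R g v)) = wmul S (act1 S g (F1 v)) (de (g,wsrc R v))"
  if g: "g <: Ar G" "v <: W1 R" "src G g = p1 R v" for g v
 proof -
  let ?x = "wsrc R v" and ?y = "wtgt R v"
  have xy: "?x <: W0 R" "?y <: W0 R" "src G g = p0 R ?x" "src G g = p0 R ?y" using g by (simp_all add: R.es R.vs)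
  have gv: "act1 R g v <: W1 R" by (rule R.w1[OF g])
  have t: "Triple g ?y (act1 R g v) <: R.A1" using g xy gv by (simp add: R.act_iff R.wr_p)
  have c: "cmp (AG G R) (horiz g ?x) (vert v)"
   using vert_pts[OF g(2)] horiz_pts[OF g(1) xy(1,3)] by (simp add: R.acts(2,3)) (simp add: vert_def horiz_def)
  have "mul (AG G R) (horiz g ?x) (vert v) = Triple g ?y (act1 R g v)"
   using R.Triple_mul_unit[of g ?x "wunt R (act0 R g ?x)" ?y v] c g(3) gp_idr[OF R.gE gv] wr_src_act[OF G R.R g]
   by (simp add: vert_def horiz_def)
  moreover have "mul (AG G S) (f1 (horiz g ?x)) (f1 (vert v)) = Triple g (f0 ?y) (wmul S (act1 S g (F1 v)) (de (g,?x)))"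
   using S.Triple_mul_unit[of g "f0 ?x" "de (g,?x)" "f0 ?y" "F1 v"] fc[OF c] g(3) by (simp add: fv[OF g(2)] fh[OF g(1) xy(1,3)])
  ultimately show ?thesis using fm[OF c] fm[OF vert_horiz(2)[OF t]] vert_horiz(1)[OF t] vh[OF t] by simp
 qed
 \<comment> \<open>Coherence: the product of two horizontal arrows is (g k, x, alp (g, k, x)), which
   is also vertical times horizontal.\<close>
 have coc: "wmul S (wmul S (alp S g k (f0 x)) (act1 S g (de (k,x)))) (de (g,act0 R k x)) =
    wmul S (de (mul G g k,x)) (F1 (alp R g k x))" if gk: "cmp G g k" and x: "x <: W0 R" "src G k = p0 R x" for g k x
 proof -
  have kx: "act0 R k x <: W0 R" "src G g = p0 R (act0 R k x)" using gk x by (simp_all add: R.w0 R.wr_p)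
  have al: "alp R g k x <: W1 R" using gk x by (simp add: R.wa)
  have t: "Triple (mul G g k) x (alp R g k x) <: R.A1" using gk x al by (simp add: R.act_iff R.gs R.wr_p)
  have c: "cmp (AG G R) (horiz g (act0 R k x)) (horiz k x)"
   using horiz_pts kx gk x by (simp add: R.acts(2,3)) (simp add: horiz_def R.es)
  have "wmul R (act1 R g (wunt R (act0 R k x))) (wunt R (act0 R g (act0 R k x))) = wunt R (act0 R g (act0 R k x))"
   using wr_act_unt[OF G R.R _ kx] gk gp_idr[OF R.gE R.es(3)[OF R.w0[OF _ kx]]] R.w0[OF _ kx] by (simp add: R.es)
  hence "mul (AG G R) (horiz g (act0 R k x)) (horiz k x) = Triple (mul G g k) x (alp R g k x)"
   using R.act_mul(1)[OF c[unfolded horiz_def]] gp_idr[OF R.gE al] wr_src_alp[OF G R.R gk x] by (simp add: horiz_def)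
  moreover have "mul (AG G S) (f1 (horiz g (act0 R k x))) (f1 (horiz k x)) =
    Triple (mul G g k) (f0 x) (wmul S (wmul S (alp S g k (f0 x)) (act1 S g (de (k,x)))) (de (g,act0 R k x)))"
   using gk x kx by (simp add: fh S.acts)
  ultimately show ?thesis using fm[OF c] fm[OF vert_horiz(2)[OF t]] vert_horiz(1)[OF t] vh[OF t] by simp
 qed
 show "weak_rep_map G R S (act_inv (f0,f1))" unfolding ai weak_rep_map_unfold prod.case
 proof (intro conjI ballI allI impI vgF sd e0; (elim conjE)?; (simp add: D nat coc; fail)?)
  show "F1 : extensional (pts (W1 R))" "de : extensional (act_dom G R)" by (simp_all add: F1_def de_def)
  fix x assume x: "x <: W0 R"
  have "horiz (unt G (p0 R x)) x = unt (AG G R) x" using wr_u0[OF G R.R x] by (simp add: horiz_def R.acts)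
  thus "de (unt G (p0 R x),x) = wunt S (f0 x)"
   using fh[of "unt G (p0 R x)" x] fu(1)[OF x] x l_pr0_pts[OF R.V x] by (simp add: R.gs S.acts)
 next
  fix g x c assume g: "g <: Ar G" "x <: W0 R" "src G g = p0 R x"
  show "de (g,scale0 (bnd R) c x) = scale1 (bnd S) c (de (g,x))"
   using fsc[OF horiz_pts[OF g],of c] fh[OF g] fh[of g "scale0 (bnd R) c x"] g R.w0[OF g]
   by (simp add: R.acts(11) S.acts(11) horiz_def R.vs wr_act_scale0[OF G R.R])
 next
  fix g x y assume g: "g <: Ar G" "x <: W0 R" "y <: W0 R" "src G g = p0 R x" "src G g = p0 R y"
  have xy: "add0 (bnd R) x y <: W0 R" "src G g = p0 R (add0 (bnd R) x y)" using g(4,5) R.vs(1,2)[OF g(2,3)] by simp_all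
  have "wunt R (add0 (bnd R) (act0 R g x) (act0 R g y)) = add1 (bnd R) (wunt R (act0 R g x)) (wunt R (act0 R g y))"
   by (rule vg_unt_add[OF R.V R.w0[OF g(1,2,4)] R.w0[OF g(1,3,5)]]) (simp add: wr_pr_act0[OF G R.R g(1,2,4)] wr_pr_act0[OF G R.R g(1,3,5)])
  hence "horiz g (add0 (bnd R) x y) = add1 (Act_ob G R) (horiz g x) (horiz g y)"
   by (simp add: horiz_def R.acts(10) wr_act_add0[OF G R.R g])
  thus "de (g,add0 (bnd R) x y) = add1 (bnd S) (de (g,x)) (de (g,y))"
   using fa[OF horiz_pts[OF g(1,2,4)] horiz_pts[OF g(1,3,5)]] fh[OF g(1) xy]
   by (simp add: fh[OF g(1,2,4)] fh[OF g(1,3,5)] S.acts(10)) (simp add: horiz_def)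
 qed
qed

text \<open>The hypotheses are weaker than being a morphism, so that the lemma applies to the identities and composites before these are known to be morphisms.\<close>

lemma act_inv_Act_mor:
 assumes e: "F0 : extensional (pts (W0 R))" "F1 : extensional (pts (W1 R))" "de : extensional (act_dom G R)"
  and F0: "!!x. x <: W0 R ==> F0 x <: W0 S & F1 (wunt R x) = wunt S (F0 x) & de (unt G (p0 R x),x) = wunt S (F0 x)"
  and F1: "!!v. v <: W1 R ==> F1 v <: W1 S & wtgt S (F1 v) = F0 (wtgt R v)"
  and de: "!!g x. g <: Ar G ==> x <: W0 R ==> src G g = p0 R x ==> de (g,x) <: W1 S & wsrc S (de (g,x)) = F0 (act0 R g x)"
 shows "act_inv (Act_mor G R S ((F0,F1),de)) = ((F0,F1),de)"
proof -
 have "vcp (act_fun F0 F1 de (vert v)) = F1 v" if v: "v <: W1 R" for v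
  using F0[OF R.es(2)[OF v]] F1[OF v] gp_idl[OF S.gE,of "F1 v"] v by (simp add: vert_def act_fun_simp flip: l_pr_tgt[OF R.V v])
 hence 1: "restrict (%v. vcp (restrict (act_fun F0 F1 de) (pts R.A1) (vert v))) (pts (W1 R)) = F1"
  using e(2) vert_pts by (auto simp: restrict_def extensional_def fun_eq_iff)
 have "vcp (act_fun F0 F1 de (horiz g x)) = de (g,x)" if g: "g <: Ar G" "x <: W0 R" "src G g = p0 R x" for g x
  using F0[OF R.w0[OF g]] de[OF g] gp_idr[OF S.gE,of "de (g,x)"] by (simp add: horiz_def act_fun_simp)
 hence 2: "restrict (%(g,x). vcp (restrict (act_fun F0 F1 de) (pts R.A1) (horiz g x))) (act_dom G R) = de"
  using e(3) horiz_pts by (auto simp: restrict_def extensional_def fun_eq_iff act_dom_iff)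
 show ?thesis unfolding Act_mor_eq act_inv_def fst_conv snd_conv 1 2 ..
qed

lemma Act_mor_Hom:
 assumes m: "weak_rep_map G R S m"
 shows "vb_gpd_map G (Act_ob G R) (Act_ob G S) (Act_mor G R S m)" "act_inv (Act_mor G R S m) = m"
proof -
 obtain F0 F1 de where e: "m = ((F0,F1),de)" by (cases m) auto
 note t = weak_rep_map_typing[OF m[unfolded e]]
 have "vgmap (Act_ob G R) (Act_ob G S) F0 (restrict (act_fun F0 F1 de) (pts R.A1))"
  by (rule vgmap_cong[OF R.Act_vb act_fun_vgmap[OF m[unfolded e]]]) auto
 thus "vb_gpd_map G (Act_ob G R) (Act_ob G S) (Act_mor G R S m)"
  using t(1) by (simp add: e Act_mor_eq vb_gpd_map_iff[OF R.Act_vb] R.acts(1))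
 show "act_inv (Act_mor G R S m) = m" unfolding e by (rule act_inv_Act_mor[OF t(1-3)]) (use t(4-6) in auto)
qed

lemma act_inv_Hom:
 assumes f: "vb_gpd_map G (Act_ob G R) (Act_ob G S) f" shows "weak_rep_map G R S (act_inv f)" "Act_mor G R S (act_inv f) = f"
proof -
 obtain f0 f1 where e: "f = (f0,f1)" by (cases f) auto
 have v: "vgmap (Act_ob G R) (Act_ob G S) f0 f1" "f0 : extensional (pts (W0 R))" "f1 : extensional (pts R.A1)"
  using f by (simp_all add: e vb_gpd_map_iff[OF R.Act_vb] R.acts(1))
 show "weak_rep_map G R S (act_inv f)" unfolding e by (rule act_inv_weak_rep_map(1)[OF v(1,2)])
 obtain F1 de where a: "act_inv (f0,f1) = ((f0,F1),de)" by (simp add: act_inv_def)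
 show "Act_mor G R S (act_inv f) = f"
  using act_inv_weak_rep_map(2)[OF v(1,2) a] v(3) by (auto simp: e a Act_mor_eq restrict_def extensional_def fun_eq_iff)
qed

end

section \<open>Equivalences of categories\<close>

context
 fixes C :: "('o,'m) cat"
 assumes C: "category C"
begin

lemma cat_Idn: "a : Objs C ==> Idn C a : Hom C a a"
 and cat_Cmp: "a : Objs C ==> b : Objs C ==> c : Objs C ==> h : Hom C a b ==> k : Hom C b c ==> Cmp C a b c k h : Hom C a c"
 and cat_idr: "a : Objs C ==> b : Objs C ==> h : Hom C a b ==> Cmp C a a b h (Idn C a) = h"
 and cat_idl: "a : Objs C ==> b : Objs C ==> h : Hom C a b ==> Cmp C a b b (Idn C b) h = h"
 and cat_assoc: "a : Objs C ==> b : Objs C ==> c : Objs C ==> d : Objs C ==> h : Hom C a b ==> k : Hom C b c ==>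
  l : Hom C c d ==> Cmp C a c d l (Cmp C a b c k h) = Cmp C a b d (Cmp C b c d l k) h" using C unfolding category_def by blast+

end

text \<open>The laws of C are pulled back from D: both sides of each law agree after applying Fm,
  which is injective on every Hom set. In this way weak representations are seen to form a category
  at the same time as the functor is constructed.\<close>

lemma faithful_functorI:
 assumes D: "category D" and Fo: "!!a. a : Objs C ==> Fo a : Objs D"
  and Fm: "!!a b h. a : Objs C ==> b : Objs C ==> h : Hom C a b ==> Fm a b h : Hom D (Fo a) (Fo b)"
  and inj: "!!a b h k. a : Objs C ==> b : Objs C ==> h : Hom C a b ==> k : Hom C a b ==> Fm a b h = Fm a b k ==> h = k"
  and id: "!!a. a : Objs C ==> Idn C a : Hom C a a & Fm a a (Idn C a) = Idn D (Fo a)"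
  and cmp: "!!a b c h k. a : Objs C ==> b : Objs C ==> c : Objs C ==> h : Hom C a b ==> k : Hom C b c ==>
   Cmp C a b c k h : Hom C a c & Fm a c (Cmp C a b c k h) = Cmp D (Fo a) (Fo b) (Fo c) (Fm b c k) (Fm a b h)"
 shows "is_functor C D (Fo,Fm)"
proof -
 note d = cat_idr[OF D] cat_idl[OF D] cat_assoc[OF D]
 have "category C" unfolding category_def
 proof (intro conjI ballI)
  fix a b c e h k l assume "a : Objs C" "b : Objs C" "c : Objs C" "e : Objs C" "h : Hom C a b" "k : Hom C b c" "l : Hom C c e"
  thus "Cmp C a c e l (Cmp C a b c k h) = Cmp C a b e (Cmp C b c e l k) h" by (intro inj[of a e]) (simp_all add: cmp d Fo Fm)
 next
  fix a b h assume "a : Objs C" "b : Objs C" "h : Hom C a b"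
  thus "Cmp C a a b h (Idn C a) = h" "Cmp C a b b (Idn C b) h = h" by (auto intro!: inj[of a b] simp: cmp d Fo Fm id)
 qed (simp_all add: id cmp)
 thus ?thesis using D Fo Fm id cmp by (simp add: is_functor_def)
qed

text \<open>The inverse functor chooses an object Qo d and an isomorphism e d for each d, and on
  morphisms lifts conjugates along the full functor. Injectivity of Fm reduces all equations in C to
  equations in D.\<close>

lemma equivalence_of_categoriesI:
 assumes F: "is_functor C D (Fo,Fm)"
  and full: "!!a b f. a : Objs C ==> b : Objs C ==> f : Hom D (Fo a) (Fo b) ==> EX h:Hom C a b. Fm a b h = f"
  and inj: "!!a b h k. a : Objs C ==> b : Objs C ==> h : Hom C a b ==> k : Hom C a b ==> Fm a b h = Fm a b k ==> h = k"
  and ess: "!!d. d : Objs D ==> EX a:Objs C. EX e. is_iso D (Fo a) d e" shows "equivalence_of_categories C D (Fo,Fm)"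
proof -
 have C: "category C" and D: "category D" and Fo: "!!a. a : Objs C ==> Fo a : Objs D"
  and Fid: "!!a. a : Objs C ==> Fm a a (Idn C a) = Idn D (Fo a)"
  and Fm: "!!a b h. a : Objs C ==> b : Objs C ==> h : Hom C a b ==> Fm a b h : Hom D (Fo a) (Fo b)"
  and Fc: "!!a b c h k. a : Objs C ==> b : Objs C ==> c : Objs C ==> h : Hom C a b ==> k : Hom C b c ==>
   Fm a c (Cmp C a b c k h) = Cmp D (Fo a) (Fo b) (Fo c) (Fm b c k) (Fm a b h)" using F by (auto simp: is_functor_def)
 note Ci = cat_Idn[OF C] and Cc = cat_Cmp[OF C] and Di = cat_Idn[OF D] and Dc = cat_Cmp[OF D]
  and Dr = cat_idr[OF D] and Dl = cat_idl[OF D] and Da = cat_assoc[OF D]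
 obtain Qo e e' where Qo: "!!d. d : Objs D ==> Qo d : Objs C" and e: "!!d. d : Objs D ==> e d : Hom D (Fo (Qo d)) d"
  and e': "!!d. d : Objs D ==> e' d : Hom D d (Fo (Qo d))"
  and e'e: "!!d. d : Objs D ==> Cmp D (Fo (Qo d)) d (Fo (Qo d)) (e' d) (e d) = Idn D (Fo (Qo d))"
  and ee': "!!d. d : Objs D ==> Cmp D d (Fo (Qo d)) d (e d) (e' d) = Idn D d" using ess unfolding is_iso_def by metis
 note FQ = Fo[OF Qo]
 obtain L where L: "!!a b f. a : Objs C ==> b : Objs C ==> f : Hom D (Fo a) (Fo b) ==> L a b f : Hom C a b & Fm a b (L a b f) = f"
  using full by metis
 \<comment> \<open>f conjugated by the chosen isomorphisms: first e d, then f, then the inverse e'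
   d'.\<close>
 define conj where "conj d d' f = Cmp D (Fo (Qo d)) d (Fo (Qo d')) (Cmp D d d' (Fo (Qo d')) (e' d') f) (e d)" for d d' f
 define Qm where "Qm d d' f = L (Qo d) (Qo d') (conj d d' f)" for d d' f
 have cj: "conj d d' f : Hom D (Fo (Qo d)) (Fo (Qo d'))" if "d : Objs D" "d' : Objs D" "f : Hom D d d'" for d d' f
  using that by (simp add: conj_def Dc e e' FQ)
 have Qm: "Qm d d' f : Hom C (Qo d) (Qo d')" "Fm (Qo d) (Qo d') (Qm d d' f) = conj d d' f" if "d : Objs D" "d' : Objs D" "f : Hom D d d'" for d d' f
  using L[OF Qo Qo cj[OF that]] that by (simp_all add: Qm_def)
 have ec: "Cmp D (Fo (Qo d)) (Fo (Qo d')) d' (e d') (conj d d' f) = Cmp D (Fo (Qo d)) d d' f (e d)"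
  if d: "d : Objs D" "d' : Objs D" and f: "f : Hom D d d'" for d d' f
 proof -
  have "Cmp D (Fo (Qo d)) (Fo (Qo d')) d' (e d') (conj d d' f) = Cmp D (Fo (Qo d)) d d' (Cmp D d (Fo (Qo d')) d' (e d') (Cmp D d d' (Fo (Qo d')) (e' d') f)) (e d)"
   unfolding conj_def by (rule Da) (use d f in "simp_all add: FQ e e' Dc")
  also have "Cmp D d (Fo (Qo d')) d' (e d') (Cmp D d d' (Fo (Qo d')) (e' d') f) = f"
   using Da[of d d' "Fo (Qo d')" d' f "e' d'" "e d'"] d f by (simp add: FQ e e' ee' Dl)
  finally show ?thesis .
 qed
 \<comment> \<open>As e d' is invertible, the conjugate is the only morphism making the square with
   e d and e d' commute. Functoriality of Qm then reduces to pasting squares.\<close>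
 have conj_eq: "conj d d' f = x" if d: "d : Objs D" "d' : Objs D" and f: "f : Hom D d d'" and x: "x : Hom D (Fo (Qo d)) (Fo (Qo d'))"
  and q: "Cmp D (Fo (Qo d)) (Fo (Qo d')) d' (e d') x = Cmp D (Fo (Qo d)) d d' f (e d)" for d d' f x
 proof -
  have "y = Cmp D (Fo (Qo d)) d' (Fo (Qo d')) (e' d') (Cmp D (Fo (Qo d)) (Fo (Qo d')) d' (e d') y)" if y: "y : Hom D (Fo (Qo d)) (Fo (Qo d'))" for y
   using Da[of "Fo (Qo d)" "Fo (Qo d')" d' "Fo (Qo d')" y "e d'" "e' d'"] d y by (simp add: FQ e e' e'e Dl)
  from this[OF x] this[OF cj[OF d f]] show ?thesis using q ec[OF d f] by simp
 qed
 have Q: "is_functor D C (Qo,Qm)" unfolding is_functor_def prod.case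
 proof (intro conjI ballI C D)
  fix a assume a: "a : Objs D"
  show "Qo a : Objs C" by (rule Qo[OF a])
  have "conj a a (Idn D a) = Idn D (Fo (Qo a))"
   by (rule conj_eq[OF a a Di[OF a] Di[OF FQ[OF a]]]) (use a in "simp add: Dr Dl e FQ")
  thus "Qm a a (Idn D a) = Idn C (Qo a)" using a Qm[OF a a Di[OF a]] by (intro inj[of "Qo a" "Qo a"]) (simp_all add: Qo Ci Fid)
  fix b h assume b: "b : Objs D" and h: "h : Hom D a b"
  show "Qm a b h : Hom C (Qo a) (Qo b)" by (rule Qm(1)[OF a b h])
  fix c k assume c: "c : Objs D" and k: "k : Hom D b c"
  have kh: "Cmp D a b c k h : Hom D a c" by (rule Dc[OF a b c h k])
  have "conj a c (Cmp D a b c k h) = Cmp D (Fo (Qo a)) (Fo (Qo b)) (Fo (Qo c)) (conj b c k) (conj a b h)"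
  proof (rule conj_eq[OF a c kh])
   show "Cmp D (Fo (Qo a)) (Fo (Qo b)) (Fo (Qo c)) (conj b c k) (conj a b h) : Hom D (Fo (Qo a)) (Fo (Qo c))"
    using a b c h k by (simp add: Dc FQ cj)
   show "Cmp D (Fo (Qo a)) (Fo (Qo c)) c (e c) (Cmp D (Fo (Qo a)) (Fo (Qo b)) (Fo (Qo c)) (conj b c k) (conj a b h)) =
     Cmp D (Fo (Qo a)) a c (Cmp D a b c k h) (e a)"
    using Da[of "Fo (Qo a)" "Fo (Qo b)" "Fo (Qo c)" c "conj a b h" "conj b c k" "e c"] Da[of "Fo (Qo a)" "Fo (Qo b)" b c "conj a b h" "e b" k]
     Da[of "Fo (Qo a)" a b c "e a" h k] ec[OF b c k] ec[OF a b h] a b c h k by (simp add: FQ cj e)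
  qed
  thus "Qm a c (Cmp D a b c k h) = Cmp C (Qo a) (Qo b) (Qo c) (Qm b c k) (Qm a b h)"
   using a b c Qm[OF a c kh] Qm[OF b c k] Qm[OF a b h] by (intro inj[of "Qo a" "Qo c"]) (simp_all add: Qo Cc Fc)
 qed
 have PQ: "naturally_isomorphic D D (comp_ftor (Fo,Fm) (Qo,Qm)) id_ftor"
  unfolding naturally_isomorphic_def comp_ftor_def id_ftor_def is_iso_def fst_conv snd_conv o_def id_def
 proof (intro exI[of _ e] conjI ballI)
  fix a assume a: "a : Objs D"
  show "e a : Hom D (Fo (Qo a)) a" by (rule e[OF a])
  show "EX k:Hom D a (Fo (Qo a)). Cmp D (Fo (Qo a)) a (Fo (Qo a)) k (e a) = Idn D (Fo (Qo a)) & Cmp D a (Fo (Qo a)) a (e a) k = Idn D a"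
   using e'[OF a] e'e[OF a] ee'[OF a] by blast
  fix b h assume "b : Objs D" "h : Hom D a b"
  thus "Cmp D (Fo (Qo a)) (Fo (Qo b)) b (e b) (Fm (Qo a) (Qo b) (Qm a b h)) = Cmp D (Fo (Qo a)) a b h (e a)"
   using Qm(2) ec a by simp
 qed
 \<comment> \<open>The natural isomorphism on the side of C is the lift of e (Fo a), and its inverse
   is the lift of e' (Fo a).\<close>
 define et where "et a = L (Qo (Fo a)) a (e (Fo a))" for a
 define et' where "et' a = L a (Qo (Fo a)) (e' (Fo a))" for a
 note QF = Qo[OF Fo]
 have et: "et a : Hom C (Qo (Fo a)) a" "Fm (Qo (Fo a)) a (et a) = e (Fo a)" and et': "et' a : Hom C a (Qo (Fo a))" "Fm a (Qo (Fo a)) (et' a) = e' (Fo a)"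
  if "a : Objs C" for a
  using L[OF QF[OF that] that e[OF Fo[OF that]]] L[OF that QF[OF that] e'[OF Fo[OF that]]] by (simp_all add: et_def et'_def)
 have QP: "naturally_isomorphic C C (comp_ftor (Qo,Qm) (Fo,Fm)) id_ftor"
  unfolding naturally_isomorphic_def comp_ftor_def id_ftor_def is_iso_def fst_conv snd_conv o_def id_def
 proof (intro exI[of _ et] conjI ballI bexI)
  fix a assume a: "a : Objs C"
  note h = et[OF a] et'[OF a]
  show "et a : Hom C (Qo (Fo a)) a" "et' a : Hom C a (Qo (Fo a))" by (rule h)+
  show "Cmp C (Qo (Fo a)) a (Qo (Fo a)) (et' a) (et a) = Idn C (Qo (Fo a))"
   by (rule inj[OF QF[OF a] QF[OF a]]) (use a h in "simp_all add: Cc Ci QF Fc Fid e'e Fo")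
  show "Cmp C a (Qo (Fo a)) a (et a) (et' a) = Idn C a" by (rule inj[OF a a]) (use a h in "simp_all add: Cc Ci QF Fc Fid ee' Fo")
  fix b k assume b: "b : Objs C" and k: "k : Hom C a b"
  have q: "Qm (Fo a) (Fo b) (Fm a b k) : Hom C (Qo (Fo a)) (Qo (Fo b))" "Fm (Qo (Fo a)) (Qo (Fo b)) (Qm (Fo a) (Fo b) (Fm a b k)) = conj (Fo a) (Fo b) (Fm a b k)"
   using Qm[OF Fo[OF a] Fo[OF b] Fm[OF a b k]] .
  show "Cmp C (Qo (Fo a)) (Qo (Fo b)) b (et b) (Qm (Fo a) (Fo b) (Fm a b k)) = Cmp C (Qo (Fo a)) a b k (et a)"
   by (rule inj[OF QF[OF a] b]) (use a b k h et[OF b] q ec[OF Fo[OF a] Fo[OF b] Fm[OF a b k]] in "simp_all add: Cc QF Fc")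
 qed
 show ?thesis unfolding equivalence_of_categories_def using F Q PQ QP by blast
qed

section \<open>The action functor\<close>

lemma WRep_simps: "Objs (WRep G) = {R. weak_rep G R}" "Hom (WRep G) R S = {m. weak_rep_map G R S m}"
 "Idn (WRep G) R = ((restrict id (pts (W0 R)),restrict id (pts (W1 R))),restrict (%(g,x). wunt R (act0 R g x)) (act_dom G R))"
 "Cmp (WRep G) R S T ((F0',F1'),de') ((F0,F1),de) = ((compose (pts (W0 R)) F0' F0,compose (pts (W1 R)) F1' F1),
   restrict (%(g,x). wmul T (de' (g,F0 x)) (F1' (de (g,x)))) (act_dom G R))" by (simp_all add: WRep_def)

lemma weak_rep_pairI: "lie_groupoid G ==> weak_rep G R ==> weak_rep G S ==> weak_rep_pair G R S"
 by (simp add: weak_rep_pair_def weak_rep_on_def)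

text \<open>That identities and composites are maps of weak representations follows from the other
  side: their images under \<open>Act_mor\<close> are an identity and a composite of VB-groupoid
  maps, and \<open>act_inv\<close> takes maps of VB-groupoids to maps of weak
  representations.\<close>

lemma Act_functor:
 fixes G :: "('b,'g) lgpd"
 assumes G: "lie_groupoid G" shows "is_functor (WRep G :: (('b,'g,'a) wrep_pt,('g,'a) wrep_mor) cat) (VB G) (Act_ob G,Act_mor G)"
proof (rule faithful_functorI[OF VB_category],unfold WRep_simps mem_Collect_eq VB_simps(1,2))
 show "vb_groupoid G (Act_ob G R)" if "weak_rep G R" for R :: "('b,'g,'a) wrep_pt"
  by (rule weak_rep_on.Act_vb) (simp add: weak_rep_on_def G that)
 show "vb_gpd_map G (Act_ob G R) (Act_ob G S) (Act_mor G R S h)" if "weak_rep G R" "weak_rep G S" "weak_rep_map G R S h"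
  for R S :: "('b,'g,'a) wrep_pt" and h by (rule weak_rep_pair.Act_mor_Hom(1)[OF weak_rep_pairI[OF G that(1,2)] that(3)])
 show "h = k" if "weak_rep G R" "weak_rep G S" "weak_rep_map G R S h" "weak_rep_map G R S k" "Act_mor G R S h = Act_mor G R S k"
  for R S :: "('b,'g,'a) wrep_pt" and h k using weak_rep_pair.Act_mor_Hom(2)[OF weak_rep_pairI[OF G that(1,2)]] that(3-5) by metis
next
 fix R :: "('b,'g,'a) wrep_pt" assume R: "weak_rep G R"
 interpret A: weak_rep_pair G R R by (rule weak_rep_pairI[OF G R R])
 let ?I = "((restrict id (pts (W0 R)),restrict id (pts (W1 R))),restrict (%(g,x). wunt R (act0 R g x)) (act_dom G R))"
 have "A.act_fun (restrict id (pts (W0 R))) (restrict id (pts (W1 R))) (restrict (%(g,x). wunt R (act0 R g x)) (act_dom G R)) a = a"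
  if a: "a <: A.R.A1" for a
 proof -
  obtain g x v where e: "a = Triple g x v" "g <: Ar G" "x <: W0 R" "v <: W1 R" "src G g = p0 R x" "wtgt R v = act0 R g x"
   using a by (rule A.R.act_ptsE)
  show ?thesis using e gp_idl[OF A.R.gE e(4)] by (simp add: A.act_fun_simp A.act_dom_iff)
 qed
 hence I: "Act_mor G R R ?I = (restrict id (pts (V0 (Act_ob G R))),restrict id (pts (V1 (Act_ob G R))))"
  by (auto simp: A.Act_mor_eq A.R.acts(1) restrict_def fun_eq_iff)
 have "Act_mor G R R ?I = Idn (VB G) (Act_ob G R)" unfolding I VB_simps ..
 hence "vb_gpd_map G (Act_ob G R) (Act_ob G R) (Act_mor G R R ?I)"
  using cat_Idn[OF VB_category,of "Act_ob G R" G] A.R.Act_vb by (simp add: VB_simps)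
 from A.act_inv_Hom(1)[OF this] have "weak_rep_map G R R ?I"
  by (subst (asm) A.act_inv_Act_mor) (auto simp: A.R.es A.R.w0 A.R.gs l_pr0_pts[OF A.R.V] wr_u0[OF G R] A.act_dom_iff)
 thus "weak_rep_map G R R ?I & Act_mor G R R ?I = Idn (VB G) (Act_ob G R)" using I by (simp add: VB_simps)
next
 fix R S T :: "('b,'g,'a) wrep_pt" and h k
 assume R: "weak_rep G R" and S: "weak_rep G S" and T: "weak_rep G T" and h: "weak_rep_map G R S h" and k: "weak_rep_map G S T k"
 interpret A: weak_rep_pair G R S by (rule weak_rep_pairI[OF G R S])
 interpret B: weak_rep_pair G S T by (rule weak_rep_pairI[OF G S T])
 interpret E: weak_rep_pair G R T by (rule weak_rep_pairI[OF G R T])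
 obtain F0 F1 de where he: "h = ((F0,F1),de)" by (cases h) auto
 obtain F0' F1' de' where ke: "k = ((F0',F1'),de')" by (cases k) auto
 note a = A.weak_rep_map_typing[OF h[unfolded he]] and b = B.weak_rep_map_typing[OF k[unfolded ke]]
 define D where "D = restrict (%(g,x). wmul T (de' (g,F0 x)) (F1' (de (g,x)))) (act_dom G R)"
 have c: "Cmp (WRep G) R S T k h = ((compose (pts (W0 R)) F0' F0,compose (pts (W1 R)) F1' F1),D)"
  by (simp add: he ke WRep_simps D_def)
 have d: "D (g,x) = wmul T (de' (g,F0 x)) (F1' (de (g,x)))" "cmp (wgpd T) (de' (g,F0 x)) (F1' (de (g,x)))"
  "wsrc T (F1' (de (g,x))) = F0' (F0 (act0 R g x))" if g: "g <: Ar G" "x <: W0 R" "src G g = p0 R x" for g x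
 proof -
  note f = a(4)[OF g(2)] a(6)[OF g] a(8)[OF g(2)]
  show "D (g,x) = wmul T (de' (g,F0 x)) (F1' (de (g,x)))" using g by (simp add: D_def A.act_dom_iff)
  show "cmp (wgpd T) (de' (g,F0 x)) (F1' (de (g,x)))" "wsrc T (F1' (de (g,x))) = F0' (F0 (act0 R g x))"
   using b(6)[of g "F0 x"] b(5)[of "de (g,x)"] f g by auto
 qed
 have i: "E.act_inv (Act_mor G R T (Cmp (WRep G) R S T k h)) = Cmp (WRep G) R S T k h" unfolding c
 proof (rule E.act_inv_Act_mor)
  show "D : extensional (act_dom G R)" by (simp add: D_def)
  fix x assume x: "x <: W0 R"
  have u: "unt G (p0 R x) <: Ar G" "src G (unt G (p0 R x)) = p0 R x" using l_pr0_pts[OF A.R.V x] by (simp_all add: A.R.gs)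
  have f: "F0 x <: W0 S" "p0 S (F0 x) = p0 R x" "F0' (F0 x) <: W0 T" using a(4,8)[OF x] b(4) by auto
  have "D (unt G (p0 R x),x) = wunt T (F0' (F0 x))"
   using d(1)[OF u(1) x u(2)] a(4)[OF x] b(4)[OF f(1)] f gp_idl[OF B.S.gE,of "wunt T (F0' (F0 x))"] by (simp add: B.S.es)
  thus "compose (pts (W0 R)) F0' F0 x <: W0 T &
    compose (pts (W1 R)) F1' F1 (wunt R x) = wunt T (compose (pts (W0 R)) F0' F0 x) & D (unt G (p0 R x),x) = wunt T (compose (pts (W0 R)) F0' F0 x)"
   using x f a(4)[OF x] b(4)[OF f(1)] by (simp add: compose_eq A.R.es)
 next
  fix v assume "v <: W1 R"
  thus "compose (pts (W1 R)) F1' F1 v <: W1 T & wtgt T (compose (pts (W1 R)) F1' F1 v) = compose (pts (W0 R)) F0' F0 (wtgt R v)"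
   using a(5) b(5) by (simp add: compose_eq A.R.es)
 next
  fix g x assume g: "g <: Ar G" "x <: W0 R" "src G g = p0 R x"
  show "D (g,x) <: W1 T & wsrc T (D (g,x)) = compose (pts (W0 R)) F0' F0 (act0 R g x)"
   using d[OF g] A.R.w0[OF g] by (simp add: B.S.es compose_eq)
 qed simp_all
 have "E.act_fun (compose (pts (W0 R)) F0' F0) (compose (pts (W1 R)) F1' F1) D t = B.act_fun F0' F1' de' (A.act_fun F0 F1 de t)" "A.act_fun F0 F1 de t <: A.S.A1"
  if t: "t <: A.R.A1" for t
 proof -
  obtain g x v where e: "t = Triple g x v" "g <: Ar G" "x <: W0 R" "v <: W1 R" "src G g = p0 R x" "wtgt R v = act0 R g x"
   using t by (rule A.R.act_ptsE)
  have f: "cmp (wgpd S) (de (g,x)) (F1 v)" using a(5)[OF e(4)] a(6)[OF e(2,3,5)] e(6) by simp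
  have f': "cmp (wgpd T) (F1' (de (g,x))) (F1' (F1 v))" using f b(5)[of "de (g,x)"] b(5)[of "F1 v"] by simp
  show "E.act_fun (compose (pts (W0 R)) F0' F0) (compose (pts (W1 R)) F1' F1) D t = B.act_fun F0' F1' de' (A.act_fun F0 F1 de t)"
   using d(1,2)[OF e(2,3,5)] e gp_assoc[OF B.S.gE d(2)[OF e(2,3,5)] f'] b(7)[OF f]
   by (simp add: A.act_fun_simp B.act_fun_simp E.act_fun_simp compose_eq)
  show "A.act_fun F0 F1 de t <: A.S.A1"
   using a(4)[OF e(3)] a(6)[OF e(2,3,5)] a(8)[OF e(3)] f e by (simp add: A.act_fun_simp A.S.act_iff A.S.es)
 qed
 hence q: "Act_mor G R T (Cmp (WRep G) R S T k h) = Cmp (VB G) (Act_ob G R) (Act_ob G S) (Act_ob G T) (Act_mor G S T k) (Act_mor G R S h)"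
  unfolding c unfolding he ke A.Act_mor_eq B.Act_mor_eq E.Act_mor_eq VB_simps
  by (auto simp: A.R.acts(1) restrict_def compose_def fun_eq_iff)
 have "vb_gpd_map G (Act_ob G R) (Act_ob G T) (Act_mor G R T (Cmp (WRep G) R S T k h))"
  unfolding q using cat_Cmp[OF VB_category,of "Act_ob G R" G "Act_ob G S" "Act_ob G T" "Act_mor G R S h" "Act_mor G S T k"]
   A.R.Act_vb A.S.Act_vb B.S.Act_vb A.Act_mor_Hom(1)[OF h] B.Act_mor_Hom(1)[OF k] by (simp add: VB_simps(1,2))
 from E.act_inv_Hom(1)[OF this] show "weak_rep_map G R T (Cmp (WRep G) R S T k h) & Act_mor G R T (Cmp (WRep G) R S T k h) =
   Cmp (VB G) (Act_ob G R) (Act_ob G S) (Act_ob G T) (Act_mor G S T k) (Act_mor G R S h)" unfolding i using q by simp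
qed

section \<open>Unital cleavages of VB-groupoids\<close>

locale vb_gpd =
 fixes G :: "('b,'g) lgpd" and V :: "('x,'y,'b,'g) vbgpd"
 assumes V: "vb_groupoid G V"
begin

lemmas G = vg_G[OF V] and E = vg_V[OF V] and gG = vg_gG[OF V] and gE = vg_gV[OF V]
lemmas MO = vg_G0[OF V] and MA = vg_G1[OF V] and M0 = vg_V0[OF V] and M1 = vg_V1[OF V] and b0 = vg_b0[OF V] and b1 = vg_b1[OF V]
lemmas gs = gp_simps[OF gG] and es = gp_simps[OF gE]
lemmas pr = vg_pr0_pts[OF V] vg_pr1_pts[OF V] vg_pr_src[OF V] vg_pr_tgt[OF V] vg_pr_unt[OF V] vg_pr_mul[OF V] vg_pr_inv[OF V]
lemmas vs = vg_add0[OF V] vg_pr_add0[OF V] vg_scale0[OF V] vg_pr_scale0[OF V]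
 vg_add1[OF V] vg_pr_add1[OF V] vg_scale1[OF V] vg_pr_scale1[OF V]
 vg_src_add[OF V] vg_tgt_add[OF V] vg_unt_add[OF V] vg_src_scale[OF V] vg_tgt_scale[OF V] vg_unt_scale[OF V]

lemma linfam_src:
 assumes t0: "triv (bun0 G V) U0 k ta0 th0" and t1: "triv (bun1 G V) U1 m ta1 th1"
  and S: "opn (Ar G) S" "!!g. g : S ==> g : U1 & src G g : U0" shows "linfam (Ar G) S m k (%g z. ta0 (vsrc V (th1 g z)))"
 by (rule linfam_bundle_map[OF b1 b0 MA t1 t0,of S "%g. g",unfolded buns])
  (use S sm_id[OF MA S(1)] lg_src[OF E] in "auto simp: pr vs")

text \<open>
  A local section of the source map through the zero vector over g, applied to t x, runs through vectors
  over varying arrows; since it starts at zero, only its fibre derivative at t = 0 contributes.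
\<close>

lemma src_fibre_surj:
 assumes t0: "triv (bun0 G V) U0 k ta0 th0" and t1: "triv (bun1 G V) U1 m ta1 th1"
  and g: "g : U1" "src G g : U0" and y: "y : Rn k" shows "EX z:Rn m. ta0 (vsrc V (th1 g z)) = y"
proof -
 note D0 = trivD[OF t0,unfolded buns] and D1 = trivD[OF t1,unfolded buns]
 note T0 = triv_pts[OF b0 t0,unfolded buns] triv_Rn[OF b0 t0,unfolded buns]
  and T1 = triv_pts[OF b1 t1,unfolded buns] triv_Rn[OF b1 t1,unfolded buns]
 define S where "S = {g : U1. src G g : U0}"
 have U1A: "U1 <= pts (Ar G)" by (rule opsub[OF D1(1)])
 have S: "opn (Ar G) S" unfolding S_def by (rule sm_preim[OF MA MO sm_sub[OF MA lg_src[OF G] D1(1) U1A] D0(1)])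
 define L where "L g z = ta0 (vsrc V (th1 g z))" for g z
 have LF: "linfam (Ar G) S m k L" unfolding L_def by (rule linfam_src[OF t0 t1 S]) (auto simp: S_def)
 define z0 where "z0 = th1 g (%i. 0)"
 define x where "x = th0 (src G g) y"
 have z0: "z0 <: V1 V" "pr1 V z0 = g" "ta1 z0 = (%i. 0)" using T1(1)[OF g(1) Rn_0] D1(4,5)[OF g(1) Rn_0] by (simp_all add: z0_def)
 have x: "x <: V0 V" "pr0 V x = src G g" "ta0 x = y" using T0(1)[OF g(2) y] D0(4,5)[OF g(2) y] by (simp_all add: x_def)
 have "ta0 (vsrc V z0) = (%i. 0)" using lin_0[OF lfam_lin[OF LF,of g]] g by (simp add: S_def L_def z0_def)
 \<comment> \<open>The source of the zero vector over g is a zero vector, here written as 0 times x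
   so that the curve below passes through it.\<close>
 hence sz: "vsrc V z0 = scale0 V 0 x"
  by (intro triv_eqI[OF t0,unfolded buns]) (use z0 x g D0(8)[OF x(1),of 0] in "simp_all add: es vs pr")
 obtain W r where W: "opn (V0 V) W" "vsrc V z0 : W" and r: "sm_on (V0 V) W (V1 V) r" "r (vsrc V z0) = z0"
  "!!y. y : W ==> vsrc V (r y) = y" by (rule sectionsE[OF lg_sec_src[OF E] z0(1)]) blast
 let ?R = "eucl 1"
 note MR = mfE[of 1]
 \<comment> \<open>The line t x in V_0, parametrised by R^1 as a manifold so that the composition
   rules for smooth maps apply.\<close>
 define c where "c q = scale0 V (q 0) x" for q :: "nat => real"
 have oR: "opn ?R (Rn 1)" by (simp add: eucls)
 have cs: "sm_on ?R (Rn 1) (V0 V) c" unfolding c_def by (rule vg_sm_scale0[OF V MR smooth_on_const[OF MR M0 oR x(1)]])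
   (use Cinf_coord[of 1 "Rn 1"] in \<open>simp add: fsm_euclid\<close>)
 define A where "A = {q : Rn 1. c q : W}"
 have A: "opn ?R A" unfolding A_def by (rule sm_preim[OF MR M0 cs W(1)])
 have rA: "sm_on ?R A (V1 V) (%q. r (c q))" by (rule sm_o[OF MR M0 sm_sub[OF MR cs A] r(1)]) (auto simp: A_def)
 define B where "B = {q : A. pr1 V (r (c q)) : U1}"
 have B: "opn ?R B" unfolding B_def by (rule sm_preim[OF MR MA vg_sm_pr1[OF V MR rA] D1(1)])
 have rB: "sm_on ?R B (V1 V) (%q. r (c q))" by (rule sm_sub[OF MR rA B]) (auto simp: B_def)
 define h where "h q = pr1 V (r (c q))" for q
 have hB: "r (c q) <: V1 V" "h q : S" "c q <: V0 V" "vsrc V (r (c q)) = c q" if q: "q : B" for q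
 proof -
  show 1: "r (c q) <: V1 V" by (rule sm_pts[OF M1 rB q])
  show 2: "vsrc V (r (c q)) = c q" using q r(3) by (simp add: B_def A_def)
  show "c q <: V0 V" using x by (simp add: c_def vs)
  show "h q : S" using q vg_pr_src[OF V 1] 2 x g by (simp add: h_def B_def S_def c_def vs)
 qed
 have hs: "sm_on ?R B (Ar G) h" unfolding h_def by (rule vg_sm_pr1[OF V MR rB])
 have f1: "fsm ?R B (%q. L (h q) (ei j) i)" if "j < m" for i j by (rule fsm_comp[OF MR MA hs linfam_fsm[OF LF that]]) (rule hB(2))
 have f2: "fsm ?R B (%q. ta1 (r (c q)) j)" for j by (rule triv_fsm[OF b1 t1 MR,unfolded buns,OF rB]) (auto simp: B_def)
 \<comment> \<open>The source of r (c q) is c q; in coordinates this says that L, at the moving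
   arrow h q, sends the fibre coordinates of r (c q) to q 0 times y.\<close>
 have id: "(\<Sum>j<m. L (h q) (ei j) i * ta1 (r (c q)) j) = q 0 * y i" if q: "q : B" for q i
 proof -
  have U: "h q : U1" "pr0 V x : U0" using hB(2)[OF q] x g by (auto simp: S_def)
  have "(\<Sum>j<m. L (h q) (ei j) i * ta1 (r (c q)) j) = L (h q) (ta1 (r (c q))) i"
   by (rule lin_expand[OF lfam_lin[OF LF hB(2)[OF q]] T1(2),symmetric]) (use hB[OF q] U in "auto simp: h_def")
  also have "... = ta0 (c q) i" using D1(6)[OF hB(1)[OF q]] U(1) hB(4)[OF q] by (simp add: L_def h_def)
  also have "... = q 0 * y i" using D0(8)[OF x(1) U(2)] x by (simp add: c_def)
  finally show ?thesis .
 qed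
 let ?o = "%i::nat. 0::real"
 have c0: "c ?o = vsrc V z0" "r (c ?o) = z0" "h ?o = g" using sz r(2) z0 by (simp_all add: c_def h_def)
 have oB: "?o : B" using W(2) Rn_0 c0 z0 g by (auto simp: B_def A_def)
 have deriv: "DERIV (%t. f (?o(0 := t))) 0 :> pd 0 f ?o" if "fsm ?R B f" for f
  using Cinf_deriv[of 1 B f 0 ?o] that oB by (simp add: fsm_euclid)
 \<comment> \<open>The derivative at 0 of the fibre coordinates of r along c. In the product rule
   the terms with a derivative of L carry the fibre coordinates at 0, which vanish, so what remains
   is L g d = y.\<close>
 define d where "d = (%j. pd 0 (%q. ta1 (r (c q)) j) ?o)"
 have oe: "opR 1 B" using B by (simp add: eucls)
 obtain e where e: "e > 0" "!!z. z : Rn 1 ==> (!!i. i < 1 ==> abs (z i - 0) < e) ==> z : B" by (rule openin_Rn_box[OF oe oB]) blast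
 have ins: "?o(0 := t) : B" if "abs t < e" for t by (rule e(2)) (use that in "auto simp: Rn_iff")
 have "L g (tk m d) i = y i" for i
 proof -
  have "((%t. \<Sum>j<m. L (h (?o(0 := t))) (ei j) i * ta1 (r (c (?o(0 := t)))) j) has_field_derivative
    (\<Sum>j<m. pd 0 (%q. L (h q) (ei j) i) ?o * ta1 (r (c (?o(0 := 0)))) j + d j * L (h (?o(0 := 0))) (ei j) i)) (at 0)"
   unfolding d_def by (intro DERIV_sum DERIV_mult deriv f1 f2) auto
  hence "DERIV (%t. t * y i) 0 :> (\<Sum>j<m. d j * L g (ei j) i)"
   by (rule has_field_derivative_transform_within[where d=e,THEN DERIV_cong])
    (use e(1) id[OF ins] c0 z0 in "auto simp: fun_upd_idem dist_real_def")
  moreover have "DERIV (%t. t * y i) 0 :> y i" by (auto intro!: derivative_eq_intros)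
  ultimately have "(\<Sum>j<m. d j * L g (ei j) i) = y i" by (rule DERIV_unique)
  moreover have "g : S" using g by (simp add: S_def)
  hence "L g (tk m d) i = (\<Sum>j<m. L g (ei j) i * tk m d j)" by (rule lin_expand[OF lfam_lin[OF LF] tk_Rn])
  ultimately show ?thesis by (simp add: tk_def mult.commute)
 qed
 hence "L g (tk m d) = y" by blast
 thus ?thesis using tk_Rn unfolding L_def by blast
qed

abbreviation "PV == fibre_prod (Ar G) (src G) (V0 V) (pr0 V)"

lemmas pv = MA M0 MO lg_src[OF G] vg_sub_pr0[OF V]
lemmas PM = mf_fibre[OF pv] and pts_PV = fib_pts[OF pv] and PV_fst = fib_fst[OF pv] and PV_snd = fib_snd[OF pv]

text \<open>A partial splitting of the source map, up to a weight w, so that splittings over open sets can be cut off and added.\<close>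

definition cleavage :: "'g set => ('g => real) => ('g => 'x => 'y) => bool" where
 "cleavage U w C <-> sm_on PV {q : pts PV. fst q : U} (V1 V) (%q. C (fst q) (snd q)) &
   (ALL g:U. ALL x:pts (V0 V). src G g = pr0 V x --> pr1 V (C g x) = g & vsrc V (C g x) = scale0 V (w g) x &
    (g = unt G (pr0 V x) --> C g x = scale1 V (w g) (vunt V x)) & (ALL c. C g (scale0 V c x) = scale1 V c (C g x)) &
    (ALL y:pts (V0 V). pr0 V y = pr0 V x --> C g (add0 V x y) = add1 V (C g x) (C g y)))"


text \<open>In trivialisations the source map is the family L, and a lift amounts to a right inverse
  of L. A family B that is a right inverse at g0 is corrected nearby. If g0 is a unit, B comes from
  the unit section; if not, units are excluded from the neighbourhood and any right inverse at g0
  serves as a constant B.\<close>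

lemma local_cleavage:
 assumes g0: "g0 <: Ar G" shows "EX U C. opn (Ar G) U & g0 : U & cleavage U (%_. 1) C"
proof -
 have s0: "src G g0 <: Ob G" using g0 by (simp add: gs)
 then obtain U0 k ta0 th0 where g0U0: "src G g0 : U0" and t0: "triv (bun0 G V) U0 k ta0 th0"
  using vb_triv[OF b0,of "src G g0"] by (metis buns(2))
 obtain U1 m ta1 th1 where g0U1: "g0 : U1" and t1: "triv (bun1 G V) U1 m ta1 th1" using vb_triv[OF b1,of g0] g0 by (metis buns(7))
 note D0 = trivD[OF t0,unfolded buns] and D1 = trivD[OF t1,unfolded buns]
 note T0 = triv_pts[OF b0 t0,unfolded buns] triv_Rn[OF b0 t0,unfolded buns]
  and T1 = triv_pts[OF b1 t1,unfolded buns] triv_Rn[OF b1 t1,unfolded buns]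
 define S where "S = {g : U1. src G g : U0}"
 have U1A: "U1 <= pts (Ar G)" by (rule opsub[OF D1(1)])
 have S: "opn (Ar G) S" unfolding S_def by (rule sm_preim[OF MA MO sm_sub[OF MA lg_src[OF G] D1(1) U1A] D0(1)])
 have g0S: "g0 : S" using g0U0 g0U1 by (simp add: S_def)
 define L where "L g z = ta0 (vsrc V (th1 g z))" for g z
 have LF: "linfam (Ar G) S m k L" unfolding L_def by (rule linfam_src[OF t0 t1 S]) (auto simp: S_def)
 have us: "sm_on (Ar G) S (Ar G) (%g. unt G (src G g))" by (rule sm_unt[OF G MA sm_src[OF G MA sm_id[OF MA S]]])
 have "EX U B. opn (Ar G) U & g0 : U & U <= S & linfam (Ar G) U k m B & (ALL y:Rn k. L g0 (B g0 y) = y) &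
   (ALL g:U. unt G (src G g) = g --> (ALL y:Rn k. B g y = ta1 (vunt V (th0 (src G g) y))))"
 proof (cases "unt G (src G g0) = g0")
  case True
  define U where "U = {g : S. unt G (src G g) : U1}"
  define B where "B g y = ta1 (vunt V (th0 (src G g) y))" for g y
  have U: "opn (Ar G) U" unfolding U_def by (rule sm_preim[OF MA MA us D1(1)])
  have "linfam (Ar G) U k m B" unfolding B_def by (rule linfam_bundle_map[OF b0 b1 MA t0 t1,unfolded buns])
    (use sm_sub[OF MA lg_src[OF G] U] lg_unt[OF E] U1A in "auto simp: U_def S_def pr vs")
  moreover have "L g0 (B g0 y) = y" if y: "y : Rn k" for y
   using D1(6)[of "vunt V (th0 (src G g0) y)"] T0(1)[OF g0U0 y] D0(4,5)[OF g0U0 y] True g0U1 by (simp add: L_def B_def es pr)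
  ultimately show ?thesis using U True g0S g0U1 by (intro exI[of _ U] exI[of _ B]) (auto simp: U_def B_def)
 next
  case False
  have "unt G (src G g0) <: Ar G" using g0 by (simp add: gs)
  then obtain A A' where A: "opn (Ar G) A" "opn (Ar G) A'" "g0 : A" "unt G (src G g0) : A'" "disjnt A A'"
   using MA False g0 unfolding manifold_def Hausdorff_space_def by metis
  \<comment> \<open>A unit g equals the unit at its source, so it would lie in A and in A', which
    are disjoint. Hence U contains no units.\<close>
  define U where "U = A Int {g : S. unt G (src G g) : A'}"
  have U: "opn (Ar G) U" unfolding U_def by (intro openin_Int A(1) sm_preim[OF MA MA us A(2)])
  have "ALL j. EX z. j < k --> z : Rn m & L g0 z = ei j" using src_fibre_surj[OF t0 t1 g0U1 g0U0 ei_Rn] unfolding L_def by blast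
  then obtain z where z: "!!j. j < k ==> z j : Rn m & L g0 (z j) = ei j" by metis
  \<comment> \<open>The linear extension of chosen preimages of the basis vectors under L
    g0.\<close>
  define B where "B y = (%i. \<Sum>j<k. y j * z j i)" for y :: "nat => real"
  have Bl: "lin k m B" using z by (auto simp: lin_def B_def Rn_iff sum.distrib distrib_right sum_distrib_left mult.assoc)
  have Be: "B (ei j) = z j" if "j < k" for j
   using that by (simp add: B_def ei_def if_distrib[of "%x. x * _"] sum.delta cong: if_cong)
  have "L g0 (B y) = y" if "y : Rn k" for y
   by (rule lin_cong_basis[OF lin_compose[OF Bl lfam_lin[OF LF g0S]] lin_id _ that]) (simp add: Be z)
  moreover have "linfam (Ar G) U k m (%_. B)" by (rule linfam_const[OF MA U Bl])
  ultimately show ?thesis using U A g0S by (intro exI[of _ U] exI[of _ "%_. B"]) (auto simp: U_def disjnt_def)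
 qed
 then obtain U B where U: "opn (Ar G) U" "g0 : U" "U <= S" and B: "linfam (Ar G) U k m B" "ALL y:Rn k. L g0 (B g0 y) = y"
  and Bu': "ALL g:U. unt G (src G g) = g --> (ALL y:Rn k. B g y = ta1 (vunt V (th0 (src G g) y)))" by (elim exE conjE) (rule that)
 have Bu: "B g y = ta1 (vunt V (th0 (src G g) y))" if "g : U" "unt G (src G g) = g" "y : Rn k" for g y using Bu' that by blast
 \<comment> \<open>L B is the identity at g0 and hence invertible nearby; composing B with the
   inverse R gives an exact right inverse of L.\<close>
 obtain W R where W: "opn (Ar G) W" "g0 : W" "W <= U" and R: "linfam (Ar G) W k k R"
  and LR: "!!g y. g : W ==> y : Rn k ==> L g (B g (R g y)) = y" and RL: "!!g y. g : W ==> y : Rn k ==> R g (L g (B g y)) = y"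
  by (rule linfam_inverse[OF MA linfam_compose[OF MA B(1) linfam_subset[OF MA LF U(1,3)]] U(2) bspec[OF B(2)]]) blast+
 have BR: "linfam (Ar G) W k m (%g y. B g (R g y))" by (rule linfam_compose[OF MA R linfam_subset[OF MA B(1) W(1,3)]])
 have WS: "g : U1" "src G g : U0" "g <: Ar G" "g : U" if "g : W" for g using that W U U1A by (auto simp: S_def)
 define C where "C g x = th1 g (B g (R g (ta0 x)))" for g x
 have BRn: "B g (R g (ta0 x)) : Rn m" "ta0 x : Rn k" "pr0 V x : U0" if "g : W" "x <: V0 V" "src G g = pr0 V x" for g x
  using lin_Rn[OF lfam_lin[OF BR that(1)]] T0(2)[OF that(2)] WS(2)[OF that(1)] that(3) by auto
 have "cleavage W (%_. 1) C" unfolding cleavage_def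
 proof (intro conjI ballI impI allI)
  let ?Q = "{q : pts PV. fst q : W}"
  have Q: "opn PV ?Q" by (rule sm_preim[OF PM MA PV_fst W(1)])
  have fs: "sm_on PV ?Q (Ar G) fst" "sm_on PV ?Q (V0 V) snd"
   by (rule sm_sub[OF PM PV_fst Q],blast,rule sm_sub[OF PM PV_snd Q],blast)
  show "sm_on PV ?Q (V1 V) (%q. C (fst q) (snd q))" unfolding C_def
  proof (rule triv_smooth[OF b1 t1 PM,unfolded buns,OF fs(1)])
   show "fsm PV ?Q (%q. B (fst q) (R (fst q) (ta0 (snd q))) i)" for i
    by (rule linfam_apply[OF PM MA BR fs(1) _ _ triv_fsm[OF b0 t0 PM,unfolded buns,OF fs(2)]]) (use BRn WS in "auto simp: pts_PV")
  qed (use BRn WS in "auto simp: pts_PV")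
  fix g x assume gx: "g : W" "x <: V0 V" "src G g = pr0 V x"
  note w = WS[OF gx(1)] and b = BRn[OF gx]
  have C1: "C g x <: V1 V" using T1(1)[OF w(1) b(1)] by (simp add: C_def)
  show C2: "pr1 V (C g x) = g" using D1(4)[OF w(1) b(1)] by (simp add: C_def)
  have "ta0 (vsrc V (C g x)) = ta0 x" using LR[OF gx(1) b(2)] by (simp add: C_def L_def)
  hence "vsrc V (C g x) = x" by (intro triv_eqI[OF t0,unfolded buns]) (use C1 C2 gx w in "simp_all add: es pr")
  moreover have "scale0 V 1 x = x" using vb_cancel(7)[OF b0,of x x] gx by (simp add: buns)
  ultimately show "vsrc V (C g x) = scale0 V 1 x" by simp
  show "C g (scale0 V c x) = scale1 V c (C g x)" for c
   using D0(8)[OF gx(2),of c] w(2) lin_scale[OF lfam_lin[OF BR gx(1)] b(2)] triv_theta_scale[OF b1 t1 w(1) b(1)] gx(3)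
   by (simp add: C_def buns)
  show "C g (add0 V x y) = add1 V (C g x) (C g y)" if y: "y <: V0 V" "pr0 V y = pr0 V x" for y
  proof -
   note byy = BRn[OF gx(1) y(1) trans[OF gx(3) y(2)[symmetric]]]
   show ?thesis
    using D0(7)[OF gx(2) y(1) b(3) y(2)[symmetric]] lin_add[OF lfam_lin[OF BR gx(1)] b(2) byy(2)] triv_theta_add[OF b1 t1 w(1) b(1) byy(1)]
    by (simp add: C_def buns)
  qed
  assume u: "g = unt G (pr0 V x)"
  have sg: "src G g = pr0 V x" "unt G (src G g) = g" using u gx by simp_all
  have thx: "th0 (src G g) (ta0 x) = x" using D0(6)[OF gx(2)] w(2) sg by simp
  have px: "pr1 V (vunt V x) = g" using u gx by (simp add: pr)
  \<comment> \<open>At a unit B is already exact, so R is the identity there and the correction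
    leaves the lift equal to the unit arrow.\<close>
  have "L g (B g (ta0 x)) = ta0 x" using Bu[OF w(4) sg(2) b(2)] D1(6)[of "vunt V x"] px w(1) gx(2) thx by (simp add: L_def es)
  hence "R g (ta0 x) = ta0 x" using RL[OF gx(1) b(2)] by simp
  hence "C g x = vunt V x" using Bu[OF w(4) sg(2) b(2)] D1(6)[of "vunt V x"] px w(1) gx(2) thx by (simp add: C_def es)
  moreover have "scale1 V 1 (vunt V x) = vunt V x" using vb_cancel(7)[OF b1,of "vunt V x" "vunt V x"] gx by (simp add: buns es)
  ultimately show "C g x = scale1 V 1 (vunt V x)" by simp
 qed
 thus ?thesis using W by blast
qed

end

text \<open>The set K plays the role of the support. It is the image of a closed cube in a chart,
  therefore compact and, M being Hausdorff, closed; so f extends smoothly by zero from the chart to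
  M.\<close>

lemma bump_function:
 assumes M: "manifold M" and U: "opn M U" "p : U" shows "EX f B K. fsm M (pts M) f & opn M B & p : B & (ALL q:B. f q = 1) &
  closedin (mtop M) K & K <= U & (ALL q:pts M - K. f q = 0)"
proof -
 have pM: "p <: M" using opsub[OF U(1)] U(2) by blast
 obtain n W0 ph where c0: "cht M n W0 ph" "p : W0" by (rule chart_at[OF M pM])
 define W where "W = W0 Int U"
 have c: "cht M n W ph" and pW: "p : W" and WU: "W <= U" using chart_restrict[OF M c0(1) U(1)] c0(2) U(2) by (auto simp: W_def)
 note oW = ch_open[OF M c] and D = is_chartD[OF charts_ischart[OF M c]]
 obtain e where e: "e > 0" "!!y. y : Rn n ==> (!!i. i < n ==> abs (y i - ph p i) < e) ==> y : ph ` W"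
  by (rule openin_Rn_box[OF ch_range[OF M c],of "ph p"]) (use pW in auto)
 define r where "r q = (\<Sum>i<n. ((ph q i - ph p i) * (ph q i - ph p i)))" for q
 \<comment> \<open>Here r is the squared distance to p in the chart. The argument of
   \<open>smooth_step\<close> is at least 1 for r \<le> e^2/8 and at most 0 for r \<ge> e^2/4; the
   latter holds as soon as one coordinate is off by more than e/2, that is, outside the cube
   C.\<close>
 define f where "f q = (if q : W then smooth_step (2 - 8 / (e * e) * r q) else 0)" for q
 define C where "C = {y : Rn n. ALL i<n. abs (y i - ph p i) <= e / 2}"
 have CW: "C <= ph ` W" using e by (force simp: C_def)
 have "compactin (product_topology (%_. euclideanreal) UNIV) (\<Pi>\<^sub>E i\<in>UNIV. if i < n then {ph p i - e / 2..ph p i + e / 2} else {0})"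
  by (subst compactin_PiE) (auto simp: compactin_euclidean_iff)
 also have "(\<Pi>\<^sub>E i\<in>UNIV. if i < n then {ph p i - e / 2..ph p i + e / 2} else {0}) = C"
 proof -
  have "t : {a - d..a + d} <-> abs (t - a) <= d" for t a d :: real by auto
  thus ?thesis by (auto simp: C_def Rn_iff PiE_iff simp del: atLeastAtMost_iff split: if_splits)
 qed
 finally have "compactin (Euclidean_space n) C" unfolding Euclidean_space_def compactin_subtopology by (auto simp: C_def Rn_iff)
 hence C: "compactin (subtopology (Euclidean_space n) (ph ` W)) C" using CW by (simp add: compactin_subtopology)
 define K where "K = ivi W ph ` C"
 have iW: "ivi W ph y <: M" if "y : ph ` W" for y using sm_pts[OF M chart_inv_smooth[OF M c] that] .
 have "continuous_map (subtopology (Euclidean_space n) (ph ` W)) (mtop M) (ivi W ph)" unfolding continuous_map_def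
 proof (intro conjI allI impI)
  fix T assume "opn M T"
  from sm_preim[OF mfE M chart_inv_smooth[OF M c] this]
  have "openin (subtopology (Euclidean_space n) (ph ` W)) {y : ph ` W. ivi W ph y : T}"
   using D(2) by (simp add: eucls openin_open_subtopology subset_iff)
  thus "openin (subtopology (Euclidean_space n) (ph ` W)) {y : topspace (subtopology (Euclidean_space n) (ph ` W)). ivi W ph y : T}"
   using opsub[OF D(2)] by (simp add: inf_absorb2)
 qed (use iW in auto)
 from image_compactin[OF C this] have "closedin (mtop M) K"
  unfolding K_def using M by (intro compactin_imp_closedin) (auto simp: manifold_def)
 moreover have KW: "K <= W" using CW by (auto simp: K_def intro!: inv_into_into)
 have K: "q : K" if q: "q : W" "!!i. i < n ==> abs (ph q i - ph p i) <= e / 2" for q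
  using ch_inv[OF M c q(1)] chart_Rn[OF M c q(1)] q(2) by (auto simp: K_def C_def image_iff intro!: bexI[of _ "ph q"])
 have f0: "f q = 0" if q: "q : pts M - K" for q
 proof (cases "q : W")
  case True
  then obtain i where i: "i < n" "abs (ph q i - ph p i) > e / 2" using K q by force
  have "(e / 2) * (e / 2) <= abs (ph q i - ph p i) * abs (ph q i - ph p i)" using i e(1) by (intro mult_mono) auto
  also have "... = (ph q i - ph p i) * (ph q i - ph p i)" by simp
  also have "... <= r q" unfolding r_def using i(1) by (intro member_le_sum[of i "{..<n}" "%i. (ph q i - ph p i) * (ph q i - ph p i)"]) auto
  finally have "2 - 8 / (e * e) * r q <= 0" using e(1) by (simp add: field_simps)
  thus ?thesis using True by (simp add: f_def smooth_step_0)
 qed (simp add: f_def)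
 have rs: "fsm M W r" unfolding r_def
  by (intro fsm_sum[OF M oW] fsm_mult[OF M] fsm_diff[OF M] chart_fsm[OF M c] fsm_const[OF M oW])
 have fW: "fsm M W f"
  by (rule fsm_cong[OF M fsm_smooth_step[OF M fsm_diff[OF M fsm_const[OF M oW,of 2] fsm_mult[OF M fsm_const[OF M oW,of "8 / (e * e)"] rs]]]])
   (simp add: f_def)
 have oK: "opn M (pts M - K)" using \<open>closedin (mtop M) K\<close> by (simp add: closedin_def)
 have fK: "fsm M (pts M - K) f" by (rule fsm_cong[OF M fsm_const[OF M oK,of 0]]) (simp add: f0)
 have "fsm M (pts M) f"
 proof (rule fsm_local[OF M])
  fix q assume q: "q <: M"
  show "EX T. q : T & T <= pts M & fsm M T f"
   by (rule exI[of _ "if q : W then W else pts M - K"]) (use q fW fK KW opsub[OF oW] in auto)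
 qed
 moreover define B where "B = {q : W. r q : {..<e * e / 8}}"
 have "opn M {q : W. r q < e * e / 8}" using fsm_open_pre[OF M rs,of "{..<e * e / 8}"] by simp
 moreover have "f q = 1" if "q : W" "r q < e * e / 8" for q using that e(1) by (simp add: f_def field_simps smooth_step_1)
 moreover have "r p < e * e / 8" using e(1) by (simp add: r_def)
 ultimately show ?thesis using f0 KW WU pW by (intro exI[of _ f] exI[of _ "{q : W. r q < e * e / 8}"] exI[of _ K]) auto
qed

section \<open>Gluing local cleavages\<close>

context vb_gpd
begin

lemmas c0 = vb_cancel[OF b0,unfolded buns] and c1 = vb_cancel[OF b1,unfolded buns]

lemma cl_pts:
 assumes C: "cleavage U w C" and g: "g : U" "g <: Ar G" "x <: V0 V" "src G g = pr0 V x" shows "C g x <: V1 V" "pr1 V (C g x) = g"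
 using sm_pts[OF M1,of PV "{q : pts PV. fst q : U}" "%q. C (fst q) (snd q)" "(g,x)"] C g by (auto simp: cleavage_def pts_PV)

lemma cleavageD:
 assumes "cleavage U w C" "g : U" "x <: V0 V" "src G g = pr0 V x"
 shows "vsrc V (C g x) = scale0 V (w g) x" "g = unt G (pr0 V x) ==> C g x = scale1 V (w g) (vunt V x)"
  "C g (scale0 V c x) = scale1 V c (C g x)" "y <: V0 V ==> pr0 V y = pr0 V x ==> C g (add0 V x y) = add1 V (C g x) (C g y)"
 using assms unfolding cleavage_def by blast+

text \<open>The starting point of the gluing, with weight 0.\<close>

lemma cleavage_zero: "cleavage (pts (Ar G)) (%_. 0) (%g x. vzero (bun1 G V) g)"
proof -
 note z = vzero_triv(1,2)[OF b1,unfolded buns]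
 have zz: "vzero (bun1 G V) g = scale1 V 0 v" if g: "g <: Ar G" "v <: V1 V" "pr1 V v = g" for g v
 proof -
  obtain U k ta th where U: "g : U" and t: "triv (bun1 G V) U k ta th" using vb_triv[OF b1,of g] g(1) by (metis buns(7))
  show ?thesis by (rule triv_eqI[OF t,unfolded buns])
    (use g U z[OF g(1)] trivD(8)[OF t,of v 0] vzero_triv(3)[OF b1 _ t U] in "simp_all add: buns vs")
 qed
 have Q: "opn PV {q : pts PV. fst q <: Ar G}" by (rule sm_preim[OF PM MA PV_fst otop])
 show ?thesis unfolding cleavage_def
 proof (intro conjI ballI impI allI)
  show "sm_on PV {q : pts PV. fst q <: Ar G} (V1 V) (%q. vzero (bun1 G V) (fst q))"
   by (rule smcomp[OF PM MA sm_sub[OF PM PV_fst Q] smooth_vzero[OF b1,unfolded buns]]) auto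
  fix g x assume g: "g <: Ar G" and x: "x <: V0 V" "src G g = pr0 V x"
  note z = z[OF g]
  show "pr1 V (vzero (bun1 G V) g) = g" by (rule z)
  have "vsrc V (vzero (bun1 G V) g) = scale0 V 0 (vsrc V (vzero (bun1 G V) g))"
   using zz[OF g z] vg_src_scale[OF V z(1),of 0] by simp
  also have "... = scale0 V 0 x" by (rule c0(10)) (use z x in "simp_all add: es pr")
  finally show "vsrc V (vzero (bun1 G V) g) = scale0 V 0 x" .
  show "vzero (bun1 G V) g = scale1 V 0 (vunt V x)" if "g = unt G (pr0 V x)"
   by (rule zz[OF g]) (use x that in "simp_all add: es pr")
  show "vzero (bun1 G V) g = scale1 V c (vzero (bun1 G V) g)" for c using zz[OF g z] c1(11)[OF z(1) z(1) refl,of c 0] by simp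
  show "vzero (bun1 G V) g = add1 V (vzero (bun1 G V) g) (vzero (bun1 G V) g)" using zz[OF g z] c1(9)[OF z(1) z(1) refl] by simp
 qed
qed

text \<open>The missing weight 1 - w is filled up by f times the local cleavage C. The new weight is
  1 wherever f = 1, and where w was 1 neither the weight nor the values change.\<close>

lemma cleavage_extend:
 assumes S: "cleavage (pts (Ar G)) w S" and w: "fsm (Ar G) (pts (Ar G)) w"
  and C: "cleavage U (%_. 1) C" and U: "opn (Ar G) U" and f: "fsm (Ar G) (pts (Ar G)) f"
  and K: "closedin (mtop (Ar G)) K" "K <= U" "!!g. g <: Ar G ==> g ~: K ==> f g = 0"
 shows "cleavage (pts (Ar G)) (%g. w g + (1 - w g) * f g)
  (%g x. add1 V (S g x) (scale1 V (1 - w g) (if g : U then scale1 V (f g) (C g x) else scale1 V 0 (S g x))))"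
proof -
 \<comment> \<open>Outside U the map C is unspecified; 0 times S g x is the zero vector over g. The
   two formulas fit together smoothly because f vanishes off the closed set K inside U.\<close>
 define T where "T g x = (if g : U then scale1 V (f g) (C g x) else scale1 V 0 (S g x))" for g x
 have T: "T g x <: V1 V" "pr1 V (T g x) = g" "vsrc V (T g x) = scale0 V (f g) x"
   "T g (scale0 V c x) = scale1 V c (T g x)" "g = unt G (pr0 V x) ==> T g x = scale1 V (f g) (vunt V x)"
   "y <: V0 V ==> pr0 V y = pr0 V x ==> T g (add0 V x y) = add1 V (T g x) (T g y)"
  if g: "g <: Ar G" "x <: V0 V" "src G g = pr0 V x" for g x y c
 proof -
  note s = cl_pts[OF S g(1,1,2,3)] cleavageD[OF S g] and s' = cl_pts[OF S g(1,1)]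
  note d = cl_pts[OF C _ g] cleavageD[OF C _ g(2,3)] and d' = cl_pts[OF C _ g(1)]
  have n: "f g = 0" if "g ~: U" using that K(2,3) g(1) by blast
  show "T g x <: V1 V" "pr1 V (T g x) = g" using s(1,2) d(1,2) by (simp_all add: T_def vs)
  show "vsrc V (T g x) = scale0 V (f g) x" using s(1,3) d(1,3) n c0(11)[OF g(2) g(2) refl] by (simp add: T_def vs)
  show "T g (scale0 V c x) = scale1 V c (T g x)"
   using s(1,5) d(1,5) c1(11)[OF s(1) s(1) refl] c1(11)[OF d(1) d(1) refl] by (simp add: T_def mult.commute)
  show "T g x = scale1 V (f g) (vunt V x)" if "g = unt G (pr0 V x)"
   using s(4)[OF that] d(4)[OF _ that] n c1(11)[of "vunt V x" "vunt V x"] g(2) by (simp add: T_def es)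
  show "T g (add0 V x y) = add1 V (T g x) (T g y)" if y: "y <: V0 V" "pr0 V y = pr0 V x"
   using s(6)[OF y] d(6)[OF _ y] c1(12)[OF s(1) s'(1)[OF y(1)]] c1(12)[OF d(1) d'(1)[OF _ y(1)]] s(2) s'(2)[OF y(1)] d(2) d'(2)[OF _ y(1)] y(2) g(3)
   by (simp add: T_def)
 qed
 have all: "{q : pts PV. fst q <: Ar G} = pts PV" by (auto simp: pts_PV)
 have sS: "smooth PV (V1 V) (%q. S (fst q) (snd q))" using S all by (simp add: cleavage_def)
 note fw = fsm_comp[OF PM MA PV_fst w] and ff = fsm_comp[OF PM MA PV_fst f]
 have fm: "fst q <: Ar G" if "q <: PV" for q using that by (auto simp: pts_PV)
 have sT: "smooth PV (V1 V) (%q. T (fst q) (snd q))"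
 proof (rule smooth_on_local[OF PM])
  fix q assume q: "q <: PV"
  let ?A = "{q : pts PV. fst q : U}" and ?B = "{q : pts PV. fst q : pts (Ar G) - K}"
  have A: "opn PV ?A" by (rule sm_preim[OF PM MA PV_fst U])
  have B: "opn PV ?B" by (rule sm_preim[OF PM MA PV_fst]) (use K(1) in "simp add: closedin_def")
  have sC: "sm_on PV ?A (V1 V) (%q. C (fst q) (snd q))" using C by (simp add: cleavage_def)
  have fA: "fsm PV ?A (%q. f (fst q))" by (rule fsm_subset[OF PM ff A]) (auto simp: fm)
  have "sm_on PV ?A (V1 V) (%q. T (fst q) (snd q))" by (rule sm_cong[OF PM vg_sm_scale1[OF V PM sC fA]]) (simp add: T_def)
  moreover have "sm_on PV ?B (V1 V) (%q. T (fst q) (snd q))"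
  proof (rule sm_cong[OF PM vg_sm_scale1[OF V PM sm_sub[OF PM sS B] fsm_const[OF PM B,of 0]]])
   fix q assume q: "q : ?B"
   have g: "fst q <: Ar G" "snd q <: V0 V" "src G (fst q) = pr0 V (snd q)" using q by (auto simp: pts_PV)
   show "scale1 V 0 (S (fst q) (snd q)) = T (fst q) (snd q)"
    using c1(10)[OF cl_pts(1)[OF S g(1,1,2,3)] cl_pts(1)[OF C _ g]] cl_pts(2)[OF S g(1,1,2,3)] cl_pts(2)[OF C _ g]
     K(3)[OF g(1)] q by (simp add: T_def)
  qed auto
  moreover have "q : ?A | q : ?B" using q fm K(2) by auto
  ultimately show "EX T'. q : T' & T' <= pts PV & sm_on PV T' (V1 V) (%q. T (fst q) (snd q))"
   by (metis (no_types,lifting) mem_Collect_eq subsetI)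
 qed
 have "cleavage (pts (Ar G)) (%g. w g + (1 - w g) * f g) (%g x. add1 V (S g x) (scale1 V (1 - w g) (T g x)))"
  unfolding cleavage_def all
 proof (intro conjI ballI impI allI)
  show "smooth PV (V1 V) (%q. add1 V (S (fst q) (snd q)) (scale1 V (1 - w (fst q)) (T (fst q) (snd q))))"
   by (rule vg_sm_add1[OF V PM sS vg_sm_scale1[OF V PM sT fsm_diff[OF PM fsm_const[OF PM otop] fw]]])
    (use cl_pts[OF S] T(1,2) in "auto simp: pts_PV vs")
  fix g x assume g: "g <: Ar G" "x <: V0 V" "src G g = pr0 V x"
  note s = cl_pts[OF S g(1,1,2,3)] cleavageD[OF S g] and s' = cl_pts[OF S g(1,1)] and t = T[OF g] and t' = T(1,2)[OF g(1)]
  show "pr1 V (add1 V (S g x) (scale1 V (1 - w g) (T g x))) = g" using s(1,2) t(1,2) by (simp add: vs)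
  show "vsrc V (add1 V (S g x) (scale1 V (1 - w g) (T g x))) = scale0 V (w g + (1 - w g) * f g) x"
   using s(1-3) t(1-3) c0(8)[OF g(2) g(2) refl] by (simp add: vs)
  show "add1 V (S g x) (scale1 V (1 - w g) (T g x)) = scale1 V (w g + (1 - w g) * f g) (vunt V x)" if u: "g = unt G (pr0 V x)"
   unfolding s(4)[OF u] t(5)[OF u] by (rule c1(8)) (use g(2) in "simp_all add: es")
  show "add1 V (S g (scale0 V c x)) (scale1 V (1 - w g) (T g (scale0 V c x))) = scale1 V c (add1 V (S g x) (scale1 V (1 - w g) (T g x)))" for c
   unfolding s(5) t(4) by (rule c1(5)) (use s t in simp_all)
  show "add1 V (S g (add0 V x y)) (scale1 V (1 - w g) (T g (add0 V x y))) =
    add1 V (add1 V (S g x) (scale1 V (1 - w g) (T g x))) (add1 V (S g y) (scale1 V (1 - w g) (T g y)))"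
   if y: "y <: V0 V" "pr0 V y = pr0 V x" for y
   unfolding s(6)[OF y] t(6)[OF y] by (rule c1(6)) (use s s'[OF y(1)] t t'[OF y(1)] y g(3) in simp_all)
 qed
 thus ?thesis by (simp only: T_def)
qed

text \<open>By the Lindelof property countably many of the sets B, on which a bump function is 1,
  cover the arrows. The extension step is applied along an enumeration. On each B the sequence is
  constant from some index on, so the limit is smooth and of weight 1.\<close>

theorem unital_cleavage: "EX C. cleavage (pts (Ar G)) (%_. 1) C"
proof -
 have "EX U C f B K. opn (Ar G) U & cleavage U (%_. 1) C & fsm (Ar G) (pts (Ar G)) f & opn (Ar G) B & g : B &
   (ALL q:B. f q = 1) & closedin (mtop (Ar G)) K & K <= U & (ALL q:pts (Ar G) - K. f q = 0)" if g: "g <: Ar G" for g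
  using local_cleavage[OF g] bump_function[OF MA] by (elim exE conjE) metis
 then obtain U C f B K where D: "!!g. g <: Ar G ==> opn (Ar G) (U g) & cleavage (U g) (%_. 1) (C g) &
   fsm (Ar G) (pts (Ar G)) (f g) & opn (Ar G) (B g) & g : B g &
   (ALL q:B g. f g q = 1) & closedin (mtop (Ar G)) (K g) & K g <= U g & (ALL q:pts (Ar G) - K g. f g q = 0)" by metis
 have BA: "B g <= pts (Ar G)" if "g <: Ar G" for g using D[OF that] opsub by blast
 have "Lindelof_space (mtop (Ar G))" using MA by (simp add: manifold_def second_countable_imp_Lindelof_space)
 moreover have "ALL X:B ` pts (Ar G). opn (Ar G) X" "\<Union> (B ` pts (Ar G)) = pts (Ar G)" using D BA by blast+
 ultimately obtain \<X> where X: "countable \<X>" "\<X> <= B ` pts (Ar G)" "\<Union> \<X> = pts (Ar G)" unfolding Lindelof_space_def by metis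
 then obtain I where I: "countable I" "I <= pts (Ar G)" "\<X> = B ` I" by (metis countable_subset_image)
 have PV0: "{q : pts PV. fst q <: Ar G} = pts PV" by (auto simp: pts_PV)
 show ?thesis
 proof (cases "I = {}")
  \<comment> \<open>The enumeration \<open>from_nat_into\<close> needs a nonempty index set; if
    there is none, G has no arrows and the claim is vacuous.\<close>
  case True
  hence "pts (Ar G) = {}" using X(3) I(3) by simp
  thus ?thesis by (auto simp: cleavage_def sm_on_def)
 next
  case False
  define i where "i = from_nat_into I"
  have i: "i n <: Ar G" for n using from_nat_into[OF False,of n] I(2) by (auto simp: i_def)
  have cov: "EX n. g : B (i n)" if g: "g <: Ar G" for g
  proof -
   obtain j where "j : I" "g : B j" using g X(3) unfolding I(3) by blast
   thus ?thesis using from_nat_into_surj[OF I(1)] unfolding i_def by metis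
  qed
  define step where "step n = (%(w,S). (%g. w g + (1 - w g) * f (i n) g,
    %g x. add1 V (S g x) (scale1 V (1 - w g) (if g : U (i n) then scale1 V (f (i n) g) (C (i n) g x) else scale1 V 0 (S g x)))))" for n
  define WS where "WS = rec_nat (%_. 0,%g x. vzero (bun1 G V) g) step"
  define w where "w n = fst (WS n)" for n
  define S where "S n = snd (WS n)" for n
  have w_Suc: "w (Suc n) g = w n g + (1 - w n g) * f (i n) g" for n g by (simp add: w_def WS_def step_def case_prod_beta)
  have S_Suc: "S (Suc n) = (%g x. add1 V (S n g x) (scale1 V (1 - w n g)
    (if g : U (i n) then scale1 V (f (i n) g) (C (i n) g x) else scale1 V 0 (S n g x))))" for n
   unfolding w_def S_def WS_def by (simp add: step_def case_prod_beta)
  have inv: "fsm (Ar G) (pts (Ar G)) (w n) & cleavage (pts (Ar G)) (w n) (S n)" for n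
  proof (induction n)
   case 0
   thus ?case using cleavage_zero fsm_const[OF MA otop] by (simp add: w_def S_def WS_def)
  next
   case (Suc n)
   note d = D[OF i[of n]]
   have "fsm (Ar G) (pts (Ar G)) (%g. w n g + (1 - w n g) * f (i n) g)"
    using Suc d by (intro fsm_add[OF MA] fsm_mult[OF MA] fsm_diff[OF MA] fsm_const[OF MA otop]) auto
   moreover have "cleavage (pts (Ar G)) (%g. w n g + (1 - w n g) * f (i n) g) (S (Suc n))"
    unfolding S_Suc by (rule cleavage_extend[of _ _ _ _ _ "K (i n)"]) (use Suc d in auto)
   moreover have "w (Suc n) = (%g. w n g + (1 - w n g) * f (i n) g)" using w_Suc by auto
   ultimately show ?case by simp
  qed
  \<comment> \<open>Once the weight is 1 at g, every later step adds 0 times a vector over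
    g.\<close>
  have stable: "w m g = 1 & S m g x = S n g x"
   if n: "w n g = 1" "n <= m" and g: "g <: Ar G" "x <: V0 V" "src G g = pr0 V x" for m n g x using n(2)
  proof (induction m rule: dec_induct)
   case (step m)
   note s = cl_pts[OF conjunct2[OF inv] g(1,1,2,3),of m] and d = cl_pts[OF _ _ g,of "U (i m)" "%_. 1" "C (i m)"]
   have "S (Suc m) g x = S m g x" unfolding S_Suc using step.IH s d D[OF i[of m]] by (auto intro!: c1(9) simp: vs)
   thus ?case using step.IH by (simp add: w_Suc)
  qed (use n in simp)
  \<comment> \<open>The first index with full weight at g. By \<open>stable\<close> every later
    index gives the same lift, so on B (i n) the stage \<open>Suc n\<close> represents the
    limit.\<close>
  define N where "N g = (LEAST n. w n g = 1)" for g
  have w1: "w (Suc n) g = 1" if "g : B (i n)" for n g using D[OF i[of n]] that by (simp add: w_Suc)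
  have N: "w (N g) g = 1" if g: "g <: Ar G" for g
  proof -
   obtain n where "g : B (i n)" using cov[OF g] by blast
   from LeastI[of "%n. w n g = 1",OF w1[OF this]] show ?thesis by (simp add: N_def)
  qed
  define C' where "C' g = S (N g) g" for g
  have "smooth PV (V1 V) (%q. C' (fst q) (snd q))"
  proof (rule smooth_on_local[OF PM])
   fix q assume q: "q <: PV"
   then obtain n where n: "fst q : B (i n)" using cov by (force simp: pts_PV)
   let ?T = "{q : pts PV. fst q : B (i n)}"
   have T: "opn PV ?T" by (rule sm_preim[OF PM MA PV_fst]) (use D[OF i[of n]] in blast)
   have s: "smooth PV (V1 V) (%q. S (Suc n) (fst q) (snd q))" using inv[of "Suc n"] PV0 by (simp add: cleavage_def)
   have "sm_on PV ?T (V1 V) (%q. C' (fst q) (snd q))"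
   proof (rule sm_cong[OF PM sm_sub[OF PM s T]])
    fix r assume r: "r : ?T"
    hence g: "fst r <: Ar G" "snd r <: V0 V" "src G (fst r) = pr0 V (snd r)" "w (Suc n) (fst r) = 1"
     using w1 by (auto simp: pts_PV)
    have "N (fst r) <= Suc n" unfolding N_def by (rule Least_le[of _ "Suc n"]) (rule g(4))
    from stable[OF N[OF g(1)] this g(1-3)] show "S (Suc n) (fst r) (snd r) = C' (fst r) (snd r)" by (simp add: C'_def)
   qed auto
   thus "EX T. q : T & T <= pts PV & sm_on PV T (V1 V) (%q. C' (fst q) (snd q))" using q n by (intro exI[of _ ?T]) simp
  qed
  hence "cleavage (pts (Ar G)) (%_. 1) C'" unfolding cleavage_def PV0
  proof (intro conjI ballI impI allI)
   fix g x assume g: "g <: Ar G" "x <: V0 V" "src G g = pr0 V x"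
   have cl: "cleavage (pts (Ar G)) (w (N g)) (S (N g))" using inv by blast
   note c = cleavageD[OF cl g,folded C'_def,unfolded N[OF g(1)]]
   show "pr1 V (C' g x) = g" unfolding C'_def by (rule cl_pts(2)[OF cl g(1,1,2,3)])
   show "vsrc V (C' g x) = scale0 V 1 x" "C' g (scale0 V r x) = scale1 V r (C' g x)" for r by (rule c)+
   show "C' g x = scale1 V 1 (vunt V x)" if "g = unt G (pr0 V x)" using that by (rule c(2))
   show "C' g (add0 V x y) = add1 V (C' g x) (C' g y)" if "y <: V0 V" "pr0 V y = pr0 V x" for y using that by (rule c(4))
  qed
  thus ?thesis by blast
 qed
qed

end

section \<open>Essential surjectivity\<close>

context vb_gpd
begin

abbreviation "UF == fibre_prod (Ob G) (unt G) (V1 V) (pr1 V)"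

text \<open>The arrows of V over units of G. The manifold structure is that of the fibre product of
  the unit map with the bundle projection; transport along \<open>snd\<close> makes the points
  arrows of V again.\<close>

definition "U1 = imfd snd UF"

text \<open>V restricted to the units of G, as a bundle of groupoids over G_0; an arrow over the
  unit at p is placed over p, the source of that unit.\<close>

definition ub :: "('x,'y,'b,'b) vbgpd" where
 "ub = \<lparr>gpd = (gpd V)\<lparr>Ar := U1\<rparr>,pr0 = pr0 V,add0 = add0 V,scale0 = scale0 V,
   pr1 = (%v. src G (pr1 V v)),add1 = add1 V,scale1 = scale1 V\<rparr>"

lemma ubs: "V0 ub = V0 V" "V1 ub = U1" "vsrc ub = vsrc V" "vtgt ub = vtgt V"
 "vunt ub = vunt V" "vmul ub = vmul V" "pr0 ub = pr0 V" "add0 ub = add0 V"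
 "scale0 ub = scale0 V" "pr1 ub = (%v. src G (pr1 V v))" "add1 ub = add1 V" "scale1 ub = scale1 V"
 by (simp_all add: ub_def)

lemmas uf = MO M1 MA lg_unt[OF G] vg_sub_pr1[OF V]
lemmas UFM = mf_fibre[OF uf]

lemma UF_inj: "inj_on snd (pts UF)"
proof -
 have "p = q" if "unt G p = unt G q" "p <: Ob G" "q <: Ob G" for p q using that gs(4) by metis
 thus ?thesis unfolding fib_pts[OF uf] inj_on_def by auto
qed

lemma U1_mfd: "manifold U1" unfolding U1_def by (rule manifold_image[OF UFM UF_inj])

lemma U1_iff: "v <: U1 <-> v <: V1 V & unt G (src G (pr1 V v)) = pr1 V v"
proof
 show "v <: V1 V & unt G (src G (pr1 V v)) = pr1 V v" if "v <: U1"
  using that gs(4) unfolding U1_def pts_image[OF UFM UF_inj] fib_pts[OF uf] by fastforce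
 show "v <: U1" if v: "v <: V1 V & unt G (src G (pr1 V v)) = pr1 V v" unfolding U1_def pts_image[OF UFM UF_inj] fib_pts[OF uf]
  by (rule image_eqI[of _ _ "(src G (pr1 V v),v)"]) (use v pr(2) gs(1) in auto)
qed

lemma U1_incl: "smooth U1 (V1 V) (%v. v)"
proof -
 have "smooth U1 UF (ivi (pts UF) snd)" using smooth_image_inv[OF UFM UF_inj] pts_image[OF UFM UF_inj] by (simp add: U1_def)
 from smcomp[OF U1_mfd UFM this fib_snd[OF uf]] show ?thesis
  by (rule sm_cong[OF U1_mfd]) (auto simp: U1_def pts_image[OF UFM UF_inj] f_inv_into_f)
qed

lemma U1_incl_comp: "manifold P ==> sm_on P S U1 a ==> sm_on P S (V1 V) a" using smcomp[OF _ U1_mfd _ U1_incl] by blast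

lemma sm_U1:
 assumes P: "manifold P" and a: "sm_on P S (V1 V) a" and U: "!!q. q : S ==> a q <: U1" shows "sm_on P S U1 a"
proof -
 have "sm_on P S UF (%q. (src G (pr1 V (a q)),a q))"
  by (rule fib_pair[OF uf P sm_src[OF G P vg_sm_pr1[OF V P a]] a]) (use U U1_iff in blast)
 from smcomp[OF P UFM this smooth_image[OF UFM UF_inj]] show ?thesis by (simp add: U1_def)
qed

lemma U1D: "v <: U1 ==> v <: V1 V" "v <: U1 ==> pr1 V v = unt G (src G (pr1 V v))"
 "v <: U1 ==> tgt G (pr1 V v) = src G (pr1 V v)" "v <: U1 ==> pr1 V v <: Ar G"
 using U1_iff pr(2) gs(1,5) by (blast,metis,metis,metis)

lemma U1_closed: "x <: V0 V ==> vunt V x <: U1" "cmp (gpd V) v w ==> v <: U1 ==> w <: U1 ==> vmul V v w <: U1"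
 "v <: U1 ==> vginv V v <: U1" "v <: U1 ==> w <: U1 ==> pr1 V v = pr1 V w ==> add1 V v w <: U1"
 "v <: U1 ==> scale1 V c v <: U1"
proof -
 show "vunt V x <: U1" if "x <: V0 V" using that by (simp add: U1_iff es pr gs)
 show "vmul V v w <: U1" if vw: "cmp (gpd V) v w" "v <: U1" "w <: U1"
 proof -
  have "src G (pr1 V v) = src G (pr1 V w)" using vw U1D(3)[OF vw(3)] vg_pr_src[OF V,of v] vg_pr_tgt[OF V,of w] by simp
  hence "pr1 V v = pr1 V w" using U1D(2) vw by metis
  hence "mul G (pr1 V v) (pr1 V w) = pr1 V w" using gs(9)[OF U1D(4)[OF vw(3)]] U1D(2)[OF vw(3)] by metis
  thus ?thesis using vw U1D(2)[OF vw(3)] by (simp add: U1_iff es pr)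
 qed
 show "vginv V v <: U1" if v: "v <: U1"
 proof -
  have "ginv G (pr1 V v) = pr1 V v" using U1D(2)[OF v] gp_inv_unt[OF gG] U1D(4)[OF v] gs(1) by metis
  thus ?thesis using v by (simp add: U1_iff es pr)
 qed
 show "add1 V v w <: U1" if "v <: U1" "w <: U1" "pr1 V v = pr1 V w" using that by (simp add: U1_iff vs)
 show "scale1 V c v <: U1" if "v <: U1" using that by (simp add: U1_iff vs)
qed

lemma unit_groupoid: "groupoid (gpd ub)"
proof (rule groupoidI,unfold ubs)
 show "vmul V (vmul V u v) w = vmul V u (vmul V v w)"
  if "u <: U1 & v <: U1 & vsrc V u = vtgt V v" "v <: U1 & w <: U1 & vsrc V v = vtgt V w" for u v w
  by (rule gp_assoc[OF gE]) (use that U1D(1) in auto)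
 show "EX w. (w <: U1 & v <: U1 & vsrc V w = vtgt V v) & vmul V w v = vunt V (vsrc V v)" if "v <: U1" for v
  using that U1_closed(3) U1D(1) by (intro exI[of _ "vginv V v"]) (simp add: es)
qed (use U1_closed(1,2) U1D(1) in "simp_all add: es")

lemma unit_ginv: "v <: U1 ==> vginv ub v = vginv V v"
 by (rule groupoid_left_inverse[OF unit_groupoid]) (use U1_closed(3) U1D(1) in "auto simp: ubs es")

lemma unit_lie_groupoid: "lie_groupoid (gpd ub)"
proof (rule lie_groupoidI[OF _ _ unit_groupoid],unfold ubs)
 show "manifold (V0 V)" "manifold U1" by (fact M0,fact U1_mfd)
 show "smooth U1 (V0 V) (vsrc V)" by (rule sm_src[OF E U1_mfd U1_incl])
 show "smooth (V0 V) U1 (vunt V)" by (rule sm_U1[OF M0 lg_unt[OF E] U1_closed(1)])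
 show "smooth U1 U1 (vginv ub)"
  by (rule sm_cong[OF U1_mfd sm_U1[OF U1_mfd sm_inv[OF E U1_mfd U1_incl] U1_closed(3)]]) (simp_all add: unit_ginv)
 let ?A = "Ar2 (gpd ub)"
 assume m: "manifold ?A" and f: "smooth ?A U1 fst" "smooth ?A U1 snd"
  and c: "!!q. q <: ?A ==> fst q <: U1 & snd q <: U1 & vsrc V (fst q) = vtgt V (snd q)"
 show "smooth ?A U1 (%q. vmul V (fst q) (snd q))"
  by (rule sm_U1[OF m sm_mul[OF E m U1_incl_comp[OF m f(1)] U1_incl_comp[OF m f(2)]]]) (use c U1_closed(2) U1D(1) in auto)
next
 show "sections U1 (V0 V) (vsrc V)" unfolding sections_def
 proof
  fix v assume v: "v <: U1"
  note v' = U1D[OF v]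
  obtain U k ta th where U: "pr1 V v : U" and t: "triv (bun1 G V) U k ta th" using vb_triv[OF b1,of "pr1 V v"] v'(4) by (metis buns(7))
  note D = trivD[OF t,unfolded buns]
  have T: "ta v : Rn k" using triv_Rn[OF b1 t,unfolded buns] v'(1) U by blast
  let ?S = "{x : pts (V0 V). unt G (pr0 V x) : U}"
  have us: "smooth (V0 V) (Ar G) (%x. unt G (pr0 V x))" by (rule sm_unt[OF G M0 vg_pr0[OF V]])
  have S: "opn (V0 V) ?S" by (rule sm_preim[OF M0 MA us D(1)])
  define w where "w x = th (unt G (pr0 V x)) (ta v)" for x
  \<comment> \<open>The arrow w x over the unit at x has the wrong source; adding w x minus the unit
    at its source to the unit at x corrects it. For x the source of v one has w x = v, and the
    correction gives back v.\<close>
  define r where "r x = add1 V (vunt V x) (add1 V (w x) (scale1 V (-1) (vunt V (vsrc V (w x)))))" for x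
  have w: "w x <: V1 V" "pr1 V (w x) = unt G (pr0 V x)" if "x : ?S" for x
   using that T triv_pts[OF b1 t,unfolded buns] D(4) by (auto simp: w_def)
  have ws: "sm_on (V0 V) ?S (V1 V) w" unfolding w_def
   by (rule triv_smooth[OF b1 t M0,unfolded buns,OF sm_sub[OF M0 us S]]) (use T fsm_const[OF M0 S] in auto)
  have p: "pr0 V (vsrc V (w x)) = pr0 V x" "vsrc V (w x) <: V0 V" if "x : ?S" for x
   using w[OF that] that pr(1) by (simp_all add: pr gs es)
  have rs: "sm_on (V0 V) ?S (V1 V) r" unfolding r_def
   by (rule vg_sm_add1[OF V M0 sm_unt[OF E M0 sm_id[OF M0 S]] vg_sm_add1[OF V M0 ws vg_sm_scale1[OF V M0 sm_unt[OF E M0 sm_src[OF E M0 ws]] fsm_const[OF M0 S]]]])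
    (use w p in "auto simp: vs pr es")
  have "vsrc V (r x) = x" "r x <: U1" if x: "x : ?S" for x
  proof -
   show "vsrc V (r x) = x" using w[OF x] p[OF x] c0(3)[of x "vsrc V (w x)"] x by (simp add: r_def vs pr es)
   show "r x <: U1" unfolding r_def using w[OF x] p[OF x] x pr(1) by (intro U1_closed) (auto simp: U1_iff vs pr es gs)
  qed
  moreover have xS: "vsrc V v : ?S" using v' U by (simp add: es pr)
  moreover have "w (vsrc V v) = v" using D(6)[OF v'(1) U] v' by (simp add: w_def pr)
  hence "r (vsrc V v) = v" using c1(2)[of "vunt V (vsrc V v)" v] v' by (simp add: r_def es pr)
  ultimately show "EX W s. opn (V0 V) W & vsrc V v : W & sm_on (V0 V) W U1 s & s (vsrc V v) = v & (ALL y:W. vsrc V (s y) = y)"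
   using S sm_U1[OF M0 rs] by blast
 qed
qed

text \<open>A trivialisation of the arrows of V near the unit at p is pulled back along the unit
  map.\<close>

lemma unit_bun1: "vector_bundle (bun1 (tgpd (Ob G)) ub)"
proof (rule vector_bundleI,unfold buns trivs ubs)
 have us: "smooth (Ob G) (Ar G) (unt G)" by (rule lg_unt[OF G])
 show "manifold U1" "manifold (Ob G)" by (fact U1_mfd,fact MO)
 have prs: "smooth U1 (Ob G) (%v. src G (pr1 V v))" by (rule sm_src[OF G U1_mfd vg_sm_pr1[OF V U1_mfd U1_incl]])
 show "smooth U1 (Ob G) (%v. src G (pr1 V v))" by (rule prs)
 have pe: "pr1 V v = pr1 V w" if "v <: U1" "w <: U1" "src G (pr1 V v) = src G (pr1 V w)" for v w using that U1D(2) by metis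
 show "add1 V v w <: U1 & src G (pr1 V (add1 V v w)) = src G (pr1 V v)"
  if "v <: U1" "w <: U1" "src G (pr1 V v) = src G (pr1 V w)" for v w using pe[OF that] U1_closed(4) U1D(1) that by (simp add: vs)
 show "scale1 V c v <: U1 & src G (pr1 V (scale1 V c v)) = src G (pr1 V v)" if "v <: U1" for v c
  using that U1_closed(5) U1D(1) by (simp add: vs)
 fix p assume p: "p <: Ob G"
 obtain U k ta th where U: "unt G p : U" and t: "triv (bun1 G V) U k ta th" using vb_triv[OF b1,of "unt G p"] p gs(3) by (metis buns(7))
 note D = trivD[OF t,unfolded buns] and T = triv_pts[OF b1 t,unfolded buns]
 let ?U = "{p : pts (Ob G). unt G p : U}"
 have oU: "opn (Ob G) ?U" by (rule sm_preim[OF MO MA us D(1)])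
 have "triv (bun1 (tgpd (Ob G)) ub) ?U k ta (%p. th (unt G p))" unfolding triv_def buns trivs ubs
 proof (intro conjI ballI allI impI oU)
  let ?S = "{v : pts U1. src G (pr1 V v) : ?U}"
  have S: "opn U1 ?S" by (rule sm_preim[OF U1_mfd MO prs oU])
  have sU: "v <: V1 V" "pr1 V v : U" if "v <: U1" "src G (pr1 V v) : ?U" for v using that U1D[OF that(1)] by auto
  have "sm_on U1 ?S (V1 V) (%v. v)" by (rule sm_sub[OF U1_mfd U1_incl S]) auto
  from sm_o[OF U1_mfd M1 this D(2)] show "sm_on U1 ?S (eucl k) ta" using sU by blast
  let ?P = "prod_mfd (Ob G) (eucl k)"
  have PM: "manifold ?P" by (rule mf_prod[OF MO mfE])
  have oP: "opn ?P (?U \<times> Rn k)" by (rule prod_open[OF MO mfE oU]) (simp add: eucls)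
  have f: "sm_on ?P (?U \<times> Rn k) (Ob G) fst" "sm_on ?P (?U \<times> Rn k) (eucl k) snd"
   by (rule sm_sub[OF PM _ oP],rule smooth_fst[OF MO mfE] smooth_snd[OF MO mfE],force simp: eucls)+
  have "sm_on ?P (?U \<times> Rn k) (V1 V) (%q. th (unt G (fst q)) (snd q))"
   by (rule triv_smooth[OF b1 t PM,unfolded buns,OF sm_unt[OF G PM f(1)] _ _ fsm_of_smooth[OF PM f(2)]]) auto
  thus "sm_on ?P (?U \<times> Rn k) U1 (%(p,x). th (unt G p) x)"
   unfolding case_prod_beta' by (rule sm_U1[OF PM]) (use T D(4) in "auto simp: U1_iff gs")
  show "ta (add1 V v w) = (%i. ta v i + ta w i)"
   if "v <: U1" "w <: U1" "src G (pr1 V v) : ?U" "src G (pr1 V v) = src G (pr1 V w)" for v w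
   using D(7)[of v w] sU that pe[OF that(1,2,4)] U1D(1) by simp
  show "ta (scale1 V c v) = (%i. c * ta v i)" if "v <: U1" "src G (pr1 V v) : ?U" for c v using D(8) sU that by simp
  show "th (unt G (src G (pr1 V v))) (ta v) = v" if "v <: U1" "src G (pr1 V v) : ?U" for v
   using D(6)[OF sU[OF that]] U1D(2)[OF that(1)] by simp
 qed (use D(4,5) in "auto simp: gs")
 thus "EX U k ta th. p : U & triv (bun1 (tgpd (Ob G)) ub) U k ta th" using p U by (intro exI[of _ ?U]) auto
qed

theorem unit_vb_groupoid: "vb_groupoid (tgpd (Ob G)) ub"
proof (rule vb_groupoidI[OF trivial_lie_groupoid[OF MO] unit_lie_groupoid _ unit_bun1],unfold ubs trivs)
 have e: "bun0 (tgpd (Ob G)) ub = bun0 G V" by (simp add: bun0_def ubs trivs)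
 show "vector_bundle (bun0 (tgpd (Ob G)) ub)" unfolding e by (rule b0)
 have pe: "pr1 V v = pr1 V w" if "v <: U1" "w <: U1" "src G (pr1 V v) = src G (pr1 V w)" for v w using that U1D(2) by metis
 show "src G (pr1 V (vmul V v w)) = src G (pr1 V v)" if "v <: U1 & w <: U1 & vsrc V v = vtgt V w" for v w
  using that U1D vg_pr_src[OF V,of v] vg_pr_tgt[OF V,of w] by (simp add: pr gs)
 show "vsrc V (add1 V v w) = add0 V (vsrc V v) (vsrc V w)" "vtgt V (add1 V v w) = add0 V (vtgt V v) (vtgt V w)"
  if "v <: U1" "w <: U1" "src G (pr1 V v) = src G (pr1 V w)" for v w using that U1D(1) pe[OF that] by (simp_all add: vs)
 show "vmul V (add1 V v v') (add1 V w w') = add1 V (vmul V v w) (vmul V v' w')"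
  if "v <: U1 & w <: U1 & vsrc V v = vtgt V w" "v' <: U1 & w' <: U1 & vsrc V v' = vtgt V w'"
   "src G (pr1 V v) = src G (pr1 V v')" "src G (pr1 V w) = src G (pr1 V w')" for v v' w w'
  by (rule vg_mul_add[OF V]) (use that U1D(1) pe in auto)
 show "vmul V (scale1 V c v) (scale1 V c w) = scale1 V c (vmul V v w)" if "v <: U1 & w <: U1 & vsrc V v = vtgt V w" for c v w
  by (rule vg_mul_scale[OF V]) (use that U1D(1) in auto)
qed (auto simp: U1D(1,3) vs pr gs)

end

section \<open>The weak representation defined by a unital cleavage\<close>

locale unital_cleavage_on = vb_gpd G V for G :: "('b,'g) lgpd" and V :: "('x,'y,'b,'g) vbgpd" +
 fixes C :: "'g => 'x => 'y"
 assumes C: "cleavage (pts (Ar G)) (%_. 1) C"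
begin

abbreviation comp (infixr "\<cdot>" 70) where "v \<cdot> w == vmul V v w"
abbreviation "iv == vginv V"
abbreviation "sr == vsrc V"
abbreviation "tg == vtgt V"

definition "ac g x = tg (C g x)"

text \<open>On arrows g acts by conjugation with its lifts at the two ends of v; the outcome lies
  over the unit at the target of g.\<close>

definition "rep = \<lparr>bnd = ub,act0 = ac,act1 = (%g v. C g (tg v) \<cdot> v \<cdot> iv (C g (sr v))),
 alp = (%g k x. C (mul G g k) x \<cdot> iv (C k x) \<cdot> iv (C g (ac k x)))\<rparr>"

lemma idl: "v <: V1 V ==> tg v = x ==> vunt V x \<cdot> v = v" and idr: "v <: V1 V ==> sr v = x ==> v \<cdot> vunt V x = v"
 and idlG: "g <: Ar G ==> tgt G g = y ==> mul G (unt G y) g = g" and idrG: "g <: Ar G ==> src G g = y ==> mul G g (unt G y) = g"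
 using es(9,10) gs(9,10) by auto

text \<open>Rewrite rules for words in a groupoid: products are bracketed to the right and inverses
  cancel. The coherence laws of \<open>rep\<close> are equalities of words in the lifts and are
  decided in this way.\<close>

lemmas gr = gp_assoc[OF gE] gp_inv_cancel[OF gE] gp_cancel_inv[OF gE] gp_inv_mul[OF gE] gp_inv_inv[OF gE] gp_inv_unt[OF gE] idl idr
lemmas gG' = gp_assoc[OF gG] gp_inv_cancel[OF gG] gp_cancel_inv[OF gG] gp_inv_mul[OF gG] gp_inv_inv[OF gG] gp_inv_unt[OF gG] idlG idrG

lemma C_facts:
 assumes g: "g <: Ar G" "x <: V0 V" "src G g = pr0 V x"
 shows "C g x <: V1 V" "pr1 V (C g x) = g" "sr (C g x) = x" "tg (C g x) = ac g x" "ac g x <: V0 V" "pr0 V (ac g x) = tgt G g"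
  "C g (scale0 V r x) = scale1 V r (C g x)" "y <: V0 V ==> pr0 V y = pr0 V x ==> C g (add0 V x y) = add1 V (C g x) (C g y)"
 using cl_pts[OF C g(1,1,2,3)] cleavageD[OF C g] c0(7)[OF g(2) g(2) refl] by (simp_all add: ac_def es pr)

lemma C_unit: "x <: V0 V ==> C (unt G (pr0 V x)) x = vunt V x"
 using cleavageD(2)[OF C,of "unt G (pr0 V x)" x] c1(7)[of "vunt V x" "vunt V x"] by (simp add: gs es pr)

lemma C_smooth:
 assumes P: "manifold P" and g: "sm_on P S (Ar G) g" and x: "sm_on P S (V0 V) x" and c: "!!q. q : S ==> src G (g q) = pr0 V (x q)"
 shows "sm_on P S (V1 V) (%q. C (g q) (x q))" "sm_on P S (V0 V) (%q. ac (g q) (x q))"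
proof -
 have "{q : pts PV. fst q <: Ar G} = pts PV" by (auto simp: pts_PV)
 hence "smooth PV (V1 V) (%q. C (fst q) (snd q))" using C by (simp add: cleavage_def)
 from smcomp[OF P PM fib_pair[OF pv P g x c] this]
 show 1: "sm_on P S (V1 V) (%q. C (g q) (x q))" by simp
 show "sm_on P S (V0 V) (%q. ac (g q) (x q))" unfolding ac_def by (rule sm_tgt[OF E P 1])
qed

lemma rep_simps: "bnd rep = ub" "act0 rep = ac" "act1 rep g v = C g (tg v) \<cdot> v \<cdot> iv (C g (sr v))"
 "alp rep g k x = C (mul G g k) x \<cdot> iv (C k x) \<cdot> iv (C g (ac k x))" by (simp_all add: rep_def)

lemma rep_arrow:
 assumes g: "g <: Ar G" and v: "v <: U1" "src G g = src G (pr1 V v)"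
 shows "sr v <: V0 V" "pr0 V (sr v) = src G g" "tg v <: V0 V" "pr0 V (tg v) = src G g" "pr1 V v = unt G (src G g)" "v <: V1 V"
  "act1 rep g v <: U1" "pr1 V (act1 rep g v) = unt G (tgt G g)" "sr (act1 rep g v) = ac g (sr v)" "tg (act1 rep g v) = ac g (tg v)"
proof -
 note u = U1D[OF v(1)]
 show s: "sr v <: V0 V" "pr0 V (sr v) = src G g" "tg v <: V0 V" "pr0 V (tg v) = src G g" "pr1 V v = unt G (src G g)" "v <: V1 V"
  using u v g by (simp_all add: es pr)
 note cs = C_facts[OF g s(1) s(2)[symmetric]] and ct = C_facts[OF g s(3) s(4)[symmetric]]
 show p: "pr1 V (act1 rep g v) = unt G (tgt G g)" using s cs ct g by (simp add: rep_simps pr es gs gG')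
 show "act1 rep g v <: U1" using p s cs ct g unfolding U1_iff by (simp add: gs) (simp add: rep_simps es)
 show "sr (act1 rep g v) = ac g (sr v)" "tg (act1 rep g v) = ac g (tg v)" using s cs ct g by (simp_all add: rep_simps es)
qed

lemma rep_alp:
 assumes gk: "cmp G g k" and x: "x <: V0 V" "src G k = pr0 V x"
 shows "alp rep g k x <: U1" "pr1 V (alp rep g k x) = unt G (tgt G g)" "sr (alp rep g k x) = ac g (ac k x)" "tg (alp rep g k x) = ac (mul G g k) x"
proof -
 have m: "mul G g k <: Ar G" "src G (mul G g k) = pr0 V x" using gk x by (simp_all add: gs)
 have k: "k <: Ar G" using gk by blast
 note ck = C_facts[OF k x] and cm = C_facts[OF m(1) x(1) m(2)]
 have g: "g <: Ar G" "src G g = pr0 V (ac k x)" using gk ck by simp_all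
 note cg = C_facts[OF g(1) ck(5) g(2)]
 show p: "pr1 V (alp rep g k x) = unt G (tgt G g)" using ck cm cg gk by (simp add: rep_simps pr es gs gG')
 show "alp rep g k x <: U1" using p ck cm cg gk unfolding U1_iff by (simp add: gs) (simp add: rep_simps es)
 show "sr (alp rep g k x) = ac g (ac k x)" "tg (alp rep g k x) = ac (mul G g k) x" using ck cm cg by (simp_all add: rep_simps es)
qed

text \<open>In naturality and in the cocycle identity every inner lift meets its inverse, so both
  sides reduce to the same word. The unit laws hold because lifts of units are units, and linearity
  because lifts, products and inverses are linear.\<close>

theorem rep_weak_rep: "weak_rep G rep"
proof -
 note rs = rep_simps(1,2) ubs
 have Vr: "vb_groupoid (tgpd (Ob G)) (bnd rep)" unfolding rs by (rule unit_vb_groupoid)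
 note q0 = q0[OF G Vr,unfolded rs] and q1 = q1[OF G Vr,unfolded rs] and q2 = q2[OF G Vr,unfolded rs]
 have 0: "smooth PV (V0 V) (%q. ac (fst q) (snd q))"
  by (rule C_smooth(2)[OF PM fib_fst[OF q0] fib_snd[OF q0]]) (auto simp: fib_pts[OF q0])
 let ?P = "fibre_prod (Ar G) (src G) U1 (%v. src G (pr1 V v))"
 note M = mf_fibre[OF q1] and f = fib_fst[OF q1] and s = U1_incl_comp[OF mf_fibre[OF q1] fib_snd[OF q1]]
 have a: "pr0 V (tg (snd q)) = src G (fst q)" "pr0 V (sr (snd q)) = src G (fst q)" "fst q <: Ar G" "snd q <: V1 V"
  "act1 rep (fst q) (snd q) <: U1" if "q <: ?P" for q using that rep_arrow[of "fst q" "snd q"] by (auto simp: fib_pts[OF q1])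
 note Ct = C_smooth(1)[OF M f sm_tgt[OF E M s] a(1)[symmetric]] and Cs = C_smooth(1)[OF M f sm_src[OF E M s] a(2)[symmetric]]
 have "smooth ?P (V1 V) (%q. act1 rep (fst q) (snd q))" unfolding rep_simps
  by (rule sm_mul[OF E M Ct sm_mul[OF E M s sm_inv[OF E M Cs]]]) (use a in "auto simp: es C_facts")
 from sm_U1[OF M this a(5)] have 1: "smooth ?P U1 (%q. act1 rep (fst q) (snd q))" .
 let ?Q = "fibre_prod (Ar2 G) (%(g,k). src G k) (V0 V) (pr0 V)"
 note M = mf_fibre[OF q2] and h = fib_snd[OF q2]
 note f = smcomp[OF M lg_Ar2[OF G] fib_fst[OF q2] lg_fst[OF G]] and k = smcomp[OF M lg_Ar2[OF G] fib_fst[OF q2] lg_snd[OF G]]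
 have a: "cmp G (fst (fst q)) (snd (fst q))" "snd q <: V0 V" "src G (snd (fst q)) = pr0 V (snd q)" if "q <: ?Q" for q
  using that by (auto simp: fib_pts[OF q2] lg_pts_Ar2[OF G])
 have m: "smooth ?Q (Ar G) (%q. mul G (fst (fst q)) (snd (fst q)))" by (rule sm_mul[OF G M f k]) (use a in blast)
 have "smooth ?Q (V1 V) (%q. alp rep (fst (fst q)) (snd (fst q)) (snd q))" unfolding rep_simps
  by (rule sm_mul[OF E M C_smooth(1)[OF M m h] sm_mul[OF E M sm_inv[OF E M C_smooth(1)[OF M k h]]
    sm_inv[OF E M C_smooth(1)[OF M f C_smooth(2)[OF M k h]]]]]) (use a in "simp_all add: es gs C_facts")
 hence 2: "smooth ?Q U1 (%q. alp rep (fst (fst q)) (snd (fst q)) (snd q))" by (rule sm_U1[OF M]) (use a rep_alp(1) in auto)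
 {
  fix g x assume g: "g <: Ar G" and x: "x <: V0 V" "src G g = pr0 V x"
  note c = C_facts[OF g x]
  have L01: "pr0 V (ac g x) = tgt G g & act1 rep g (vunt V x) = vunt V (ac g x)" using c x by (simp add: rep_simps es gr)
  have L02: "ac g (scale0 V r x) = scale0 V r (ac g x)" for r using c by (simp add: ac_def vs)
  have u: "pr0 V x <: Ob G" "tgt G g <: Ob G" using pr(1) x g gs(2) by auto
  have L03: "alp rep g (unt G (pr0 V x)) x = vunt V (ac g x) & alp rep (unt G (tgt G g)) g x = vunt V (ac g x)"
   using c x g u C_unit[OF x(1)] C_unit[OF c(5)] by (simp add: rep_simps gs gG' es gr ac_def[of "unt G (pr0 V x)"])
  have L04: "ac g (add0 V x y) = add0 V (ac g x) (ac g y)" if y: "y <: V0 V" "src G g = pr0 V y" for y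
  proof -
   show ?thesis using c C_facts[OF g y] x y by (simp add: ac_def vs)
  qed
  note L01 L02 L03 L04
 }
 note N0 = this
 {
  fix x assume x: "x <: V0 V"
  have "ac (unt G (pr0 V x)) x = x" using C_unit[OF x] x by (simp add: ac_def es)
 }
 note N1 = this
 {
  fix g v assume g: "g <: Ar G" and v: "v <: U1" "src G g = src G (pr1 V v)"
  note a = rep_arrow[OF g v] and cs = C_facts[OF g rep_arrow(1)[OF g v] rep_arrow(2)[OF g v,symmetric]]
   and ct = C_facts[OF g rep_arrow(3)[OF g v] rep_arrow(4)[OF g v,symmetric]]
  have L21: "src G (pr1 V (act1 rep g v)) = tgt G g & sr (act1 rep g v) = ac g (sr v) & tg (act1 rep g v) = ac g (tg v)" using a g by (simp add: gs)
  have L22: "act1 rep g (scale1 V r v) = scale1 V r (act1 rep g v)" for r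
   using a cs ct vg_mul_scale[OF V,of v "iv (C g (sr v))" r] vg_mul_scale[OF V,of "C g (tg v)" "v \<cdot> iv (C g (sr v))" r]
   by (simp add: rep_simps vs es vg_inv_scale[OF V,symmetric])
  have L23: "act1 rep g (add1 V v w) = add1 V (act1 rep g v) (act1 rep g w)" if w: "w <: U1" "src G g = src G (pr1 V w)" for w
  proof -
   note b = rep_arrow[OF g w] and ds = C_facts[OF g rep_arrow(1)[OF g w] rep_arrow(2)[OF g w,symmetric]]
    and dt = C_facts[OF g rep_arrow(3)[OF g w] rep_arrow(4)[OF g w,symmetric]]
   have "pr1 V v = pr1 V w" using a b by simp
   thus ?thesis using a b cs ct ds dt vg_mul_add[OF V,of v "iv (C g (sr v))" w "iv (C g (sr w))"]
     vg_mul_add[OF V,of "C g (tg v)" "v \<cdot> iv (C g (sr v))" "C g (tg w)" "w \<cdot> iv (C g (sr w))"]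
    by (simp add: rep_simps vs es pr vg_inv_add[OF V])
  qed
  note L21 L22 L23
 }
 note N2 = this
 {
  fix g v w assume g: "g <: Ar G" and vw: "v <: U1 & w <: U1 & sr v = tg w" and v: "src G g = src G (pr1 V v)"
  have w: "src G g = src G (pr1 V w)" using vw v U1D(1,3) vg_pr_src[OF V,of v] vg_pr_tgt[OF V,of w] by simp
  note a = rep_arrow[OF g conjunct1[OF vw] v] and b = rep_arrow[OF g conjunct1[OF conjunct2[OF vw]] w]
  have "act1 rep g (v \<cdot> w) = act1 rep g v \<cdot> act1 rep g w"
   using vw C_facts[OF g a(1) a(2)[symmetric]] C_facts[OF g a(3) a(4)[symmetric]] C_facts[OF g b(1) b(2)[symmetric]] C_facts[OF g b(3) b(4)[symmetric]] a(6) b(6)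
   by (simp add: rep_simps es gr)
 }
 note N3 = this
 {
  fix v assume v: "v <: U1"
  note u = U1D[OF v]
  have "pr0 V (sr v) = src G (pr1 V v)" "pr0 V (tg v) = src G (pr1 V v)" using u by (simp_all add: pr)
  hence "act1 rep (unt G (src G (pr1 V v))) v = v" using C_unit[of "sr v"] C_unit[of "tg v"] u by (simp add: rep_simps es gr)
 }
 note N4 = this
 {
  fix g k v assume gk: "g <: Ar G & k <: Ar G & src G g = tgt G k" and v: "v <: U1" "src G k = src G (pr1 V v)"
  have k: "k <: Ar G" and g: "g <: Ar G" and m: "mul G g k <: Ar G" "src G (mul G g k) = src G k" using gk by (simp_all add: gs)
  note a = rep_arrow[OF k v]
  note cs = C_facts[OF k a(1) a(2)[symmetric]] and ct = C_facts[OF k a(3) a(4)[symmetric]]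
  have e: "src G g = pr0 V (ac k (sr v))" "src G g = pr0 V (ac k (tg v))" "src G (mul G g k) = pr0 V (sr v)" "src G (mul G g k) = pr0 V (tg v)"
   using gk cs ct m a by simp_all
  note ds = C_facts[OF g cs(5) e(1)] and dt = C_facts[OF g ct(5) e(2)] and ms = C_facts[OF m(1) a(1) e(3)] and mt = C_facts[OF m(1) a(3) e(4)]
  \<comment> \<open>Both sides reduce to the lift of g k at the target of v, then backwards v, the
    inverse lift of k and the inverse lift of g along the source of v.\<close>
  have "alp rep g k (tg v) \<cdot> act1 rep g (act1 rep k v) = act1 rep (mul G g k) v \<cdot> alp rep g k (sr v)"
   using cs(1-5) ct(1-5) ds(1-5) dt(1-5) ms(1-5) mt(1-5) a(1,3,6,9,10) by (simp add: rep_simps(3)[of g] rep_simps(4)) (simp add: rep_simps(3) es gr)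
 }
 note N5 = this
 {
  fix g k x assume gk: "g <: Ar G & k <: Ar G & src G g = tgt G k" and x: "x <: V0 V" "src G k = pr0 V x"
  have L61: "src G (pr1 V (alp rep g k x)) = tgt G g & sr (alp rep g k x) = ac g (ac k x) & tg (alp rep g k x) = ac (mul G g k) x"
   using rep_alp[OF gk x] gk by (simp add: gs)
  have k: "k <: Ar G" and g: "g <: Ar G" and m: "mul G g k <: Ar G" "src G (mul G g k) = pr0 V x" using gk x by (simp_all add: gs)
  note ck = C_facts[OF k x] and cm = C_facts[OF m(1) x(1) m(2)]
  have gx: "src G g = pr0 V (ac k x)" using gk ck by simp
  note cg = C_facts[OF g ck(5) gx]
  have L62: "alp rep g k (scale0 V r x) = scale1 V r (alp rep g k x)" for r
   using ck cm cg vg_mul_scale[OF V,of "iv (C k x)" "iv (C g (ac k x))" r] vg_mul_scale[OF V,of "C (mul G g k) x" "iv (C k x) \<cdot> iv (C g (ac k x))" r]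
   by (simp add: rep_simps ac_def[of k "scale0 V r x"] vs es vg_inv_scale[OF V,symmetric])
  have L63: "alp rep g k (add0 V x y) = add1 V (alp rep g k x) (alp rep g k y)" if y: "y <: V0 V" "src G k = pr0 V y" for y
  proof -
   have my: "src G (mul G g k) = pr0 V y" using m x y by simp
   note dk = C_facts[OF k y] and dm = C_facts[OF m(1) y(1) my]
   have gy: "src G g = pr0 V (ac k y)" using gk dk by simp
   note dg = C_facts[OF g dk(5) gy]
   have xy: "pr0 V y = pr0 V x" "pr0 V (ac k y) = pr0 V (ac k x)" using x y ck dk by simp_all
   have ak: "ac k (add0 V x y) = add0 V (ac k x) (ac k y)" using ck(8)[OF y(1) xy(1)] ck(1,2,4) dk(1,2,4) by (simp add: ac_def[of k "add0 V x y"] vs)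
   show ?thesis unfolding rep_simps ak cm(8)[OF y(1) xy(1)] ck(8)[OF y(1) xy(1)] cg(8)[OF dk(5) xy(2)]
    using ck(1-5) cm(1-5) cg(1-5) dk(1-5) dm(1-5) dg(1-5) vg_mul_add[OF V,of "iv (C k x)" "iv (C g (ac k x))" "iv (C k y)" "iv (C g (ac k y))"]
     vg_mul_add[OF V,of "C (mul G g k) x" "iv (C k x) \<cdot> iv (C g (ac k x))" "C (mul G g k) y" "iv (C k y) \<cdot> iv (C g (ac k y))"]
    by (simp add: es pr vg_inv_add[OF V])
  qed
  note L61 L62 L63
 }
 note N6 = this
 {
  fix g k l x assume gk: "g <: Ar G & k <: Ar G & src G g = tgt G k" and kl: "k <: Ar G & l <: Ar G & src G k = tgt G l"
   and x: "x <: V0 V" "src G l = pr0 V x"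
  have gkl: "g <: Ar G" "k <: Ar G" "l <: Ar G" "mul G k l <: Ar G" "mul G g k <: Ar G" "mul G g (mul G k l) <: Ar G"
   "src G (mul G k l) = pr0 V x" "src G (mul G g (mul G k l)) = pr0 V x" "mul G (mul G g k) l = mul G g (mul G k l)"
   using gk kl x gp_assoc[OF gG] by (simp_all add: gs)
  note c1 = C_facts[OF gkl(3) x]
  have e1: "src G k = pr0 V (ac l x)" "src G (mul G g k) = pr0 V (ac l x)" using c1 gk kl by (simp_all add: gs)
  note c2 = C_facts[OF gkl(2) c1(5) e1(1)] and c3 = C_facts[OF gkl(5) c1(5) e1(2)] and c4 = C_facts[OF gkl(4) x(1) gkl(7)] and c5 = C_facts[OF gkl(6) x(1) gkl(8)]
  have e2: "src G g = pr0 V (ac k (ac l x))" "src G g = pr0 V (ac (mul G k l) x)" using c2 c4 gk kl by (simp_all add: gs)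
  note c6 = C_facts[OF gkl(1) c2(5) e2(1)] and c7 = C_facts[OF gkl(1) c4(5) e2(2)]
  have "alp rep g (mul G k l) x \<cdot> act1 rep g (alp rep k l x) = alp rep (mul G g k) l x \<cdot> alp rep g k (ac l x)"
   using rep_alp(3,4)[OF kl x] c1(1-5) c2(1-5) c3(1-5) c4(1-5) c5(1-5) c6(1-5) c7(1-5)
   by (simp add: rep_simps(3)) (simp add: rep_simps(4) gkl(9) es gr)
 }
 note N7 = this
 \<comment> \<open>The facts N0 to N7 have the shape of the clauses of the unfolded definition of
   \<open>weak_rep\<close>, with 0, 1 and 2 for the smoothness clauses.\<close>
 show ?thesis unfolding weak_rep_unfold[OF G Vr] lg_pts_Ar2[OF G] rs
  using Vr 0 1 2 N0 N1 N2 N3 N4 N5 N6 N7 by (simp add: rs case_prod_beta')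
qed

end

text \<open>The algebraic conditions transport along the bijections: each equation is moved to V by
  h, where it follows from the corresponding one for f. Smoothness of the inverse is the remaining
  input.\<close>

lemma vgmap_inverse:
 assumes V: "vb_groupoid G V" and W: "vb_groupoid G W" and f: "vgmap V W f0 f1"
  and s: "smooth (V0 W) (V0 V) h0" "smooth (V1 W) (V1 V) h1"
  and hf: "!!x. x <: V0 V ==> h0 (f0 x) = x" "!!v. v <: V1 V ==> h1 (f1 v) = v"
  and fh: "!!x. x <: V0 W ==> f0 (h0 x) = x" "!!v. v <: V1 W ==> f1 (h1 v) = v" shows "vgmap W V h0 h1"
proof -
 have p: "h0 x <: V0 V" "h1 v <: V1 V" if "x <: V0 W" "v <: V1 W" for x v
  using sm_pts[OF vg_V0[OF V] s(1)] sm_pts[OF vg_V1[OF V] s(2)] that by auto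
 have p0: "h0 x <: V0 V" if "x <: V0 W" for x using sm_pts[OF vg_V0[OF V] s(1) that] .
 have p1: "h1 x <: V1 V" if "x <: V1 W" for x using sm_pts[OF vg_V1[OF V] s(2) that] .
 note e = gp_simps[OF vg_gV[OF V]] gp_simps[OF vg_gV[OF W]] vg_add0[OF V] vg_scale0[OF V] vg_add1[OF V] vg_scale1[OF V]
 note f' = f[unfolded vgmap_def]
 have st: "vsrc V (h1 v) = h0 (vsrc W v)" "vtgt V (h1 v) = h0 (vtgt W v)" "pr1 V (h1 v) = pr1 W v" if v: "v <: V1 W" for v
  using f' p1[OF v] fh(2)[OF v] hf(1)[of "vsrc V (h1 v)"] hf(1)[of "vtgt V (h1 v)"] by (auto simp: e)
 have pr0: "pr0 V (h0 x) = pr0 W x" if x: "x <: V0 W" for x using f' p0[OF x] fh(1)[OF x] by metis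
 show ?thesis unfolding vgmap_def
 proof (intro conjI ballI allI impI s st pr0)
  fix x assume x: "x <: V0 W"
  show "h1 (vunt W x) = vunt V (h0 x)" using f' p0[OF x] fh(1)[OF x] hf(2)[of "vunt V (h0 x)"] by (simp add: e)
  show "h0 (scale0 W c x) = scale0 V c (h0 x)" for c using f' p0[OF x] fh(1)[OF x] hf(1)[of "scale0 V c (h0 x)"] by (simp add: e)
  fix y assume "y <: V0 W" "pr0 W x = pr0 W y"
  thus "h0 (add0 W x y) = add0 V (h0 x) (h0 y)"
   using f' p0[of x] p0[of y] x fh(1)[of x] fh(1)[of y] pr0 hf(1)[of "add0 V (h0 x) (h0 y)"] by (simp add: e)
 next
  fix v assume v: "v <: V1 W"
  show "h1 (scale1 W c v) = scale1 V c (h1 v)" for c using f' p1[OF v] fh(2)[OF v] hf(2)[of "scale1 V c (h1 v)"] by (simp add: e)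
  fix w assume "w <: V1 W" "pr1 W v = pr1 W w"
  thus "h1 (add1 W v w) = add1 V (h1 v) (h1 w)"
   using f' p1[of v] p1[of w] v fh(2)[of v] fh(2)[of w] st(3) hf(2)[of "add1 V (h1 v) (h1 w)"] by (simp add: e)
 next
  fix v w assume "cmp (gpd W) v w"
  thus "h1 (vmul W v w) = vmul V (h1 v) (h1 w)"
   using f' p1[of v] p1[of w] fh(2)[of v] fh(2)[of w] st hf(2)[of "vmul V (h1 v) (h1 w)"] by (simp add: e)
 qed
qed

lemma VB_is_iso:
 assumes V: "vb_groupoid G V" and W: "vb_groupoid G W" and f: "vgmap V W f0 f1" and h: "vgmap W V h0 h1"
  and hf: "!!x. x <: V0 V ==> h0 (f0 x) = x" "!!v. v <: V1 V ==> h1 (f1 v) = v"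
  and fh: "!!x. x <: V0 W ==> f0 (h0 x) = x" "!!v. v <: V1 W ==> f1 (h1 v) = v"
 shows "is_iso (VB G) V W (restrict f0 (pts (V0 V)),restrict f1 (pts (V1 V)))" unfolding is_iso_def
proof (intro conjI bexI)
 show "(restrict f0 (pts (V0 V)),restrict f1 (pts (V1 V))) : Hom (VB G) V W"
  "(restrict h0 (pts (V0 W)),restrict h1 (pts (V1 W))) : Hom (VB G) W V"
  using vgmap_cong[OF V f,of "restrict f0 (pts (V0 V))" "restrict f1 (pts (V1 V))"]
   vgmap_cong[OF W h,of "restrict h0 (pts (V0 W))" "restrict h1 (pts (V1 W))"]
  by (simp_all add: VB_simps vb_gpd_map_iff[OF V] vb_gpd_map_iff[OF W])
qed (use vgmap_pts[OF W f] vgmap_pts[OF V h] hf fh in "auto simp: VB_simps compose_def restrict_def fun_eq_iff")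

theorem Act_essentially_surjective:
 fixes G :: "('b,'g) lgpd" and V :: "('b,'g,'a) vbgpd_pt"
 assumes "vb_groupoid G V" shows "EX R. weak_rep G R & (EX e. is_iso (VB G) (Act_ob G R) V e)"
proof -
 interpret vb_gpd G V by unfold_locales (fact assms)
 obtain C where "cleavage (pts (Ar G)) (%_. 1) C" using unital_cleavage by blast
 then interpret unital_cleavage_on G V C by unfold_locales
 interpret A: weak_rep_on G rep by unfold_locales (fact G rep_weak_rep)+
 note rs = rep_simps ubs
 \<comment> \<open>An arrow of the action groupoid is sent to the lift of g at x followed by the
   inverse of its vertical part; h1 recovers the vertical part by comparing an arrow with the lift
   having the same source.\<close>
 define f1 where "f1 a = iv (vcp a) \<cdot> C (arp a) (obp a)" for a
 define h1 where "h1 v = Triple (pr1 V v) (sr v) (C (pr1 V v) (sr v) \<cdot> iv v)" for v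
 have f1: "f1 (Triple g x v) = iv v \<cdot> C g x" for g x v by (simp add: f1_def)
 have T: "g <: Ar G" "x <: V0 V" "src G g = pr0 V x" "v <: U1" "v <: V1 V" "tg v = ac g x" "pr1 V v = unt G (tgt G g)"
   "C g x <: V1 V" "pr1 V (C g x) = g" "sr (C g x) = x" "tg (C g x) = ac g x" if "Triple g x v <: A.A1" for g x v
 proof -
  show a: "g <: Ar G" "x <: V0 V" "src G g = pr0 V x" "v <: U1" "tg v = ac g x" using that by (simp_all add: A.act_iff rs)
  show "C g x <: V1 V" "pr1 V (C g x) = g" "sr (C g x) = x" "tg (C g x) = ac g x" using C_facts[OF a(1-3)] by simp_all
  have "src G (pr1 V v) = tgt G g" using that by (auto elim!: A.act_ptsE simp: rs)
  thus "pr1 V v = unt G (tgt G g)" "v <: V1 V" using U1D(1,2)[OF a(4)] by simp_all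
 qed
 have D: "a = Triple (arp a) (obp a) (vcp a)" if "a <: A.A1" for a using that by (rule A.act_ptsE) simp
 have AV: "vb_groupoid G (Act_ob G rep)" by (rule A.Act_vb)
 have f: "vgmap (Act_ob G rep) V (%x. x) f1" unfolding vgmap_def A.acts(1,2,6,7,8,9) rs
 proof (intro conjI ballI allI impI)
  show "smooth (V0 V) (V0 V) (%x. x)" by (rule sm_id[OF M0 otop])
  show "smooth A.A1 (V1 V) f1" unfolding f1_def
  proof (rule sm_mul[OF E A.act_mfd sm_inv[OF E A.act_mfd U1_incl_comp[OF A.act_mfd A.act_vec[unfolded rs]]] C_smooth(1)[OF A.act_mfd A.act_arrow A.act_obj[unfolded rs]]])
   fix a assume a: "a <: A.A1"
   show "src G (arp a) = pr0 V (obp a)" "sr (iv (vcp a)) = tg (C (arp a) (obp a))"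
    using T[of "arp a" "obp a" "vcp a"] D[OF a] a by (simp_all add: es)
  qed
  fix a assume a: "a <: A.A1"
  then obtain g x v where e: "a = Triple g x v" by (rule A.act_ptsE)
  note t = T[OF a[unfolded e]]
  show "sr (f1 a) = obp a" "tg (f1 a) = tgt (AG G rep) a" "pr1 V (f1 a) = arp a"
   using t by (simp_all add: e f1 A.acts(3) rs es pr gs gG')
  show "f1 (scale1 (Act_ob G rep) c a) = scale1 V c (f1 a)" for c
   using t vg_mul_scale[OF V,of "iv v" "C g x" c] C_facts(7)[OF t(1-3)] by (simp add: e f1 A.acts(11) rs es vg_inv_scale[OF V])
  fix b assume b: "b <: A.A1" "arp a = arp b"
  obtain y w where e': "b = Triple g y w" using b e by (cases b) (auto elim: A.act_ptsE)
  note t' = T[OF b(1)[unfolded e']]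
  show "f1 (add1 (Act_ob G rep) a b) = add1 V (f1 a) (f1 b)"
   using t t' vg_mul_add[OF V,of "iv v" "C g x" "iv w" "C g y"] C_facts(8)[OF t(1-3) t'(2)]
   by (simp add: e e' f1 A.acts(10) rs es pr vg_inv_add[OF V])
 next
  fix x assume x: "x <: V0 V"
  show "f1 (unt (AG G rep) x) = vunt V x" using x C_unit[OF x] by (simp add: f1 A.acts(4) rs es gr)
 next
  fix a b assume ab: "a <: A.A1 & b <: A.A1 & obp a = tgt (AG G rep) b"
  obtain g x v h y w where e: "a = Triple g x v" "b = Triple h y w" using D ab by blast
  have c: "cmp (AG G rep) (Triple g x v) (Triple h y w)" using ab unfolding e A.acts(2) point.sel .
  note m = A.act_mul[OF c,unfolded rs]
  note t = T[OF conjunct1[OF c]] and t' = T[OF conjunct1[OF conjunct2[OF c]]]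
  have x: "x = sr w" and gh: "cmp G g h" by (fact m)+
  have k: "mul G g h <: Ar G" "src G (mul G g h) = pr0 V y" using gh t' by (simp_all add: gs)
  have k': "src G g = pr0 V (ac h y)" using C_facts[OF t'(1-3)] gh by simp
  note ck = C_facts[OF k(1) t'(2) k(2)] and cg = C_facts[OF t(1) C_facts(5)[OF t'(1-3)] k']
  \<comment> \<open>Multiplicativity: in alp (g, h, y) times the conjugate of w the lift of g at h y
    cancels, and after inverting the product the lift of g h cancels as well.\<close>
  have "iv (alp rep g h y \<cdot> act1 rep g w \<cdot> v) \<cdot> C (mul G g h) y = (iv v \<cdot> C g x) \<cdot> (iv w \<cdot> C h y)"
   using t t' ck(1-5) cg(1-5) unfolding rep_simps x by (simp add: es gr)
  thus "f1 (mul (AG G rep) a b) = f1 a \<cdot> f1 b" unfolding e m(1) f1 rep_simps .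
 qed (rule refl)+
 have P: "src G (pr1 V v) = pr0 V (sr v)" if "v <: V1 V" for v using that by (simp add: pr)
 have H: "C (pr1 V v) (sr v) \<cdot> iv v <: U1" "tg (C (pr1 V v) (sr v) \<cdot> iv v) = ac (pr1 V v) (sr v)" if v: "v <: V1 V" for v
  using C_facts[OF pr(2)[OF v] es(1)[OF v] P[OF v]] v pr(2)[OF v] by (simp_all add: U1_iff es pr gs)
 have sh: "smooth (V1 V) A.A1 h1" unfolding h1_def
  by (rule A.act_sm_Triple[unfolded rs,OF M1 vg_pr1[OF V] lg_src[OF E] sm_U1[OF M1 sm_mul[OF E M1 C_smooth(1)[OF M1 vg_pr1[OF V] lg_src[OF E]] lg_inv[OF E]]]])
   (use H P C_facts(3)[OF pr(2) es(1) P] in "simp_all add: es")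
 have hf: "h1 (f1 a) = a" if a: "a <: A.A1" for a
 proof -
  obtain g x v where e: "a = Triple g x v" using a by (rule A.act_ptsE)
  note t = T[OF a[unfolded e]]
  have "pr1 V (iv v \<cdot> C g x) = g" "sr (iv v \<cdot> C g x) = x" using t by (simp_all add: es pr gs gG')
  thus ?thesis using t by (simp add: e f1 h1_def es gr)
 qed
 have fh: "f1 (h1 v) = v" if v: "v <: V1 V" for v
  using C_facts[OF pr(2)[OF v] es(1)[OF v] P[OF v]] v by (simp add: f1 h1_def es gr)
 have h: "vgmap V (Act_ob G rep) (%x. x) h1"
  by (rule vgmap_inverse[OF AV V f]) (use sh hf fh sm_id[OF M0 otop] in "simp_all add: A.acts(1) rs")
 show ?thesis by (rule exI[of _ rep],rule conjI[OF rep_weak_rep],rule exI,rule VB_is_iso[OF AV V f h]) (use hf fh in simp_all)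
qed

theorem theorem5p5:
  fixes G :: "('b, 'g) lgpd"
  assumes "lie_groupoid G"
  shows "equivalence_of_categories
    (WRep G :: (('b, 'g, 'a) wrep_pt, ('g, 'a) wrep_mor) cat)
    (VB G :: (('b, 'g, 'a) vbgpd_pt, ('g, 'a) vb_mor) cat)
    (Act G)"
  unfolding Act_def
proof (rule equivalence_of_categoriesI[OF Act_functor[OF assms]])
 fix R S :: "('b,'g,'a) wrep_pt" assume "R : Objs (WRep G)" "S : Objs (WRep G)"
 then interpret weak_rep_pair G R S by (intro weak_rep_pairI assms) (simp_all add: WRep_simps)
 show "EX h:Hom (WRep G) R S. Act_mor G R S h = f" if "f : Hom (VB G) (Act_ob G R) (Act_ob G S)" for f
  using act_inv_Hom[of f] that by (intro bexI[of _ "act_inv f"]) (simp_all add: WRep_simps VB_simps)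
 show "h = k" if "h : Hom (WRep G) R S" "k : Hom (WRep G) R S" "Act_mor G R S h = Act_mor G R S k" for h k
  using Act_mor_Hom(2) that unfolding WRep_simps by (metis mem_Collect_eq)
next
 show "EX R:Objs (WRep G). EX e. is_iso (VB G) (Act_ob G R) V e" if "V : Objs (VB G)" for V :: "('b,'g,'a) vbgpd_pt"
  using Act_essentially_surjective[of G V] that by (auto simp: WRep_simps VB_simps)
qed

end
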